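(* Let $A$ be a $C^*$-algebra, let $k\ge 2$, and let $(Y,\theta)$ be a generating system of $A$-correspondences, with $Y=\{Y_1,\dots,Y_k\}$ and $\theta=\{\theta_{ij}\}_{i,j=1}^k$. Let $(\mathcal E^mY,\mathcal R^m\theta)$, $m=0,1,\dots,k-1$, be the iterated generating systems constructed from $(Y,\theta)$. Then for each $i$ with $1\le i<k$ and each $j=1,\dots,k$, $$\mathcal E^iY_j\;\simeq\; Y_j\otimes_A\mathcal O(\ast_{l=1}^{i}Y_l)$$ as correspondences, and, for $j=i+1$, $$\mathcal O(\mathcal E^iY_{i+1})\;\simeq\;\mathcal O(\ast_{l=1}^{i+1}Y_l)$$ as $C^*$-algebras, where $\ast_{l=1}^{i}Y_l$ denotes the product system over $\mathbb N^{i}$ generated by $Y_1,\dots,Y_i$.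
   Context: **Correspondences.** For a $C^*$-algebra $A$, an $A$-correspondence is a right Hilbert $A$-module $X$ with a $*$-homomorphism $\varphi_X:A\to\mathcal L(X)$, written $a\cdot x=\varphi_X(a)x$. All correspondences are assumed nondegenerate ($AX=X$) and regular ($\varphi_X$ is injective with $\varphi_X(A)\subseteq\mathcal K(X)$). $X\otimes_AY$ is the balanced tensor product. Isomorphisms of $A$-correspondences are bijective, inner-product-preserving bimodule maps. A $B$-correspondence $Z$ and a $C$-correspondence $W$ over different algebras are isomorphic if there are a $*$-isomorphism $\iota:B\to C$ and a linear bijection $\phi:Z\to W$ with $\phi(b z b')=\iota(b)\phi(z)\iota(b')$ and $\langle\phi(z),\phi(z')\rangle_C=\iota(\langle z,z'\rangle_B)$. **Representations.** A representation of $X$ in a $C^*$-algebra $D$ is a pair $(\pi,t)$ with $\pi:A\to D$ a $*$-homomorphism and $t:X\to D$ linear, such that $\pi(a)t(x)=t(a\cdot x)$ and $t(x)^*t(y)=\pi(\langle x,y\rangle_A)$; $t^{(1)}:\mathcal K(X)\to D$ is the homomorphism with $t^{(1)}(\theta_{x,y})=t(x)t(y)^*$, where $\theta_{x,y}z=x\langle y,z\rangle_A$. It is (Cuntz–Pimsner) covariant if $\pi=t^{(1)}\circ\varphi_X$. $\mathcal O(X)$ (also written $\mathcal O_X$) is the $C^*$-algebra generated by the universal covariant representation $(\pi_X,t_X)$. **Generating systems.** A generating system of $A$-correspondences is a pair $(Y,\theta)$, with $Y=\{Y_i\}_{i=1}^k$ a collection of $A$-correspondences and $\theta_{ij}:Y_i\otimes_AY_j\to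 Y_j\otimes_AY_i$ isomorphisms of $A$-correspondences such that $\theta_{ii}=\mathrm{id}$, $\theta_{ij}=\theta_{ji}^{-1}$, and the hexagonal relations hold for all $i,j,\ell$: $$(\theta_{j\ell}\otimes1)(1\otimes\theta_{i\ell})(\theta_{ij}\otimes1)=(1\otimes\theta_{ij})(\theta_{i\ell}\otimes1)(1\otimes\theta_{j\ell})$$ on $Y_i\otimes_AY_j\otimes_AY_\ell$. **Product systems.** A product system over $\mathbb N^n$ of $A$-correspondences is a semigroup $X=\bigsqcup_{s\in\mathbb N^n}X_s$, each $X_s$ an $A$-correspondence, with $X_0=A$ (standard structure, acting by the module actions) and with the multiplication inducing isomorphisms $X_s\otimes_AX_t\simeq X_{s+t}$. A representation $\psi$ of $X$ in $D$ consists of representations $\psi_s$ of $X_s$ (all with coefficient map $\psi_0$) with $\psi_s(x)\psi_t(y)=\psi_{s+t}(xy)$; it is covariant if each $\psi_s$ is. $\mathcal O(X)$ is the $C^*$-algebra generated by the universal covariant representation. By Fowler–Sims, for a generating system $(Y,\theta)$ of $n$ correspondences there is a product system $\ast_{l=1}^nY_l$ over $\mathbb N^n$, unique up to isomorphism, with $X_{e_l}=Y_l$ and with $\theta_{ij}$ equal to the composite $Y_i\otimes_AY_j\simeq X_{e_i+e_j}\simeq Y_j\otimes_AY_i$ given by multiplication. For $i\le k$, $\ast_{l=1}^iY_l$ is the product system generated by $Y_1,\dots,Y_i$ and the $\theta$'s among them. **The correspondence $Y_j\otimes_A\mathcal O(\ast_{l=1}^iY_l)$.** Put $B=\mathcal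 O(\ast_{l=1}^iY_l)$ with universal covariant representation $\psi$. The Hilbert $B$-module $Y_j\otimes_AB$ is a $B$-correspondence with left action determined by $\psi_0(a)\cdot(y\otimes T)=ay\otimes T$ and $\psi_{e_l}(x)\cdot(y\otimes T)=(1\otimes\overline V_l)(\theta_{lj}(x\otimes y)\otimes T)$ for $l\le i$, $x\in Y_l$, where $\overline V_l:Y_l\otimes_AB\to B$, $\overline V_l(x\otimes T)=\psi_{e_l}(x)T$. **One step of the iteration.** Let $(Z,\zeta)$ be a generating system of $C$-correspondences $Z_1,\dots,Z_k$, and fix an index $p$. Let $V:Z_p\otimes_C\mathcal O_{Z_p}\to\mathcal O_{Z_p}$, $V(x\otimes S)=t_{Z_p}(x)S$. Define the $\mathcal O_{Z_p}$-correspondence $\mathcal EZ_i=Z_i\otimes_C\mathcal O_{Z_p}$, with left action determined by $\pi_{Z_p}(c)\cdot(z\otimes S)=cz\otimes S$ and $t_{Z_p}(x)\cdot(z\otimes S)=(1\otimes V)(\zeta_{pi}(x\otimes z)\otimes S)$. Define $\nu_{ij}:\mathcal EZ_i\otimes_{\mathcal O_{Z_p}}\mathcal EZ_j\to Z_i\otimes_CZ_j\otimes_C\mathcal O_{Z_p}$ by $(z\otimes T)\otimes\xi\mapsto z\otimes T\cdot\xi$, and $\mathcal R\zeta_{ij}=\nu_{ji}^{-1}(\zeta_{ij}\otimes1_{\mathcal O_{Z_p}})\nu_{ij}$. Then $(\mathcal EZ,\mathcal R\zeta)$ is a generating system of $\mathcal O_{Z_p}$-correspondences. **Iteration.** $(\mathcal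 E^0Y,\mathcal R^0\theta)=(Y,\theta)$, and $(\mathcal E^mY,\mathcal R^m\theta)$ is obtained from $(\mathcal E^{m-1}Y,\mathcal R^{m-1}\theta)$ by one step with $p=m$. Thus $\mathcal E^mY_j$ is a correspondence over $\mathcal O(\mathcal E^{m-1}Y_m)$, e.g. $\mathcal E^1Y_j=Y_j\otimes_A\mathcal O_{Y_1}$ and $\mathcal E^2Y_j=\mathcal EY_j\otimes_{\mathcal O_{Y_1}}\mathcal O(\mathcal EY_2)$. *)

theory Defs
  imports
    "HOL-Algebra.Module"
    "HOL-Analysis.Abstract_Metric_Spaces"
    "HOL-Library.Poly_Mapping"
    "HOL-Library.FuncSet"
begin

section \<open>C*-algebras\<close>

definition complex_ring :: "complex ring" where
  "complex_ring = \<lparr>carrier = UNIV, mult = (*), one = 1, zero = 0, add = (+)\<rparr>"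

text \<open>
  Complex vector spaces are modules over \<^const>\<open>complex_ring\<close>.  Module records also carry fields \<^const>\<open>one\<close> and \<^const>\<open>mult\<close>, about which the locale of modules says nothing.
  C*-algebras need not be unital, so \<^const>\<open>one\<close> is never used for them; for Hilbert modules
  neither field is used.
\<close>

record 'a cstar_algebra = "(complex, 'a) module" +
  star :: "'a \<Rightarrow> 'a"
  cnorm :: "'a \<Rightarrow> real"

text \<open>The case distinction makes the distance symmetric and nonnegative off the carrier as well, as
  the locale \<^locale>\<open>Metric_space\<close> demands.\<close>

definition norm_dist :: "('r, 'v, 'm) module_scheme \<Rightarrow> ('v \<Rightarrow> real) \<Rightarrow> 'v \<Rightarrow> 'v \<Rightarrow> real" where
  "norm_dist M N x y =
    (if x \<in> carrier M \<and> y \<in> carrier M then N (x \<ominus>\<^bsub>M\<^esub> y) else 0)"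

definition norm_closure :: "('r, 'v, 'm) module_scheme \<Rightarrow> ('v \<Rightarrow> real) \<Rightarrow> 'v set \<Rightarrow> 'v set" where
  "norm_closure M N S = Metric_space.mtopology (carrier M) (norm_dist M N) closure_of S"

definition norm_complete :: "('r, 'v, 'm) module_scheme \<Rightarrow> ('v \<Rightarrow> real) \<Rightarrow> bool" where
  "norm_complete M N \<longleftrightarrow> Metric_space.mcomplete (carrier M) (norm_dist M N)"

definition cspan :: "(complex, 'v, 'm) module_scheme \<Rightarrow> 'v set \<Rightarrow> 'v set" where
  "cspan M S = \<Inter>{H. submodule H complex_ring M \<and> S \<subseteq> H}"

locale cstar_algebra = Module.module complex_ring A
  for A :: "('a, 'm) cstar_algebra_scheme" (structure) +
  assumes mult_closed: "\<lbrakk>x \<in> carrier A; y \<in> carrier A\<rbrakk> \<Longrightarrow> x \<otimes> y \<in> carrier A"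
    and mult_assoc: "\<lbrakk>x \<in> carrier A; y \<in> carrier A; z \<in> carrier A\<rbrakk> \<Longrightarrow>
      (x \<otimes> y) \<otimes> z = x \<otimes> (y \<otimes> z)"
    and mult_l_distr: "\<lbrakk>x \<in> carrier A; y \<in> carrier A; z \<in> carrier A\<rbrakk> \<Longrightarrow>
      (x \<oplus> y) \<otimes> z = x \<otimes> z \<oplus> y \<otimes> z"
    and mult_r_distr: "\<lbrakk>x \<in> carrier A; y \<in> carrier A; z \<in> carrier A\<rbrakk> \<Longrightarrow>
      z \<otimes> (x \<oplus> y) = z \<otimes> x \<oplus> z \<otimes> y"
    and smult_mult_left: "\<lbrakk>x \<in> carrier A; y \<in> carrier A\<rbrakk> \<Longrightarrow> (c \<odot> x) \<otimes> y = c \<odot> (x \<otimes> y)"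
    and smult_mult_right: "\<lbrakk>x \<in> carrier A; y \<in> carrier A\<rbrakk> \<Longrightarrow> x \<otimes> (c \<odot> y) = c \<odot> (x \<otimes> y)"
    and star_closed: "x \<in> carrier A \<Longrightarrow> star A x \<in> carrier A"
    and star_star: "x \<in> carrier A \<Longrightarrow> star A (star A x) = x"
    and star_add: "\<lbrakk>x \<in> carrier A; y \<in> carrier A\<rbrakk> \<Longrightarrow> star A (x \<oplus> y) = star A x \<oplus> star A y"
    and star_smult: "x \<in> carrier A \<Longrightarrow> star A (c \<odot> x) = cnj c \<odot> star A x"
    and star_mult: "\<lbrakk>x \<in> carrier A; y \<in> carrier A\<rbrakk> \<Longrightarrow> star A (x \<otimes> y) = star A y \<otimes> star A x"
    and cnorm_nonneg: "x \<in> carrier A \<Longrightarrow> 0 \<le> cnorm A x"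
    and cnorm_eq_0_iff: "x \<in> carrier A \<Longrightarrow> cnorm A x = 0 \<longleftrightarrow> x = \<zero>"
    and cnorm_add: "\<lbrakk>x \<in> carrier A; y \<in> carrier A\<rbrakk> \<Longrightarrow> cnorm A (x \<oplus> y) \<le> cnorm A x + cnorm A y"
    and cnorm_smult: "x \<in> carrier A \<Longrightarrow> cnorm A (c \<odot> x) = cmod c * cnorm A x"
    and cnorm_mult: "\<lbrakk>x \<in> carrier A; y \<in> carrier A\<rbrakk> \<Longrightarrow> cnorm A (x \<otimes> y) \<le> cnorm A x * cnorm A y"
    and cnorm_star: "x \<in> carrier A \<Longrightarrow> cnorm A (star A x \<otimes> x) = (cnorm A x)\<^sup>2"
    and complete: "norm_complete A (cnorm A)"

definition cstar_hom ::
  "('a, 'm) cstar_algebra_scheme \<Rightarrow> ('b, 'n) cstar_algebra_scheme \<Rightarrow> ('a \<Rightarrow> 'b) \<Rightarrow> bool" where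
  "cstar_hom A B f \<longleftrightarrow>
    f \<in> carrier A \<rightarrow> carrier B \<and>
    (\<forall>x\<in>carrier A. \<forall>y\<in>carrier A. f (x \<oplus>\<^bsub>A\<^esub> y) = f x \<oplus>\<^bsub>B\<^esub> f y) \<and>
    (\<forall>c. \<forall>x\<in>carrier A. f (c \<odot>\<^bsub>A\<^esub> x) = c \<odot>\<^bsub>B\<^esub> f x) \<and>
    (\<forall>x\<in>carrier A. \<forall>y\<in>carrier A. f (x \<otimes>\<^bsub>A\<^esub> y) = f x \<otimes>\<^bsub>B\<^esub> f y) \<and>
    (\<forall>x\<in>carrier A. f (star A x) = star B (f x))"

definition cstar_iso ::
  "('a, 'm) cstar_algebra_scheme \<Rightarrow> ('b, 'n) cstar_algebra_scheme \<Rightarrow> ('a \<Rightarrow> 'b) \<Rightarrow> bool" where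
  "cstar_iso A B f \<longleftrightarrow> cstar_hom A B f \<and> bij_betw f (carrier A) (carrier B)"

definition cstar_isomorphic ::
  "('a, 'm) cstar_algebra_scheme \<Rightarrow> ('b, 'n) cstar_algebra_scheme \<Rightarrow> bool" where
  "cstar_isomorphic A B \<longleftrightarrow> (\<exists>f. cstar_iso A B f)"

definition cstar_subalgebra :: "'a set \<Rightarrow> ('a, 'm) cstar_algebra_scheme \<Rightarrow> bool" where
  "cstar_subalgebra H A \<longleftrightarrow>
    submodule H complex_ring A \<and>
    (\<forall>x\<in>H. \<forall>y\<in>H. x \<otimes>\<^bsub>A\<^esub> y \<in> H) \<and>
    (\<forall>x\<in>H. star A x \<in> H) \<and>
    norm_closure A (cnorm A) H = H"

definition cstar_generate :: "('a, 'm) cstar_algebra_scheme \<Rightarrow> 'a set \<Rightarrow> 'a set" where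
  "cstar_generate A S = \<Inter>{H. cstar_subalgebra H A \<and> S \<subseteq> H}"

section \<open>Hilbert modules and correspondences\<close>

record ('a, 'x) hilbert_module = "(complex, 'x) module" +
  ract :: "'x \<Rightarrow> 'a \<Rightarrow> 'x"
  hinner :: "'x \<Rightarrow> 'x \<Rightarrow> 'a"

definition hnorm ::
  "('a, 'm) cstar_algebra_scheme \<Rightarrow> ('a, 'x, 'n) hilbert_module_scheme \<Rightarrow> 'x \<Rightarrow> real" where
  "hnorm A X x = sqrt (cnorm A (hinner X x x))"

locale hilbert_module = A?: cstar_algebra A + X?: Module.module complex_ring X
  for A :: "('a, 'm) cstar_algebra_scheme" and X :: "('a, 'x, 'n) hilbert_module_scheme" +
  assumes ract_closed: "\<lbrakk>x \<in> carrier X; a \<in> carrier A\<rbrakk> \<Longrightarrow> ract X x a \<in> carrier X"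
    and ract_add_left: "\<lbrakk>x \<in> carrier X; y \<in> carrier X; a \<in> carrier A\<rbrakk> \<Longrightarrow>
      ract X (x \<oplus>\<^bsub>X\<^esub> y) a = ract X x a \<oplus>\<^bsub>X\<^esub> ract X y a"
    and ract_add_right: "\<lbrakk>x \<in> carrier X; a \<in> carrier A; b \<in> carrier A\<rbrakk> \<Longrightarrow>
      ract X x (a \<oplus>\<^bsub>A\<^esub> b) = ract X x a \<oplus>\<^bsub>X\<^esub> ract X x b"
    and ract_smult_left: "\<lbrakk>x \<in> carrier X; a \<in> carrier A\<rbrakk> \<Longrightarrow>
      ract X (c \<odot>\<^bsub>X\<^esub> x) a = c \<odot>\<^bsub>X\<^esub> ract X x a"
    and ract_smult_right: "\<lbrakk>x \<in> carrier X; a \<in> carrier A\<rbrakk> \<Longrightarrow>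
      ract X x (c \<odot>\<^bsub>A\<^esub> a) = c \<odot>\<^bsub>X\<^esub> ract X x a"
    and ract_mult: "\<lbrakk>x \<in> carrier X; a \<in> carrier A; b \<in> carrier A\<rbrakk> \<Longrightarrow>
      ract X x (a \<otimes>\<^bsub>A\<^esub> b) = ract X (ract X x a) b"
    and hinner_closed: "\<lbrakk>x \<in> carrier X; y \<in> carrier X\<rbrakk> \<Longrightarrow> hinner X x y \<in> carrier A"
    and hinner_add: "\<lbrakk>x \<in> carrier X; y \<in> carrier X; z \<in> carrier X\<rbrakk> \<Longrightarrow>
      hinner X x (y \<oplus>\<^bsub>X\<^esub> z) = hinner X x y \<oplus>\<^bsub>A\<^esub> hinner X x z"
    and hinner_smult: "\<lbrakk>x \<in> carrier X; y \<in> carrier X\<rbrakk> \<Longrightarrow>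
      hinner X x (c \<odot>\<^bsub>X\<^esub> y) = c \<odot>\<^bsub>A\<^esub> hinner X x y"
    and hinner_ract: "\<lbrakk>x \<in> carrier X; y \<in> carrier X; a \<in> carrier A\<rbrakk> \<Longrightarrow>
      hinner X x (ract X y a) = hinner X x y \<otimes>\<^bsub>A\<^esub> a"
    and hinner_star: "\<lbrakk>x \<in> carrier X; y \<in> carrier X\<rbrakk> \<Longrightarrow>
      star A (hinner X x y) = hinner X y x"
    and hinner_pos: "x \<in> carrier X \<Longrightarrow> \<exists>b\<in>carrier A. hinner X x x = star A b \<otimes>\<^bsub>A\<^esub> b"
    and hinner_definite: "\<lbrakk>x \<in> carrier X; hinner X x x = \<zero>\<^bsub>A\<^esub>\<rbrakk> \<Longrightarrow> x = \<zero>\<^bsub>X\<^esub>"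
    and hilbert_complete: "norm_complete X (hnorm A X)"

text \<open>Operators on a Hilbert module are represented by functions that are extensional on its carrier,
  so that equality of operators is equality of functions.\<close>

definition is_adjoint ::
  "('a, 'x, 'n) hilbert_module_scheme \<Rightarrow> ('x \<Rightarrow> 'x) \<Rightarrow> ('x \<Rightarrow> 'x) \<Rightarrow> bool" where
  "is_adjoint X T S \<longleftrightarrow>
    (\<forall>x\<in>carrier X. \<forall>y\<in>carrier X. hinner X (T x) y = hinner X x (S y))"

definition adjointable_ops ::
  "('a, 'm) cstar_algebra_scheme \<Rightarrow> ('a, 'x, 'n) hilbert_module_scheme \<Rightarrow>
    ('x \<Rightarrow> 'x) cstar_algebra" where
  "adjointable_ops A X =
    \<lparr>carrier = {T \<in> carrier X \<rightarrow>\<^sub>E carrier X. \<exists>S \<in> carrier X \<rightarrow>\<^sub>E carrier X. is_adjoint X T S},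
     mult = (\<lambda>S T. compose (carrier X) S T),
     one = (\<lambda>x\<in>carrier X. x),
     zero = (\<lambda>x\<in>carrier X. \<zero>\<^bsub>X\<^esub>),
     add = (\<lambda>S T. \<lambda>x\<in>carrier X. S x \<oplus>\<^bsub>X\<^esub> T x),
     smult = (\<lambda>c T. \<lambda>x\<in>carrier X. c \<odot>\<^bsub>X\<^esub> T x),
     star = (\<lambda>T. THE S. S \<in> carrier X \<rightarrow>\<^sub>E carrier X \<and> is_adjoint X T S),
     cnorm = (\<lambda>T. SUP x\<in>{x\<in>carrier X. hnorm A X x \<le> 1}. hnorm A X (T x))\<rparr>"

definition rank_one :: "('a, 'x, 'n) hilbert_module_scheme \<Rightarrow> 'x \<Rightarrow> 'x \<Rightarrow> 'x \<Rightarrow> 'x" where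
  "rank_one X x y = (\<lambda>z\<in>carrier X. ract X x (hinner X y z))"

definition compact_ops ::
  "('a, 'm) cstar_algebra_scheme \<Rightarrow> ('a, 'x, 'n) hilbert_module_scheme \<Rightarrow>
    ('x \<Rightarrow> 'x) cstar_algebra" where
  "compact_ops A X = (adjointable_ops A X)\<lparr>carrier :=
    norm_closure (adjointable_ops A X) (cnorm (adjointable_ops A X))
      (cspan (adjointable_ops A X) {rank_one X x y |x y. x \<in> carrier X \<and> y \<in> carrier X})\<rparr>"

record ('a, 'x) correspondence = "('a, 'x) hilbert_module" +
  lact :: "'a \<Rightarrow> 'x \<Rightarrow> 'x"

definition left_op :: "('a, 'x, 'n) correspondence_scheme \<Rightarrow> 'a \<Rightarrow> 'x \<Rightarrow> 'x" where
  "left_op X a = (\<lambda>x\<in>carrier X. lact X a x)"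

text \<open>Following the standing convention, correspondences are nondegenerate and regular.\<close>

locale correspondence = hilbert_module A X
  for A :: "('a, 'm) cstar_algebra_scheme" and X :: "('a, 'x, 'n) correspondence_scheme" +
  assumes left_hom: "cstar_hom A (adjointable_ops A X) (left_op X)"
    and nondegenerate: "{lact X a x |a x. a \<in> carrier A \<and> x \<in> carrier X} = carrier X"
    and left_inj: "inj_on (left_op X) (carrier A)"
    and left_compact: "left_op X ` carrier A \<subseteq> carrier (compact_ops A X)"

definition alg_corr :: "('a, 'm) cstar_algebra_scheme \<Rightarrow> ('a, 'a) correspondence" where
  "alg_corr A =
    \<lparr>carrier = carrier A, mult = mult A, one = one A, zero = zero A, add = add A, smult = smult A,
     ract = mult A, hinner = (\<lambda>a b. star A a \<otimes>\<^bsub>A\<^esub> b), lact = mult A\<rparr>"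

definition hilbert_isometry ::
  "('a, 'm) cstar_algebra_scheme \<Rightarrow> ('a, 'x, 'n) hilbert_module_scheme \<Rightarrow>
    ('a, 'y, 'p) hilbert_module_scheme \<Rightarrow> ('x \<Rightarrow> 'y) \<Rightarrow> bool" where
  "hilbert_isometry A X Y f \<longleftrightarrow>
    f \<in> carrier X \<rightarrow> carrier Y \<and>
    (\<forall>x\<in>carrier X. \<forall>y\<in>carrier X. f (x \<oplus>\<^bsub>X\<^esub> y) = f x \<oplus>\<^bsub>Y\<^esub> f y) \<and>
    (\<forall>c. \<forall>x\<in>carrier X. f (c \<odot>\<^bsub>X\<^esub> x) = c \<odot>\<^bsub>Y\<^esub> f x) \<and>
    (\<forall>x\<in>carrier X. \<forall>a\<in>carrier A. f (ract X x a) = ract Y (f x) a) \<and>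
    (\<forall>x\<in>carrier X. \<forall>y\<in>carrier X. hinner Y (f x) (f y) = hinner X x y)"

definition hilbert_iso ::
  "('a, 'm) cstar_algebra_scheme \<Rightarrow> ('a, 'x, 'n) hilbert_module_scheme \<Rightarrow>
    ('a, 'y, 'p) hilbert_module_scheme \<Rightarrow> ('x \<Rightarrow> 'y) \<Rightarrow> bool" where
  "hilbert_iso A X Y f \<longleftrightarrow> hilbert_isometry A X Y f \<and> bij_betw f (carrier X) (carrier Y)"

definition corr_iso ::
  "('a, 'm) cstar_algebra_scheme \<Rightarrow> ('a, 'x, 'n) correspondence_scheme \<Rightarrow>
    ('a, 'y, 'p) correspondence_scheme \<Rightarrow> ('x \<Rightarrow> 'y) \<Rightarrow> bool" where
  "corr_iso A X Y f \<longleftrightarrow>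
    hilbert_iso A X Y f \<and>
    (\<forall>a\<in>carrier A. \<forall>x\<in>carrier X. f (lact X a x) = lact Y a (f x))"

definition corr_isomorphic ::
  "('b, 'm) cstar_algebra_scheme \<Rightarrow> ('b, 'x, 'n) correspondence_scheme \<Rightarrow>
    ('c, 'p) cstar_algebra_scheme \<Rightarrow> ('c, 'y, 'q) correspondence_scheme \<Rightarrow> bool" where
  "corr_isomorphic B Z C W \<longleftrightarrow> (\<exists>\<iota> \<phi>.
    cstar_iso B C \<iota> \<and>
    bij_betw \<phi> (carrier Z) (carrier W) \<and>
    (\<forall>z\<in>carrier Z. \<forall>z'\<in>carrier Z. \<phi> (z \<oplus>\<^bsub>Z\<^esub> z') = \<phi> z \<oplus>\<^bsub>W\<^esub> \<phi> z') \<and>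
    (\<forall>c. \<forall>z\<in>carrier Z. \<phi> (c \<odot>\<^bsub>Z\<^esub> z) = c \<odot>\<^bsub>W\<^esub> \<phi> z) \<and>
    (\<forall>b\<in>carrier B. \<forall>z\<in>carrier Z. \<forall>b'\<in>carrier B.
      \<phi> (lact Z b (ract Z z b')) = lact W (\<iota> b) (ract W (\<phi> z) (\<iota> b'))) \<and>
    (\<forall>z\<in>carrier Z. \<forall>z'\<in>carrier Z. hinner W (\<phi> z) (\<phi> z') = \<iota> (hinner Z z z')))"

section \<open>Balanced tensor products\<close>

text \<open>
  \<open>interior_tensor A X \<phi> B Y W \<tau>\<close> says that the Hilbert \<open>B\<close>-module \<open>W\<close>, with elementary tensors
  \<open>\<tau> x y\<close>, is the balanced tensor product of the Hilbert \<open>A\<close>-module \<open>X\<close> and the Hilbert \<open>B\<close>-module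
  \<open>Y\<close>, on which \<open>A\<close> acts by \<open>\<phi>\<close>.  That is, \<open>W\<close> is the completion of the span of the elementary
  tensors for the inner product \<open>\<langle>x \<otimes> y, x' \<otimes> y'\<rangle> = \<langle>y, \<phi>(\<langle>x, x'\<rangle>) y'\<rangle>\<close>, which fixes it up
  to a unique isomorphism respecting elementary tensors.  All tensor products below are given by
  such models, and a map on a tensor product by its values on elementary tensors.
\<close>

definition interior_tensor ::
  "('a, 'm) cstar_algebra_scheme \<Rightarrow> ('a, 'x, 'n) hilbert_module_scheme \<Rightarrow> ('a \<Rightarrow> 'y \<Rightarrow> 'y) \<Rightarrow>
    ('b, 'p) cstar_algebra_scheme \<Rightarrow> ('b, 'y, 'q) hilbert_module_scheme \<Rightarrow>
    ('b, 'w, 'r) hilbert_module_scheme \<Rightarrow> ('x \<Rightarrow> 'y \<Rightarrow> 'w) \<Rightarrow> bool" where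
  "interior_tensor A X \<phi> B Y W \<tau> \<longleftrightarrow>
    hilbert_module A X \<and> hilbert_module B Y \<and> hilbert_module B W \<and>
    cstar_hom A (adjointable_ops B Y) (\<lambda>a. \<lambda>y\<in>carrier Y. \<phi> a y) \<and>
    (\<forall>x\<in>carrier X. \<forall>y\<in>carrier Y. \<tau> x y \<in> carrier W) \<and>
    (\<forall>x\<in>carrier X. \<forall>x'\<in>carrier X. \<forall>y\<in>carrier Y. \<tau> (x \<oplus>\<^bsub>X\<^esub> x') y = \<tau> x y \<oplus>\<^bsub>W\<^esub> \<tau> x' y) \<and>
    (\<forall>x\<in>carrier X. \<forall>y\<in>carrier Y. \<forall>y'\<in>carrier Y. \<tau> x (y \<oplus>\<^bsub>Y\<^esub> y') = \<tau> x y \<oplus>\<^bsub>W\<^esub> \<tau> x y') \<and>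
    (\<forall>c. \<forall>x\<in>carrier X. \<forall>y\<in>carrier Y. \<tau> (c \<odot>\<^bsub>X\<^esub> x) y = c \<odot>\<^bsub>W\<^esub> \<tau> x y) \<and>
    (\<forall>c. \<forall>x\<in>carrier X. \<forall>y\<in>carrier Y. \<tau> x (c \<odot>\<^bsub>Y\<^esub> y) = c \<odot>\<^bsub>W\<^esub> \<tau> x y) \<and>
    (\<forall>x\<in>carrier X. \<forall>a\<in>carrier A. \<forall>y\<in>carrier Y. \<tau> (ract X x a) y = \<tau> x (\<phi> a y)) \<and>
    (\<forall>x\<in>carrier X. \<forall>y\<in>carrier Y. \<forall>b\<in>carrier B. ract W (\<tau> x y) b = \<tau> x (ract Y y b)) \<and>
    (\<forall>x\<in>carrier X. \<forall>y\<in>carrier Y. \<forall>x'\<in>carrier X. \<forall>y'\<in>carrier Y.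
      hinner W (\<tau> x y) (\<tau> x' y') = hinner Y y (\<phi> (hinner X x x') y')) \<and>
    norm_closure W (hnorm B W) (cspan W {\<tau> x y |x y. x \<in> carrier X \<and> y \<in> carrier Y}) = carrier W"

definition corr_tensor ::
  "('a, 'm) cstar_algebra_scheme \<Rightarrow> ('a, 'x, 'n) correspondence_scheme \<Rightarrow>
    ('a, 'y, 'p) correspondence_scheme \<Rightarrow> ('a, 'w, 'q) correspondence_scheme \<Rightarrow>
    ('x \<Rightarrow> 'y \<Rightarrow> 'w) \<Rightarrow> bool" where
  "corr_tensor A X Y W \<tau> \<longleftrightarrow>
    correspondence A X \<and> correspondence A Y \<and> correspondence A W \<and>
    interior_tensor A X (lact Y) A Y W \<tau> \<and>
    (\<forall>a\<in>carrier A. \<forall>x\<in>carrier X. \<forall>y\<in>carrier Y. lact W a (\<tau> x y) = \<tau> (lact X a x) y)"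

text \<open>
  \<open>N\<close> is the triple tensor product \<open>X \<otimes>\<^sub>A Y \<otimes>\<^sub>A Z\<close>, both as \<open>(X \<otimes>\<^sub>A Y) \<otimes>\<^sub>A Z\<close> (via \<open>n\<close>) and as
  \<open>X \<otimes>\<^sub>A (Y \<otimes>\<^sub>A Z)\<close> (via \<open>n'\<close>), for given models \<open>(T, \<tau>)\<close> of \<open>X \<otimes>\<^sub>A Y\<close> and \<open>(U, u)\<close> of
  \<open>Y \<otimes>\<^sub>A Z\<close>.  Here \<open>Z\<close> is a Hilbert \<open>B\<close>-module, and \<open>A\<close> acts on \<open>Z\<close> by \<open>\<phi>\<close> and on \<open>U\<close> by \<open>\<phi>'\<close>.
\<close>

definition triple_tensor ::
  "('a, 'm) cstar_algebra_scheme \<Rightarrow> ('a, 'x, 'n) hilbert_module_scheme \<Rightarrow>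
    ('a, 'y, 'p) hilbert_module_scheme \<Rightarrow> ('a \<Rightarrow> 'z \<Rightarrow> 'z) \<Rightarrow>
    ('b, 'q) cstar_algebra_scheme \<Rightarrow> ('b, 'z, 'r) hilbert_module_scheme \<Rightarrow>
    ('a, 't, 's) hilbert_module_scheme \<Rightarrow> ('x \<Rightarrow> 'y \<Rightarrow> 't) \<Rightarrow>
    ('a \<Rightarrow> 'u \<Rightarrow> 'u) \<Rightarrow> ('b, 'u, 'v) hilbert_module_scheme \<Rightarrow> ('y \<Rightarrow> 'z \<Rightarrow> 'u) \<Rightarrow>
    ('b, 'w, 'o) hilbert_module_scheme \<Rightarrow> ('t \<Rightarrow> 'z \<Rightarrow> 'w) \<Rightarrow> ('x \<Rightarrow> 'u \<Rightarrow> 'w) \<Rightarrow> bool" where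
  "triple_tensor A X Y \<phi> B Z T \<tau> \<phi>' U u N n n' \<longleftrightarrow>
    interior_tensor A T \<phi> B Z N n \<and>
    interior_tensor A X \<phi>' B U N n' \<and>
    (\<forall>x\<in>carrier X. \<forall>y\<in>carrier Y. \<forall>z\<in>carrier Z. n (\<tau> x y) z = n' x (u y z))"

section \<open>Representations and Cuntz--Pimsner algebras\<close>

definition representation ::
  "('a, 'm) cstar_algebra_scheme \<Rightarrow> ('a, 'x, 'n) correspondence_scheme \<Rightarrow>
    ('d, 'p) cstar_algebra_scheme \<Rightarrow> ('a \<Rightarrow> 'd) \<Rightarrow> ('x \<Rightarrow> 'd) \<Rightarrow> bool" where
  "representation A X D \<pi> t \<longleftrightarrow>
    cstar_hom A D \<pi> \<and>
    t \<in> carrier X \<rightarrow> carrier D \<and>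
    (\<forall>x\<in>carrier X. \<forall>y\<in>carrier X. t (x \<oplus>\<^bsub>X\<^esub> y) = t x \<oplus>\<^bsub>D\<^esub> t y) \<and>
    (\<forall>c. \<forall>x\<in>carrier X. t (c \<odot>\<^bsub>X\<^esub> x) = c \<odot>\<^bsub>D\<^esub> t x) \<and>
    (\<forall>a\<in>carrier A. \<forall>x\<in>carrier X. \<pi> a \<otimes>\<^bsub>D\<^esub> t x = t (lact X a x)) \<and>
    (\<forall>x\<in>carrier X. \<forall>y\<in>carrier X. star D (t x) \<otimes>\<^bsub>D\<^esub> t y = \<pi> (hinner X x y))"

text \<open>The map \<open>t1\<close> is the homomorphism \<open>t\<^sup>(\<^sup>1\<^sup>)\<close> on the compact operators, which is determined by its
  values on the rank-one operators.\<close>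

definition covariant_representation ::
  "('a, 'm) cstar_algebra_scheme \<Rightarrow> ('a, 'x, 'n) correspondence_scheme \<Rightarrow>
    ('d, 'p) cstar_algebra_scheme \<Rightarrow> ('a \<Rightarrow> 'd) \<Rightarrow> ('x \<Rightarrow> 'd) \<Rightarrow> bool" where
  "covariant_representation A X D \<pi> t \<longleftrightarrow>
    representation A X D \<pi> t \<and>
    (\<exists>t1. cstar_hom (compact_ops A X) D t1 \<and>
      (\<forall>x\<in>carrier X. \<forall>y\<in>carrier X. t1 (rank_one X x y) = t x \<otimes>\<^bsub>D\<^esub> star D (t y)) \<and>
      (\<forall>a\<in>carrier A. \<pi> a = t1 (left_op X a)))"

text \<open>
  The type \<open>nat \<Rightarrow> 'u\<close> of the target algebras loses no generality.  Let a covariant representation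
  in a C*-algebra of any type be given.  The C*-subalgebra generated by its range consists of limits
  of sequences of noncommutative *-polynomials, with coefficients in the field generated by the
  rationals and the imaginary unit, in the images of elements of type \<open>'u\<close>.  If \<open>'u\<close> has at least two
  elements, there are at most as many such limits as functions \<open>nat \<Rightarrow> 'u\<close>, so a copy of the
  subalgebra has this type.  If \<open>'u\<close> has only one element, the generated subalgebra is zero.  The same
  applies to product systems below, which have countably many fibres.
\<close>

definition cuntz_pimsner ::
  "'u cstar_algebra \<Rightarrow> ('u, 'u) correspondence \<Rightarrow> 'u cstar_algebra \<Rightarrow>
    ('u \<Rightarrow> 'u) \<Rightarrow> ('u \<Rightarrow> 'u) \<Rightarrow> bool" where
  "cuntz_pimsner A X B \<pi> t \<longleftrightarrow>
    cstar_algebra B \<and>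
    covariant_representation A X B \<pi> t \<and>
    cstar_generate B (\<pi> ` carrier A \<union> t ` carrier X) = carrier B \<and>
    (\<forall>(D :: (nat \<Rightarrow> 'u) cstar_algebra) \<pi>' t'.
      cstar_algebra D \<and> covariant_representation A X D \<pi>' t' \<longrightarrow>
      (\<exists>\<rho>. cstar_hom B D \<rho> \<and> (\<forall>a\<in>carrier A. \<rho> (\<pi> a) = \<pi>' a) \<and>
        (\<forall>x\<in>carrier X. \<rho> (t x) = t' x)))"

section \<open>Generating systems and their iteration\<close>

text \<open>
  The fields \<open>sq i j\<close> and \<open>tens i j\<close> are the model of the tensor product of the fibres \<open>i\<close> and
  \<open>j\<close> and its elementary tensors; \<open>flip i j\<close> is the isomorphism \<open>\<theta>\<^sub>i\<^sub>j\<close>.  All carriers are subsets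
  of one type \<open>'u\<close>, so that the iteration, which changes the algebra and the modules at every step,
  stays within one type.  This loses no generality: whatever the data, one can choose a type \<open>'u\<close> of
  the form \<open>nat \<Rightarrow> 'b\<close> that contains copies of them, and such a type also has room for copies of all
  the tensor products and Cuntz--Pimsner algebras formed from them.
\<close>

record 'u corr_system =
  coeff :: "'u cstar_algebra"
  fibre :: "nat \<Rightarrow> ('u, 'u) correspondence"
  sq :: "nat \<Rightarrow> nat \<Rightarrow> ('u, 'u) correspondence"
  tens :: "nat \<Rightarrow> nat \<Rightarrow> 'u \<Rightarrow> 'u \<Rightarrow> 'u"
  flip :: "nat \<Rightarrow> nat \<Rightarrow> 'u \<Rightarrow> 'u"

text \<open>In the hexagonal relations \<open>L i j l\<close> is \<open>\<theta>\<^sub>i\<^sub>j \<otimes> 1\<close> and \<open>R i j l\<close> is \<open>1 \<otimes> \<theta>\<^sub>j\<^sub>l\<close>, both on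
  the triple tensor product \<open>Q i j l\<close>.\<close>

definition hexagonal :: "nat \<Rightarrow> 'u corr_system \<Rightarrow> bool" where
  "hexagonal k Y \<longleftrightarrow> (\<exists>(Q :: nat \<Rightarrow> nat \<Rightarrow> nat \<Rightarrow> ('u, 'u) correspondence) q q' L R.
    (\<forall>i\<in>{1..k}. \<forall>j\<in>{1..k}. \<forall>l\<in>{1..k}.
      triple_tensor (coeff Y) (fibre Y i) (fibre Y j) (lact (fibre Y l)) (coeff Y) (fibre Y l)
        (sq Y i j) (tens Y i j) (lact (sq Y j l)) (sq Y j l) (tens Y j l)
        (Q i j l) (q i j l) (q' i j l) \<and>
      hilbert_iso (coeff Y) (Q i j l) (Q j i l) (L i j l) \<and>
      (\<forall>w\<in>carrier (sq Y i j). \<forall>y\<in>carrier (fibre Y l).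
        L i j l (q i j l w y) = q j i l (flip Y i j w) y) \<and>
      hilbert_iso (coeff Y) (Q i j l) (Q i l j) (R i j l) \<and>
      (\<forall>y\<in>carrier (fibre Y i). \<forall>w\<in>carrier (sq Y j l).
        R i j l (q' i j l y w) = q' i l j y (flip Y j l w))) \<and>
    (\<forall>i\<in>{1..k}. \<forall>j\<in>{1..k}. \<forall>l\<in>{1..k}. \<forall>v\<in>carrier (Q i j l).
      L j l i (R j i l (L i j l v)) = R l i j (L i l j (R i j l v))))"

definition generating_system :: "nat \<Rightarrow> 'u corr_system \<Rightarrow> bool" where
  "generating_system k Y \<longleftrightarrow>
    cstar_algebra (coeff Y) \<and>
    (\<forall>i\<in>{1..k}. correspondence (coeff Y) (fibre Y i)) \<and>
    (\<forall>i\<in>{1..k}. \<forall>j\<in>{1..k}.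
      corr_tensor (coeff Y) (fibre Y i) (fibre Y j) (sq Y i j) (tens Y i j) \<and>
      corr_iso (coeff Y) (sq Y i j) (sq Y j i) (flip Y i j)) \<and>
    (\<forall>i\<in>{1..k}. \<forall>w\<in>carrier (sq Y i i). flip Y i i w = w) \<and>
    (\<forall>i\<in>{1..k}. \<forall>j\<in>{1..k}. \<forall>w\<in>carrier (sq Y i j). flip Y j i (flip Y i j w) = w) \<and>
    hexagonal k Y"

definition hom_lact :: "('b, 'm) cstar_algebra_scheme \<Rightarrow> ('a \<Rightarrow> 'b) \<Rightarrow> 'a \<Rightarrow> 'b \<Rightarrow> 'b" where
  "hom_lact B \<pi> a b = \<pi> a \<otimes>\<^bsub>B\<^esub> b"

text \<open>\<open>W\<close> is a \<open>B\<close>-correspondence whose Hilbert module is \<open>Z \<otimes>\<^sub>A B\<close>, with elementary tensors \<open>e z S\<close>,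
  and on which the image of \<open>A\<close> under \<open>\<pi>\<close> acts through the left action on \<open>Z\<close>.\<close>

definition extended_corr ::
  "'u cstar_algebra \<Rightarrow> ('u, 'u) correspondence \<Rightarrow> 'u cstar_algebra \<Rightarrow> ('u \<Rightarrow> 'u) \<Rightarrow>
    ('u, 'u) correspondence \<Rightarrow> ('u \<Rightarrow> 'u \<Rightarrow> 'u) \<Rightarrow> bool" where
  "extended_corr A Z B \<pi> W e \<longleftrightarrow>
    correspondence B W \<and>
    interior_tensor A Z (hom_lact B \<pi>) B (alg_corr B) W e \<and>
    (\<forall>a\<in>carrier A. \<forall>z\<in>carrier Z. \<forall>S\<in>carrier B. lact W (\<pi> a) (e z S) = e (lact Z a z) S)"

text \<open>
  For \<open>x\<close> in the fibre \<open>p\<close>, the element \<open>t x\<close> acts on \<open>W\<close>, a model of the tensor product of the fibre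
  \<open>j\<close> with \<open>B\<close>, by \<open>z \<otimes> S \<mapsto> (1 \<otimes> V) (\<theta>\<^sub>p\<^sub>j (x \<otimes> z) \<otimes> S)\<close>, where \<open>V (x \<otimes> S) = t x S\<close>.  In this
  definition \<open>U\<close> is the tensor product of the fibre \<open>p\<close> with \<open>B\<close>, with \<open>A\<close> acting by \<open>\<phi>\<close>, \<open>N\<close> is the
  tensor product of the fibre \<open>j\<close>, the fibre \<open>p\<close> and \<open>B\<close>, and \<open>F\<close> is \<open>1 \<otimes> V\<close>.
\<close>

definition creation_action ::
  "'u corr_system \<Rightarrow> nat \<Rightarrow> nat \<Rightarrow> 'u cstar_algebra \<Rightarrow> ('u \<Rightarrow> 'u) \<Rightarrow> ('u \<Rightarrow> 'u) \<Rightarrow>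
    ('u, 'u) correspondence \<Rightarrow> ('u \<Rightarrow> 'u \<Rightarrow> 'u) \<Rightarrow> bool" where
  "creation_action Y p j B \<pi> t W e \<longleftrightarrow>
    (\<exists>(U :: ('u, 'u) hilbert_module) u \<phi> V (N :: ('u, 'u) hilbert_module) n n' F.
      interior_tensor (coeff Y) (fibre Y p) (hom_lact B \<pi>) B (alg_corr B) U u \<and>
      (\<forall>a\<in>carrier (coeff Y). \<forall>x\<in>carrier (fibre Y p). \<forall>S\<in>carrier B.
        \<phi> a (u x S) = u (lact (fibre Y p) a x) S) \<and>
      hilbert_isometry B U (alg_corr B) V \<and>
      (\<forall>x\<in>carrier (fibre Y p). \<forall>S\<in>carrier B. V (u x S) = t x \<otimes>\<^bsub>B\<^esub> S) \<and>
      triple_tensor (coeff Y) (fibre Y j) (fibre Y p) (hom_lact B \<pi>) B (alg_corr B)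
        (sq Y j p) (tens Y j p) \<phi> U u N n n' \<and>
      hilbert_isometry B N W F \<and>
      (\<forall>z\<in>carrier (fibre Y j). \<forall>\<xi>\<in>carrier U. F (n' z \<xi>) = e z (V \<xi>)) \<and>
      (\<forall>x\<in>carrier (fibre Y p). \<forall>z\<in>carrier (fibre Y j). \<forall>S\<in>carrier B.
        lact W (t x) (e z S) = F (n (flip Y p j (tens Y p j x z)) S)))"

text \<open>
  One step of the iteration with index \<open>p\<close>, from \<open>Z\<close> to \<open>E\<close>; the coefficient algebra of \<open>E\<close> is the
  Cuntz--Pimsner algebra of the fibre \<open>p\<close> of \<open>Z\<close>.  Here \<open>N i j\<close> is the tensor product of the fibres
  \<open>i\<close> and \<open>j\<close> of \<open>Z\<close> with this algebra, and \<open>M i j\<close> is \<open>\<zeta>\<^sub>i\<^sub>j \<otimes> 1\<close>.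
\<close>

definition iteration_step :: "nat \<Rightarrow> nat \<Rightarrow> 'u corr_system \<Rightarrow> 'u corr_system \<Rightarrow> bool" where
  "iteration_step k p Z E \<longleftrightarrow> (\<exists>\<pi> t e.
    cuntz_pimsner (coeff Z) (fibre Z p) (coeff E) \<pi> t \<and>
    (\<forall>i\<in>{1..k}.
      extended_corr (coeff Z) (fibre Z i) (coeff E) \<pi> (fibre E i) (e i) \<and>
      creation_action Z p i (coeff E) \<pi> t (fibre E i) (e i)) \<and>
    (\<forall>i\<in>{1..k}. \<forall>j\<in>{1..k}.
      corr_tensor (coeff E) (fibre E i) (fibre E j) (sq E i j) (tens E i j)) \<and>
    (\<exists>(N :: nat \<Rightarrow> nat \<Rightarrow> ('u, 'u) hilbert_module) n n' \<nu> M.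
      \<forall>i\<in>{1..k}. \<forall>j\<in>{1..k}.
        triple_tensor (coeff Z) (fibre Z i) (fibre Z j) (hom_lact (coeff E) \<pi>)
          (coeff E) (alg_corr (coeff E)) (sq Z i j) (tens Z i j)
          (\<lambda>c. lact (fibre E j) (\<pi> c)) (fibre E j) (e j) (N i j) (n i j) (n' i j) \<and>
        hilbert_iso (coeff E) (sq E i j) (N i j) (\<nu> i j) \<and>
        (\<forall>z\<in>carrier (fibre Z i). \<forall>S\<in>carrier (coeff E). \<forall>\<xi>\<in>carrier (fibre E j).
          \<nu> i j (tens E i j (e i z S) \<xi>) = n' i j z (lact (fibre E j) S \<xi>)) \<and>
        hilbert_iso (coeff E) (N i j) (N j i) (M i j) \<and>
        (\<forall>w\<in>carrier (sq Z i j). \<forall>S\<in>carrier (coeff E).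
          M i j (n i j w S) = n j i (flip Z i j w) S) \<and>
        (\<forall>w\<in>carrier (sq E i j).
          flip E i j w = inv_into (carrier (sq E j i)) (\<nu> j i) (M i j (\<nu> i j w)))))"

definition iterated_systems :: "nat \<Rightarrow> 'u corr_system \<Rightarrow> (nat \<Rightarrow> 'u corr_system) \<Rightarrow> bool" where
  "iterated_systems k Y E \<longleftrightarrow>
    E 0 = Y \<and> (\<forall>m\<in>{1..k - 1}. iteration_step k m (E (m - 1)) (E m))"

section \<open>Product systems\<close>

text \<open>The monoid \<open>\<nat>\<^sup>n\<close>, with coordinates numbered from 1 to \<open>n\<close>.\<close>

definition multi_index :: "nat \<Rightarrow> (nat \<Rightarrow>\<^sub>0 nat) set" where
  "multi_index n = {s. Poly_Mapping.keys s \<subseteq> {1..n}}"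

abbreviation unit_index :: "nat \<Rightarrow> (nat \<Rightarrow>\<^sub>0 nat)" where
  "unit_index l \<equiv> Poly_Mapping.single l 1"

text \<open>The multiplication \<open>mul s r\<close> induces an isomorphism of the tensor product of the fibres \<open>s\<close> and
  \<open>r\<close> with the fibre \<open>s + r\<close> iff the latter, with \<open>mul s r\<close>, is a model of this tensor product.\<close>

definition product_system ::
  "'u cstar_algebra \<Rightarrow> nat \<Rightarrow> ((nat \<Rightarrow>\<^sub>0 nat) \<Rightarrow> ('u, 'u) correspondence) \<Rightarrow>
    ((nat \<Rightarrow>\<^sub>0 nat) \<Rightarrow> (nat \<Rightarrow>\<^sub>0 nat) \<Rightarrow> 'u \<Rightarrow> 'u \<Rightarrow> 'u) \<Rightarrow> bool" where
  "product_system A n X mul \<longleftrightarrow>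
    cstar_algebra A \<and>
    (\<forall>s\<in>multi_index n. correspondence A (X s)) \<and>
    X 0 = alg_corr A \<and>
    (\<forall>s\<in>multi_index n. \<forall>r\<in>multi_index n. corr_tensor A (X s) (X r) (X (s + r)) (mul s r)) \<and>
    (\<forall>s\<in>multi_index n. \<forall>r\<in>multi_index n. \<forall>q\<in>multi_index n.
      \<forall>x\<in>carrier (X s). \<forall>y\<in>carrier (X r). \<forall>z\<in>carrier (X q).
        mul (s + r) q (mul s r x y) z = mul s (r + q) x (mul r q y z)) \<and>
    (\<forall>s\<in>multi_index n. \<forall>a\<in>carrier A. \<forall>x\<in>carrier (X s).
      mul 0 s a x = lact (X s) a x \<and> mul s 0 x a = ract (X s) x a)"

definition ps_covariant_representation ::
  "'u cstar_algebra \<Rightarrow> nat \<Rightarrow> ((nat \<Rightarrow>\<^sub>0 nat) \<Rightarrow> ('u, 'u) correspondence) \<Rightarrow>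
    ((nat \<Rightarrow>\<^sub>0 nat) \<Rightarrow> (nat \<Rightarrow>\<^sub>0 nat) \<Rightarrow> 'u \<Rightarrow> 'u \<Rightarrow> 'u) \<Rightarrow> 'd cstar_algebra \<Rightarrow>
    ((nat \<Rightarrow>\<^sub>0 nat) \<Rightarrow> 'u \<Rightarrow> 'd) \<Rightarrow> bool" where
  "ps_covariant_representation A n X mul D \<psi> \<longleftrightarrow>
    (\<forall>s\<in>multi_index n. covariant_representation A (X s) D (\<psi> 0) (\<psi> s)) \<and>
    (\<forall>s\<in>multi_index n. \<forall>r\<in>multi_index n. \<forall>x\<in>carrier (X s). \<forall>y\<in>carrier (X r).
      \<psi> s x \<otimes>\<^bsub>D\<^esub> \<psi> r y = \<psi> (s + r) (mul s r x y))"

definition ps_cuntz_pimsner ::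
  "'u cstar_algebra \<Rightarrow> nat \<Rightarrow> ((nat \<Rightarrow>\<^sub>0 nat) \<Rightarrow> ('u, 'u) correspondence) \<Rightarrow>
    ((nat \<Rightarrow>\<^sub>0 nat) \<Rightarrow> (nat \<Rightarrow>\<^sub>0 nat) \<Rightarrow> 'u \<Rightarrow> 'u \<Rightarrow> 'u) \<Rightarrow> 'u cstar_algebra \<Rightarrow>
    ((nat \<Rightarrow>\<^sub>0 nat) \<Rightarrow> 'u \<Rightarrow> 'u) \<Rightarrow> bool" where
  "ps_cuntz_pimsner A n X mul B \<psi> \<longleftrightarrow>
    cstar_algebra B \<and>
    ps_covariant_representation A n X mul B \<psi> \<and>
    cstar_generate B (\<Union>s\<in>multi_index n. \<psi> s ` carrier (X s)) = carrier B \<and>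
    (\<forall>(D :: (nat \<Rightarrow> 'u) cstar_algebra) \<psi>'.
      cstar_algebra D \<and> ps_covariant_representation A n X mul D \<psi>' \<longrightarrow>
      (\<exists>\<rho>. cstar_hom B D \<rho> \<and> (\<forall>s\<in>multi_index n. \<forall>x\<in>carrier (X s). \<rho> (\<psi> s x) = \<psi>' s x)))"

text \<open>The product system generated by the first \<open>n\<close> fibres of \<open>Y\<close>; \<open>m i j\<close> is the isomorphism induced
  by the multiplication of the fibres \<open>i\<close> and \<open>j\<close>.\<close>

definition generated_product_system ::
  "nat \<Rightarrow> 'u corr_system \<Rightarrow> ((nat \<Rightarrow>\<^sub>0 nat) \<Rightarrow> ('u, 'u) correspondence) \<Rightarrow>
    ((nat \<Rightarrow>\<^sub>0 nat) \<Rightarrow> (nat \<Rightarrow>\<^sub>0 nat) \<Rightarrow> 'u \<Rightarrow> 'u \<Rightarrow> 'u) \<Rightarrow> bool" where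
  "generated_product_system n Y X mul \<longleftrightarrow>
    product_system (coeff Y) n X mul \<and>
    (\<forall>l\<in>{1..n}. X (unit_index l) = fibre Y l) \<and>
    (\<exists>m. \<forall>i\<in>{1..n}. \<forall>j\<in>{1..n}.
      corr_iso (coeff Y) (sq Y i j) (X (unit_index i + unit_index j)) (m i j) \<and>
      (\<forall>x\<in>carrier (fibre Y i). \<forall>y\<in>carrier (fibre Y j).
        m i j (tens Y i j x y) = mul (unit_index i) (unit_index j) x y) \<and>
      (\<forall>w\<in>carrier (sq Y i j).
        flip Y i j w = inv_into (carrier (sq Y j i)) (m j i) (m i j w)))"

text \<open>\<open>W\<close> is the tensor product of the fibre \<open>j\<close> of \<open>Y\<close> with \<open>B\<close>, as a \<open>B\<close>-correspondence, where
  \<open>B\<close> with \<open>\<psi>\<close> is the Cuntz--Pimsner algebra of the product system generated by the first \<open>i\<close>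
  fibres.\<close>

definition ps_extended_corr ::
  "nat \<Rightarrow> 'u corr_system \<Rightarrow> nat \<Rightarrow> 'u cstar_algebra \<Rightarrow> ((nat \<Rightarrow>\<^sub>0 nat) \<Rightarrow> 'u \<Rightarrow> 'u) \<Rightarrow>
    ('u, 'u) correspondence \<Rightarrow> bool" where
  "ps_extended_corr i Y j B \<psi> W \<longleftrightarrow> (\<exists>e.
    extended_corr (coeff Y) (fibre Y j) B (\<psi> 0) W e \<and>
    (\<forall>l\<in>{1..i}. creation_action Y l j B (\<psi> 0) (\<psi> (unit_index l)) W e))"

end

theory Submission
  imports Defs "HOL-Analysis.Urysohn"
begin

text \<open>
  A commuting family for \<open>Y\<^sub>1, \<dots>, Y\<^sub>n\<close> consists of covariant representations \<open>(\<pi>, t\<^sub>l)\<close> of the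
  \<open>Y\<^sub>l\<close> with \<open>t\<^sub>i(x) t\<^sub>j(y) = (t\<^sub>j t\<^sub>i)(\<theta>\<^sub>i\<^sub>j(x \<otimes> y))\<close>.  Both sides of the theorem are determined by such families.

  A commuting family extends uniquely to a covariant representation of the product system: on the
  fibre over \<open>r + e\<^sub>l\<close> it is the product of its values over \<open>r\<close> and of \<open>t\<^sub>l\<close>, and it does not depend on
  the decomposition because two decompositions differ by one flip.  Hence the Cuntz--Pimsner
  algebra of the product system is the universal algebra of commuting families.

  By induction on \<open>m\<close>, the coefficient algebra \<open>B\<close> of the \<open>m\<close>-th iterate is universal for commuting
  families of length \<open>m\<close>, and its fibre \<open>W\<close> over \<open>j\<close> is \<open>Y\<^sub>j \<otimes> B\<close>, where \<open>t\<^sub>l(x)\<close> acts by creation.  If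
  \<open>(\<sigma>, \<tau>)\<close> is the universal covariant representation of the fibre over \<open>m + 1\<close>, then \<open>\<sigma> \<circ> t\<^sub>l\<close> for
  \<open>l \<le> m\<close> together with \<open>y \<mapsto> \<tau>(y \<otimes> 1)\<close> is the universal commuting family of length \<open>m + 1\<close>; the
  description of the left action on \<open>W\<close> is just the commutation relation.

  Covariance is used in the form that \<open>\<pi>(A)\<close> lies in the closed span of \<open>t(X) t(X)\<^sup>*\<close>.  This form is
  preserved by products, compositions and homomorphisms, and an element of this closed span is
  determined by its products with the elements of \<open>t(X)\<close>.
\<close>

section \<open>Normed spaces given by records\<close>

text \<open>Two obstacles shape the development. The algebras may lack a unit, so neither z
  \<otimes> 1 nor a functional calculus is at hand: square roots come from a fixed point equation,
  approximate units from a halving estimate, and a unit from the adjointable operators on the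
  algebra itself, where positivity is developed without spectra. Moreover t^(1) is given by its
  values on rank-one operators, so its existence has to be proved for every representation before
  covariance can be replaced by a condition on closed spans; the norm bound behind this comes from
  comparing 2^j-th powers.

  The induction cannot speak of B and its fibres alone. The next step creates with the flips of the
  iterated system, whereas the commutation relations are stated with \<theta>. So the maps from the
  tensor products of the given fibres to those of the iterated ones, which intertwine the two kinds
  of flips, are carried along.\<close>

lemma complex_ring_simps [simp]:
  "carrier complex_ring = UNIV" "monoid.mult complex_ring = (*)" "one complex_ring = 1"
  "zero complex_ring = 0" "add complex_ring = (+)"
  by (auto simp: complex_ring_def)

lemma cring_complex_ring: "cring complex_ring"
proof -
  have "\<exists>y. y + x = 0 \<and> x + y = 0" for x :: complex
    by (rule exI[of _ "- x"]) simp
  then show ?thesis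
    by unfold_locales (auto simp: Units_def algebra_simps)
qed

lemma complex_ring_a_inv [simp]: "a_inv complex_ring c = - c"
proof -
  interpret cring complex_ring by (rule cring_complex_ring)
  show ?thesis by (rule minus_equality) auto
qed

locale cvs = Module.module complex_ring M
  for M :: "(complex, 'v, 'm) module_scheme" (structure)
begin

lemma smult_closed' [simp, intro]: "x \<in> carrier M \<Longrightarrow> c \<odot> x \<in> carrier M"
  using smult_closed[of c x] by simp

lemma smult_add_left: "x \<in> carrier M \<Longrightarrow> (c + d) \<odot> x = c \<odot> x \<oplus> d \<odot> x"
  using smult_l_distr[of c d x] by simp

lemma smult_add_right: "\<lbrakk>x \<in> carrier M; y \<in> carrier M\<rbrakk> \<Longrightarrow> c \<odot> (x \<oplus> y) = c \<odot> x \<oplus> c \<odot> y"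
  using smult_r_distr[of c x y] by simp

lemma smult_smult: "x \<in> carrier M \<Longrightarrow> c \<odot> (d \<odot> x) = (c * d) \<odot> x"
  using smult_assoc1[of c d x] by simp

lemma smult_1 [simp]: "x \<in> carrier M \<Longrightarrow> 1 \<odot> x = x"
  using smult_one[of x] by simp

lemma smult_0 [simp]: "x \<in> carrier M \<Longrightarrow> 0 \<odot> x = \<zero>"
  using smult_l_null[of x] by simp

lemma smult_zero [simp]: "c \<odot> \<zero> = \<zero>"
  using smult_r_null[of c] by simp

lemma smult_neg_left: "x \<in> carrier M \<Longrightarrow> (- c) \<odot> x = \<ominus> (c \<odot> x)"
  using smult_l_minus[of c x] by simp

lemma smult_neg_right: "x \<in> carrier M \<Longrightarrow> c \<odot> (\<ominus> x) = \<ominus> (c \<odot> x)"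
  using smult_r_minus[of c x] by simp

lemma neg_eq_smult: "x \<in> carrier M \<Longrightarrow> \<ominus> x = (-1) \<odot> x"
  using smult_neg_left[of x 1] by simp

lemma minus_eq_smult: "\<lbrakk>x \<in> carrier M; y \<in> carrier M\<rbrakk> \<Longrightarrow> x \<ominus> y = x \<oplus> (-1) \<odot> y"
  by (simp add: a_minus_def neg_eq_smult)

lemma smult_minus_right: "\<lbrakk>x \<in> carrier M; y \<in> carrier M\<rbrakk> \<Longrightarrow> c \<odot> (x \<ominus> y) = c \<odot> x \<ominus> c \<odot> y"
  by (simp add: a_minus_def smult_add_right smult_neg_right)

lemma smult_diff_left: "x \<in> carrier M \<Longrightarrow> (c - d) \<odot> x = c \<odot> x \<ominus> d \<odot> x"
  using smult_add_left[of x c "- d"] by (simp add: a_minus_def smult_neg_left)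

lemma minus_self [simp]: "x \<in> carrier M \<Longrightarrow> x \<ominus> x = \<zero>"
  by (simp add: a_minus_def r_neg)

lemma minus_zero' [simp]: "x \<in> carrier M \<Longrightarrow> x \<ominus> \<zero> = x"
  by (simp add: a_minus_def)

lemma eq_minus_iff:
  "\<lbrakk>x \<in> carrier M; y \<in> carrier M; z \<in> carrier M\<rbrakk> \<Longrightarrow> x = y \<ominus> z \<longleftrightarrow> x \<oplus> z = y"
  by (metis a_minus_def add.inv_solve_right)

lemma minus_eq_zero_iff: "\<lbrakk>x \<in> carrier M; y \<in> carrier M\<rbrakk> \<Longrightarrow> x \<ominus> y = \<zero> \<longleftrightarrow> x = y"
  using eq_minus_iff[of \<zero> x y] by auto

lemma add_left_cancel_neg: "\<lbrakk>x \<in> carrier M; y \<in> carrier M\<rbrakk> \<Longrightarrow> x \<oplus> (\<ominus> x \<oplus> y) = y"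
  by (simp add: a_assoc[symmetric] r_neg)

lemma minus_add_minus:
  "\<lbrakk>x \<in> carrier M; y \<in> carrier M; z \<in> carrier M\<rbrakk> \<Longrightarrow> (x \<ominus> y) \<oplus> (y \<ominus> z) = x \<ominus> z"
  by (simp add: a_minus_def a_ac add_left_cancel_neg)

lemma minus_minus_swap:
  "\<lbrakk>a \<in> carrier M; b \<in> carrier M; c \<in> carrier M; d \<in> carrier M\<rbrakk>
    \<Longrightarrow> (a \<oplus> b) \<ominus> (c \<oplus> d) = (a \<ominus> c) \<oplus> (b \<ominus> d)"
  by (simp add: a_minus_def a_ac minus_add)

lemma neg_minus: "\<lbrakk>x \<in> carrier M; y \<in> carrier M\<rbrakk> \<Longrightarrow> \<ominus> (x \<ominus> y) = y \<ominus> x"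
  by (simp add: a_minus_def minus_add a_ac)

lemma submodule_iff:
  "submodule H complex_ring M \<longleftrightarrow>
    H \<subseteq> carrier M \<and> \<zero> \<in> H \<and> (\<forall>x\<in>H. \<forall>y\<in>H. x \<oplus> y \<in> H) \<and> (\<forall>c. \<forall>x\<in>H. c \<odot> x \<in> H)"
  (is "?L \<longleftrightarrow> ?R")
proof
  assume L: ?L
  from submoduleE(2)[OF this] obtain x where x: "x \<in> H" by blast
  then have "0 \<odot> x \<in> H" using submoduleE(4)[OF L, of 0 x] by simp
  moreover have "x \<in> carrier M" using submoduleE(1)[OF L] x by blast
  ultimately have "\<zero> \<in> H" by simp
  then show ?R
    using submoduleE(1)[OF L] submoduleE(4)[OF L] submoduleE(5)[OF L] by auto
next
  assume R: ?R
  then have "\<ominus> x \<in> H" if "x \<in> H" for x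
    using that neg_eq_smult[of x] by auto
  with R show ?L by (intro submoduleI) auto
qed

lemma submoduleD:
  assumes "submodule H complex_ring M"
  shows "H \<subseteq> carrier M" "\<zero> \<in> H" "\<lbrakk>x \<in> H; y \<in> H\<rbrakk> \<Longrightarrow> x \<oplus> y \<in> H" "x \<in> H \<Longrightarrow> c \<odot> x \<in> H"
  using assms unfolding submodule_iff by simp_all

lemma submodule_minus: "\<lbrakk>submodule H complex_ring M; x \<in> H; y \<in> H\<rbrakk> \<Longrightarrow> x \<ominus> y \<in> H"
  by (metis a_minus_def submoduleE(3,5))

lemma cspan_submodule: "S \<subseteq> carrier M \<Longrightarrow> submodule (cspan M S) complex_ring M"
proof -
  assume S: "S \<subseteq> carrier M"
  have "submodule (carrier M) complex_ring M" by (rule carrier_is_submodule)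
  then show ?thesis
    unfolding cspan_def submodule_iff using S by blast
qed

lemma cspan_superset: "S \<subseteq> cspan M S"
  unfolding cspan_def by blast

lemma cspan_minimal: "\<lbrakk>submodule H complex_ring M; S \<subseteq> H\<rbrakk> \<Longrightarrow> cspan M S \<subseteq> H"
  unfolding cspan_def by blast

lemma cspan_carrier: "S \<subseteq> carrier M \<Longrightarrow> cspan M S \<subseteq> carrier M"
  using cspan_minimal carrier_is_submodule by blast

end

locale normed_cvs = cvs M
  for M :: "(complex, 'v, 'm) module_scheme" (structure) +
  fixes N :: "'v \<Rightarrow> real"
  assumes N_nonneg [simp]: "x \<in> carrier M \<Longrightarrow> 0 \<le> N x"
    and N_eq_0_iff: "x \<in> carrier M \<Longrightarrow> N x = 0 \<longleftrightarrow> x = \<zero>"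
    and N_add: "\<lbrakk>x \<in> carrier M; y \<in> carrier M\<rbrakk> \<Longrightarrow> N (x \<oplus> y) \<le> N x + N y"
    and N_smult: "x \<in> carrier M \<Longrightarrow> N (c \<odot> x) = cmod c * N x"
begin

lemma N_zero [simp]: "N \<zero> = 0"
  using N_eq_0_iff by blast

lemma N_neg [simp]: "x \<in> carrier M \<Longrightarrow> N (\<ominus> x) = N x"
  by (simp add: neg_eq_smult N_smult)

lemma N_minus_commute: "\<lbrakk>x \<in> carrier M; y \<in> carrier M\<rbrakk> \<Longrightarrow> N (x \<ominus> y) = N (y \<ominus> x)"
  by (metis N_neg neg_minus minus_closed)

lemma N_minus: "\<lbrakk>x \<in> carrier M; y \<in> carrier M\<rbrakk> \<Longrightarrow> N (x \<ominus> y) \<le> N x + N y"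
  unfolding a_minus_def using N_add[of x "\<ominus> y"] by simp

lemma N_triangle_minus:
  "\<lbrakk>x \<in> carrier M; y \<in> carrier M; z \<in> carrier M\<rbrakk> \<Longrightarrow> N (x \<ominus> z) \<le> N (x \<ominus> y) + N (y \<ominus> z)"
  using N_add[of "x \<ominus> y" "y \<ominus> z"] by (simp add: minus_add_minus)

lemma N_le_minus: "\<lbrakk>x \<in> carrier M; y \<in> carrier M\<rbrakk> \<Longrightarrow> N x \<le> N y + N (x \<ominus> y)"
  using N_triangle_minus[of x y \<zero>] by simp

lemma N_minus_eq_0: "\<lbrakk>x \<in> carrier M; y \<in> carrier M; N (x \<ominus> y) = 0\<rbrakk> \<Longrightarrow> x = y"
  by (simp add: N_eq_0_iff minus_eq_zero_iff)

text \<open>The metric gives access to closures, to completeness and to the theorems of Baire and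
  Banach. Later estimates are phrased with \<open>nlim\<close> and the norm itself.\<close>

sublocale Metric_space "carrier M" "norm_dist M N"
proof
  fix x y
  show "0 \<le> norm_dist M N x y" by (simp add: norm_dist_def)
  show "norm_dist M N x y = norm_dist M N y x"
    by (simp add: norm_dist_def N_minus_commute)
  assume xy: "x \<in> carrier M" "y \<in> carrier M"
  then show "(norm_dist M N x y = 0) = (x = y)"
    by (simp add: norm_dist_def N_eq_0_iff minus_eq_zero_iff)
  fix z assume "z \<in> carrier M"
  then show "norm_dist M N x z \<le> norm_dist M N x y + norm_dist M N y z"
    using xy by (simp add: norm_dist_def N_triangle_minus)
qed

lemma norm_dist_eq [simp]: "\<lbrakk>x \<in> carrier M; y \<in> carrier M\<rbrakk> \<Longrightarrow> norm_dist M N x y = N (x \<ominus> y)"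
  by (simp add: norm_dist_def)

lemma in_norm_closure_iff:
  assumes "S \<subseteq> carrier M"
  shows "x \<in> norm_closure M N S \<longleftrightarrow> x \<in> carrier M \<and> (\<forall>e>0. \<exists>s\<in>S. N (x \<ominus> s) < e)"
  unfolding norm_closure_def metric_closure_of mball_def mem_Collect_eq
  using assms by (intro conj_cong refl all_cong imp_cong) (auto simp: subset_iff Bex_def)

lemma norm_closure_carrier: "norm_closure M N S \<subseteq> carrier M"
  unfolding norm_closure_def metric_closure_of by blast

lemma norm_closure_superset: "S \<subseteq> carrier M \<Longrightarrow> S \<subseteq> norm_closure M N S"
  by (subst subset_eq) (auto simp: in_norm_closure_iff subset_iff intro!: bexI)

section \<open>Sequential limits, closed sets and closed spans\<close>

definition nlim :: "(nat \<Rightarrow> 'v) \<Rightarrow> 'v \<Rightarrow> bool" where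
  "nlim \<sigma> x \<longleftrightarrow> (\<forall>n. \<sigma> n \<in> carrier M) \<and> x \<in> carrier M \<and> (\<lambda>n. N (\<sigma> n \<ominus> x)) \<longlonglongrightarrow> 0"

definition nCauchy :: "(nat \<Rightarrow> 'v) \<Rightarrow> bool" where
  "nCauchy \<sigma> \<longleftrightarrow> (\<forall>n. \<sigma> n \<in> carrier M) \<and>
    (\<forall>e>0. \<exists>n0. \<forall>m\<ge>n0. \<forall>n\<ge>n0. N (\<sigma> m \<ominus> \<sigma> n) < e)"

lemma norm_complete_iff: "norm_complete M N \<longleftrightarrow> (\<forall>\<sigma>. nCauchy \<sigma> \<longrightarrow> (\<exists>x. nlim \<sigma> x))"
proof -
  have 1: "MCauchy \<sigma> \<longleftrightarrow> nCauchy \<sigma>" for \<sigma>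
    unfolding MCauchy_def nCauchy_def
    by (rule conj_cong) (auto simp: image_subset_iff)
  have 2: "limitin mtopology \<sigma> x sequentially \<longleftrightarrow> nlim \<sigma> x" if "nCauchy \<sigma>" for \<sigma> x
  proof -
    have c: "\<forall>n. \<sigma> n \<in> carrier M" using that by (auto simp: nCauchy_def)
    show ?thesis
      unfolding limitin_metric_dist_null nlim_def using c by auto
  qed
  show ?thesis
    unfolding norm_complete_def mcomplete_def using 1 2 by auto
qed

lemma nlimD: "nlim \<sigma> x \<Longrightarrow> \<sigma> n \<in> carrier M" "nlim \<sigma> x \<Longrightarrow> x \<in> carrier M"
  "nlim \<sigma> x \<Longrightarrow> (\<lambda>n. N (\<sigma> n \<ominus> x)) \<longlonglongrightarrow> 0"
  by (auto simp: nlim_def)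

lemma nlimI:
  assumes "\<And>n. \<sigma> n \<in> carrier M" "x \<in> carrier M" "\<And>n. N (\<sigma> n \<ominus> x) \<le> b n" "b \<longlonglongrightarrow> 0"
  shows "nlim \<sigma> x"
  unfolding nlim_def using assms
  by (auto intro!: tendsto_sandwich[OF _ _ tendsto_const assms(4)])

lemma nlim_const: "x \<in> carrier M \<Longrightarrow> nlim (\<lambda>_. x) x"
  by (auto simp: nlim_def)

lemma nlim_unique: "\<lbrakk>nlim \<sigma> x; nlim \<sigma> y\<rbrakk> \<Longrightarrow> x = y"
proof -
  assume a: "nlim \<sigma> x" "nlim \<sigma> y"
  have "(\<lambda>n. N (\<sigma> n \<ominus> x) + N (\<sigma> n \<ominus> y)) \<longlonglongrightarrow> 0 + 0"
    by (intro tendsto_add nlimD a)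
  moreover have "N (x \<ominus> y) \<le> N (\<sigma> n \<ominus> x) + N (\<sigma> n \<ominus> y)" for n
    using N_triangle_minus[of x "\<sigma> n" y] nlimD[OF a(1)] nlimD[OF a(2)]
    by (simp add: N_minus_commute)
  ultimately have "N (x \<ominus> y) \<le> 0"
    by (intro tendsto_lowerbound[of _ 0 sequentially]) auto
  then show ?thesis
    using nlimD[OF a(1)] nlimD[OF a(2)] by (intro N_minus_eq_0) (auto intro: antisym)
qed

lemma nlim_add: "\<lbrakk>nlim \<sigma> x; nlim \<tau> y\<rbrakk> \<Longrightarrow> nlim (\<lambda>n. \<sigma> n \<oplus> \<tau> n) (x \<oplus> y)"
proof -
  assume a: "nlim \<sigma> x" "nlim \<tau> y"
  have "(\<lambda>n. N (\<sigma> n \<ominus> x) + N (\<tau> n \<ominus> y)) \<longlonglongrightarrow> 0 + 0"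
    by (intro tendsto_add nlimD a)
  then show ?thesis
    using nlimD[OF a(1)] nlimD[OF a(2)]
    by (intro nlimI[of _ _ "\<lambda>n. N (\<sigma> n \<ominus> x) + N (\<tau> n \<ominus> y)"])
      (auto simp: minus_minus_swap intro!: N_add)
qed

lemma nlim_smult: "nlim \<sigma> x \<Longrightarrow> nlim (\<lambda>n. c \<odot> \<sigma> n) (c \<odot> x)"
proof -
  assume a: "nlim \<sigma> x"
  have "(\<lambda>n. cmod c * N (\<sigma> n \<ominus> x)) \<longlonglongrightarrow> cmod c * 0"
    by (intro tendsto_intros nlimD a)
  then show ?thesis
    using nlimD[OF a]
    by (intro nlimI[of _ _ "\<lambda>n. cmod c * N (\<sigma> n \<ominus> x)"])
      (auto simp: smult_minus_right[symmetric] N_smult)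
qed

lemma nlim_minus: "\<lbrakk>nlim \<sigma> x; nlim \<tau> y\<rbrakk> \<Longrightarrow> nlim (\<lambda>n. \<sigma> n \<ominus> \<tau> n) (x \<ominus> y)"
proof -
  assume a: "nlim \<sigma> x" "nlim \<tau> y"
  then have e: "\<And>n. \<sigma> n \<ominus> \<tau> n = \<sigma> n \<oplus> (-1) \<odot> \<tau> n" "x \<ominus> y = x \<oplus> (-1) \<odot> y"
    by (auto simp: nlim_def minus_eq_smult)
  show ?thesis
    unfolding e by (intro nlim_add nlim_smult a)
qed

lemma nlim_norm: "nlim \<sigma> x \<Longrightarrow> (\<lambda>n. N (\<sigma> n)) \<longlonglongrightarrow> N x"
proof -
  assume a: "nlim \<sigma> x"
  have "\<bar>N (\<sigma> n) - N x\<bar> \<le> N (\<sigma> n \<ominus> x)" for n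
    using N_le_minus[of "\<sigma> n" x] N_le_minus[of x "\<sigma> n"] nlimD[OF a]
    by (auto simp: N_minus_commute)
  then have "(\<lambda>n. N (\<sigma> n) - N x) \<longlonglongrightarrow> 0"
    by (intro Lim_null_comparison[OF _ nlimD(3)[OF a]]) auto
  then show ?thesis by (simp add: LIM_zero_iff)
qed

lemma nlim_Cauchy: "nlim \<sigma> x \<Longrightarrow> nCauchy \<sigma>"
  unfolding nCauchy_def
proof (intro conjI allI impI)
  assume a: "nlim \<sigma> x"
  show "\<sigma> n \<in> carrier M" for n using nlimD[OF a] by blast
  fix e :: real assume "e > 0"
  then obtain n0 where n0: "\<And>n. n \<ge> n0 \<Longrightarrow> N (\<sigma> n \<ominus> x) < e/2"
    using nlimD(3)[OF a] nlimD(1,2)[OF a] unfolding LIMSEQ_iff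
    by (metis N_nonneg abs_of_nonneg diff_zero half_gt_zero minus_closed real_norm_def)
  have "N (\<sigma> m \<ominus> \<sigma> n) < e" if "m \<ge> n0" "n \<ge> n0" for m n
    using N_triangle_minus[of "\<sigma> m" x "\<sigma> n"] n0[OF that(1)] n0[OF that(2)] nlimD[OF a]
    by (auto simp: N_minus_commute)
  then show "\<exists>n0. \<forall>m\<ge>n0. \<forall>n\<ge>n0. N (\<sigma> m \<ominus> \<sigma> n) < e" by blast
qed

lemma norm_closure_seq:
  assumes "S \<subseteq> carrier M"
  shows "x \<in> norm_closure M N S \<longleftrightarrow> (\<exists>\<sigma>. (\<forall>n. \<sigma> n \<in> S) \<and> nlim \<sigma> x)"
proof
  assume x: "x \<in> norm_closure M N S"
  then have xc: "x \<in> carrier M" using norm_closure_carrier by blast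
  have "\<exists>s\<in>S. N (x \<ominus> s) < 1 / Suc n" for n
    using x in_norm_closure_iff[OF assms] by (metis of_nat_0_less_iff zero_less_Suc zero_less_divide_1_iff)
  then obtain \<sigma> where \<sigma>: "\<And>n. \<sigma> n \<in> S" "\<And>n. N (x \<ominus> \<sigma> n) < 1 / Suc n"
    by metis
  moreover have "nlim \<sigma> x"
  proof (rule nlimI)
    show "(\<lambda>n. 1 / real (Suc n)) \<longlonglongrightarrow> 0"
      using LIMSEQ_inverse_real_of_nat by (simp add: inverse_eq_divide)
    show "N (\<sigma> n \<ominus> x) \<le> 1 / real (Suc n)" for n
      using \<sigma>[of n] xc assms by (subst N_minus_commute) auto
  qed (use \<sigma> xc assms in auto)
  ultimately show "\<exists>\<sigma>. (\<forall>n. \<sigma> n \<in> S) \<and> nlim \<sigma> x" by blast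
next
  assume "\<exists>\<sigma>. (\<forall>n. \<sigma> n \<in> S) \<and> nlim \<sigma> x"
  then obtain \<sigma> where \<sigma>: "\<And>n. \<sigma> n \<in> S" "nlim \<sigma> x" by blast
  have "\<exists>s\<in>S. N (x \<ominus> s) < e" if "e > 0" for e
  proof -
    have "\<forall>\<^sub>F n in sequentially. N (\<sigma> n \<ominus> x) < e"
      using nlimD(3)[OF \<sigma>(2)] that order_tendstoD(2) by blast
    then obtain n where "N (\<sigma> n \<ominus> x) < e" by (auto simp: eventually_sequentially)
    then show ?thesis using \<sigma> nlimD[OF \<sigma>(2)] N_minus_commute by metis
  qed
  then show "x \<in> norm_closure M N S"
    using in_norm_closure_iff[OF assms] nlimD[OF \<sigma>(2)] by blast
qed

definition nclosed :: "'v set \<Rightarrow> bool" where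
  "nclosed H \<longleftrightarrow> (\<forall>\<sigma> x. (\<forall>n. \<sigma> n \<in> H) \<and> nlim \<sigma> x \<longrightarrow> x \<in> H)"

lemma nclosedI: "(\<And>\<sigma> x. \<lbrakk>\<And>n. \<sigma> n \<in> H; nlim \<sigma> x\<rbrakk> \<Longrightarrow> x \<in> H) \<Longrightarrow> nclosed H"
  unfolding nclosed_def by blast

lemma nclosedD: "\<lbrakk>nclosed H; \<And>n. \<sigma> n \<in> H; nlim \<sigma> x\<rbrakk> \<Longrightarrow> x \<in> H"
  unfolding nclosed_def by blast

lemma nclosed_iff: "H \<subseteq> carrier M \<Longrightarrow> nclosed H \<longleftrightarrow> norm_closure M N H = H"
  using norm_closure_superset[of H] norm_closure_seq[of H] unfolding nclosed_def by blast

definition nclspan :: "'v set \<Rightarrow> 'v set" where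
  "nclspan S = norm_closure M N (cspan M S)"

lemma nclosed_norm_closure: "S \<subseteq> carrier M \<Longrightarrow> nclosed (norm_closure M N S)"
proof -
  assume S: "S \<subseteq> carrier M"
  then have "norm_closure M N (norm_closure M N S) = norm_closure M N S"
    unfolding norm_closure_def by simp
  then show ?thesis using nclosed_iff norm_closure_carrier by blast
qed

lemma norm_closure_submodule:
  assumes "submodule H complex_ring M"
  shows "submodule (norm_closure M N H) complex_ring M"
proof -
  note sub = submoduleD[OF assms]
  note H = sub(1)
  show ?thesis
    unfolding submodule_iff
  proof (intro conjI ballI allI)
    show "norm_closure M N H \<subseteq> carrier M" by (rule norm_closure_carrier)
    show "\<zero> \<in> norm_closure M N H"
      using norm_closure_superset[OF H] sub(2) by blast
    fix x assume x: "x \<in> norm_closure M N H"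
    then obtain \<sigma> where \<sigma>: "\<And>n. \<sigma> n \<in> H" "nlim \<sigma> x" using norm_closure_seq[OF H] by blast
    show "c \<odot> x \<in> norm_closure M N H" for c
      unfolding norm_closure_seq[OF H]
      by (rule exI[of _ "\<lambda>n. c \<odot> \<sigma> n"]) (auto intro: nlim_smult \<sigma> sub)
    fix y assume "y \<in> norm_closure M N H"
    then obtain \<tau> where \<tau>: "\<And>n. \<tau> n \<in> H" "nlim \<tau> y" using norm_closure_seq[OF H] by blast
    show "x \<oplus> y \<in> norm_closure M N H"
      unfolding norm_closure_seq[OF H]
      by (rule exI[of _ "\<lambda>n. \<sigma> n \<oplus> \<tau> n"]) (auto intro: nlim_add \<sigma> \<tau> sub)
  qed
qed

lemma nclspan_submodule: "S \<subseteq> carrier M \<Longrightarrow> submodule (nclspan S) complex_ring M"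
  unfolding nclspan_def using cspan_submodule norm_closure_submodule by blast

lemma nclspan_closed: "S \<subseteq> carrier M \<Longrightarrow> nclosed (nclspan S)"
  unfolding nclspan_def using cspan_carrier nclosed_norm_closure by blast

lemma nclspan_superset: "S \<subseteq> carrier M \<Longrightarrow> S \<subseteq> nclspan S"
  unfolding nclspan_def using cspan_superset norm_closure_superset cspan_carrier by blast

lemma nclspan_carrier: "nclspan S \<subseteq> carrier M"
  unfolding nclspan_def by (rule norm_closure_carrier)

lemma nclspan_minimal:
  assumes "submodule H complex_ring M" "nclosed H" "S \<subseteq> H"
  shows "nclspan S \<subseteq> H"
proof
  fix x assume x: "x \<in> nclspan S"
  have S: "S \<subseteq> carrier M" using assms(3) submoduleD(1)[OF assms(1)] by blast
  have "cspan M S \<subseteq> H" using cspan_minimal assms by blast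
  moreover obtain \<sigma> where "\<And>n. \<sigma> n \<in> cspan M S" "nlim \<sigma> x"
    using x norm_closure_seq[OF cspan_carrier[OF S]] unfolding nclspan_def by blast
  ultimately show "x \<in> H" using nclosedD[OF assms(2)] by blast
qed

text \<open>The elements of the carrier with \<open>P\<close> form a closed subspace containing
  \<open>S\<close>. Identities and memberships are moved from generators to closed spans by this
  rule.\<close>

lemma nclspan_induct:
  assumes "x \<in> nclspan S" and S: "S \<subseteq> carrier M"
    and "\<And>s. s \<in> S \<Longrightarrow> P s"
    and "P \<zero>"
    and "\<And>x y. \<lbrakk>x \<in> carrier M; y \<in> carrier M; P x; P y\<rbrakk> \<Longrightarrow> P (x \<oplus> y)"
    and "\<And>c x. \<lbrakk>x \<in> carrier M; P x\<rbrakk> \<Longrightarrow> P (c \<odot> x)"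
    and "\<And>\<sigma> x. \<lbrakk>\<And>n. P (\<sigma> n); nlim \<sigma> x\<rbrakk> \<Longrightarrow> P x"
  shows "P x"
proof -
  have "nclspan S \<subseteq> {x \<in> carrier M. P x}"
  proof (rule nclspan_minimal)
    show "submodule {x \<in> carrier M. P x} complex_ring M"
      unfolding submodule_iff using assms by auto
    show "nclosed {x \<in> carrier M. P x}"
      using assms(7) nlimD(2) by (intro nclosedI) blast
  qed (use assms in blast)
  then show ?thesis using assms(1) by blast
qed

end

section \<open>Hilbert modules and their adjointable operators\<close>

context cvs
begin

lemma vadd_closed: "\<lbrakk>x \<in> carrier M; y \<in> carrier M\<rbrakk> \<Longrightarrow> x \<oplus> y \<in> carrier M"
  by simp

lemma vadd_ac:
  "\<lbrakk>x \<in> carrier M; y \<in> carrier M\<rbrakk> \<Longrightarrow> x \<oplus> y = y \<oplus> x"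
  "\<lbrakk>x \<in> carrier M; y \<in> carrier M; z \<in> carrier M\<rbrakk> \<Longrightarrow> (x \<oplus> y) \<oplus> z = x \<oplus> (y \<oplus> z)"
  "\<lbrakk>x \<in> carrier M; y \<in> carrier M; z \<in> carrier M\<rbrakk> \<Longrightarrow> x \<oplus> (y \<oplus> z) = y \<oplus> (x \<oplus> z)"
  by (simp_all add: a_ac)

end

sublocale cstar_algebra \<subseteq> normed_cvs A "cnorm A"
  by unfold_locales
    (simp_all add: cnorm_nonneg cnorm_eq_0_iff cnorm_add cnorm_smult)

section \<open>Arithmetic and limits in a C*-algebra\<close>

context cstar_algebra
begin

declare mult_closed [simp, intro] star_closed [simp, intro] star_star [simp]

lemma mult_zero_left [simp]: "x \<in> carrier A \<Longrightarrow> \<zero> \<otimes> x = \<zero>"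
  using smult_mult_left[of x x 0] by simp

lemma mult_zero_right [simp]: "x \<in> carrier A \<Longrightarrow> x \<otimes> \<zero> = \<zero>"
  using smult_mult_right[of x x 0] by simp

lemma mult_neg_left: "\<lbrakk>x \<in> carrier A; y \<in> carrier A\<rbrakk> \<Longrightarrow> (\<ominus> x) \<otimes> y = \<ominus> (x \<otimes> y)"
  by (simp add: neg_eq_smult smult_mult_left)

lemma mult_neg_right: "\<lbrakk>x \<in> carrier A; y \<in> carrier A\<rbrakk> \<Longrightarrow> x \<otimes> (\<ominus> y) = \<ominus> (x \<otimes> y)"
  by (simp add: neg_eq_smult smult_mult_right)

lemma mult_minus_left:
  "\<lbrakk>x \<in> carrier A; y \<in> carrier A; z \<in> carrier A\<rbrakk> \<Longrightarrow> (x \<ominus> y) \<otimes> z = x \<otimes> z \<ominus> y \<otimes> z"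
  by (simp add: a_minus_def mult_l_distr mult_neg_left)

lemma mult_minus_right:
  "\<lbrakk>x \<in> carrier A; y \<in> carrier A; z \<in> carrier A\<rbrakk> \<Longrightarrow> z \<otimes> (x \<ominus> y) = z \<otimes> x \<ominus> z \<otimes> y"
  by (simp add: a_minus_def mult_r_distr mult_neg_right)

lemma star_zero [simp]: "star A \<zero> = \<zero>"
  using star_smult[of \<zero> 0] by simp

lemma star_neg: "x \<in> carrier A \<Longrightarrow> star A (\<ominus> x) = \<ominus> star A x"
  by (simp add: neg_eq_smult star_smult)

lemma star_minus: "\<lbrakk>x \<in> carrier A; y \<in> carrier A\<rbrakk> \<Longrightarrow> star A (x \<ominus> y) = star A x \<ominus> star A y"
  by (simp add: a_minus_def star_add star_neg)

text \<open>The C*-identity and submultiplicativity give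
  \<open>cnorm A y \<le> cnorm A (star A y)\<close> for every y; applying this to x and to its
  adjoint gives both inequalities.\<close>

lemma cnorm_star_eq [simp]: "x \<in> carrier A \<Longrightarrow> cnorm A (star A x) = cnorm A x"
proof -
  have le: "cnorm A y \<le> cnorm A (star A y)" if "y \<in> carrier A" for y
  proof -
    have "(cnorm A y)\<^sup>2 \<le> cnorm A (star A y) * cnorm A y"
      using cnorm_mult[of "star A y" y] cnorm_star[of y] that by simp
    moreover have "0 \<le> cnorm A y" "0 \<le> cnorm A (star A y)" using that by simp_all
    ultimately show ?thesis
      by (metis less_eq_real_def mult_right_le_imp_le power2_eq_square)
  qed
  assume "x \<in> carrier A"
  then show ?thesis using le[of x] le[of "star A x"] by simp
qed

lemma cnorm_mult_star: "x \<in> carrier A \<Longrightarrow> cnorm A (x \<otimes> star A x) = (cnorm A x)\<^sup>2"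
  using cnorm_star[of "star A x"] by simp

lemma star_mult_self_eq_0: "\<lbrakk>x \<in> carrier A; star A x \<otimes> x = \<zero>\<rbrakk> \<Longrightarrow> x = \<zero>"
  using cnorm_star[of x] N_eq_0_iff[of x] by simp

lemma nlim_mult: "\<lbrakk>nlim \<sigma> x; nlim \<tau> y\<rbrakk> \<Longrightarrow> nlim (\<lambda>n. \<sigma> n \<otimes> \<tau> n) (x \<otimes> y)"
proof -
  assume a: "nlim \<sigma> x" "nlim \<tau> y"
  note c = nlimD[OF a(1)] nlimD[OF a(2)]
  have "(\<lambda>n. cnorm A (\<sigma> n) * cnorm A (\<tau> n \<ominus> y) + cnorm A (\<sigma> n \<ominus> x) * cnorm A y) \<longlonglongrightarrow>
      cnorm A x * 0 + 0 * cnorm A y"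
    by (intro tendsto_intros c nlim_norm a)
  moreover have "cnorm A (\<sigma> n \<otimes> \<tau> n \<ominus> x \<otimes> y) \<le>
      cnorm A (\<sigma> n) * cnorm A (\<tau> n \<ominus> y) + cnorm A (\<sigma> n \<ominus> x) * cnorm A y" for n
  proof -
    have "cnorm A (\<sigma> n \<otimes> \<tau> n \<ominus> x \<otimes> y) \<le>
        cnorm A (\<sigma> n \<otimes> \<tau> n \<ominus> \<sigma> n \<otimes> y) + cnorm A (\<sigma> n \<otimes> y \<ominus> x \<otimes> y)"
      using c by (intro N_triangle_minus) auto
    also have "\<dots> = cnorm A (\<sigma> n \<otimes> (\<tau> n \<ominus> y)) + cnorm A ((\<sigma> n \<ominus> x) \<otimes> y)"
      using c by (simp add: mult_minus_left mult_minus_right)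
    also have "\<dots> \<le> cnorm A (\<sigma> n) * cnorm A (\<tau> n \<ominus> y) + cnorm A (\<sigma> n \<ominus> x) * cnorm A y"
      using c by (intro add_mono cnorm_mult) auto
    finally show ?thesis .
  qed
  ultimately show ?thesis using c by (intro nlimI) auto
qed

lemma nlim_star: "nlim \<sigma> x \<Longrightarrow> nlim (\<lambda>n. star A (\<sigma> n)) (star A x)"
  unfolding nlim_def by (auto simp flip: star_minus)

end

section \<open>Inner products and the right action\<close>

context hilbert_module
begin

sublocale X?: cvs X ..

lemma hinner_closed' [simp, intro]: "\<lbrakk>x \<in> carrier X; y \<in> carrier X\<rbrakk> \<Longrightarrow> hinner X x y \<in> carrier A"
  by (rule hinner_closed)

lemma ract_closed' [simp, intro]: "\<lbrakk>x \<in> carrier X; a \<in> carrier A\<rbrakk> \<Longrightarrow> ract X x a \<in> carrier X"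
  by (rule ract_closed)

lemma hinner_add_left:
  assumes "x \<in> carrier X" "y \<in> carrier X" "z \<in> carrier X"
  shows "hinner X (x \<oplus>\<^bsub>X\<^esub> y) z = hinner X x z \<oplus>\<^bsub>A\<^esub> hinner X y z"
  using assms by (metis hinner_add hinner_star hinner_closed star_add X.vadd_closed)

lemma hinner_smult_left:
  assumes "x \<in> carrier X" "y \<in> carrier X"
  shows "hinner X (c \<odot>\<^bsub>X\<^esub> x) y = cnj c \<odot>\<^bsub>A\<^esub> hinner X x y"
  using assms by (metis hinner_smult hinner_star hinner_closed star_smult X.smult_closed')

lemma hinner_ract_left:
  assumes "x \<in> carrier X" "y \<in> carrier X" "a \<in> carrier A"
  shows "hinner X (ract X x a) y = star A a \<otimes>\<^bsub>A\<^esub> hinner X x y"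
  using assms by (metis hinner_ract hinner_star hinner_closed star_mult ract_closed)

lemma hinner_zero_right [simp]: "x \<in> carrier X \<Longrightarrow> hinner X x \<zero>\<^bsub>X\<^esub> = \<zero>\<^bsub>A\<^esub>"
  using hinner_smult[of x x 0] by simp

lemma hinner_zero_left [simp]: "x \<in> carrier X \<Longrightarrow> hinner X \<zero>\<^bsub>X\<^esub> x = \<zero>\<^bsub>A\<^esub>"
  using hinner_smult_left[of x x 0] by simp

lemma hinner_minus:
  assumes "x \<in> carrier X" "y \<in> carrier X" "z \<in> carrier X"
  shows "hinner X x (y \<ominus>\<^bsub>X\<^esub> z) = hinner X x y \<ominus>\<^bsub>A\<^esub> hinner X x z"
  using assms by (simp add: X.minus_eq_smult A.minus_eq_smult hinner_add hinner_smult)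

lemma hinner_minus_left:
  assumes "x \<in> carrier X" "y \<in> carrier X" "z \<in> carrier X"
  shows "hinner X (x \<ominus>\<^bsub>X\<^esub> y) z = hinner X x z \<ominus>\<^bsub>A\<^esub> hinner X y z"
  using assms by (simp add: X.minus_eq_smult A.minus_eq_smult hinner_add_left hinner_smult_left)

text \<open>Under these equations the inner square of x - y expands to zero. Later this makes
  linearity of a map a consequence of its preserving inner products.\<close>

lemma hinner_eqI:
  assumes "x \<in> carrier X" "y \<in> carrier X"
    and "hinner X x x = hinner X x y" "hinner X y x = hinner X y y"
  shows "x = y"
proof -
  have "hinner X (x \<ominus>\<^bsub>X\<^esub> y) (x \<ominus>\<^bsub>X\<^esub> y) = \<zero>\<^bsub>A\<^esub>"
    using assms by (simp add: hinner_minus hinner_minus_left)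
  then have "x \<ominus>\<^bsub>X\<^esub> y = \<zero>\<^bsub>X\<^esub>" by (intro hinner_definite) (use assms in auto)
  then show ?thesis using assms by (simp add: X.minus_eq_zero_iff)
qed

lemma hinner_extensionality:
  assumes "x \<in> carrier X" "y \<in> carrier X"
    and "\<And>z. z \<in> carrier X \<Longrightarrow> hinner X z x = hinner X z y"
  shows "x = y"
  by (intro hinner_eqI assms)

lemma hinner_extensionality_left:
  assumes "x \<in> carrier X" "y \<in> carrier X"
    and "\<And>z. z \<in> carrier X \<Longrightarrow> hinner X x z = hinner X y z"
  shows "x = y"
  by (rule hinner_extensionality[OF assms(1,2)]) (metis assms hinner_star)

lemma ract_zero [simp]: "x \<in> carrier X \<Longrightarrow> ract X x \<zero>\<^bsub>A\<^esub> = \<zero>\<^bsub>X\<^esub>"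
  using ract_smult_right[of x "\<zero>\<^bsub>A\<^esub>" 0] by simp

lemma ract_zero_left [simp]: "a \<in> carrier A \<Longrightarrow> ract X \<zero>\<^bsub>X\<^esub> a = \<zero>\<^bsub>X\<^esub>"
  using ract_smult_left[of "\<zero>\<^bsub>X\<^esub>" a 0] by simp

lemma ract_minus_left:
  "\<lbrakk>x \<in> carrier X; y \<in> carrier X; a \<in> carrier A\<rbrakk> \<Longrightarrow>
    ract X (x \<ominus>\<^bsub>X\<^esub> y) a = ract X x a \<ominus>\<^bsub>X\<^esub> ract X y a"
  by (simp add: X.minus_eq_smult ract_add_left ract_smult_left)

lemma ract_minus_right:
  "\<lbrakk>x \<in> carrier X; b \<in> carrier A; a \<in> carrier A\<rbrakk> \<Longrightarrow>
    ract X x (a \<ominus>\<^bsub>A\<^esub> b) = ract X x a \<ominus>\<^bsub>X\<^esub> ract X x b"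
  by (simp add: X.minus_eq_smult A.minus_eq_smult ract_add_right ract_smult_right)

text \<open>Cancellation without an approximate unit: test with \<open>a = \<langle>x, x\<rangle>\<close>.\<close>

lemma ract_eq_zeroD:
  assumes "x \<in> carrier X" "\<And>a. a \<in> carrier A \<Longrightarrow> ract X x a = \<zero>\<^bsub>X\<^esub>"
  shows "x = \<zero>\<^bsub>X\<^esub>"
proof -
  let ?h = "hinner X x x"
  have h: "?h \<in> carrier A" "star A ?h = ?h" using assms by (auto simp: hinner_star)
  have "?h \<otimes>\<^bsub>A\<^esub> ?h = \<zero>\<^bsub>A\<^esub>"
    using assms h hinner_ract[of x x ?h] by simp
  then have "?h = \<zero>\<^bsub>A\<^esub>" using h star_mult_self_eq_0[of ?h] by simp
  then show ?thesis using hinner_definite assms by blast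
qed

lemma ract_cancel:
  assumes "x \<in> carrier X" "y \<in> carrier X" "\<And>a. a \<in> carrier A \<Longrightarrow> ract X x a = ract X y a"
  shows "x = y"
proof -
  have "x \<ominus>\<^bsub>X\<^esub> y = \<zero>\<^bsub>X\<^esub>"
    using assms by - (rule ract_eq_zeroD, auto simp: ract_minus_left)
  then show ?thesis using assms by (simp add: X.minus_eq_zero_iff)
qed

lemma hnorm_sq: "x \<in> carrier X \<Longrightarrow> (hnorm A X x)\<^sup>2 = cnorm A (hinner X x x)"
  by (simp add: hnorm_def)

lemma hnorm_nonneg: "x \<in> carrier X \<Longrightarrow> 0 \<le> hnorm A X x"
  by (simp add: hnorm_def)

lemma hnorm_zero_iff: "x \<in> carrier X \<Longrightarrow> hnorm A X x = 0 \<longleftrightarrow> x = \<zero>\<^bsub>X\<^esub>"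
  using hinner_definite by (auto simp: hnorm_def A.N_eq_0_iff)

lemma hnorm_smult: "x \<in> carrier X \<Longrightarrow> hnorm A X (c \<odot>\<^bsub>X\<^esub> x) = cmod c * hnorm A X x"
proof -
  assume x: "x \<in> carrier X"
  then have "(hnorm A X (c \<odot>\<^bsub>X\<^esub> x))\<^sup>2 = (cmod c * hnorm A X x)\<^sup>2"
    by (simp only: hnorm_sq power_mult_distrib X.smult_closed')
      (simp add: hinner_smult hinner_smult_left A.smult_smult A.N_smult norm_mult power2_eq_square)
  then show ?thesis using x hnorm_nonneg
    by (metis X.smult_closed' abs_of_nonneg mult_nonneg_nonneg norm_ge_zero power2_eq_iff_nonneg)
qed

lemma hnorm_ract: "\<lbrakk>x \<in> carrier X; a \<in> carrier A\<rbrakk> \<Longrightarrow> hnorm A X (ract X x a) \<le> hnorm A X x * cnorm A a"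
proof -
  assume x: "x \<in> carrier X" and a: "a \<in> carrier A"
  have "(hnorm A X (ract X x a))\<^sup>2 = cnorm A (star A a \<otimes>\<^bsub>A\<^esub> (hinner X x x \<otimes>\<^bsub>A\<^esub> a))"
    using x a by (simp add: hnorm_sq hinner_ract hinner_ract_left A.mult_assoc)
  also have "\<dots> \<le> cnorm A (star A a) * (cnorm A (hinner X x x) * cnorm A a)"
    using x a by (intro order_trans[OF cnorm_mult] mult_left_mono cnorm_mult) auto
  also have "\<dots> = (hnorm A X x * cnorm A a)\<^sup>2"
    using x a by (simp only: power_mult_distrib hnorm_sq) (simp add: power2_eq_square)
  finally show ?thesis
    by (rule power2_le_imp_le) (simp add: x a hnorm_nonneg)
qed

end

text \<open>The Cauchy-Schwarz inequality is at first an assumption, because its proof uses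
  positivity in a unital algebra, and the unital algebra at hand is
  \<open>adjointable_ops A (alg_corr A)\<close>, which becomes a C*-algebra by means of this
  inequality. For \<open>alg_corr A\<close> it is mere submultiplicativity of the norm, and this
  starts the circle; for all other modules it is proved afterwards.\<close>

locale hilbert_module_cs = hilbert_module +
  assumes cauchy_schwarz:
    "\<lbrakk>x \<in> carrier X; y \<in> carrier X\<rbrakk> \<Longrightarrow> cnorm A (hinner X x y) \<le> hnorm A X x * hnorm A X y"
begin

lemma hnorm_add:
  assumes x: "x \<in> carrier X" and y: "y \<in> carrier X"
  shows "hnorm A X (x \<oplus>\<^bsub>X\<^esub> y) \<le> hnorm A X x + hnorm A X y"
proof -
  have "(hnorm A X (x \<oplus>\<^bsub>X\<^esub> y))\<^sup>2 =
      cnorm A ((hinner X x x \<oplus>\<^bsub>A\<^esub> hinner X x y) \<oplus>\<^bsub>A\<^esub> (hinner X y x \<oplus>\<^bsub>A\<^esub> hinner X y y))"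
    using x y by (simp add: hnorm_sq hinner_add hinner_add_left A.vadd_ac)
  also have "\<dots> \<le> (cnorm A (hinner X x x) + cnorm A (hinner X x y)) +
      (cnorm A (hinner X y x) + cnorm A (hinner X y y))"
    using x y by (intro order_trans[OF A.N_add] add_mono A.N_add) auto
  also have "\<dots> \<le> ((hnorm A X x)\<^sup>2 + hnorm A X x * hnorm A X y) + (hnorm A X y * hnorm A X x + (hnorm A X y)\<^sup>2)"
    using x y by (intro add_mono cauchy_schwarz) (auto simp: hnorm_sq)
  also have "\<dots> = (hnorm A X x + hnorm A X y)\<^sup>2" by (simp add: power2_eq_square algebra_simps)
  finally show ?thesis
    by (rule power2_le_imp_le) (simp add: x y hnorm_nonneg)
qed

sublocale X?: normed_cvs X "hnorm A X"
  by unfold_locales (rule hnorm_nonneg hnorm_zero_iff hnorm_add hnorm_smult; assumption)+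

end

lemma (in cvs) diff_add_cancel:
  "\<lbrakk>x \<in> carrier M; y \<in> carrier M\<rbrakk> \<Longrightarrow> (x \<ominus> y) \<oplus> y = x"
  using eq_minus_iff[of "x \<ominus> y" x y] by simp

section \<open>Adjointable operators and their boundedness\<close>

context hilbert_module_cs
begin

abbreviation "\<L> \<equiv> adjointable_ops A X"

lemma is_adjoint_sym:
  assumes "is_adjoint X T S" "T \<in> carrier X \<rightarrow> carrier X" "S \<in> carrier X \<rightarrow> carrier X"
  shows "is_adjoint X S T"
  unfolding is_adjoint_def
proof (intro ballI)
  fix x y assume "x \<in> carrier X" "y \<in> carrier X"
  then show "hinner X (S x) y = hinner X x (T y)"
    using assms unfolding is_adjoint_def by (metis PiE hinner_star)
qed

lemma is_adjoint_unique:
  assumes "is_adjoint X T S" "is_adjoint X T S'" "T \<in> carrier X \<rightarrow> carrier X"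
    "S \<in> carrier X \<rightarrow>\<^sub>E carrier X" "S' \<in> carrier X \<rightarrow>\<^sub>E carrier X"
  shows "S = S'"
proof (rule extensionalityI[of _ "carrier X"])
  fix y assume y: "y \<in> carrier X"
  show "S y = S' y"
  proof (rule hinner_extensionality)
    show "S y \<in> carrier X" "S' y \<in> carrier X" using assms(4,5) y by auto
    fix z assume "z \<in> carrier X"
    then show "hinner X z (S y) = hinner X z (S' y)"
      using assms(1,2) y unfolding is_adjoint_def by (metis (no_types))
  qed
qed (use assms in \<open>auto simp: PiE_def\<close>)

lemma adj_carrier_iff:
  "T \<in> carrier \<L> \<longleftrightarrow>
    T \<in> carrier X \<rightarrow>\<^sub>E carrier X \<and> (\<exists>S \<in> carrier X \<rightarrow>\<^sub>E carrier X. is_adjoint X T S)"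
  by (simp add: adjointable_ops_def)

lemma adj_star_eq:
  assumes "T \<in> carrier X \<rightarrow>\<^sub>E carrier X" "S \<in> carrier X \<rightarrow>\<^sub>E carrier X" "is_adjoint X T S"
  shows "star \<L> T = S"
proof -
  have "star \<L> T = (THE S. S \<in> carrier X \<rightarrow>\<^sub>E carrier X \<and> is_adjoint X T S)"
    by (simp add: adjointable_ops_def)
  also have "\<dots> = S"
    using assms by (intro the_equality) (auto intro: is_adjoint_unique[of T])
  finally show ?thesis .
qed

lemma adj_starD:
  assumes "T \<in> carrier \<L>"
  shows "star \<L> T \<in> carrier \<L>" "is_adjoint X T (star \<L> T)"
proof -
  obtain S where S: "T \<in> carrier X \<rightarrow>\<^sub>E carrier X" "S \<in> carrier X \<rightarrow>\<^sub>E carrier X" "is_adjoint X T S"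
    using assms unfolding adj_carrier_iff by blast
  have "is_adjoint X S T" by (rule is_adjoint_sym[OF S(3)]) (use S in \<open>simp_all add: PiE_def\<close>)
  then show "star \<L> T \<in> carrier \<L>" "is_adjoint X T (star \<L> T)"
    using S(1,2,3) unfolding adj_star_eq[OF S] adj_carrier_iff by blast+
qed

lemma adj_closed: "\<lbrakk>T \<in> carrier \<L>; x \<in> carrier X\<rbrakk> \<Longrightarrow> T x \<in> carrier X"
  unfolding adj_carrier_iff by auto

lemma adj_inner:
  "\<lbrakk>T \<in> carrier \<L>; x \<in> carrier X; y \<in> carrier X\<rbrakk> \<Longrightarrow> hinner X (T x) y = hinner X x (star \<L> T y)"
  using adj_starD(2) unfolding is_adjoint_def by blast

lemma adj_inner':
  "\<lbrakk>T \<in> carrier \<L>; x \<in> carrier X; y \<in> carrier X\<rbrakk> \<Longrightarrow> hinner X (star \<L> T x) y = hinner X x (T y)"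
  using is_adjoint_sym[OF adj_starD(2)[of T]] adj_starD(1)[of T] unfolding is_adjoint_def adj_carrier_iff
  by blast

lemma adj_eqI: "\<lbrakk>T \<in> carrier \<L>; S \<in> carrier \<L>; \<And>x. x \<in> carrier X \<Longrightarrow> T x = S x\<rbrakk> \<Longrightarrow> T = S"
  unfolding adj_carrier_iff by (auto intro: PiE_ext)

lemma adj_memI:
  assumes "\<And>x. x \<in> carrier X \<Longrightarrow> f x \<in> carrier X" "\<And>x. x \<in> carrier X \<Longrightarrow> g x \<in> carrier X"
    "\<And>x y. \<lbrakk>x \<in> carrier X; y \<in> carrier X\<rbrakk> \<Longrightarrow> hinner X (f x) y = hinner X x (g y)"
  shows "restrict f (carrier X) \<in> carrier \<L>" "star \<L> (restrict f (carrier X)) = restrict g (carrier X)"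
proof -
  have "restrict f (carrier X) \<in> carrier X \<rightarrow>\<^sub>E carrier X" "restrict g (carrier X) \<in> carrier X \<rightarrow>\<^sub>E carrier X"
    "is_adjoint X (restrict f (carrier X)) (restrict g (carrier X))"
    using assms by (auto simp: is_adjoint_def)
  note r = this
  show "star \<L> (restrict f (carrier X)) = restrict g (carrier X)" by (rule adj_star_eq[OF r])
  show "restrict f (carrier X) \<in> carrier \<L>"
    unfolding adj_carrier_iff using r by blast
qed

lemma adj_add:
  assumes T: "T \<in> carrier \<L>" and x: "x \<in> carrier X" "y \<in> carrier X"
  shows "T (x \<oplus>\<^bsub>X\<^esub> y) = T x \<oplus>\<^bsub>X\<^esub> T y"
  by (rule hinner_extensionality_left)
    (use assms adj_starD(1)[OF T] adj_closed[OF T] adj_closed[OF adj_starD(1)[OF T]]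
      in \<open>simp_all add: adj_inner[OF T] hinner_add_left\<close>)

lemma adj_smult:
  assumes T: "T \<in> carrier \<L>" and x: "x \<in> carrier X"
  shows "T (c \<odot>\<^bsub>X\<^esub> x) = c \<odot>\<^bsub>X\<^esub> T x"
  by (rule hinner_extensionality_left)
    (use assms adj_starD(1)[OF T] adj_closed[OF T] adj_closed[OF adj_starD(1)[OF T]]
      in \<open>simp_all add: adj_inner[OF T] hinner_smult_left\<close>)

lemma adj_ract:
  assumes T: "T \<in> carrier \<L>" and x: "x \<in> carrier X" "a \<in> carrier A"
  shows "T (ract X x a) = ract X (T x) a"
  by (rule hinner_extensionality_left)
    (use assms adj_starD(1)[OF T] adj_closed[OF T] adj_closed[OF adj_starD(1)[OF T]]
      in \<open>simp_all add: adj_inner[OF T] hinner_ract_left\<close>)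

lemma adj_zero: "T \<in> carrier \<L> \<Longrightarrow> T \<zero>\<^bsub>X\<^esub> = \<zero>\<^bsub>X\<^esub>"
  using adj_smult[of T "\<zero>\<^bsub>X\<^esub>" 0] adj_closed[of T "\<zero>\<^bsub>X\<^esub>"] by simp

lemma adj_minus:
  assumes T: "T \<in> carrier \<L>" and x: "x \<in> carrier X" "y \<in> carrier X"
  shows "T (x \<ominus>\<^bsub>X\<^esub> y) = T x \<ominus>\<^bsub>X\<^esub> T y"
  using assms by (simp add: X.minus_eq_smult adj_add adj_smult adj_closed[OF T])

text \<open>Boundedness is not part of the definition of adjointable operators, but the existence of
  an adjoint forces it. The sets \<open>F n\<close> are closed and cover the complete space, so by
  Baire's theorem one of them contains a ball.\<close>

lemma adj_bounded:
  assumes T: "T \<in> carrier \<L>"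
  obtains C where "C \<ge> 0" "\<And>x. x \<in> carrier X \<Longrightarrow> hnorm A X (T x) \<le> C * hnorm A X x"
proof -
  define F where "F n = {y \<in> carrier X. hnorm A X (T y) \<le> real n}" for n
  note T' = adj_starD(1)[OF T]
  note [simp] = adj_closed[OF T] adj_closed[OF T']
  have closed: "closedin X.mtopology (F n)" for n
  proof -
    have sub: "F n \<subseteq> carrier X" by (auto simp: F_def)
    have "X.nclosed (F n)"
    proof (rule X.nclosedI)
      fix \<sigma> y assume \<sigma>: "\<And>k. \<sigma> k \<in> F n" "X.nlim \<sigma> y"
      then have y: "y \<in> carrier X" and \<sigma>c: "\<And>k. \<sigma> k \<in> carrier X" using X.nlimD by auto
      have "(hnorm A X (T y))\<^sup>2 \<le> real n * hnorm A X (T y)"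
      proof (rule LIMSEQ_le_const)
        \<comment> \<open>Split T y as T(y - \<sigma> k) + T(\<sigma> k) inside the inner square of
          T y. In the first summand T passes to the other side as its adjoint, so this term tends to
          0; the second is at most n times the norm of T y.\<close>
        let ?b = "\<lambda>k. hnorm A X (star \<L> T (T y)) * hnorm A X (y \<ominus>\<^bsub>X\<^esub> \<sigma> k) + real n * hnorm A X (T y)"
        have "?b \<longlonglongrightarrow> hnorm A X (star \<L> T (T y)) * 0 + real n * hnorm A X (T y)"
          using X.nlimD[OF \<sigma>(2)] X.N_minus_commute[OF y \<sigma>c]
          by (intro tendsto_intros) simp
        then show "?b \<longlonglongrightarrow> real n * hnorm A X (T y)" by simp
        have "(hnorm A X (T y))\<^sup>2 \<le> ?b k" for k
        proof -
          have "(hnorm A X (T y))\<^sup>2 =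
              cnorm A (hinner X (T y) (T (y \<ominus>\<^bsub>X\<^esub> \<sigma> k)) \<oplus>\<^bsub>A\<^esub> hinner X (T y) (T (\<sigma> k)))"
            using T y \<sigma>c by (simp add: hnorm_sq adj_minus X.diff_add_cancel flip: hinner_add)
          also have "\<dots> \<le> cnorm A (hinner X (star \<L> T (T y)) (y \<ominus>\<^bsub>X\<^esub> \<sigma> k)) +
              cnorm A (hinner X (T y) (T (\<sigma> k)))"
            using T T' y \<sigma>c by (subst adj_inner') (auto intro!: A.N_add)
          also have "\<dots> \<le> hnorm A X (star \<L> T (T y)) * hnorm A X (y \<ominus>\<^bsub>X\<^esub> \<sigma> k) +
              hnorm A X (T y) * hnorm A X (T (\<sigma> k))"
            using T T' y \<sigma>c by (intro add_mono cauchy_schwarz) auto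
          also have "\<dots> \<le> ?b k"
            using \<sigma>(1)[of k] T y \<sigma>c by (auto simp: F_def mult.commute[of "real n"] intro!: mult_left_mono)
          finally show ?thesis .
        qed
        then show "\<exists>N. \<forall>k\<ge>N. (hnorm A X (T y))\<^sup>2 \<le> ?b k" by simp
      qed
      then have "hnorm A X (T y) \<le> real n"
        using hnorm_nonneg[of "T y"] T y unfolding power2_eq_square
        by (metis adj_closed[OF T] less_eq_real_def mult_right_le_imp_le of_nat_0_le_iff)
      then show "y \<in> F n" using y by (simp add: F_def)
    qed
    then have "norm_closure X (hnorm A X) (F n) = F n" using X.nclosed_iff[OF sub] by blast
    then show ?thesis
      unfolding norm_closure_def by (metis closedin_closure_of)
  qed
  have "\<exists>n. X.mtopology interior_of (F n) \<noteq> {}"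
  proof (rule ccontr)
    assume "\<nexists>n. X.mtopology interior_of (F n) \<noteq> {}"
    then have "X.mtopology interior_of \<Union>(range F) = {}"
      using closed hilbert_complete unfolding norm_complete_def
      by (intro X.metric_Baire_category_alt) auto
    moreover have "\<Union>(range F) = carrier X"
      using T by (auto simp: F_def intro: real_arch_simple)
    ultimately show False
      using interior_of_topspace[of X.mtopology] X.topspace_mtopology X.M.zero_closed
      by (metis empty_iff)
  qed
  then obtain n y0 where "y0 \<in> X.mtopology interior_of (F n)" by blast
  then obtain r where r: "r > 0" "X.mball y0 r \<subseteq> F n" and y0: "y0 \<in> F n"
    using interior_of_subset[of X.mtopology "F n"] unfolding X.metric_interior_of by blast
  then have y0c: "y0 \<in> carrier X" by (auto simp: F_def)
  have *: "hnorm A X (T z) \<le> 2 * n" if z: "z \<in> carrier X" "hnorm A X z < r" for z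
  proof -
    have eq: "y0 \<ominus>\<^bsub>X\<^esub> (y0 \<oplus>\<^bsub>X\<^esub> z) = \<ominus>\<^bsub>X\<^esub> z"
      using y0c z by (metis X.eq_minus_iff X.neg_minus X.vadd_ac(1) X.vadd_closed)
    then have "y0 \<oplus>\<^bsub>X\<^esub> z \<in> X.mball y0 r"
      using z y0c X.norm_dist_eq[of y0 "y0 \<oplus>\<^bsub>X\<^esub> z"] by (simp add: X.in_mball)
    then have "hnorm A X (T (y0 \<oplus>\<^bsub>X\<^esub> z)) \<le> n"
      using subsetD[OF r(2)] unfolding F_def by blast
    moreover have "T z = T (y0 \<oplus>\<^bsub>X\<^esub> z) \<ominus>\<^bsub>X\<^esub> T y0"
      using y0c z T by (simp add: adj_add X.eq_minus_iff X.vadd_ac)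
    ultimately show ?thesis
      using X.N_minus[of "T (y0 \<oplus>\<^bsub>X\<^esub> z)" "T y0"] y0 T y0c z by (auto simp: F_def)
  qed
  show thesis
  proof
    \<comment> \<open>A vector of norm below r moves y0 inside the ball, so T is bounded by n + n on
      it. Scaling x to norm r / 2, strictly below r, gives the constant 2n / (r / 2).\<close>
    show "0 \<le> 4 * real n / r" using r by simp
    fix x assume x: "x \<in> carrier X"
    show "hnorm A X (T x) \<le> 4 * real n / r * hnorm A X x"
    proof (cases "hnorm A X x = 0")
      case True
      then have "x = \<zero>\<^bsub>X\<^esub>" using x hnorm_zero_iff by blast
      then show ?thesis using adj_zero[OF T] by simp
    next
      case False
      then have pos: "hnorm A X x > 0" using hnorm_nonneg[OF x] by simp
      define c where "c = r / (2 * hnorm A X x)"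
      have c: "c > 0" using pos r by (simp add: c_def)
      have "hnorm A X (of_real c \<odot>\<^bsub>X\<^esub> x) < r"
        using x pos r c by (simp add: hnorm_smult) (simp add: c_def)
      then have "hnorm A X (T (of_real c \<odot>\<^bsub>X\<^esub> x)) \<le> 2 * n" using x by (intro *) auto
      then have "c * hnorm A X (T x) \<le> 2 * n"
        using x T c by (simp add: adj_smult hnorm_smult)
      then have "hnorm A X (T x) \<le> 2 * n / c" using c by (simp add: field_simps)
      also have "2 * n / c = 4 * real n / r * hnorm A X x" using r pos by (simp add: c_def)
      finally show ?thesis .
    qed
  qed
qed

end

section \<open>The operator norm and the algebraic operations\<close>

context hilbert_module_cs
begin

lemma adj_opnorm_def: "cnorm \<L> T = (SUP x\<in>{x\<in>carrier X. hnorm A X x \<le> 1}. hnorm A X (T x))"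
  by (simp add: adjointable_ops_def)

lemma adj_opnorm_le:
  assumes "\<And>x. \<lbrakk>x \<in> carrier X; hnorm A X x \<le> 1\<rbrakk> \<Longrightarrow> hnorm A X (T x) \<le> C"
  shows "cnorm \<L> T \<le> C"
  unfolding adj_opnorm_def by (rule cSUP_least) (use assms in \<open>auto intro!: exI[of _ "\<zero>\<^bsub>X\<^esub>"]\<close>)

lemma adj_norm_apply:
  assumes T: "T \<in> carrier \<L>" and x: "x \<in> carrier X"
  shows "hnorm A X (T x) \<le> cnorm \<L> T * hnorm A X x"
proof -
  note [simp] = adj_closed[OF T]
  obtain C where C: "C \<ge> 0" "\<And>x. x \<in> carrier X \<Longrightarrow> hnorm A X (T x) \<le> C * hnorm A X x"
    using adj_bounded[OF T] by blast
  have bdd: "bdd_above ((\<lambda>x. hnorm A X (T x)) ` {x\<in>carrier X. hnorm A X x \<le> 1})"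
  proof (rule bdd_aboveI2)
    fix x assume "x \<in> {x\<in>carrier X. hnorm A X x \<le> 1}"
    then show "hnorm A X (T x) \<le> C"
      using C(2)[of x] mult_left_mono[of "hnorm A X x" 1 C] C(1) by auto
  qed
  have le: "hnorm A X (T y) \<le> cnorm \<L> T" if "y \<in> carrier X" "hnorm A X y \<le> 1" for y
    unfolding adj_opnorm_def by (rule cSUP_upper[OF _ bdd]) (use that in auto)
  show ?thesis
  proof (cases "hnorm A X x = 0")
    case True
    then have "x = \<zero>\<^bsub>X\<^esub>" using x hnorm_zero_iff by blast
    then show ?thesis using adj_zero[OF T] by simp
  next
    case False
    then have pos: "hnorm A X x > 0" using hnorm_nonneg[OF x] by simp
    let ?c = "1 / hnorm A X x"
    have "hnorm A X (T (of_real ?c \<odot>\<^bsub>X\<^esub> x)) \<le> cnorm \<L> T"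
      using x pos by (intro le) (auto simp: hnorm_smult norm_divide)
    then show ?thesis
      using x T pos by (simp add: adj_smult hnorm_smult norm_divide field_simps)
  qed
qed

lemma adj_opnorm_nonneg: "T \<in> carrier \<L> \<Longrightarrow> 0 \<le> cnorm \<L> T"
proof -
  assume T: "T \<in> carrier \<L>"
  obtain C where C: "C \<ge> 0" "\<And>x. x \<in> carrier X \<Longrightarrow> hnorm A X (T x) \<le> C * hnorm A X x"
    using adj_bounded[OF T] by blast
  have bdd: "bdd_above ((\<lambda>x. hnorm A X (T x)) ` {x\<in>carrier X. hnorm A X x \<le> 1})"
  proof (rule bdd_aboveI2)
    fix x assume "x \<in> {x\<in>carrier X. hnorm A X x \<le> 1}"
    then show "hnorm A X (T x) \<le> C"
      using C(2)[of x] mult_left_mono[of "hnorm A X x" 1 C] C(1) by auto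
  qed
  show ?thesis
    unfolding adj_opnorm_def
    by (rule order_trans[OF _ cSUP_upper[OF _ bdd, of "\<zero>\<^bsub>X\<^esub>"]]) (auto simp: adj_zero[OF T])
qed

lemma adj_simps:
  "S \<otimes>\<^bsub>\<L>\<^esub> T = compose (carrier X) S T"
  "\<one>\<^bsub>\<L>\<^esub> = (\<lambda>x\<in>carrier X. x)"
  "\<zero>\<^bsub>\<L>\<^esub> = (\<lambda>x\<in>carrier X. \<zero>\<^bsub>X\<^esub>)"
  "S \<oplus>\<^bsub>\<L>\<^esub> T = (\<lambda>x\<in>carrier X. S x \<oplus>\<^bsub>X\<^esub> T x)"
  "c \<odot>\<^bsub>\<L>\<^esub> T = (\<lambda>x\<in>carrier X. c \<odot>\<^bsub>X\<^esub> T x)"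
  by (simp_all add: adjointable_ops_def)

lemma adj_apply [simp]:
  assumes "x \<in> carrier X"
  shows "(S \<otimes>\<^bsub>\<L>\<^esub> T) x = S (T x)" "\<one>\<^bsub>\<L>\<^esub> x = x" "\<zero>\<^bsub>\<L>\<^esub> x = \<zero>\<^bsub>X\<^esub>"
    "(S \<oplus>\<^bsub>\<L>\<^esub> T) x = S x \<oplus>\<^bsub>X\<^esub> T x" "(c \<odot>\<^bsub>\<L>\<^esub> T) x = c \<odot>\<^bsub>X\<^esub> T x"
  using assms by (simp_all add: adj_simps compose_def)

lemma adj_ops_closed:
  assumes S: "S \<in> carrier \<L>" and T: "T \<in> carrier \<L>"
  shows "S \<otimes>\<^bsub>\<L>\<^esub> T \<in> carrier \<L>" "S \<oplus>\<^bsub>\<L>\<^esub> T \<in> carrier \<L>" "c \<odot>\<^bsub>\<L>\<^esub> T \<in> carrier \<L>"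
    and "star \<L> (S \<otimes>\<^bsub>\<L>\<^esub> T) = star \<L> T \<otimes>\<^bsub>\<L>\<^esub> star \<L> S"
    and "star \<L> (S \<oplus>\<^bsub>\<L>\<^esub> T) = star \<L> S \<oplus>\<^bsub>\<L>\<^esub> star \<L> T"
    and "star \<L> (c \<odot>\<^bsub>\<L>\<^esub> T) = cnj c \<odot>\<^bsub>\<L>\<^esub> star \<L> T"
proof -
  note S' = adj_starD(1)[OF S] and T' = adj_starD(1)[OF T]
  note [simp] = adj_closed[OF S] adj_closed[OF T] adj_closed[OF S'] adj_closed[OF T']
    adj_inner[OF S] adj_inner[OF T]
  show "S \<otimes>\<^bsub>\<L>\<^esub> T \<in> carrier \<L>" "star \<L> (S \<otimes>\<^bsub>\<L>\<^esub> T) = star \<L> T \<otimes>\<^bsub>\<L>\<^esub> star \<L> S"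
    unfolding adj_simps compose_def
    by (rule adj_memI[of _ "\<lambda>x. star \<L> T (star \<L> S x)"]; simp)+
  show "S \<oplus>\<^bsub>\<L>\<^esub> T \<in> carrier \<L>" "star \<L> (S \<oplus>\<^bsub>\<L>\<^esub> T) = star \<L> S \<oplus>\<^bsub>\<L>\<^esub> star \<L> T"
    unfolding adj_simps
    by (rule adj_memI[of _ "\<lambda>x. star \<L> S x \<oplus>\<^bsub>X\<^esub> star \<L> T x"];
        simp add: hinner_add hinner_add_left)+
  show "c \<odot>\<^bsub>\<L>\<^esub> T \<in> carrier \<L>" "star \<L> (c \<odot>\<^bsub>\<L>\<^esub> T) = cnj c \<odot>\<^bsub>\<L>\<^esub> star \<L> T"
    unfolding adj_simps
    by (rule adj_memI[of _ "\<lambda>x. cnj c \<odot>\<^bsub>X\<^esub> star \<L> T x"];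
        simp add: hinner_smult hinner_smult_left)+
qed

lemma adj_smult_closed:
  "T \<in> carrier \<L> \<Longrightarrow> c \<odot>\<^bsub>\<L>\<^esub> T \<in> carrier \<L>"
  "T \<in> carrier \<L> \<Longrightarrow> star \<L> (c \<odot>\<^bsub>\<L>\<^esub> T) = cnj c \<odot>\<^bsub>\<L>\<^esub> star \<L> T"
  using adj_ops_closed(3,6) by blast+

lemma adj_one_closed: "\<one>\<^bsub>\<L>\<^esub> \<in> carrier \<L>" "star \<L> \<one>\<^bsub>\<L>\<^esub> = \<one>\<^bsub>\<L>\<^esub>"
  unfolding adj_simps by (rule adj_memI; simp)+

lemma adj_zero_closed: "\<zero>\<^bsub>\<L>\<^esub> \<in> carrier \<L>"
  unfolding adj_simps by (rule adj_memI(1)[of _ "\<lambda>_. \<zero>\<^bsub>X\<^esub>"]; simp)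

lemma adj_star_star: "T \<in> carrier \<L> \<Longrightarrow> star \<L> (star \<L> T) = T"
  by (rule adj_star_eq)
    (use adj_starD[of T] is_adjoint_sym[OF adj_starD(2)[of T]] in \<open>auto simp: adj_carrier_iff\<close>)

lemma adj_module: "Module.module complex_ring \<L>"
proof (rule Module.moduleI[OF cring_complex_ring])
  show "abelian_group \<L>"
  proof (rule abelian_groupI)
    fix S T U assume [simp]: "S \<in> carrier \<L>" "T \<in> carrier \<L>" "U \<in> carrier \<L>"
    note [simp] = adj_ops_closed adj_zero_closed adj_closed[of S] adj_closed[of T] adj_closed[of U]
    show "S \<oplus>\<^bsub>\<L>\<^esub> T \<in> carrier \<L>" by simp
    show "S \<oplus>\<^bsub>\<L>\<^esub> T \<oplus>\<^bsub>\<L>\<^esub> U = S \<oplus>\<^bsub>\<L>\<^esub> (T \<oplus>\<^bsub>\<L>\<^esub> U)"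
      by (rule adj_eqI) (simp_all add: X.vadd_ac)
    show "S \<oplus>\<^bsub>\<L>\<^esub> T = T \<oplus>\<^bsub>\<L>\<^esub> S"
      by (rule adj_eqI) (simp_all add: X.vadd_ac)
    show "\<zero>\<^bsub>\<L>\<^esub> \<oplus>\<^bsub>\<L>\<^esub> S = S" by (rule adj_eqI) simp_all
    have "(-1) \<odot>\<^bsub>\<L>\<^esub> S \<oplus>\<^bsub>\<L>\<^esub> S = \<zero>\<^bsub>\<L>\<^esub>"
      by (rule adj_eqI[OF adj_ops_closed(2)])
        (simp_all add: adj_smult_closed X.vadd_ac flip: X.minus_eq_smult)
    then show "\<exists>T\<in>carrier \<L>. T \<oplus>\<^bsub>\<L>\<^esub> S = \<zero>\<^bsub>\<L>\<^esub>"
      by (intro bexI[of _ "(-1) \<odot>\<^bsub>\<L>\<^esub> S"]) (auto intro: adj_smult_closed)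
  qed (rule adj_zero_closed)
next
  fix c d and S T assume [simp]: "S \<in> carrier \<L>" "T \<in> carrier \<L>"
  note [simp] = adj_ops_closed adj_zero_closed adj_smult_closed adj_closed[of S] adj_closed[of T]
  show "c \<odot>\<^bsub>\<L>\<^esub> S \<in> carrier \<L>" by simp
  show "(c \<oplus>\<^bsub>complex_ring\<^esub> d) \<odot>\<^bsub>\<L>\<^esub> S = c \<odot>\<^bsub>\<L>\<^esub> S \<oplus>\<^bsub>\<L>\<^esub> d \<odot>\<^bsub>\<L>\<^esub> S"
    by (rule adj_eqI) (simp_all add: X.smult_add_left)
  show "c \<odot>\<^bsub>\<L>\<^esub> (S \<oplus>\<^bsub>\<L>\<^esub> T) = c \<odot>\<^bsub>\<L>\<^esub> S \<oplus>\<^bsub>\<L>\<^esub> c \<odot>\<^bsub>\<L>\<^esub> T"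
    by (rule adj_eqI) (simp_all add: X.smult_add_right)
  show "(c \<otimes>\<^bsub>complex_ring\<^esub> d) \<odot>\<^bsub>\<L>\<^esub> S = c \<odot>\<^bsub>\<L>\<^esub> (d \<odot>\<^bsub>\<L>\<^esub> S)"
    by (rule adj_eqI) (simp_all add: X.smult_smult)
  show "\<one>\<^bsub>complex_ring\<^esub> \<odot>\<^bsub>\<L>\<^esub> S = S"
    by (rule adj_eqI) simp_all
qed

end

section \<open>The C*-identity for the operator norm\<close>

context hilbert_module_cs
begin

lemma adj_normed: "normed_cvs \<L> (cnorm \<L>)"
proof -
  interpret cvs \<L> by (intro cvs.intro adj_module)
  show ?thesis
  proof
    fix T assume T: "T \<in> carrier \<L>"
    show "0 \<le> cnorm \<L> T" by (rule adj_opnorm_nonneg[OF T])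
    show "cnorm \<L> T = 0 \<longleftrightarrow> T = \<zero>\<^bsub>\<L>\<^esub>"
    proof
      assume "cnorm \<L> T = 0"
      then have "hnorm A X (T x) \<le> 0" if "x \<in> carrier X" for x
        using adj_norm_apply[OF T that] by simp
      then have "T x = \<zero>\<^bsub>X\<^esub>" if "x \<in> carrier X" for x
        using that hnorm_zero_iff[OF adj_closed[OF T that]] hnorm_nonneg[OF adj_closed[OF T that]]
        by (meson order_antisym)
      then show "T = \<zero>\<^bsub>\<L>\<^esub>" by (intro adj_eqI[OF T adj_zero_closed]) simp
    next
      assume "T = \<zero>\<^bsub>\<L>\<^esub>"
      then have "hnorm A X (T x) \<le> 0" if "x \<in> carrier X" for x
        using that by simp
      then have "cnorm \<L> T \<le> 0" by (rule adj_opnorm_le)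
      then show "cnorm \<L> T = 0" using adj_opnorm_nonneg[OF T] by simp
    qed
    fix S assume S: "S \<in> carrier \<L>"
    show "cnorm \<L> (T \<oplus>\<^bsub>\<L>\<^esub> S) \<le> cnorm \<L> T + cnorm \<L> S"
    proof (rule adj_opnorm_le)
      fix x assume x: "x \<in> carrier X" "hnorm A X x \<le> 1"
      have "hnorm A X (T x \<oplus>\<^bsub>X\<^esub> S x) \<le> cnorm \<L> T * hnorm A X x + cnorm \<L> S * hnorm A X x"
        by (rule order_trans[OF X.N_add[OF adj_closed[OF T x(1)] adj_closed[OF S x(1)]]])
          (intro add_mono adj_norm_apply S T x)
      also have "\<dots> \<le> cnorm \<L> T * 1 + cnorm \<L> S * 1"
        by (intro add_mono mult_left_mono adj_opnorm_nonneg S T x)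
      finally show "hnorm A X ((T \<oplus>\<^bsub>\<L>\<^esub> S) x) \<le> cnorm \<L> T + cnorm \<L> S" using x by simp
    qed
  next
    have le: "cnorm \<L> (c \<odot>\<^bsub>\<L>\<^esub> T) \<le> cmod c * cnorm \<L> T" if T: "T \<in> carrier \<L>" for c T
    proof (rule adj_opnorm_le)
      fix x assume x: "x \<in> carrier X" "hnorm A X x \<le> 1"
      then have "hnorm A X (T x) \<le> cnorm \<L> T * 1"
        by (intro order_trans[OF adj_norm_apply[OF T]] mult_left_mono adj_opnorm_nonneg T)
      then show "hnorm A X ((c \<odot>\<^bsub>\<L>\<^esub> T) x) \<le> cmod c * cnorm \<L> T"
        using x adj_closed[OF T] by (simp add: hnorm_smult mult_left_mono)
    qed
    fix T c assume T: "T \<in> carrier \<L>"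
    show "cnorm \<L> (c \<odot>\<^bsub>\<L>\<^esub> T) = cmod c * cnorm \<L> T"
    proof (cases "c = 0")
      case True
      have "cnorm \<L> (c \<odot>\<^bsub>\<L>\<^esub> T) \<le> 0" using le[OF T, of c] True by simp
      moreover have "0 \<le> cnorm \<L> (c \<odot>\<^bsub>\<L>\<^esub> T)"
        by (rule adj_opnorm_nonneg[OF adj_smult_closed(1)[OF T]])
      ultimately show ?thesis using True by simp
    next
      case False
      \<comment> \<open>The reverse inequality is \<open>le\<close> for the scalar 1/c and the
        operator c T.\<close>
      have "cnorm \<L> ((1/c) \<odot>\<^bsub>\<L>\<^esub> (c \<odot>\<^bsub>\<L>\<^esub> T)) \<le> cmod (1/c) * cnorm \<L> (c \<odot>\<^bsub>\<L>\<^esub> T)"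
        using adj_ops_closed(3)[OF T T] by (intro le)
      then have "cmod c * cnorm \<L> T \<le> cnorm \<L> (c \<odot>\<^bsub>\<L>\<^esub> T)"
        using False T by (simp add: smult_smult norm_divide field_simps)
      then show ?thesis using le[OF T, of c] by simp
    qed
  qed
qed

lemma adj_cnorm_mult:
  assumes S: "S \<in> carrier \<L>" and T: "T \<in> carrier \<L>"
  shows "cnorm \<L> (S \<otimes>\<^bsub>\<L>\<^esub> T) \<le> cnorm \<L> S * cnorm \<L> T"
proof (rule adj_opnorm_le)
  fix x assume x: "x \<in> carrier X" "hnorm A X x \<le> 1"
  have "hnorm A X (S (T x)) \<le> cnorm \<L> S * (cnorm \<L> T * hnorm A X x)"
    by (rule order_trans[OF adj_norm_apply[OF S adj_closed[OF T x(1)]]])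
      (intro mult_left_mono adj_norm_apply adj_opnorm_nonneg S T x)
  also have "\<dots> \<le> cnorm \<L> S * (cnorm \<L> T * 1)"
    by (intro mult_left_mono adj_opnorm_nonneg S T x)
  finally show "hnorm A X ((S \<otimes>\<^bsub>\<L>\<^esub> T) x) \<le> cnorm \<L> S * cnorm \<L> T" using x by simp
qed

text \<open>For x in the unit ball, Cauchy-Schwarz bounds the square of the norm of T x by the norm
  of T^* T. This is the analytic input; the isometry of the involution and the C*-identity then
  follow formally from submultiplicativity.\<close>

lemma adj_cnorm_star:
  assumes T: "T \<in> carrier \<L>"
  shows "cnorm \<L> (star \<L> T) = cnorm \<L> T" "cnorm \<L> (star \<L> T \<otimes>\<^bsub>\<L>\<^esub> T) = (cnorm \<L> T)\<^sup>2"
proof -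
  have sq: "(cnorm \<L> T)\<^sup>2 \<le> cnorm \<L> (star \<L> T \<otimes>\<^bsub>\<L>\<^esub> T)" if T: "T \<in> carrier \<L>" for T
  proof -
    note T' = adj_starD(1)[OF T]
    note TT = adj_ops_closed(1)[OF T' T]
    have "cnorm \<L> T \<le> sqrt (cnorm \<L> (star \<L> T \<otimes>\<^bsub>\<L>\<^esub> T))"
    proof (rule adj_opnorm_le)
      fix x assume x: "x \<in> carrier X" "hnorm A X x \<le> 1"
      have "(hnorm A X (T x))\<^sup>2 = cnorm A (hinner X x ((star \<L> T \<otimes>\<^bsub>\<L>\<^esub> T) x))"
        using x adj_inner[OF T x(1)] adj_closed[OF T] by (simp add: hnorm_sq)
      also have "\<dots> \<le> hnorm A X x * (cnorm \<L> (star \<L> T \<otimes>\<^bsub>\<L>\<^esub> T) * hnorm A X x)"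
        using x TT hnorm_nonneg[OF x(1)] adj_closed[OF TT x(1)]
        by (intro order_trans[OF cauchy_schwarz] mult_left_mono adj_norm_apply)
      also have "\<dots> \<le> 1 * (cnorm \<L> (star \<L> T \<otimes>\<^bsub>\<L>\<^esub> T) * 1)"
        using x TT hnorm_nonneg[OF x(1)] adj_opnorm_nonneg[OF TT]
        by (intro mult_mono mult_nonneg_nonneg) simp_all
      finally show "hnorm A X (T x) \<le> sqrt (cnorm \<L> (star \<L> T \<otimes>\<^bsub>\<L>\<^esub> T))"
        by (simp add: real_le_rsqrt)
    qed
    then have "(cnorm \<L> T)\<^sup>2 \<le> (sqrt (cnorm \<L> (star \<L> T \<otimes>\<^bsub>\<L>\<^esub> T)))\<^sup>2"
      using adj_opnorm_nonneg[OF T] by (intro power_mono)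
    then show ?thesis using adj_opnorm_nonneg[OF TT] by simp
  qed
  have le: "cnorm \<L> T \<le> cnorm \<L> (star \<L> T)" if T: "T \<in> carrier \<L>" for T
  proof -
    note T' = adj_starD(1)[OF T]
    have "(cnorm \<L> T)\<^sup>2 \<le> cnorm \<L> (star \<L> T) * cnorm \<L> T"
      using order_trans[OF sq[OF T] adj_cnorm_mult[OF T' T]] .
    then show ?thesis
      using adj_opnorm_nonneg[OF T] adj_opnorm_nonneg[OF T']
      by (metis less_eq_real_def mult_right_le_imp_le power2_eq_square)
  qed
  note T' = adj_starD(1)[OF T]
  show 1: "cnorm \<L> (star \<L> T) = cnorm \<L> T"
    using le[OF T] le[OF T'] adj_star_star[OF T] by simp
  show "cnorm \<L> (star \<L> T \<otimes>\<^bsub>\<L>\<^esub> T) = (cnorm \<L> T)\<^sup>2"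
    using sq[OF T] adj_cnorm_mult[OF T' T] 1 by (simp add: power2_eq_square)
qed

lemma adj_minus_apply:
  assumes "S \<in> carrier \<L>" "T \<in> carrier \<L>" "x \<in> carrier X"
  shows "(S \<ominus>\<^bsub>\<L>\<^esub> T) x = S x \<ominus>\<^bsub>X\<^esub> T x"
proof -
  interpret cvs \<L> by (intro cvs.intro adj_module)
  show ?thesis
    using assms adj_closed[of S] adj_closed[of T] by (simp add: minus_eq_smult X.minus_eq_smult)
qed

end

section \<open>Completeness of the adjointable operators\<close>

context hilbert_module_cs
begin

text \<open>A Cauchy sequence converges pointwise, but the limit must also have an adjoint. The
  involution is isometric, so the adjoints form a Cauchy sequence too, and their pointwise limit
  \<open>S\<close> is the adjoint of \<open>T\<close>.\<close>

lemma adj_complete: "norm_complete \<L> (cnorm \<L>)"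
proof -
  interpret LL: normed_cvs \<L> "cnorm \<L>" by (rule adj_normed)
  show ?thesis
    unfolding LL.norm_complete_iff
  proof (intro allI impI)
    fix \<sigma> assume \<sigma>: "LL.nCauchy \<sigma>"
    then have \<sigma>c: "\<And>n. \<sigma> n \<in> carrier \<L>" by (auto simp: LL.nCauchy_def)
    have pw: "\<exists>y. X.nlim (\<lambda>n. \<tau> n x) y"
      if \<tau>: "LL.nCauchy \<tau>" and x: "x \<in> carrier X" for \<tau> x
    proof -
      have \<tau>c: "\<And>n. \<tau> n \<in> carrier \<L>" using \<tau> by (auto simp: LL.nCauchy_def)
      have "X.nCauchy (\<lambda>n. \<tau> n x)"
        unfolding X.nCauchy_def
      proof (intro conjI allI impI)
        show "\<tau> n x \<in> carrier X" for n by (rule adj_closed[OF \<tau>c x])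
        fix e :: real assume "e > 0"
        then have "e / (hnorm A X x + 1) > 0" using hnorm_nonneg[OF x] by simp
        then obtain n0 where n0: "\<And>m n. \<lbrakk>m \<ge> n0; n \<ge> n0\<rbrakk> \<Longrightarrow> cnorm \<L> (\<tau> m \<ominus>\<^bsub>\<L>\<^esub> \<tau> n) < e / (hnorm A X x + 1)"
          using \<tau> unfolding LL.nCauchy_def by blast
        have "hnorm A X (\<tau> m x \<ominus>\<^bsub>X\<^esub> \<tau> n x) < e" if "m \<ge> n0" "n \<ge> n0" for m n
        proof -
          have "hnorm A X (\<tau> m x \<ominus>\<^bsub>X\<^esub> \<tau> n x) \<le> cnorm \<L> (\<tau> m \<ominus>\<^bsub>\<L>\<^esub> \<tau> n) * hnorm A X x"
            using adj_norm_apply[of "\<tau> m \<ominus>\<^bsub>\<L>\<^esub> \<tau> n" x] \<tau>c x adj_minus_apply[OF \<tau>c \<tau>c x] by auto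
          also have "\<dots> \<le> cnorm \<L> (\<tau> m \<ominus>\<^bsub>\<L>\<^esub> \<tau> n) * (hnorm A X x + 1)"
            using \<tau>c by (intro mult_left_mono adj_opnorm_nonneg) auto
          also have "\<dots> < e"
            using n0[OF that] hnorm_nonneg[OF x] by (simp add: pos_less_divide_eq)
          finally show ?thesis .
        qed
        then show "\<exists>n0. \<forall>m\<ge>n0. \<forall>n\<ge>n0. hnorm A X (\<tau> m x \<ominus>\<^bsub>X\<^esub> \<tau> n x) < e" by blast
      qed
      then show ?thesis using hilbert_complete X.norm_complete_iff by blast
    qed
    note [simp] = adj_closed[OF \<sigma>c]
    define \<rho> where "\<rho> n = star \<L> (\<sigma> n)" for n
    have \<rho>c: "\<And>n. \<rho> n \<in> carrier \<L>" unfolding \<rho>_def using \<sigma>c adj_starD(1) by blast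
    have \<rho>: "LL.nCauchy \<rho>"
    proof -
      have "\<rho> m \<ominus>\<^bsub>\<L>\<^esub> \<rho> n = star \<L> (\<sigma> m \<ominus>\<^bsub>\<L>\<^esub> \<sigma> n)" for m n
        using \<sigma>c \<rho>c adj_ops_closed[OF \<sigma>c \<sigma>c]
        by (simp add: LL.minus_eq_smult \<rho>_def adj_ops_closed)
      then have "cnorm \<L> (\<rho> m \<ominus>\<^bsub>\<L>\<^esub> \<rho> n) = cnorm \<L> (\<sigma> m \<ominus>\<^bsub>\<L>\<^esub> \<sigma> n)" for m n
        using adj_cnorm_star(1)[of "\<sigma> m \<ominus>\<^bsub>\<L>\<^esub> \<sigma> n"] \<sigma>c by simp
      then show ?thesis using \<sigma> \<rho>c unfolding LL.nCauchy_def by simp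
    qed
    obtain T where T: "\<And>x. x \<in> carrier X \<Longrightarrow> X.nlim (\<lambda>n. \<sigma> n x) (T x)"
      using pw[OF \<sigma>] by metis
    obtain S where S: "\<And>x. x \<in> carrier X \<Longrightarrow> X.nlim (\<lambda>n. \<rho> n x) (S x)"
      using pw[OF \<rho>] by metis
    have inner_lim: "A.nlim (\<lambda>n. hinner X (u n) v) (hinner X w v)"
      if "X.nlim u w" "v \<in> carrier X" for u w v
    proof (rule A.nlimI)
      note c = X.nlimD[OF that(1)]
      show "cnorm A (hinner X (u n) v \<ominus>\<^bsub>A\<^esub> hinner X w v) \<le> hnorm A X (u n \<ominus>\<^bsub>X\<^esub> w) * hnorm A X v" for n
        using c that cauchy_schwarz[of "u n \<ominus>\<^bsub>X\<^esub> w" v] by (simp add: hinner_minus_left)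
      have "(\<lambda>n. hnorm A X (u n \<ominus>\<^bsub>X\<^esub> w) * hnorm A X v) \<longlonglongrightarrow> 0 * hnorm A X v"
        by (intro tendsto_intros c)
      then show "(\<lambda>n. hnorm A X (u n \<ominus>\<^bsub>X\<^esub> w) * hnorm A X v) \<longlonglongrightarrow> 0" by simp
    qed (use X.nlimD[OF that(1)] that in auto)
    have adj: "hinner X (T x) y = hinner X x (S y)" if x: "x \<in> carrier X" and y: "y \<in> carrier X" for x y
    proof (rule A.nlim_unique)
      show "A.nlim (\<lambda>n. hinner X (\<sigma> n x) y) (hinner X (T x) y)"
        using T[OF x] y by (rule inner_lim)
      have "A.nlim (\<lambda>n. star A (hinner X (\<rho> n y) x)) (star A (hinner X (S y) x))"
        using S[OF y] x by (intro A.nlim_star inner_lim)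
      moreover have "star A (hinner X (\<rho> n y) x) = hinner X (\<sigma> n x) y" for n
        using x y \<sigma>c[of n] \<rho>c[of n] by (simp add: hinner_star \<rho>_def adj_inner adj_star_star)
      ultimately show "A.nlim (\<lambda>n. hinner X (\<sigma> n x) y) (hinner X x (S y))"
        using x y X.nlimD[OF S[OF y]] by (simp add: hinner_star)
    qed
    have Tc: "restrict T (carrier X) \<in> carrier \<L>"
      by (rule adj_memI(1)[of _ S]) (use X.nlimD[OF T] X.nlimD[OF S] adj in auto)
    have "LL.nlim \<sigma> (restrict T (carrier X))"
      unfolding LL.nlim_def
    proof (intro conjI allI)
      show "(\<lambda>n. cnorm \<L> (\<sigma> n \<ominus>\<^bsub>\<L>\<^esub> restrict T (carrier X))) \<longlonglongrightarrow> 0"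
      proof (rule LIMSEQ_I)
        fix e :: real assume e: "e > 0"
        then have "e / 2 > 0" by simp
        then obtain n0 where n0: "\<And>m n. \<lbrakk>m \<ge> n0; n \<ge> n0\<rbrakk> \<Longrightarrow> cnorm \<L> (\<sigma> m \<ominus>\<^bsub>\<L>\<^esub> \<sigma> n) < e / 2"
          using \<sigma> unfolding LL.nCauchy_def by blast
        have "cnorm \<L> (\<sigma> n \<ominus>\<^bsub>\<L>\<^esub> restrict T (carrier X)) \<le> e / 2" if n: "n \<ge> n0" for n
        proof (rule adj_opnorm_le)
          fix x assume x: "x \<in> carrier X" "hnorm A X x \<le> 1"
          \<comment> \<open>The index n stays fixed while m tends to infinity. The Cauchy estimate
            survives as a weak inequality with e / 2, which is still strictly below e.\<close>
          have lim: "X.nlim (\<lambda>m. \<sigma> n x \<ominus>\<^bsub>X\<^esub> \<sigma> m x) (\<sigma> n x \<ominus>\<^bsub>X\<^esub> T x)"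
            by (intro X.nlim_minus X.nlim_const adj_closed[OF \<sigma>c] x T)
          have "hnorm A X (\<sigma> n x \<ominus>\<^bsub>X\<^esub> \<sigma> m x) \<le> e / 2" if "m \<ge> n0" for m
          proof -
            have "hnorm A X (\<sigma> n x \<ominus>\<^bsub>X\<^esub> \<sigma> m x) \<le> cnorm \<L> (\<sigma> n \<ominus>\<^bsub>\<L>\<^esub> \<sigma> m) * hnorm A X x"
              using adj_norm_apply[OF LL.M.minus_closed[OF \<sigma>c \<sigma>c] x(1), of n m]
              unfolding adj_minus_apply[OF \<sigma>c \<sigma>c x(1)] .
            moreover have "cnorm \<L> (\<sigma> n \<ominus>\<^bsub>\<L>\<^esub> \<sigma> m) * hnorm A X x \<le> cnorm \<L> (\<sigma> n \<ominus>\<^bsub>\<L>\<^esub> \<sigma> m) * 1"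
              by (rule mult_left_mono[OF x(2) adj_opnorm_nonneg[OF LL.M.minus_closed[OF \<sigma>c \<sigma>c]]])
            moreover have "cnorm \<L> (\<sigma> n \<ominus>\<^bsub>\<L>\<^esub> \<sigma> m) < e / 2" by (rule n0[OF n that])
            ultimately show ?thesis by linarith
          qed
          then have "hnorm A X (\<sigma> n x \<ominus>\<^bsub>X\<^esub> T x) \<le> e / 2"
            by (intro LIMSEQ_le_const2[OF X.nlim_norm[OF lim]]) blast
          then show "hnorm A X ((\<sigma> n \<ominus>\<^bsub>\<L>\<^esub> restrict T (carrier X)) x) \<le> e / 2"
            using adj_minus_apply[OF \<sigma>c Tc x(1)] x by simp
        qed
        then show "\<exists>no. \<forall>n\<ge>no. norm (cnorm \<L> (\<sigma> n \<ominus>\<^bsub>\<L>\<^esub> restrict T (carrier X)) - 0) < e"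
        proof (intro exI[of _ n0] allI impI)
          fix n assume "n \<ge> n0"
          note le = \<open>\<And>n. n \<ge> n0 \<Longrightarrow> cnorm \<L> (\<sigma> n \<ominus>\<^bsub>\<L>\<^esub> restrict T (carrier X)) \<le> e / 2\<close>[OF this]
          have "0 \<le> cnorm \<L> (\<sigma> n \<ominus>\<^bsub>\<L>\<^esub> restrict T (carrier X))"
            by (rule adj_opnorm_nonneg[OF LL.M.minus_closed[OF \<sigma>c Tc]])
          then show "norm (cnorm \<L> (\<sigma> n \<ominus>\<^bsub>\<L>\<^esub> restrict T (carrier X)) - 0) < e"
            using le e by simp
        qed
      qed
    qed (use \<sigma>c Tc in auto)
    then show "\<exists>x. LL.nlim \<sigma> x" by blast
  qed
qed

lemma adj_cstar_algebra: "cstar_algebra \<L>"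
proof -
  interpret LL: normed_cvs \<L> "cnorm \<L>" by (rule adj_normed)
  show ?thesis
  proof (intro cstar_algebra.intro adj_module cstar_algebra_axioms.intro)
    fix S T U c assume [simp]: "S \<in> carrier \<L>" "T \<in> carrier \<L>" "U \<in> carrier \<L>"
    note [simp] = adj_ops_closed adj_smult_closed adj_starD(1) adj_star_star
      adj_closed[of S] adj_closed[of T] adj_closed[of U]
    show "S \<otimes>\<^bsub>\<L>\<^esub> T \<otimes>\<^bsub>\<L>\<^esub> U = S \<otimes>\<^bsub>\<L>\<^esub> (T \<otimes>\<^bsub>\<L>\<^esub> U)"
      "(S \<oplus>\<^bsub>\<L>\<^esub> T) \<otimes>\<^bsub>\<L>\<^esub> U = S \<otimes>\<^bsub>\<L>\<^esub> U \<oplus>\<^bsub>\<L>\<^esub> T \<otimes>\<^bsub>\<L>\<^esub> U"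
      "c \<odot>\<^bsub>\<L>\<^esub> S \<otimes>\<^bsub>\<L>\<^esub> T = c \<odot>\<^bsub>\<L>\<^esub> (S \<otimes>\<^bsub>\<L>\<^esub> T)"
      by (rule adj_eqI; simp)+
    show "U \<otimes>\<^bsub>\<L>\<^esub> (S \<oplus>\<^bsub>\<L>\<^esub> T) = U \<otimes>\<^bsub>\<L>\<^esub> S \<oplus>\<^bsub>\<L>\<^esub> U \<otimes>\<^bsub>\<L>\<^esub> T"
      by (rule adj_eqI) (simp_all add: adj_add)
    show "S \<otimes>\<^bsub>\<L>\<^esub> (c \<odot>\<^bsub>\<L>\<^esub> T) = c \<odot>\<^bsub>\<L>\<^esub> (S \<otimes>\<^bsub>\<L>\<^esub> T)"
      by (rule adj_eqI) (simp_all add: adj_smult)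
  qed (simp_all add: adj_ops_closed adj_smult_closed adj_starD(1) adj_star_star LL.N_add LL.N_smult
      LL.N_eq_0_iff adj_cnorm_mult adj_cnorm_star adj_complete)
qed

end

section \<open>Positivity in unital C*-algebras\<close>

text \<open>The closed subset carries the restricted metric, whose completeness has to be derived
  from that of the whole space before Banach's theorem applies.\<close>

lemma (in normed_cvs) contraction_fixpoint:
  assumes compl: "norm_complete M N" and H: "H \<subseteq> carrier M" "nclosed H" "H \<noteq> {}"
    and f: "f \<in> H \<rightarrow> H" and k: "k < 1"
    and contr: "\<And>x y. \<lbrakk>x \<in> H; y \<in> H\<rbrakk> \<Longrightarrow> N (f x \<ominus> f y) \<le> k * N (x \<ominus> y)"
  obtains x where "x \<in> H" "f x = x"
proof -
  interpret sub: Metric_space H "norm_dist M N" by (rule subspace[OF H(1)])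
  have "sub.mcomplete"
    unfolding sub.mcomplete_def
  proof (intro allI impI)
    fix \<sigma> assume "sub.MCauchy \<sigma>"
    then have \<sigma>: "\<And>n. \<sigma> n \<in> H"
      and C: "\<And>e. e > 0 \<Longrightarrow> \<exists>n0. \<forall>m n. n0 \<le> m \<longrightarrow> n0 \<le> n \<longrightarrow> norm_dist M N (\<sigma> m) (\<sigma> n) < e"
      unfolding sub.MCauchy_def by auto
    have \<sigma>c: "\<And>n. \<sigma> n \<in> carrier M" using \<sigma> H(1) by blast
    have "nCauchy \<sigma>"
      unfolding nCauchy_def using C \<sigma>c by simp
    then obtain x where x: "nlim \<sigma> x" using compl norm_complete_iff by blast
    have xH: "x \<in> H" using nclosedD[OF H(2) \<sigma> x] .
    have "limitin sub.mtopology \<sigma> x sequentially"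
      unfolding sub.limitin_metric_dist_null using xH \<sigma> \<sigma>c x by (simp add: nlim_def)
    then show "\<exists>x. limitin sub.mtopology \<sigma> x sequentially" by blast
  qed
  moreover have "norm_dist M N (f x) (f y) \<le> k * norm_dist M N x y" if "x \<in> H" "y \<in> H" for x y
  proof -
    have "x \<in> carrier M" "y \<in> carrier M" "f x \<in> carrier M" "f y \<in> carrier M"
      using that f H(1) by auto
    then show ?thesis using contr[OF that] by simp
  qed
  ultimately show thesis
    using sub.Banach_fixedpoint_thm[OF _ H(3) f k] that by blast
qed

context cstar_algebra
begin

lemma commute_mult:
  assumes "x \<in> carrier A" "a \<in> carrier A" "b \<in> carrier A" "x \<otimes> a = a \<otimes> x" "x \<otimes> b = b \<otimes> x"
  shows "x \<otimes> (a \<otimes> b) = (a \<otimes> b) \<otimes> x"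
proof -
  have "x \<otimes> (a \<otimes> b) = (a \<otimes> x) \<otimes> b" using assms by (simp flip: mult_assoc)
  also have "\<dots> = a \<otimes> (b \<otimes> x)" using assms by (simp add: mult_assoc)
  finally show ?thesis using assms by (simp add: mult_assoc)
qed

lemma commute_square:
  assumes "a \<in> carrier A" "b \<in> carrier A" "a \<otimes> b = b \<otimes> a"
  shows "(a \<otimes> b) \<otimes> (a \<otimes> b) = (a \<otimes> a) \<otimes> (b \<otimes> b)"
proof -
  have "(a \<otimes> b) \<otimes> (a \<otimes> b) = a \<otimes> ((b \<otimes> a) \<otimes> b)" using assms(1,2) by (simp add: mult_assoc)
  also have "\<dots> = a \<otimes> ((a \<otimes> b) \<otimes> b)" using assms(3) by simp
  finally show ?thesis using assms(1,2) by (simp add: mult_assoc)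
qed

end

text \<open>The solution \<open>b\<close> of \<open>2 b = h + b\<^sup>2\<close> is \<open>1 - \<surd>(1 - h)\<close>, written without a unit.\<close>

lemma (in cstar_algebra) ex_one_minus_sqrt:
  assumes h: "h \<in> carrier A" "star A h = h" "cnorm A h < 1"
  shows "\<exists>b\<in>carrier A. star A b = b \<and> b \<oplus> b = h \<oplus> b \<otimes> b \<and> cnorm A b \<le> cnorm A h \<and>
    (\<forall>x\<in>carrier A. x \<otimes> h = h \<otimes> x \<longrightarrow> x \<otimes> b = b \<otimes> x)"
proof -
  define r where "r = cnorm A h"
  have r: "0 \<le> r" "r < 1" using h by (auto simp: r_def)
  define f where "f b = (1/2) \<odot> (h \<oplus> b \<otimes> b)" for b
  \<comment> \<open>All side conditions are put into the closed set on which the contraction acts: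
    self-adjointness, the norm bound, and commuting with everything that commutes with h. The fixed
    point then has them without any power series. On \<open>H\<close> the map \<open>f\<close> is
    Lipschitz with constant r, since b^2 - c^2 = b(b - c) + (b - c)c.\<close>
  define H where "H = {b \<in> carrier A. star A b = b \<and> cnorm A b \<le> r \<and>
    (\<forall>x\<in>carrier A. x \<otimes> h = h \<otimes> x \<longrightarrow> x \<otimes> b = b \<otimes> x)}"
  have H: "H \<subseteq> carrier A" by (auto simp: H_def)
  have fc [simp]: "b \<in> carrier A \<Longrightarrow> f b \<in> carrier A" for b using h by (simp add: f_def)
  have "nclosed H"
  proof (rule nclosedI)
    fix \<sigma> b assume \<sigma>: "\<And>n. \<sigma> n \<in> H" and lim: "nlim \<sigma> b"
    have b: "b \<in> carrier A" using lim nlimD by blast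
    have "nlim \<sigma> (star A b)" using nlim_star[OF lim] \<sigma> by (simp add: H_def)
    then have sb: "star A b = b" using nlim_unique lim by blast
    have nb: "cnorm A b \<le> r"
      using \<sigma> by (intro LIMSEQ_le_const2[OF nlim_norm[OF lim]]) (auto simp: H_def)
    have "x \<otimes> b = b \<otimes> x" if x: "x \<in> carrier A" "x \<otimes> h = h \<otimes> x" for x
    proof (rule nlim_unique)
      show "nlim (\<lambda>n. x \<otimes> \<sigma> n) (x \<otimes> b)" by (intro nlim_mult nlim_const x lim)
      have "nlim (\<lambda>n. \<sigma> n \<otimes> x) (b \<otimes> x)" by (intro nlim_mult nlim_const x lim)
      moreover have "x \<otimes> \<sigma> n = \<sigma> n \<otimes> x" for n using \<sigma>[of n] x by (simp add: H_def)
      ultimately show "nlim (\<lambda>n. x \<otimes> \<sigma> n) (b \<otimes> x)" by simp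
    qed
    then show "b \<in> H" using b sb nb by (simp add: H_def)
  qed
  moreover have "\<zero> \<in> H" using r by (simp add: H_def)
  moreover have "f \<in> H \<rightarrow> H"
  proof
    fix b assume "b \<in> H"
    then have b: "b \<in> carrier A" "star A b = b" "cnorm A b \<le> r"
      and comm: "\<And>x. \<lbrakk>x \<in> carrier A; x \<otimes> h = h \<otimes> x\<rbrakk> \<Longrightarrow> x \<otimes> b = b \<otimes> x"
      by (auto simp: H_def)
    have "cnorm A (f b) = cnorm A (h \<oplus> b \<otimes> b) / 2"
      using b h by (simp add: f_def N_smult norm_divide)
    also have "\<dots> \<le> (cnorm A h + cnorm A (b \<otimes> b)) / 2" using b h by (simp add: N_add)
    also have "\<dots> \<le> (r + cnorm A b * cnorm A b) / 2" using b h cnorm_mult[of b b] by (simp add: r_def)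
    also have "\<dots> \<le> (r + r * 1) / 2"
      using b r by (intro divide_right_mono add_left_mono mult_mono) auto
    finally have "cnorm A (f b) \<le> r" by simp
    moreover have "star A (f b) = f b"
      using b h by (simp add: f_def star_smult star_add star_mult)
    moreover have "x \<otimes> f b = f b \<otimes> x" if x: "x \<in> carrier A" "x \<otimes> h = h \<otimes> x" for x
    proof -
      have "x \<otimes> (b \<otimes> b) = (b \<otimes> b) \<otimes> x"
        using comm[OF x] b x by (metis mult_assoc)
      then show ?thesis
        using b x h by (simp add: f_def smult_mult_left smult_mult_right mult_l_distr mult_r_distr)
    qed
    ultimately show "f b \<in> H" using b by (simp add: H_def)
  qed
  moreover have "cnorm A (f b \<ominus> f c) \<le> r * cnorm A (b \<ominus> c)" if bc: "b \<in> H" "c \<in> H" for b c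
  proof -
    have b: "b \<in> carrier A" "cnorm A b \<le> r" and c: "c \<in> carrier A" "cnorm A c \<le> r"
      using bc by (auto simp: H_def)
    have "(h \<oplus> b \<otimes> b) \<ominus> (h \<oplus> c \<otimes> c) = b \<otimes> b \<ominus> c \<otimes> c"
      using h b c minus_minus_swap[of h "b \<otimes> b" h "c \<otimes> c"] by simp
    also have "\<dots> = (b \<otimes> b \<ominus> b \<otimes> c) \<oplus> (b \<otimes> c \<ominus> c \<otimes> c)"
      using b c by (simp add: minus_add_minus)
    also have "\<dots> = b \<otimes> (b \<ominus> c) \<oplus> (b \<ominus> c) \<otimes> c"
      using b c by (simp add: mult_minus_left mult_minus_right)
    finally have e: "(h \<oplus> b \<otimes> b) \<ominus> (h \<oplus> c \<otimes> c) = b \<otimes> (b \<ominus> c) \<oplus> (b \<ominus> c) \<otimes> c" .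
    have "cnorm A (f b \<ominus> f c) = cnorm A (b \<otimes> (b \<ominus> c) \<oplus> (b \<ominus> c) \<otimes> c) / 2"
      using b c h e by (simp add: f_def N_smult norm_divide flip: smult_minus_right)
    also have "\<dots> \<le> (cnorm A b * cnorm A (b \<ominus> c) + cnorm A (b \<ominus> c) * cnorm A c) / 2"
      using b c by (intro divide_right_mono order_trans[OF N_add] add_mono cnorm_mult) auto
    also have "\<dots> \<le> (r * cnorm A (b \<ominus> c) + cnorm A (b \<ominus> c) * r) / 2"
      using b c by (intro divide_right_mono add_mono mult_left_mono mult_right_mono) auto
    finally show ?thesis by simp
  qed
  ultimately obtain b where b: "b \<in> H" "f b = b"
    using contraction_fixpoint[OF complete H _ _ _ r(2)] by blast
  have bc: "b \<in> carrier A" using b H by blast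
  have "b \<oplus> b = 2 \<odot> b" using smult_add_left[of b 1 1] bc by simp
  also have "\<dots> = 2 \<odot> f b" using b by simp
  also have "\<dots> = h \<oplus> b \<otimes> b" using bc h by (simp add: f_def smult_smult)
  finally have "b \<oplus> b = h \<oplus> b \<otimes> b" .
  then show ?thesis using b bc by (intro bexI[of _ b]) (simp_all add: H_def r_def)
qed

locale unital_cstar = cstar_algebra A for A :: "('a, 'm) cstar_algebra_scheme" (structure) +
  assumes one_closed': "\<one> \<in> carrier A"
    and l_one': "x \<in> carrier A \<Longrightarrow> \<one> \<otimes> x = x"
    and r_one': "x \<in> carrier A \<Longrightarrow> x \<otimes> \<one> = x"

sublocale unital_cstar \<subseteq> ring A
  by unfold_locales
    (simp_all add: one_closed' l_one' r_one' mult_assoc mult_l_distr mult_r_distr)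

section \<open>Scalars, self-adjoint elements, unitaries and positive elements\<close>

context unital_cstar
begin

definition sc :: "real \<Rightarrow> 'a" where "sc t = complex_of_real t \<odot> \<one>"

lemma star_one [simp]: "star A \<one> = \<one>"
  by (metis one_closed l_one r_one star_closed star_mult star_star)

lemma cnorm_one: "cnorm A \<one> \<le> 1"
proof -
  have "cnorm A \<one> = (cnorm A \<one>)\<^sup>2"
    using cnorm_star[of \<one>] by simp
  then have "cnorm A \<one> = 0 \<or> cnorm A \<one> = 1" by (simp add: power2_eq_square)
  then show ?thesis by auto
qed

lemma sc_closed [simp, intro]: "sc t \<in> carrier A"
  by (simp add: sc_def)

lemma star_sc [simp]: "star A (sc t) = sc t"
  by (simp add: sc_def star_smult)

lemma sc_add: "sc s \<oplus> sc t = sc (s + t)"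
  by (simp add: sc_def smult_add_left)

lemma sc_diff: "sc s \<ominus> sc t = sc (s - t)"
  by (simp add: sc_def smult_diff_left)

lemma sc_mult_left: "x \<in> carrier A \<Longrightarrow> sc t \<otimes> x = complex_of_real t \<odot> x"
  by (simp add: sc_def smult_mult_left)

lemma sc_mult_right: "x \<in> carrier A \<Longrightarrow> x \<otimes> sc t = complex_of_real t \<odot> x"
  by (simp add: sc_def smult_mult_right)

lemma sc_commute: "x \<in> carrier A \<Longrightarrow> sc t \<otimes> x = x \<otimes> sc t"
  by (simp add: sc_mult_left sc_mult_right)

lemma sc_mult: "sc s \<otimes> sc t = sc (s * t)"
  by (simp add: sc_mult_left) (simp add: sc_def smult_smult)

lemma sc_0 [simp]: "sc 0 = \<zero>" and sc_1 [simp]: "sc 1 = \<one>"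
  by (simp_all add: sc_def)

lemma cnorm_sc: "cnorm A (sc t) \<le> \<bar>t\<bar>"
  using cnorm_one by (simp add: sc_def N_smult mult_left_le)

definition sa :: "'a \<Rightarrow> bool" where "sa h \<longleftrightarrow> h \<in> carrier A \<and> star A h = h"

lemma sa_closed [dest]: "sa h \<Longrightarrow> h \<in> carrier A"
  by (simp add: sa_def)

lemma sa_star: "sa h \<Longrightarrow> star A h = h"
  by (simp add: sa_def)

lemma sa_add: "\<lbrakk>sa h; sa k\<rbrakk> \<Longrightarrow> sa (h \<oplus> k)"
  and sa_minus: "\<lbrakk>sa h; sa k\<rbrakk> \<Longrightarrow> sa (h \<ominus> k)"
  and sa_sc: "sa (sc t)"
  and sa_smult: "sa h \<Longrightarrow> sa (complex_of_real t \<odot> h)"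
  and sa_mult: "\<lbrakk>sa h; sa k; h \<otimes> k = k \<otimes> h\<rbrakk> \<Longrightarrow> sa (h \<otimes> k)"
  by (simp_all add: sa_def star_add star_minus star_smult star_mult)

lemma cnorm_sa_square: "sa h \<Longrightarrow> cnorm A (h \<otimes> h) = (cnorm A h)\<^sup>2"
  using cnorm_star[of h] by (simp add: sa_def)

text \<open>The element u = k + i l satisfies u^* u = 1, so its norm is at most 1, and k is the mean
  of u and its adjoint. With l a square root of 1 - k^2 this replaces spectral bounds for
  self-adjoint elements.\<close>

lemma unitary_bound:
  assumes k: "sa k" and l: "sa l" and kl: "k \<otimes> l = l \<otimes> k" and one: "k \<otimes> k \<oplus> l \<otimes> l = \<one>"
  shows "cnorm A k \<le> 1"
proof -
  note [simp] = sa_closed[OF k] sa_closed[OF l]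
  define m where "m = \<i> \<odot> l"
  have m [simp]: "m \<in> carrier A" by (simp add: m_def)
  have sm: "star A m = \<ominus> m" using l by (simp add: m_def star_smult sa_star smult_neg_left)
  have mm: "m \<otimes> m = \<ominus> (l \<otimes> l)"
    by (simp add: m_def smult_mult_left smult_mult_right smult_smult neg_eq_smult)
  have km: "m \<otimes> k = k \<otimes> m" by (simp add: m_def smult_mult_left smult_mult_right kl)
  have u: "star A (k \<oplus> m) = k \<ominus> m" using k by (simp add: star_add sa_star sm a_minus_def)
  have "(k \<ominus> m) \<otimes> (k \<oplus> m) = k \<otimes> k \<ominus> m \<otimes> m \<oplus> (k \<otimes> m \<ominus> m \<otimes> k)"
    using m sa_closed[OF k] by algebra
  then have "star A (k \<oplus> m) \<otimes> (k \<oplus> m) = \<one>"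
    using one by (simp add: u km mm) (simp add: a_minus_def)
  then have "(cnorm A (k \<oplus> m))\<^sup>2 \<le> 1" using cnorm_star[of "k \<oplus> m"] cnorm_one by simp
  then have n: "cnorm A (k \<oplus> m) \<le> 1" by (simp add: abs_square_le_1)
  have "(k \<oplus> m) \<oplus> (k \<ominus> m) = k \<oplus> k" using m sa_closed[OF k] by algebra
  then have "(k \<oplus> m) \<oplus> star A (k \<oplus> m) = 2 \<odot> k" using smult_add_left[of k 1 1] by (simp add: u)
  then have "2 * cnorm A k = cnorm A ((k \<oplus> m) \<oplus> star A (k \<oplus> m))" by (simp add: N_smult)
  also have "\<dots> \<le> cnorm A (k \<oplus> m) + cnorm A (star A (k \<oplus> m))" by (intro N_add) auto
  also have "\<dots> \<le> 2" using n cnorm_star_eq[of "k \<oplus> m"] by simp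
  finally show ?thesis by simp
qed

lemma unitary_bound_scaled:
  assumes k: "sa k" and l: "sa l" and kl: "k \<otimes> l = l \<otimes> k" and r: "r > 0"
    and eq: "k \<otimes> k \<oplus> l \<otimes> l = sc (r * r)"
  shows "cnorm A k \<le> r"
proof -
  note [simp] = sa_closed[OF k] sa_closed[OF l]
  let ?c = "complex_of_real (1 / r)"
  have cc: "?c * ?c * complex_of_real (r * r) = 1" using r by simp
  have "cnorm A (?c \<odot> k) \<le> 1"
  proof (rule unitary_bound)
    show "sa (?c \<odot> k)" "sa (?c \<odot> l)" by (intro sa_smult k l)+
    show "?c \<odot> k \<otimes> (?c \<odot> l) = ?c \<odot> l \<otimes> (?c \<odot> k)"
      by (simp add: smult_mult_left smult_mult_right kl)
    have "?c \<odot> k \<otimes> (?c \<odot> k) \<oplus> ?c \<odot> l \<otimes> (?c \<odot> l) = (?c * ?c) \<odot> (k \<otimes> k \<oplus> l \<otimes> l)"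
      by (simp only: smult_mult_left smult_mult_right smult_smult smult_add_right sa_closed[OF k]
          sa_closed[OF l] smult_closed' mult_closed)
    also have "\<dots> = (?c * ?c * complex_of_real (r * r)) \<odot> \<one>"
      unfolding eq sc_def by (rule smult_smult) simp
    also have "\<dots> = \<one>" unfolding cc by simp
    finally show "?c \<odot> k \<otimes> (?c \<odot> k) \<oplus> ?c \<odot> l \<otimes> (?c \<odot> l) = \<one>" .
  qed
  then show ?thesis using r by (simp add: N_smult norm_divide field_simps)
qed

text \<open>Positivity without a spectrum: for self-adjoint h the norm condition says that the
  spectrum lies between 0 and 2t. In this form sums are positive at once; that squares and elements
  x^* x are positive takes work.\<close>

definition pos :: "'a \<Rightarrow> bool" where
  "pos h \<longleftrightarrow> sa h \<and> (\<exists>t\<ge>0. cnorm A (sc t \<ominus> h) \<le> t)"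

lemma pos_sa: "pos h \<Longrightarrow> sa h"
  by (simp add: pos_def)

lemma pos_closed' [dest]: "pos h \<Longrightarrow> h \<in> carrier A"
  using pos_sa by blast

text \<open>With T = t + e one has h + e = T(1 - z) for z = (t - h) / T, and e > 0 makes the norm of
  z strictly less than 1, as \<open>ex_one_minus_sqrt\<close> demands. The root is sqrt T times 1 -
  b. Applications remove e by passing to a limit.\<close>

lemma pos_sqrt:
  assumes h: "pos h" and e: "e > 0"
  obtains a where "pos a" "a \<otimes> a = h \<oplus> sc e"
    "\<And>x. \<lbrakk>x \<in> carrier A; x \<otimes> h = h \<otimes> x\<rbrakk> \<Longrightarrow> x \<otimes> a = a \<otimes> x"
proof -
  obtain t where t: "t \<ge> 0" "cnorm A (sc t \<ominus> h) \<le> t" and sh: "sa h" using h by (auto simp: pos_def)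
  note [simp] = sa_closed[OF sh]
  define T where "T = t + e"
  have T: "T > 0" using t e by (simp add: T_def)
  define z where "z = complex_of_real (1 / T) \<odot> (sc t \<ominus> h)"
  have z: "sa z" unfolding z_def by (intro sa_smult sa_minus sa_sc sh)
  note [simp] = sa_closed[OF z]
  have Tz: "complex_of_real T \<odot> z = sc t \<ominus> h" using T by (simp add: z_def smult_smult)
  have "cnorm A z \<le> t / T" using t T by (simp add: z_def N_smult norm_divide field_simps)
  also have "t / T < 1" using T e by (simp add: T_def)
  finally have nz: "cnorm A z < 1" .
  obtain b where b: "b \<in> carrier A" "star A b = b" "b \<oplus> b = z \<oplus> b \<otimes> b" "cnorm A b \<le> cnorm A z"
    "\<And>x. \<lbrakk>x \<in> carrier A; x \<otimes> z = z \<otimes> x\<rbrakk> \<Longrightarrow> x \<otimes> b = b \<otimes> x"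
    using ex_one_minus_sqrt[OF sa_closed[OF z] sa_star[OF z] nz] by blast
  note [simp] = b(1)
  have sb: "sa b" using b(1,2) by (simp add: sa_def)
  define g where "g = \<one> \<ominus> b"
  have g: "sa g" unfolding g_def using sa_minus[OF sa_sc[of 1] sb] by simp
  note [simp] = sa_closed[OF g]
  have gg: "g \<otimes> g = \<one> \<ominus> z"
  proof -
    have "g \<otimes> g = \<one> \<ominus> (b \<oplus> b \<ominus> b \<otimes> b)"
      unfolding g_def by (simp add: mult_minus_left mult_minus_right) (use b(1) in algebra)
    also have "b \<oplus> b \<ominus> b \<otimes> b = z" unfolding b(3) using b(1) sa_closed[OF z] by algebra
    finally show ?thesis .
  qed
  define a where "a = complex_of_real (sqrt T) \<odot> g"
  have a: "sa a" unfolding a_def by (intro sa_smult g)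
  show thesis
  proof
    have "cnorm A (sc (sqrt T) \<ominus> a) \<le> sqrt T"
    proof -
      have "\<one> \<ominus> g = b" unfolding g_def using b(1) one_closed by algebra
      then have "sc (sqrt T) \<ominus> a = complex_of_real (sqrt T) \<odot> b"
        unfolding sc_def a_def by (simp flip: smult_minus_right)
      then have "cnorm A (sc (sqrt T) \<ominus> a) = sqrt T * cnorm A b" using T by (simp add: N_smult)
      also have "\<dots> \<le> sqrt T * 1"
        using b(4) nz T by (intro mult_left_mono) auto
      finally show ?thesis by simp
    qed
    then show "pos a" unfolding pos_def using a T by (intro conjI exI[of _ "sqrt T"]) auto
    have "a \<otimes> a = complex_of_real T \<odot> (g \<otimes> g)"
      using T by (simp add: a_def smult_mult_left smult_mult_right smult_smult flip: of_real_mult)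
    also have "\<dots> = sc T \<ominus> (sc t \<ominus> h)"
      unfolding gg by (simp add: smult_minus_right Tz) (simp add: sc_def)
    also have "sc T = sc t \<oplus> sc e" by (simp add: T_def sc_add)
    also have "sc t \<oplus> sc e \<ominus> (sc t \<ominus> h) = h \<oplus> sc e"
      using sa_closed[OF sh] sc_closed[of t] sc_closed[of e] by algebra
    finally show "a \<otimes> a = h \<oplus> sc e" .
    fix x assume x: "x \<in> carrier A" "x \<otimes> h = h \<otimes> x"
    have "x \<otimes> z = z \<otimes> x"
      using x by (simp add: z_def smult_mult_left smult_mult_right mult_minus_left mult_minus_right
          sc_commute)
    then have "x \<otimes> b = b \<otimes> x" using b x by blast
    then show "x \<otimes> a = a \<otimes> x"
      using x by (simp add: a_def g_def smult_mult_left smult_mult_right mult_minus_left mult_minus_right)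
  qed
qed

text \<open>Scale k to l of norm below 1 and let g be the root of 1 - l^2. Then g + i l is unitary,
  so the norm of g is at most 1, and so is that of g^2 = 1 - l^2. Scaling back, t = R^2 works in
  \<open>pos\<close>.\<close>

lemma pos_square:
  assumes k: "sa k"
  shows "pos (k \<otimes> k)"
proof -
  note [simp] = sa_closed[OF k]
  define R where "R = cnorm A k + 1"
  have R: "R > 0" "cnorm A k < R" using N_nonneg[of k] by (simp_all add: R_def add_nonneg_pos del: N_nonneg)
  define c where "c = complex_of_real (1 / R)"
  define l where "l = c \<odot> k"
  have l: "sa l" unfolding l_def c_def by (intro sa_smult k)
  note [simp] = sa_closed[OF l]
  have nl: "cnorm A l < 1" using R by (simp add: l_def c_def N_smult norm_divide)
  have ll: "sa (l \<otimes> l)" by (intro sa_mult l refl)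
  have nll: "cnorm A (l \<otimes> l) < 1"
    using cnorm_sa_square[OF l] nl N_nonneg[of l] by (simp add: abs_square_less_1 del: N_nonneg)
  obtain b where b: "b \<in> carrier A" "star A b = b" "b \<oplus> b = l \<otimes> l \<oplus> b \<otimes> b" "cnorm A b \<le> cnorm A (l \<otimes> l)"
    "\<And>x. \<lbrakk>x \<in> carrier A; x \<otimes> (l \<otimes> l) = (l \<otimes> l) \<otimes> x\<rbrakk> \<Longrightarrow> x \<otimes> b = b \<otimes> x"
    using ex_one_minus_sqrt[OF sa_closed[OF ll] sa_star[OF ll] nll] by blast
  note [simp] = b(1)
  have sb: "sa b" using b(1,2) by (simp add: sa_def)
  define g where "g = \<one> \<ominus> b"
  have g: "sa g" unfolding g_def using sa_minus[OF sa_sc[of 1] sb] by simp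
  note [simp] = sa_closed[OF g]
  have "g \<otimes> g = \<one> \<ominus> (b \<oplus> b \<ominus> b \<otimes> b)"
    unfolding g_def by (simp add: mult_minus_left mult_minus_right) (use b(1) in algebra)
  also have "b \<oplus> b \<ominus> b \<otimes> b = l \<otimes> l" unfolding b(3) using b(1) sa_closed[OF l] by algebra
  finally have gg: "g \<otimes> g = \<one> \<ominus> l \<otimes> l" .
  have "l \<otimes> b = b \<otimes> l" by (rule b(5)) (simp_all add: mult_assoc)
  then have gl: "g \<otimes> l = l \<otimes> g" by (simp add: g_def mult_minus_left mult_minus_right)
  have "g \<otimes> g \<oplus> l \<otimes> l = \<one>" unfolding gg by (simp add: diff_add_cancel)
  then have "cnorm A g \<le> 1" by (intro unitary_bound[OF g l gl])
  then have n: "cnorm A (\<one> \<ominus> l \<otimes> l) \<le> 1"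
    using cnorm_sa_square[OF g] gg N_nonneg[of g] by (simp add: abs_square_le_1 del: N_nonneg)
  have Rk: "complex_of_real (R * R) \<odot> (l \<otimes> l) = k \<otimes> k"
    using R by (simp add: l_def c_def smult_mult_left smult_mult_right smult_smult)
  have "sc (R * R) \<ominus> k \<otimes> k = complex_of_real (R * R) \<odot> (\<one> \<ominus> l \<otimes> l)"
    unfolding sc_def Rk[symmetric] by (simp only: smult_minus_right one_closed sa_closed[OF ll])
  then have "cnorm A (sc (R * R) \<ominus> k \<otimes> k) = (R * R) * cnorm A (\<one> \<ominus> l \<otimes> l)"
    using R by (simp add: N_smult norm_mult)
  also have "\<dots> \<le> R * R" using n R by (simp add: mult_left_le)
  finally have "cnorm A (sc (R * R) \<ominus> k \<otimes> k) \<le> R * R" .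
  then show ?thesis
    unfolding pos_def using R by (intro conjI sa_mult k refl exI[of _ "R * R"]) auto
qed

text \<open>Up to e, both h and r - h have square roots a and b, and these commute. The product l =
  a b and the shifted element k = h + e - c satisfy k^2 + l^2 = c^2, so
  \<open>unitary_bound_scaled\<close> bounds k by c and hence h by c + |c - e|, which is close to
  r.\<close>

lemma pos_le_norm:
  assumes h: "pos h" and rh: "pos (sc r \<ominus> h)" and r: "r \<ge> 0"
  shows "cnorm A h \<le> r"
proof (rule field_le_epsilon)
  fix d :: real assume "d > 0"
  define e where "e = d / 3"
  have e: "e > 0" "3 * e = d" using \<open>d > 0\<close> by (simp_all add: e_def)
  note [simp] = pos_closed'[OF h]
  obtain a where a: "pos a" "a \<otimes> a = h \<oplus> sc e"
    "\<And>x. \<lbrakk>x \<in> carrier A; x \<otimes> h = h \<otimes> x\<rbrakk> \<Longrightarrow> x \<otimes> a = a \<otimes> x"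
    using pos_sqrt[OF h e(1)] by blast
  obtain b where b: "pos b" "b \<otimes> b = (sc r \<ominus> h) \<oplus> sc e"
    "\<And>x. \<lbrakk>x \<in> carrier A; x \<otimes> (sc r \<ominus> h) = (sc r \<ominus> h) \<otimes> x\<rbrakk> \<Longrightarrow> x \<otimes> b = b \<otimes> x"
    using pos_sqrt[OF rh e(1)] by blast
  note [simp] = pos_closed'[OF a(1)] pos_closed'[OF b(1)]
  have ha: "h \<otimes> a = a \<otimes> h" by (rule a(3)) auto
  have hb: "h \<otimes> b = b \<otimes> h"
    by (rule b(3)) (auto simp: mult_minus_left mult_minus_right sc_commute)
  have ab: "a \<otimes> b = b \<otimes> a"
    by (rule b(3)) (auto simp: mult_minus_left mult_minus_right sc_commute ha)
  \<comment> \<open>The sum of h + e and r - h + e is 2c. So with x = h + e the square of b is 2c -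
    x, and (x - c)^2 + x(2c - x) = c^2.\<close>
  define c where "c = (r + 2 * e) / 2"
  have c: "c > 0" "sc c \<oplus> sc c = sc r \<oplus> (sc e \<oplus> sc e)" using r e by (simp_all add: c_def sc_add)
  define k where "k = h \<oplus> sc e \<ominus> sc c"
  define l where "l = a \<otimes> b"
  have k: "sa k" unfolding k_def by (intro sa_add sa_minus sa_sc pos_sa h)
  have l: "sa l" unfolding l_def by (intro sa_mult pos_sa a b ab)
  have kl: "k \<otimes> l = l \<otimes> k"
  proof -
    have "h \<otimes> (a \<otimes> b) = (a \<otimes> b) \<otimes> h" using ha hb by (intro commute_mult) auto
    then show ?thesis
      unfolding k_def l_def by (simp add: mult_minus_left mult_minus_right mult_l_distr mult_r_distr sc_commute)
  qed
  have "l \<otimes> l = (a \<otimes> a) \<otimes> (b \<otimes> b)"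
    unfolding l_def by (rule commute_square) (auto simp: ab)
  also have "\<dots> = (h \<oplus> sc e) \<otimes> ((sc c \<oplus> sc c) \<ominus> (h \<oplus> sc e))"
  proof -
    have "sc r \<ominus> h \<oplus> sc e = (sc c \<oplus> sc c) \<ominus> (h \<oplus> sc e)"
      unfolding c(2) using pos_closed'[OF h] sc_closed[of r] sc_closed[of e] by algebra
    then show ?thesis unfolding a(2) b(2) by simp
  qed
  finally have ll: "l \<otimes> l = (h \<oplus> sc e) \<otimes> ((sc c \<oplus> sc c) \<ominus> (h \<oplus> sc e))" .
  have alg: "(x \<ominus> y) \<otimes> (x \<ominus> y) \<oplus> x \<otimes> ((y \<oplus> y) \<ominus> x) = y \<otimes> y"
    if "x \<in> carrier A" "y \<in> carrier A" "y \<otimes> x = x \<otimes> y" for x y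
    using that by algebra
  have "k \<otimes> k \<oplus> l \<otimes> l = sc (c * c)"
    unfolding k_def ll sc_mult[symmetric] by (rule alg) (simp_all add: sc_commute)
  then have nk: "cnorm A k \<le> c" by (intro unitary_bound_scaled[OF k l kl c(1)])
  have "h = k \<oplus> (sc c \<ominus> sc e)"
    unfolding k_def using pos_closed'[OF h] sc_closed[of c] sc_closed[of e] by algebra
  then have "cnorm A h \<le> cnorm A k + cnorm A (sc c \<ominus> sc e)"
    using N_add[of k "sc c \<ominus> sc e"] sa_closed[OF k] by simp
  also have "\<dots> \<le> c + \<bar>c - e\<bar>" using nk cnorm_sc[of "c - e"] by (simp add: sc_diff)
  also have "\<dots> \<le> r + d" using e r by (simp add: c_def abs_if)
  finally show "cnorm A h \<le> r + d" .
qed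

lemma pos_add: "\<lbrakk>pos h; pos k\<rbrakk> \<Longrightarrow> pos (h \<oplus> k)"
proof -
  assume hk: "pos h" "pos k"
  then obtain s t where s: "s \<ge> 0" "cnorm A (sc s \<ominus> h) \<le> s" and t: "t \<ge> 0" "cnorm A (sc t \<ominus> k) \<le> t"
    by (auto simp: pos_def)
  have "sc (s + t) \<ominus> (h \<oplus> k) = (sc s \<ominus> h) \<oplus> (sc t \<ominus> k)"
    using hk by (simp add: minus_minus_swap pos_closed' flip: sc_add)
  then have "cnorm A (sc (s + t) \<ominus> (h \<oplus> k)) \<le> s + t"
    using N_add[of "sc s \<ominus> h" "sc t \<ominus> k"] s t hk by (simp add: pos_closed')
  then show ?thesis
    unfolding pos_def using hk s t by (intro conjI sa_add pos_sa exI[of _ "s + t"]) auto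
qed

lemma pos_smult: "\<lbrakk>pos h; c \<ge> 0\<rbrakk> \<Longrightarrow> pos (complex_of_real c \<odot> h)"
proof -
  assume h: "pos h" and c: "c \<ge> 0"
  then obtain s where s: "s \<ge> 0" "cnorm A (sc s \<ominus> h) \<le> s" by (auto simp: pos_def)
  have "sc (c * s) \<ominus> complex_of_real c \<odot> h = complex_of_real c \<odot> (sc s \<ominus> h)"
    using h by (simp add: smult_minus_right pos_closed' sc_def smult_smult)
  then have "cnorm A (sc (c * s) \<ominus> complex_of_real c \<odot> h) \<le> c * s"
    using s c h by (simp add: N_smult pos_closed' mult_left_mono)
  then show ?thesis
    unfolding pos_def using h s c by (intro conjI sa_smult pos_sa exI[of _ "c * s"]) auto
qed

lemma pos_norm_minus: "\<lbrakk>sa h; cnorm A h \<le> r\<rbrakk> \<Longrightarrow> pos (sc r \<ominus> h)"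
proof -
  assume h: "sa h" and r: "cnorm A h \<le> r"
  have "sc r \<ominus> (sc r \<ominus> h) = h" using sa_closed[OF h] sc_closed[of r] by algebra
  moreover have "0 \<le> r" using r N_nonneg[OF sa_closed[OF h]] by linarith
  ultimately show ?thesis
    unfolding pos_def using r h by (intro conjI sa_minus sa_sc exI[of _ r]) auto
qed

text \<open>Any bound of the norm may serve as the constant in \<open>pos\<close>. This makes limits
  of positive elements positive, because one constant then serves the whole sequence.\<close>

lemma pos_norm_le:
  assumes h: "pos h" and r: "cnorm A h \<le> r"
  shows "cnorm A (sc r \<ominus> h) \<le> r"
proof (rule pos_le_norm)
  show "pos (sc r \<ominus> h)" by (intro pos_norm_minus pos_sa h r)
  have "sc r \<ominus> (sc r \<ominus> h) = h" using pos_closed'[OF h] sc_closed[of r] by algebra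
  then show "pos (sc r \<ominus> (sc r \<ominus> h))" using h by simp
  show "0 \<le> r" using r N_nonneg[OF pos_closed'[OF h]] by linarith
qed

lemma pos_limit:
  assumes \<sigma>: "\<And>n. pos (\<sigma> n)" and lim: "nlim \<sigma> h"
  shows "pos h"
proof -
  have hc: "h \<in> carrier A" using nlimD(2)[OF lim] .
  have "nlim \<sigma> (star A h)" using nlim_star[OF lim] sa_star[OF pos_sa[OF \<sigma>]] by simp
  then have h: "sa h" using nlim_unique lim hc by (auto simp: sa_def)
  have "convergent (\<lambda>n. cnorm A (\<sigma> n))" using nlim_norm[OF lim] by (rule convergentI)
  then have "Bseq (\<lambda>n. cnorm A (\<sigma> n))" by (rule convergent_imp_Bseq)
  then obtain r where r: "r > 0" "\<And>n. cnorm A (\<sigma> n) \<le> r"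
    by (auto elim!: BseqE simp: abs_le_iff)
  have "cnorm A (sc r \<ominus> \<sigma> n) \<le> r" for n by (rule pos_norm_le[OF \<sigma> r(2)])
  moreover have "nlim (\<lambda>n. sc r \<ominus> \<sigma> n) (sc r \<ominus> h)" by (intro nlim_minus nlim_const lim sc_closed)
  ultimately have "cnorm A (sc r \<ominus> h) \<le> r" by (intro LIMSEQ_le_const2[OF nlim_norm]) auto
  then show ?thesis unfolding pos_def using h r(1) by (intro conjI exI[of _ r]) auto
qed

text \<open>The roots of a + e and b + e commute, so the product of these two elements is the square
  of a self-adjoint element; then e tends to 0.\<close>

lemma pos_mult:
  assumes a: "pos a" and b: "pos b" and ab: "a \<otimes> b = b \<otimes> a"
  shows "pos (a \<otimes> b)"
proof -
  note [simp] = pos_closed'[OF a] pos_closed'[OF b]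
  define e where "e n = 1 / real (Suc n)" for n
  have e: "e n > 0" for n by (simp add: e_def)
  have e0: "e \<longlonglongrightarrow> 0" unfolding e_def using LIMSEQ_inverse_real_of_nat by (simp add: inverse_eq_divide)
  have p: "pos ((a \<oplus> sc (e n)) \<otimes> (b \<oplus> sc (e n)))" for n
  proof -
    obtain f where f: "pos f" "f \<otimes> f = a \<oplus> sc (e n)"
      "\<And>x. \<lbrakk>x \<in> carrier A; x \<otimes> a = a \<otimes> x\<rbrakk> \<Longrightarrow> x \<otimes> f = f \<otimes> x"
      using pos_sqrt[OF a e] by blast
    obtain g where g: "pos g" "g \<otimes> g = b \<oplus> sc (e n)"
      "\<And>x. \<lbrakk>x \<in> carrier A; x \<otimes> b = b \<otimes> x\<rbrakk> \<Longrightarrow> x \<otimes> g = g \<otimes> x"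
      using pos_sqrt[OF b e] by blast
    note [simp] = pos_closed'[OF f(1)] pos_closed'[OF g(1)]
    have "b \<otimes> f = f \<otimes> b" by (rule f(3)) (auto simp: ab)
    then have fg: "f \<otimes> g = g \<otimes> f" by (intro g(3)) auto
    have "(f \<otimes> g) \<otimes> (f \<otimes> g) = (f \<otimes> f) \<otimes> (g \<otimes> g)"
      by (rule commute_square) (auto simp: fg)
    moreover have "pos ((f \<otimes> g) \<otimes> (f \<otimes> g))" by (intro pos_square sa_mult pos_sa f g fg)
    ultimately show ?thesis unfolding f(2) g(2) by simp
  qed
  have lim: "nlim (\<lambda>n. c \<oplus> sc (e n)) c" if "c \<in> carrier A" for c
  proof (rule nlimI)
    have "c \<oplus> sc (e n) \<ominus> c = sc (e n)" for n using that sc_closed[of "e n"] by algebra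
    then show "cnorm A (c \<oplus> sc (e n) \<ominus> c) \<le> e n" for n using cnorm_sc[of "e n"] e[of n] by simp
  qed (use that e0 in auto)
  show ?thesis by (rule pos_limit[OF p nlim_mult[OF lim lim]]) auto
qed

end

section \<open>Positivity of x^* x\<close>

context unital_cstar
begin

lemma cnorm_pow_le: "z \<in> carrier A \<Longrightarrow> cnorm A (z [^] (n::nat)) \<le> cnorm A z ^ n"
proof (induction n)
  case 0
  then show ?case using cnorm_one by simp
next
  case (Suc n)
  have "cnorm A (z [^] Suc n) \<le> cnorm A (z [^] n) * cnorm A z"
    using cnorm_mult[of "z [^] n" z] Suc.prems by simp
  also have "\<dots> \<le> cnorm A z ^ n * cnorm A z"
    using Suc by (intro mult_right_mono) auto
  finally show ?case by (simp add: mult.commute)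
qed

lemma sa_pow: "sa z \<Longrightarrow> sa (z [^] (n::nat))"
proof (induction n)
  case 0
  show ?case using sa_sc[of 1] by simp
next
  case (Suc n)
  then have "z [^] n \<otimes> z = z \<otimes> z [^] n" using nat_pow_comm[of z n 1] by auto
  then show ?case using Suc by (simp add: sa_mult)
qed

text \<open>The C*-identity computes the norm of the square of a self-adjoint element, so exact
  norms are known for exponents 2^k. Growth along these exponents stands in for the spectral
  radius.\<close>

lemma cnorm_sa_pow: "sa z \<Longrightarrow> cnorm A (z [^] (2 ^ k :: nat)) = cnorm A z ^ (2 ^ k)"
proof (induction k)
  case 0
  then show ?case by auto
next
  case (Suc k)
  have "z [^] (2 ^ Suc k :: nat) = z [^] (2 ^ k :: nat) \<otimes> z [^] (2 ^ k :: nat)"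
    using Suc.prems by (simp add: nat_pow_mult mult_2 sa_closed)
  then have "cnorm A (z [^] (2 ^ Suc k :: nat)) = (cnorm A (z [^] (2 ^ k :: nat)))\<^sup>2"
    using cnorm_sa_square[OF sa_pow[OF Suc.prems, of "2 ^ k"]] by simp
  also have "\<dots> = cnorm A z ^ (2 ^ Suc k)"
    using Suc by (simp flip: power_mult add: mult.commute)
  finally show ?case .
qed

text \<open>Powers of \<open>t + y y\<^sup>*\<close> applied to \<open>y\<close> are powers of \<open>t + y\<^sup>* y\<close>, so an upper bound for
  \<open>y\<^sup>* y\<close> is an upper bound for \<open>y y\<^sup>*\<close>.\<close>

lemma pos_swap_bound:
  assumes y: "y \<in> carrier A" and d: "d \<ge> 0" and q: "pos (sc d \<ominus> star A y \<otimes> y)"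
    and p: "pos (y \<otimes> star A y \<oplus> sc d)"
  shows "(cnorm A y)\<^sup>2 \<le> 3 * d"
proof -
  note [simp] = y
  let ?p = "y \<otimes> star A y" and ?q = "star A y \<otimes> y"
  have sp: "sa ?p" and sq: "sa ?q" by (simp_all add: sa_def star_mult)
  define t where "t = cnorm A ?q"
  have t: "t \<ge> 0" by (simp add: t_def)
  \<comment> \<open>The shift by t, the norm of y^* y, makes v positive whatever the sign of y^* y.
    Then v lies between 0 and r = t + d in the order and has norm at most r.\<close>
  define z where "z = ?p \<oplus> sc t"
  define v where "v = ?q \<oplus> sc t"
  have z: "sa z" unfolding z_def by (intro sa_add sp sa_sc)
  have v: "sa v" unfolding v_def by (intro sa_add sq sa_sc)
  note [simp] = sa_closed[OF z] sa_closed[OF v]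
  define r where "r = t + d"
  have r: "r \<ge> 0" using t d by (simp add: r_def)
  have "pos (sc t \<ominus> (\<ominus> ?q))"
    by (rule pos_norm_minus) (simp_all add: sa_def star_neg star_mult t_def)
  then have "pos v" by (simp add: v_def a_minus_def vadd_ac)
  moreover have "sc r \<ominus> v = sc d \<ominus> ?q"
    unfolding r_def v_def sc_add[symmetric]
    using sa_closed[OF sq] sc_closed[of t] sc_closed[of d] by algebra
  ultimately have nv: "cnorm A v \<le> r" using q r by (intro pos_le_norm) auto
  have zy: "z [^] n \<otimes> y = y \<otimes> v [^] n" for n :: nat
  proof (induction n)
    case (Suc n)
    have "z \<otimes> y = y \<otimes> v"
      by (simp add: z_def v_def mult_l_distr mult_r_distr mult_assoc sc_commute)
    then have "z [^] Suc n \<otimes> y = (z [^] n \<otimes> y) \<otimes> v" by (simp add: mult_assoc)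
    then show ?case using Suc by (simp add: mult_assoc)
  qed simp
  define C where "C = (cnorm A y)\<^sup>2"
  have C: "C \<ge> 0" by (simp add: C_def)
  define Z where "Z = cnorm A z"
  have Z: "Z \<ge> 0" by (simp add: Z_def)
  have zp: "cnorm A (z [^] n \<otimes> ?p) \<le> C * r ^ n" for n :: nat
  proof -
    have "z [^] n \<otimes> ?p = y \<otimes> v [^] n \<otimes> star A y" by (simp add: zy flip: mult_assoc)
    then have "cnorm A (z [^] n \<otimes> ?p) \<le> cnorm A (y \<otimes> v [^] n) * cnorm A (star A y)"
      using cnorm_mult[of "y \<otimes> v [^] n" "star A y"] by simp
    also have "\<dots> \<le> (cnorm A y * cnorm A v ^ n) * cnorm A y"
      by (simp, intro mult_right_mono order_trans[OF cnorm_mult] mult_left_mono cnorm_pow_le) auto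
    also have "\<dots> \<le> (cnorm A y * r ^ n) * cnorm A y"
      using nv by (intro mult_right_mono mult_left_mono power_mono) auto
    finally show ?thesis by (simp add: C_def power2_eq_square mult_ac)
  qed
  \<comment> \<open>One factor z = y y^* + t is split off the power 2^k. The summand with y y^* is
    bounded through v, hence by powers of r. If Z > r, dividing by the power 2^k - 1 of Z and
    letting k grow gives Z \<le> t, which contradicts t \<le> r.\<close>
  have step: "Z ^ (2 ^ k) \<le> C * r ^ (2 ^ k - 1) + t * Z ^ (2 ^ k - 1)" for k :: nat
  proof -
    define n :: nat where "n = 2 ^ k - 1"
    have n: "Suc n = 2 ^ k" by (simp add: n_def)
    have "Z ^ (2 ^ k) = cnorm A (z [^] Suc n)" unfolding n Z_def using cnorm_sa_pow[OF z] by simp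
    also have "z [^] Suc n = z [^] n \<otimes> ?p \<oplus> complex_of_real t \<odot> z [^] n"
    proof -
      have "z [^] n \<otimes> (?p \<oplus> sc t) = z [^] n \<otimes> ?p \<oplus> complex_of_real t \<odot> z [^] n"
        by (simp add: mult_r_distr sc_mult_right)
      then show ?thesis by (simp flip: z_def)
    qed
    also have "cnorm A \<dots> \<le> C * r ^ n + t * Z ^ n"
    proof (rule order_trans[OF N_add])
      have "t * cnorm A (z [^] n) \<le> t * Z ^ n"
        using t cnorm_pow_le[of z n] by (intro mult_left_mono) (auto simp: Z_def)
      then show "cnorm A (z [^] n \<otimes> ?p) + cnorm A (complex_of_real t \<odot> z [^] n) \<le> C * r ^ n + t * Z ^ n"
        using zp[of n] t by (simp add: N_smult)
    qed auto
    finally show ?thesis by (simp add: n_def)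
  qed
  have "Z \<le> r"
  proof (rule ccontr)
    assume "\<not> Z \<le> r"
    then have Zr: "r < Z" by simp
    then have Z0: "Z > 0" using r by simp
    have le: "Z \<le> C * (r / Z) ^ (2 ^ k - 1) + t" for k :: nat
    proof -
      define n :: nat where "n = 2 ^ k - 1"
      have n: "2 ^ k = Suc n" by (simp add: n_def)
      have "Z * Z ^ n \<le> C * r ^ n + t * Z ^ n" using step[of k] by (simp add: n)
      then have "Z * Z ^ n / Z ^ n \<le> (C * r ^ n + t * Z ^ n) / Z ^ n"
        using Z0 by (intro divide_right_mono) auto
      then show ?thesis using Z0 by (simp add: add_divide_distrib power_divide n_def)
    qed
    have "(\<lambda>k. (r / Z) ^ (2 ^ k - 1 :: nat)) \<longlonglongrightarrow> 0"
    proof -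
      have "strict_mono (\<lambda>k. 2 ^ k - 1 :: nat)"
        by (rule strict_monoI) (simp add: diff_less_mono)
      then have "((\<lambda>n. (r / Z) ^ n) \<circ> (\<lambda>k. 2 ^ k - 1 :: nat)) \<longlonglongrightarrow> 0"
        using Zr r by (intro LIMSEQ_subseq_LIMSEQ LIMSEQ_power_zero) auto
      then show ?thesis by (simp add: o_def)
    qed
    then have "(\<lambda>k. C * (r / Z) ^ (2 ^ k - 1 :: nat) + t) \<longlonglongrightarrow> C * 0 + t"
      by (intro tendsto_intros)
    then have "Z \<le> C * 0 + t" using le by (intro LIMSEQ_le_const) auto
    then show False using Zr d by (simp add: r_def)
  qed
  \<comment> \<open>Subtracting t from z \<le> t + d leaves y y^* \<le> d. Together with y y^* + d
    \<ge> 0 this bounds the norm of y y^* + d by 2d and that of y y^* by 3d.\<close>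
  then have "pos (sc r \<ominus> z)" unfolding Z_def by (intro pos_norm_minus z)
  moreover have "sc r \<ominus> z = sc (2 * d) \<ominus> (?p \<oplus> sc d)"
  proof -
    have "sc (2 * d) = sc d \<oplus> sc d" by (simp add: sc_add)
    then show ?thesis
      unfolding r_def z_def sc_add[of t d, symmetric] \<open>sc (2 * d) = sc d \<oplus> sc d\<close>
      using y star_closed[OF y] sc_closed[of t] sc_closed[of d] by algebra
  qed
  ultimately have "cnorm A (?p \<oplus> sc d) \<le> 2 * d" using p d by (intro pos_le_norm) auto
  moreover have "?p = (?p \<oplus> sc d) \<ominus> sc d" using sa_closed[OF sp] sc_closed[of d] by algebra
  ultimately have "cnorm A ?p \<le> 2 * d + cnorm A (sc d)"
    using N_minus[of "?p \<oplus> sc d" "sc d"] sa_closed[OF sp] by simp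
  also have "\<dots> \<le> 3 * d" using cnorm_sc[of d] d by simp
  finally show ?thesis using cnorm_mult_star[OF y] by simp
qed

text \<open>Kaplansky's argument.  With \<open>c \<approx> \<bar>h\<bar>\<close> and \<open>s = c - h\<close>, twice the negative part of \<open>h = x\<^sup>* x\<close>,
  the element \<open>y = x f\<close> with \<open>f\<^sup>2 \<approx> s\<^sup>2 / 2\<close> has \<open>y\<^sup>* y \<lesssim> 0\<close>; hence \<open>y\<close> and then \<open>s\<close> are small.\<close>

lemma pos_star_mult:
  assumes x: "x \<in> carrier A"
  shows "pos (star A x \<otimes> x)"
proof -
  define h where "h = star A x \<otimes> x"
  have h: "sa h" using x by (simp add: h_def sa_def star_mult)
  note [simp] = x sa_closed[OF h]
  define K where "K = cnorm A h + 1"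
  have K: "K \<ge> 1" "K > 0" using N_nonneg[OF sa_closed[OF h]] by (simp_all add: K_def add_nonneg_pos del: N_nonneg)
  \<comment> \<open>It suffices to approximate h by positive elements, since these form a closed
    set. All estimates carry a factor e; the constant 20 is 10 times 2, from the bounds 10 e K for
    s^3 and 2 K for s.\<close>
  have approx: "\<exists>c. pos c \<and> cnorm A (c \<ominus> h) ^ 4 \<le> e * (20 * K\<^sup>2)" if e: "0 < e" "e \<le> 1" for e
  proof -
    have hh: "pos (h \<otimes> h)" by (rule pos_square[OF h])
    obtain c where c: "pos c" "c \<otimes> c = h \<otimes> h \<oplus> sc e"
      "\<And>x. \<lbrakk>x \<in> carrier A; x \<otimes> (h \<otimes> h) = (h \<otimes> h) \<otimes> x\<rbrakk> \<Longrightarrow> x \<otimes> c = c \<otimes> x"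
      using pos_sqrt[OF hh e(1)] by blast
    note [simp] = pos_closed'[OF c(1)]
    have hc: "h \<otimes> c = c \<otimes> h" by (rule c(3)) (simp_all add: mult_assoc)
    have nc: "cnorm A c \<le> K"
    proof (rule power2_le_imp_le)
      have "(cnorm A c)\<^sup>2 \<le> cnorm A (h \<otimes> h) + cnorm A (sc e)"
        using cnorm_sa_square[OF pos_sa[OF c(1)]] N_add[of "h \<otimes> h" "sc e"] c(2) by simp
      also have "\<dots> \<le> (cnorm A h)\<^sup>2 + 1"
        using cnorm_sa_square[OF h] cnorm_sc[of e] e by simp
      also have "\<dots> \<le> K\<^sup>2" using N_nonneg[OF sa_closed[OF h]] by (simp add: K_def power2_eq_square algebra_simps del: N_nonneg)
      finally show "(cnorm A c)\<^sup>2 \<le> K\<^sup>2" .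
    qed (use K in simp)
    define s where "s = c \<ominus> h"
    have s: "sa s" unfolding s_def by (intro sa_minus h pos_sa c)
    note [simp] = sa_closed[OF s]
    have sc': "s \<otimes> c = c \<otimes> s" by (simp add: s_def mult_minus_left mult_minus_right hc)
    have hs: "h \<otimes> s = s \<otimes> h" by (simp add: s_def mult_minus_left mult_minus_right hc)
    have ns: "cnorm A s \<le> 2 * K"
      using N_minus[of c h] nc by (simp add: s_def K_def)
    define w where "w = complex_of_real (1/2) \<odot> (s \<otimes> s)"
    have w: "pos w" unfolding w_def by (intro pos_smult pos_square s) simp
    note [simp] = pos_closed'[OF w]
    have ww: "w \<oplus> w = s \<otimes> s" using smult_add_left[of "s \<otimes> s" "1/2" "1/2"] by (simp add: w_def)
    have "e / 2 > 0" using e by simp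
    then obtain f where f: "pos f" "f \<otimes> f = w \<oplus> sc (e / 2)"
      "\<And>x. \<lbrakk>x \<in> carrier A; x \<otimes> w = w \<otimes> x\<rbrakk> \<Longrightarrow> x \<otimes> f = f \<otimes> x"
      using pos_sqrt[OF w] by blast
    note [simp] = pos_closed'[OF f(1)]
    have hss: "h \<otimes> (s \<otimes> s) = (s \<otimes> s) \<otimes> h" by (rule commute_mult) (simp_all add: hs)
    have hf: "h \<otimes> f = f \<otimes> h"
      by (rule f(3)) (simp_all add: w_def smult_mult_left smult_mult_right hss)
    define y where "y = x \<otimes> f"
    have y [simp]: "y \<in> carrier A" by (simp add: y_def)
    define q where "q = star A y \<otimes> y"
    have q [simp]: "q \<in> carrier A" by (simp add: q_def)
    have ee: "sc e = c \<otimes> c \<ominus> h \<otimes> h"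
      unfolding c(2) using sa_closed[OF h] sc_closed[of e] by algebra
    \<comment> \<open>Since f^2 = (s^2 + e) / 2 and h commutes with f, one has 2 y^* y = h(s^2 + e).
      Inserting e = c^2 - h^2 and s = c - h turns this into e c - c s^2.\<close>
    have qq: "q \<oplus> q = sc e \<otimes> c \<ominus> c \<otimes> (s \<otimes> s)"
    proof -
      have "q = f \<otimes> (h \<otimes> f)"
        using sa_star[OF pos_sa[OF f(1)]] by (simp add: q_def y_def star_mult h_def mult_assoc)
      also have "\<dots> = (f \<otimes> f) \<otimes> h" by (simp add: hf mult_assoc)
      also have "\<dots> = h \<otimes> (f \<otimes> f)" by (rule commute_mult[symmetric]) (simp_all add: hf)
      also have "\<dots> = h \<otimes> (w \<oplus> sc (e / 2))" unfolding f(2) ..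
      finally have "q \<oplus> q = h \<otimes> (s \<otimes> s \<oplus> sc e)"
        by (simp add: ww[symmetric] sc_add[of "e/2" "e/2", simplified, symmetric] mult_r_distr vadd_ac)
      also have "\<dots> = (c \<otimes> c \<ominus> h \<otimes> h) \<otimes> c \<ominus> c \<otimes> (s \<otimes> s)"
      proof -
        have "h \<otimes> (c \<otimes> c) = c \<otimes> (c \<otimes> h)" "h \<otimes> (c \<otimes> h) = c \<otimes> (h \<otimes> h)"
          by (simp_all add: hc flip: mult_assoc) (simp add: hc mult_assoc)
        then show ?thesis
          unfolding ee unfolding s_def
          using sa_closed[OF h] pos_closed'[OF c(1)] hc by algebra
      qed
      finally show ?thesis unfolding ee .
    qed
    \<comment> \<open>From c \<le> K and c s^2 \<ge> 0 follows 2q \<le> e K, whence the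
      constant.\<close>
    define d where "d = e * K / 2"
    have d: "d \<ge> 0" using e K by (simp add: d_def)
    have css: "pos (c \<otimes> (s \<otimes> s))"
      by (intro pos_mult c pos_square s) (simp add: commute_mult sc')
    have pq: "pos (sc d \<ominus> q)"
    proof -
      have "pos (complex_of_real e \<odot> (sc K \<ominus> c) \<oplus> c \<otimes> (s \<otimes> s))"
        using e by (intro pos_add pos_smult pos_norm_minus pos_sa[OF c(1)] nc css) auto
      also have "complex_of_real e \<odot> (sc K \<ominus> c) = sc e \<otimes> sc K \<ominus> sc e \<otimes> c"
        by (simp add: sc_mult_left smult_minus_right)
      also have "sc e \<otimes> sc K \<ominus> sc e \<otimes> c \<oplus> c \<otimes> (s \<otimes> s) = sc e \<otimes> sc K \<ominus> (q \<oplus> q)"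
        unfolding qq using sc_closed[of e] sc_closed[of K] pos_closed'[OF c(1)] sa_closed[OF s] by algebra
      also have "sc e \<otimes> sc K = sc d \<oplus> sc d" by (simp add: sc_mult sc_add d_def mult.commute)
      also have "sc d \<oplus> sc d \<ominus> (q \<oplus> q) = (sc d \<ominus> q) \<oplus> (sc d \<ominus> q)" by (simp add: minus_minus_swap)
      also have "\<dots> = complex_of_real 2 \<odot> (sc d \<ominus> q)" using smult_add_left[of "sc d \<ominus> q" 1 1] by simp
      finally have "pos (complex_of_real (1/2) \<odot> (complex_of_real 2 \<odot> (sc d \<ominus> q)))"
        by (rule pos_smult) simp
      then show ?thesis by (simp add: smult_smult)
    qed
    define p where "p = y \<otimes> star A y"
    have p [simp]: "p \<in> carrier A" by (simp add: p_def)
    \<comment> \<open>In terms of real and imaginary parts, u^2 + v^2 = 2(p + q). It follows that p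
      + d = (p + q) + (d - q) is positive, which \<open>pos_swap_bound\<close> requires.\<close>
    have "pos (p \<oplus> q)"
    proof -
      define u where "u = y \<oplus> star A y"
      define v where "v = \<i> \<odot> (y \<ominus> star A y)"
      have u: "sa u" by (simp add: u_def sa_def star_add vadd_ac)
      have v: "sa v"
        by (simp add: v_def sa_def star_smult star_minus smult_neg_left smult_neg_right neg_minus
            flip: smult_neg_right)
      have vv: "v \<otimes> v = \<ominus> ((y \<ominus> star A y) \<otimes> (y \<ominus> star A y))"
        by (simp add: v_def smult_mult_left smult_mult_right smult_smult neg_eq_smult)
      have "pos (u \<otimes> u \<oplus> v \<otimes> v)" by (intro pos_add pos_square u v)
      also have "u \<otimes> u \<oplus> v \<otimes> v = (p \<oplus> q) \<oplus> (p \<oplus> q)"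
        unfolding vv u_def p_def q_def using y star_closed[OF y] by algebra
      also have "\<dots> = complex_of_real 2 \<odot> (p \<oplus> q)" using smult_add_left[of "p \<oplus> q" 1 1] by simp
      finally have "pos (complex_of_real (1/2) \<odot> (complex_of_real 2 \<odot> (p \<oplus> q)))"
        by (rule pos_smult) simp
      then show ?thesis by (simp add: smult_smult)
    qed
    then have "pos ((p \<oplus> q) \<oplus> (sc d \<ominus> q))" using pq by (rule pos_add)
    also have "(p \<oplus> q) \<oplus> (sc d \<ominus> q) = p \<oplus> sc d" using p q sc_closed[of d] by algebra
    finally have "(cnorm A y)\<^sup>2 \<le> 3 * d"
      using pq unfolding p_def q_def by (intro pos_swap_bound[OF y d])
    then have nq: "cnorm A q \<le> 3 * d" by (simp add: q_def cnorm_star)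
    have "c \<otimes> (s \<otimes> s) = sc e \<otimes> c \<ominus> (q \<oplus> q)"
      unfolding qq using sc_closed[of e] pos_closed'[OF c(1)] sa_closed[OF s] by algebra
    then have "cnorm A (c \<otimes> (s \<otimes> s)) \<le> cnorm A (sc e \<otimes> c) + (cnorm A q + cnorm A q)"
      using order_trans[OF N_minus[of "sc e \<otimes> c" "q \<oplus> q"] add_left_mono[OF N_add[of q q]]] by simp
    also have "\<dots> \<le> e * K + (3 * d + 3 * d)"
      using e nc nq by (intro add_mono) (auto simp: sc_mult_left N_smult)
    finally have ncss: "cnorm A (c \<otimes> (s \<otimes> s)) \<le> 4 * e * K" by (simp add: d_def mult_ac)
    \<comment> \<open>The relation 2 c s = s^2 + e expresses s^3 by c s^2, which is already small:
      its bound 4 e K is e K from e c plus 6 d from 2q.\<close>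
    have sss: "s \<otimes> (s \<otimes> s) = c \<otimes> (s \<otimes> s) \<oplus> c \<otimes> (s \<otimes> s) \<ominus> sc e \<otimes> s"
    proof -
      have cs2: "c \<otimes> s \<oplus> c \<otimes> s = s \<otimes> s \<oplus> sc e"
        unfolding ee unfolding s_def
        using sa_closed[OF h] pos_closed'[OF c(1)] hc by algebra
      have "c \<otimes> (s \<otimes> s) = s \<otimes> (c \<otimes> s)"
        by (simp add: sc' flip: mult_assoc)
      then have "c \<otimes> (s \<otimes> s) \<oplus> c \<otimes> (s \<otimes> s) = s \<otimes> (c \<otimes> s \<oplus> c \<otimes> s)" by (simp add: mult_r_distr)
      also have "\<dots> = s \<otimes> (s \<otimes> s) \<oplus> sc e \<otimes> s" unfolding cs2 by (simp add: mult_r_distr sc_commute)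
      finally show ?thesis by (simp add: eq_minus_iff)
    qed
    have "cnorm A (s \<otimes> (s \<otimes> s)) \<le> (cnorm A (c \<otimes> (s \<otimes> s)) + cnorm A (c \<otimes> (s \<otimes> s))) + cnorm A (sc e \<otimes> s)"
      unfolding sss by (intro order_trans[OF N_minus] add_mono N_add) auto
    also have "\<dots> \<le> (4 * e * K + 4 * e * K) + e * (2 * K)"
      using ncss ns e by (intro add_mono) (auto simp: sc_mult_left N_smult)
    finally have nsss: "cnorm A (s \<otimes> (s \<otimes> s)) \<le> 10 * e * K" by (simp add: mult_ac)
    have "cnorm A s ^ 4 = (cnorm A (s \<otimes> s))\<^sup>2"
      unfolding cnorm_sa_square[OF s] by simp
    also have "\<dots> = cnorm A ((s \<otimes> s) \<otimes> (s \<otimes> s))"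
      using cnorm_sa_square[OF pos_sa[OF pos_square[OF s]]] by simp
    also have "(s \<otimes> s) \<otimes> (s \<otimes> s) = (s \<otimes> (s \<otimes> s)) \<otimes> s" by (simp add: mult_assoc)
    also have "cnorm A \<dots> \<le> cnorm A (s \<otimes> (s \<otimes> s)) * cnorm A s" by (intro cnorm_mult) auto
    also have "\<dots> \<le> (10 * e * K) * (2 * K)" using nsss ns e K by (intro mult_mono) auto
    finally have "cnorm A (c \<ominus> h) ^ 4 \<le> e * (20 * K\<^sup>2)"
      by (simp add: s_def power2_eq_square mult_ac)
    then show ?thesis using c(1) by blast
  qed
  define e where "e n = 1 / real (Suc n)" for n
  have e: "0 < e n" "e n \<le> 1" for n by (simp_all add: e_def)
  have e0: "e \<longlonglongrightarrow> 0" unfolding e_def using LIMSEQ_inverse_real_of_nat by (simp add: inverse_eq_divide)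
  obtain c where c: "\<And>n. pos (c n)" "\<And>n. cnorm A (c n \<ominus> h) ^ 4 \<le> e n * (20 * K\<^sup>2)"
    using approx[OF e] by metis
  have "nlim c h"
  proof (rule nlimI)
    have "(\<lambda>n. root 4 (e n * (20 * K\<^sup>2))) \<longlonglongrightarrow> root 4 (0 * (20 * K\<^sup>2))"
      by (intro tendsto_intros e0)
    then show "(\<lambda>n. root 4 (e n * (20 * K\<^sup>2))) \<longlonglongrightarrow> 0" by simp
    show "cnorm A (c n \<ominus> h) \<le> root 4 (e n * (20 * K\<^sup>2))" for n
    proof -
      have "root 4 (cnorm A (c n \<ominus> h) ^ 4) \<le> root 4 (e n * (20 * K\<^sup>2))"
        using c(2)[of n] by simp
      then show ?thesis using pos_closed'[OF c(1)[of n]] by (simp add: real_root_power_cancel)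
    qed
  qed (use c in auto)
  then show ?thesis using pos_limit[OF c(1)] by (simp add: h_def)
qed

text \<open>If v + e is the square of a self-adjoint f, conjugating it by a gives the adjoint of f a
  times f a, which is positive by \<open>pos_star_mult\<close>; then e tends to 0.\<close>

lemma pos_conj:
  assumes v: "pos v" and a: "a \<in> carrier A"
  shows "pos (star A a \<otimes> v \<otimes> a)"
proof -
  note [simp] = pos_closed'[OF v] a
  define e where "e n = 1 / real (Suc n)" for n
  have e: "0 < e n" for n by (simp add: e_def)
  have e0: "e \<longlonglongrightarrow> 0" unfolding e_def using LIMSEQ_inverse_real_of_nat by (simp add: inverse_eq_divide)
  have lim: "nlim (\<lambda>n. v \<oplus> sc (e n)) v"
  proof (rule nlimI)
    have "v \<oplus> sc (e n) \<ominus> v = sc (e n)" for n using pos_closed'[OF v] sc_closed[of "e n"] by algebra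
    then show "cnorm A (v \<oplus> sc (e n) \<ominus> v) \<le> e n" for n using cnorm_sc[of "e n"] e[of n] by simp
  qed (use e0 in auto)
  show ?thesis
  proof (rule pos_limit)
    show "nlim (\<lambda>n. star A a \<otimes> (v \<oplus> sc (e n)) \<otimes> a) (star A a \<otimes> v \<otimes> a)"
      by (intro nlim_mult nlim_const lim) auto
    fix n
    obtain f where f: "pos f" "f \<otimes> f = v \<oplus> sc (e n)" using pos_sqrt[OF v e] by blast
    note [simp] = pos_closed'[OF f(1)]
    have "pos (star A (f \<otimes> a) \<otimes> (f \<otimes> a))" by (intro pos_star_mult) auto
    also have "star A (f \<otimes> a) \<otimes> (f \<otimes> a) = star A a \<otimes> (f \<otimes> f) \<otimes> a"
      using sa_star[OF pos_sa[OF f(1)]] by (simp add: star_mult mult_assoc)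
    finally show "pos (star A a \<otimes> (v \<oplus> sc (e n)) \<otimes> a)" unfolding f(2) .
  qed
qed

end

lemma (in unital_cstar) pos_norm_mono:
  assumes "pos p" "pos q"
  shows "cnorm A p \<le> cnorm A (p \<oplus> q)"
proof (rule pos_le_norm[OF assms(1)])
  note [simp] = pos_closed'[OF assms(1)] pos_closed'[OF assms(2)]
  have "pos ((sc (cnorm A (p \<oplus> q)) \<ominus> (p \<oplus> q)) \<oplus> q)"
    by (intro pos_add[OF _ assms(2)] pos_norm_minus pos_sa pos_add assms order_refl)
  also have "(sc (cnorm A (p \<oplus> q)) \<ominus> (p \<oplus> q)) \<oplus> q = sc (cnorm A (p \<oplus> q)) \<ominus> p"
    using pos_closed'[OF assms(1)] pos_closed'[OF assms(2)] sc_closed[of "cnorm A (p \<oplus> q)"] by algebra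
  finally show "pos (sc (cnorm A (p \<oplus> q)) \<ominus> p)" .
qed (use assms in \<open>simp add: pos_closed'\<close>)

section \<open>A C*-algebra as a Hilbert module over itself\<close>

lemma alg_corr_simps [simp]:
  "carrier (alg_corr A) = carrier A" "zero (alg_corr A) = zero A" "add (alg_corr A) = add A"
  "smult (alg_corr A) = smult A" "ract (alg_corr A) = monoid.mult A"
  "hinner (alg_corr A) = (\<lambda>a b. star A a \<otimes>\<^bsub>A\<^esub> b)" "lact (alg_corr A) = monoid.mult A"
  by (simp_all add: alg_corr_def)

lemma alg_corr_a_minus [simp]: "a_minus (alg_corr A) = a_minus A"
proof -
  have "a_inv (alg_corr A) = a_inv A"
    by (simp add: a_inv_def m_inv_def Units_def fun_eq_iff alg_corr_def)
  then show ?thesis by (simp add: a_minus_def fun_eq_iff)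
qed

context cstar_algebra
begin

lemma hnorm_alg_corr [simp]: "x \<in> carrier A \<Longrightarrow> hnorm A (alg_corr A) x = cnorm A x"
  by (simp add: hnorm_def cnorm_star)

lemma cvs_alg_corr: "cvs (alg_corr A)"
proof (intro cvs.intro Module.moduleI cring_complex_ring)
  show "abelian_group (alg_corr A)"
  proof (rule abelian_groupI)
    fix x assume x: "x \<in> carrier (alg_corr A)"
    then show "\<exists>y\<in>carrier (alg_corr A). y \<oplus>\<^bsub>alg_corr A\<^esub> x = \<zero>\<^bsub>alg_corr A\<^esub>"
      by (intro bexI[of _ "\<ominus> x"]) (auto simp: l_neg)
  qed (auto simp: vadd_ac)
qed (auto simp: smult_add_left smult_add_right smult_smult)

lemma norm_dist_alg_corr: "norm_dist (alg_corr A) (hnorm A (alg_corr A)) = norm_dist A (cnorm A)"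
  by (auto simp: norm_dist_def fun_eq_iff)

lemma norm_closure_alg_corr [simp]:
  "norm_closure (alg_corr A) (hnorm A (alg_corr A)) = norm_closure A (cnorm A)"
  unfolding norm_closure_def norm_dist_alg_corr by simp

lemma hilbert_alg_corr: "hilbert_module A (alg_corr A)"
proof (intro hilbert_module.intro hilbert_module_axioms.intro)
  show "cstar_algebra A" by (rule cstar_algebra_axioms)
  show "Module.module complex_ring (alg_corr A)" using cvs_alg_corr by (simp add: cvs_def)
  show "norm_complete (alg_corr A) (hnorm A (alg_corr A))"
    using complete unfolding norm_complete_def norm_dist_alg_corr by simp
qed (auto simp: mult_l_distr mult_r_distr smult_mult_left smult_mult_right mult_assoc star_mult
    star_mult_self_eq_0)

lemma hilbert_cs_alg_corr: "hilbert_module_cs A (alg_corr A)"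
proof -
  interpret R: hilbert_module A "alg_corr A" by (rule hilbert_alg_corr)
  show ?thesis
  proof
    fix x y assume "x \<in> carrier (alg_corr A)" "y \<in> carrier (alg_corr A)"
    then show "cnorm A (hinner (alg_corr A) x y) \<le> hnorm A (alg_corr A) x * hnorm A (alg_corr A) y"
      using cnorm_mult[of "star A x" y] by simp
  qed
qed

end

context hilbert_module_cs
begin

lemma adj_unital: "unital_cstar \<L>"
proof -
  interpret L: cstar_algebra \<L> by (rule adj_cstar_algebra)
  show ?thesis
  proof
    fix T assume T: "T \<in> carrier \<L>"
    show "\<one>\<^bsub>\<L>\<^esub> \<otimes>\<^bsub>\<L>\<^esub> T = T" "T \<otimes>\<^bsub>\<L>\<^esub> \<one>\<^bsub>\<L>\<^esub> = T"
      using T adj_one_closed adj_closed[OF T] by (intro adj_eqI adj_ops_closed; simp)+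
  qed (rule adj_one_closed)
qed

end

section \<open>Consequences of positivity\<close>

context cstar_algebra
begin

abbreviation "LA \<equiv> adjointable_ops A (alg_corr A)"

text \<open>The left regular representation. It is isometric, as one sees by applying it to the
  adjoint of a, and so places the algebra, with or without unit, inside the unital algebra
  \<open>LA\<close>. It does the duty of a unitization.\<close>

definition emb :: "'a \<Rightarrow> 'a \<Rightarrow> 'a" where "emb a = (\<lambda>x\<in>carrier A. a \<otimes> x)"

lemma emb:
  assumes a: "a \<in> carrier A"
  shows emb_closed: "emb a \<in> carrier LA" and emb_star: "star LA (emb a) = emb (star A a)"
    and emb_norm: "cnorm LA (emb a) = cnorm A a"
proof -
  interpret R: hilbert_module_cs A "alg_corr A" by (rule hilbert_cs_alg_corr)
  show c: "emb a \<in> carrier LA" and s: "star LA (emb a) = emb (star A a)"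
    unfolding emb_def
    by (rule R.adj_memI[of "\<lambda>x. a \<otimes> x" "\<lambda>x. star A a \<otimes> x", simplified];
        use a in \<open>simp add: star_mult mult_assoc\<close>)+
  show "cnorm LA (emb a) = cnorm A a"
  proof (rule antisym)
    show "cnorm LA (emb a) \<le> cnorm A a"
    proof (rule R.adj_opnorm_le)
      fix x assume x: "x \<in> carrier (alg_corr A)" "hnorm A (alg_corr A) x \<le> 1"
      then show "hnorm A (alg_corr A) (emb a x) \<le> cnorm A a"
        using a cnorm_mult[of a x] mult_left_mono[of "cnorm A x" 1 "cnorm A a"] by (simp add: emb_def)
    qed
    show "cnorm A a \<le> cnorm LA (emb a)"
    proof (cases "cnorm A a = 0")
      case True
      then show ?thesis using R.adj_opnorm_nonneg[OF c] by simp
    next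
      case False
      have "(cnorm A a)\<^sup>2 \<le> cnorm LA (emb a) * cnorm A a"
        using R.adj_norm_apply[OF c, of "star A a"] a by (simp add: emb_def cnorm_mult_star)
      then show ?thesis
        using False N_nonneg[OF a] by (simp add: power2_eq_square del: N_nonneg)
    qed
  qed
qed

lemma emb_hom:
  assumes a: "a \<in> carrier A" and b: "b \<in> carrier A"
  shows emb_add: "emb (a \<oplus> b) = emb a \<oplus>\<^bsub>LA\<^esub> emb b"
    and emb_mult: "emb (a \<otimes> b) = emb a \<otimes>\<^bsub>LA\<^esub> emb b"
    and emb_minus: "emb (a \<ominus> b) = emb a \<ominus>\<^bsub>LA\<^esub> emb b"
proof -
  interpret R: hilbert_module_cs A "alg_corr A" by (rule hilbert_cs_alg_corr)
  show "emb (a \<oplus> b) = emb a \<oplus>\<^bsub>LA\<^esub> emb b"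
    using a b by (auto simp: emb_def R.adj_simps fun_eq_iff mult_l_distr)
  show "emb (a \<otimes> b) = emb a \<otimes>\<^bsub>LA\<^esub> emb b"
    using a b by (auto simp: emb_def R.adj_simps fun_eq_iff compose_def mult_assoc)
  interpret L: unital_cstar LA by (rule R.adj_unital)
  show "emb (a \<ominus> b) = emb a \<ominus>\<^bsub>LA\<^esub> emb b"
  proof (rule R.adj_eqI)
    fix x assume "x \<in> carrier (alg_corr A)"
    then show "emb (a \<ominus> b) x = (emb a \<ominus>\<^bsub>LA\<^esub> emb b) x"
      using a b R.adj_minus_apply[OF emb_closed[OF a] emb_closed[OF b], of x]
      by (simp add: emb_def mult_minus_left)
  qed (use a b in \<open>simp_all add: emb_closed\<close>)
qed

text \<open>In \<open>LA\<close> the equation reads (1 - b)^2 = 1 - k^2, so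
  \<open>unitary_bound\<close> applies to k and 1 - b. Written without a unit, the relation between
  k and b is preserved by every homomorphism.\<close>

lemma cnorm_le_1I:
  assumes k: "k \<in> carrier A" "star A k = k" and b: "b \<in> carrier A" "star A b = b"
    and kb: "k \<otimes> b = b \<otimes> k" and eq: "b \<oplus> b = k \<otimes> k \<oplus> b \<otimes> b"
  shows "cnorm A k \<le> 1"
proof -
  interpret R: hilbert_module_cs A "alg_corr A" by (rule hilbert_cs_alg_corr)
  interpret L: unital_cstar LA by (rule R.adj_unital)
  note [simp] = k b emb_closed[OF k(1)] emb_closed[OF b(1)]
  let ?k = "emb k" and ?b = "emb b"
  have "cnorm LA ?k \<le> 1"
  proof (rule L.unitary_bound)
    show "L.sa ?k" by (simp add: L.sa_def emb_star)
    show "L.sa (\<one>\<^bsub>LA\<^esub> \<ominus>\<^bsub>LA\<^esub> ?b)"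
      using L.sa_minus[OF L.sa_sc[of 1], of ?b] by (simp add: L.sa_def emb_star)
    show "?k \<otimes>\<^bsub>LA\<^esub> (\<one>\<^bsub>LA\<^esub> \<ominus>\<^bsub>LA\<^esub> ?b) = (\<one>\<^bsub>LA\<^esub> \<ominus>\<^bsub>LA\<^esub> ?b) \<otimes>\<^bsub>LA\<^esub> ?k"
      by (simp add: L.mult_minus_left L.mult_minus_right kb flip: emb_mult)
    have e: "?k \<otimes>\<^bsub>LA\<^esub> ?k = (?b \<oplus>\<^bsub>LA\<^esub> ?b) \<ominus>\<^bsub>LA\<^esub> ?b \<otimes>\<^bsub>LA\<^esub> ?b"
      unfolding L.eq_minus_iff[OF L.mult_closed L.vadd_closed L.mult_closed, OF emb_closed[OF k(1)] emb_closed[OF k(1)]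
        emb_closed[OF b(1)] emb_closed[OF b(1)] emb_closed[OF b(1)] emb_closed[OF b(1)]]
      by (simp add: eq flip: emb_mult emb_add)
    have "(\<one>\<^bsub>LA\<^esub> \<ominus>\<^bsub>LA\<^esub> ?b) \<otimes>\<^bsub>LA\<^esub> (\<one>\<^bsub>LA\<^esub> \<ominus>\<^bsub>LA\<^esub> ?b) = \<one>\<^bsub>LA\<^esub> \<ominus>\<^bsub>LA\<^esub> ((?b \<oplus>\<^bsub>LA\<^esub> ?b) \<ominus>\<^bsub>LA\<^esub> ?b \<otimes>\<^bsub>LA\<^esub> ?b)"
      by (simp add: L.mult_minus_left L.mult_minus_right) (use emb_closed[OF b(1)] in algebra)
    then show "?k \<otimes>\<^bsub>LA\<^esub> ?k \<oplus>\<^bsub>LA\<^esub> (\<one>\<^bsub>LA\<^esub> \<ominus>\<^bsub>LA\<^esub> ?b) \<otimes>\<^bsub>LA\<^esub> (\<one>\<^bsub>LA\<^esub> \<ominus>\<^bsub>LA\<^esub> ?b) = \<one>\<^bsub>LA\<^esub>"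
      by (subst L.vadd_ac(1)) (simp_all add: L.diff_add_cancel flip: e)
  qed
  then show ?thesis using emb_norm[OF k(1)] by simp
qed

text \<open>The element is h(1 - h)^2 with 0 \<le> h \<le> 1. Since (h - 1/2)^2 is positive, h(1 -
  h) is at most 1/4, and 1 - h has norm at most 1. The bound 1/4 is the square of the factor 1/2 in
  \<open>ract_half\<close>.\<close>

lemma cnorm_quarter:
  assumes x: "x \<in> carrier A" and h: "h = star A x \<otimes> x" "cnorm A h \<le> 1"
  shows "cnorm A ((h \<ominus> h \<otimes> h) \<ominus> h \<otimes> (h \<ominus> h \<otimes> h)) \<le> 1/4"
proof -
  interpret R: hilbert_module_cs A "alg_corr A" by (rule hilbert_cs_alg_corr)
  interpret L: unital_cstar LA by (rule R.adj_unital)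
  have hc [simp]: "h \<in> carrier A" using x h by simp
  note [simp] = x emb_closed[OF x] emb_closed[OF hc]
  let ?h = "emb h" and ?u = "\<one>\<^bsub>LA\<^esub>"
  have "L.pos (star LA (emb x) \<otimes>\<^bsub>LA\<^esub> emb x)" by (rule L.pos_star_mult) simp
  then have p: "L.pos ?h" by (simp add: h(1) emb_star emb_mult)
  have q: "L.pos (?u \<ominus>\<^bsub>LA\<^esub> ?h)"
    using L.pos_norm_minus[OF L.pos_sa[OF p], of 1] h(2) by (simp add: emb_norm)
  define m where "m = ?h \<otimes>\<^bsub>LA\<^esub> (?u \<ominus>\<^bsub>LA\<^esub> ?h)"
  have m: "L.pos m"
    unfolding m_def by (intro L.pos_mult p q) (simp add: L.mult_minus_left L.mult_minus_right)
  note [simp] = L.pos_closed'[OF m]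
  have "L.pos ((?h \<ominus>\<^bsub>LA\<^esub> L.sc (1/2)) \<otimes>\<^bsub>LA\<^esub> (?h \<ominus>\<^bsub>LA\<^esub> L.sc (1/2)))"
    by (intro L.pos_square L.sa_minus L.sa_sc L.pos_sa[OF p])
  also have "(?h \<ominus>\<^bsub>LA\<^esub> L.sc (1/2)) \<otimes>\<^bsub>LA\<^esub> (?h \<ominus>\<^bsub>LA\<^esub> L.sc (1/2)) = L.sc (1/4) \<ominus>\<^bsub>LA\<^esub> m"
  proof -
    have u: "?u = L.sc (1/2) \<oplus>\<^bsub>LA\<^esub> L.sc (1/2)" by (simp add: L.sc_add)
    have s: "L.sc (1/4) = L.sc (1/2) \<otimes>\<^bsub>LA\<^esub> L.sc (1/2)" by (simp add: L.sc_mult)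
    show ?thesis
      unfolding m_def u s using L.sc_closed[of "1/2"] emb_closed[OF hc] L.sc_commute[OF emb_closed[OF hc], of "1/2"]
      by algebra
  qed
  finally have "cnorm LA m \<le> 1/4" by (intro L.pos_le_norm[OF m]) auto
  moreover have "cnorm LA (?u \<ominus>\<^bsub>LA\<^esub> ?h) \<le> 1"
    using L.pos_norm_le[OF p, of 1] h(2) by (simp add: emb_norm)
  ultimately have "cnorm LA ((?u \<ominus>\<^bsub>LA\<^esub> ?h) \<otimes>\<^bsub>LA\<^esub> m) \<le> 1 * (1/4)"
    by (intro order_trans[OF L.cnorm_mult] mult_mono) auto
  also have "(?u \<ominus>\<^bsub>LA\<^esub> ?h) \<otimes>\<^bsub>LA\<^esub> m = emb ((h \<ominus> h \<otimes> h) \<ominus> h \<otimes> (h \<ominus> h \<otimes> h))"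
    by (simp add: m_def L.mult_minus_left L.mult_minus_right emb_minus emb_mult)
  finally show ?thesis by (simp add: emb_norm)
qed

text \<open>The Cauchy-Schwarz computation inside the algebra: y stands for \<langle>y, y\<rangle>,
  a for \<langle>x, y\<rangle>, c^* c for \<langle>x, x\<rangle> and z^* z for the inner square of x
  a - y. The equation makes y the sum of a^* a, of 1 - c^* c conjugated by a, and of z^* z, all
  positive.\<close>

lemma cnorm_schwarz_aux:
  assumes c: "c \<in> carrier A" "cnorm A c \<le> 1" and z: "z \<in> carrier A" and a: "a \<in> carrier A"
    and y: "y \<in> carrier A"
    and eq: "y \<oplus> star A (c \<otimes> a) \<otimes> (c \<otimes> a) = star A z \<otimes> z \<oplus> (star A a \<otimes> a \<oplus> star A a \<otimes> a)"
  shows "(cnorm A a)\<^sup>2 \<le> cnorm A y"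
proof -
  interpret R: hilbert_module_cs A "alg_corr A" by (rule hilbert_cs_alg_corr)
  interpret L: unital_cstar LA by (rule R.adj_unital)
  note [simp] = c(1) z a y emb_closed[OF c(1)] emb_closed[OF z] emb_closed[OF a] emb_closed[OF y]
  let ?a = "emb a" and ?c = "emb c" and ?z = "emb z" and ?u = "\<one>\<^bsub>LA\<^esub>"
  define p where "p = star LA ?a \<otimes>\<^bsub>LA\<^esub> ?a"
  define r where "r = star LA ?z \<otimes>\<^bsub>LA\<^esub> ?z"
  define q where "q = star LA ?a \<otimes>\<^bsub>LA\<^esub> (?u \<ominus>\<^bsub>LA\<^esub> star LA ?c \<otimes>\<^bsub>LA\<^esub> ?c) \<otimes>\<^bsub>LA\<^esub> ?a"
  have p: "L.pos p" and r: "L.pos r" unfolding p_def r_def by (intro L.pos_star_mult; simp)+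
  have "cnorm LA (star LA ?c \<otimes>\<^bsub>LA\<^esub> ?c) \<le> 1"
    using c by (simp add: L.cnorm_star emb_norm abs_square_le_1)
  then have "L.pos (L.sc 1 \<ominus>\<^bsub>LA\<^esub> star LA ?c \<otimes>\<^bsub>LA\<^esub> ?c)"
    by (intro L.pos_norm_minus L.pos_sa L.pos_star_mult) auto
  then have q: "L.pos q" unfolding q_def by (intro L.pos_conj) auto
  note [simp] = L.pos_closed'[OF p] L.pos_closed'[OF q] L.pos_closed'[OF r]
  define w where "w = star LA (?c \<otimes>\<^bsub>LA\<^esub> ?a) \<otimes>\<^bsub>LA\<^esub> (?c \<otimes>\<^bsub>LA\<^esub> ?a)"
  have w [simp]: "w \<in> carrier LA" by (simp add: w_def)
  have qw: "q = p \<ominus>\<^bsub>LA\<^esub> w"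
    by (simp add: q_def p_def w_def L.mult_minus_left L.mult_minus_right L.star_mult L.mult_assoc)
  have "emb (y \<oplus> star A (c \<otimes> a) \<otimes> (c \<otimes> a)) = emb (star A z \<otimes> z \<oplus> (star A a \<otimes> a \<oplus> star A a \<otimes> a))"
    unfolding eq ..
  then have "emb y \<oplus>\<^bsub>LA\<^esub> w = r \<oplus>\<^bsub>LA\<^esub> (p \<oplus>\<^bsub>LA\<^esub> p)"
    by (simp add: emb_add emb_mult emb_star w_def r_def p_def star_mult L.star_mult)
  then have "emb y = (r \<oplus>\<^bsub>LA\<^esub> (p \<oplus>\<^bsub>LA\<^esub> p)) \<ominus>\<^bsub>LA\<^esub> w" by (simp add: L.eq_minus_iff)
  also have "\<dots> = p \<oplus>\<^bsub>LA\<^esub> (q \<oplus>\<^bsub>LA\<^esub> r)"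
    unfolding qw using L.pos_closed'[OF p] L.pos_closed'[OF r] w by algebra
  finally have "cnorm LA p \<le> cnorm LA (emb y)"
    using L.pos_norm_mono[OF p L.pos_add[OF q r]] by simp
  then show ?thesis by (simp add: p_def L.cnorm_star emb_norm)
qed

end

section \<open>Contractivity of homomorphisms and the Cauchy-Schwarz inequality\<close>

lemma cstar_homD:
  assumes "cstar_hom A B f"
  shows "x \<in> carrier A \<Longrightarrow> f x \<in> carrier B"
    and "\<lbrakk>x \<in> carrier A; y \<in> carrier A\<rbrakk> \<Longrightarrow> f (x \<oplus>\<^bsub>A\<^esub> y) = f x \<oplus>\<^bsub>B\<^esub> f y"
    and "x \<in> carrier A \<Longrightarrow> f (c \<odot>\<^bsub>A\<^esub> x) = c \<odot>\<^bsub>B\<^esub> f x"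
    and "\<lbrakk>x \<in> carrier A; y \<in> carrier A\<rbrakk> \<Longrightarrow> f (x \<otimes>\<^bsub>A\<^esub> y) = f x \<otimes>\<^bsub>B\<^esub> f y"
    and "x \<in> carrier A \<Longrightarrow> f (star A x) = star B (f x)"
  using assms unfolding cstar_hom_def by auto

text \<open>For self-adjoint h of norm below 1, an element b with 2b = h^2 + b^2 exists in A, its
  image satisfies the same equation in B, and \<open>cnorm_le_1I\<close> bounds the image of h.
  Scaling and the C*-identity give the general case.\<close>

lemma cstar_hom_norm:
  assumes A: "cstar_algebra A" and B: "cstar_algebra B" and f: "cstar_hom A B f"
    and x: "x \<in> carrier A"
  shows "cnorm B (f x) \<le> cnorm A x"
proof -
  interpret A: cstar_algebra A by fact
  interpret B: cstar_algebra B by fact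
  note f = cstar_homD[OF f]
  have unit: "cnorm B (f h) \<le> 1" if h: "h \<in> carrier A" "star A h = h" "cnorm A h < 1" for h
  proof -
    have hh: "h \<otimes>\<^bsub>A\<^esub> h \<in> carrier A" "star A (h \<otimes>\<^bsub>A\<^esub> h) = h \<otimes>\<^bsub>A\<^esub> h"
      using h by (simp_all add: A.star_mult)
    have "cnorm A (h \<otimes>\<^bsub>A\<^esub> h) < 1"
      using A.cnorm_star[OF h(1)] h A.N_nonneg[OF h(1)] by (simp add: abs_square_less_1)
    then obtain b where b: "b \<in> carrier A" "star A b = b"
        "b \<oplus>\<^bsub>A\<^esub> b = h \<otimes>\<^bsub>A\<^esub> h \<oplus>\<^bsub>A\<^esub> b \<otimes>\<^bsub>A\<^esub> b"
        "\<forall>x\<in>carrier A. x \<otimes>\<^bsub>A\<^esub> (h \<otimes>\<^bsub>A\<^esub> h) = h \<otimes>\<^bsub>A\<^esub> h \<otimes>\<^bsub>A\<^esub> x \<longrightarrow> x \<otimes>\<^bsub>A\<^esub> b = b \<otimes>\<^bsub>A\<^esub> x"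
      using A.ex_one_minus_sqrt[OF hh] by blast
    have hb: "h \<otimes>\<^bsub>A\<^esub> b = b \<otimes>\<^bsub>A\<^esub> h" using b(4) h(1) A.mult_assoc by simp
    show ?thesis
    proof (rule B.cnorm_le_1I[of _ "f b"])
      show "f b \<oplus>\<^bsub>B\<^esub> f b = f h \<otimes>\<^bsub>B\<^esub> f h \<oplus>\<^bsub>B\<^esub> f b \<otimes>\<^bsub>B\<^esub> f b"
        using arg_cong[OF b(3), of f] h(1) b(1) by (simp add: f)
      show "f h \<otimes>\<^bsub>B\<^esub> f b = f b \<otimes>\<^bsub>B\<^esub> f h" using arg_cong[OF hb, of f] h(1) b(1) by (simp add: f)
      show "star B (f h) = f h" using f(5)[OF h(1)] h(2) by simp
      show "star B (f b) = f b" using f(5)[OF b(1)] b(2) by simp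
    qed (use h b(1,2) in \<open>simp_all add: f\<close>)
  qed
  have sa: "cnorm B (f h) \<le> cnorm A h" if h: "h \<in> carrier A" "star A h = h" for h
  proof (rule field_le_epsilon)
    fix e :: real assume e: "e > 0"
    define R where "R = cnorm A h + e"
    have R: "R > 0" "cnorm A h < R" unfolding R_def using e A.N_nonneg[OF h(1)] by linarith+
    let ?c = "complex_of_real (1 / R)"
    have "cnorm B (f (?c \<odot>\<^bsub>A\<^esub> h)) \<le> 1"
      by (rule unit) (use h R in \<open>auto simp: A.star_smult A.N_smult norm_divide\<close>)
    then show "cnorm B (f h) \<le> cnorm A h + e"
      using h R by (simp add: f B.N_smult norm_divide field_simps) (simp add: R_def)
  qed
  have "(cnorm B (f x))\<^sup>2 = cnorm B (f (star A x \<otimes>\<^bsub>A\<^esub> x))"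
    using x by (simp add: f B.cnorm_star)
  also have "\<dots> \<le> cnorm A (star A x \<otimes>\<^bsub>A\<^esub> x)"
    using x by (intro sa) (simp_all add: A.star_mult)
  also have "\<dots> = (cnorm A x)\<^sup>2" using x by (simp add: A.cnorm_star)
  finally show ?thesis using x by (auto intro: power2_le_imp_le)
qed

lemma (in cvs) cross_cancel:
  assumes "P \<in> carrier M" "Q \<in> carrier M" "S \<in> carrier M"
  shows "(P \<ominus> Q) \<ominus> (Q \<ominus> S) \<oplus> (Q \<oplus> Q) = S \<oplus> P"
proof -
  have "(P \<ominus> Q) \<ominus> (Q \<ominus> S) \<oplus> (Q \<oplus> Q) = (P \<oplus> S) \<oplus> (((\<ominus> Q) \<oplus> Q) \<oplus> ((\<ominus> Q) \<oplus> Q))"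
    using assms by (simp add: a_minus_def minus_add a_ac)
  also have "\<dots> = P \<oplus> S" using assms by (simp add: l_neg)
  finally show ?thesis using assms by (simp add: a_comm)
qed

text \<open>If x has norm at most 1, the inner square of x a - y with a = \<langle>x, y\<rangle> is
  positive and \<open>cnorm_schwarz_aux\<close> applies. Other x are scaled, and an x of norm 0
  vanishes.\<close>

lemma (in hilbert_module) hinner_cauchy_schwarz:
  assumes x: "x \<in> carrier X" and y: "y \<in> carrier X"
  shows "cnorm A (hinner X x y) \<le> hnorm A X x * hnorm A X y"
proof -
  have unit: "cnorm A (hinner X x y) \<le> hnorm A X y"
    if x: "x \<in> carrier X" "hnorm A X x \<le> 1" for x
  proof -
    define a where "a = hinner X x y"
    have a [simp]: "a \<in> carrier A" using x y by (simp add: a_def)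
    obtain c where c: "c \<in> carrier A" "hinner X x x = star A c \<otimes>\<^bsub>A\<^esub> c" using hinner_pos[OF x(1)] by blast
    define w where "w = ract X x a \<ominus>\<^bsub>X\<^esub> y"
    have w: "w \<in> carrier X" using x y by (simp add: w_def)
    obtain z where z: "z \<in> carrier A" "hinner X w w = star A z \<otimes>\<^bsub>A\<^esub> z" using hinner_pos[OF w] by blast
    have yx: "hinner X y x = star A a" using x y by (simp add: a_def hinner_star)
    define P where "P = star A (c \<otimes>\<^bsub>A\<^esub> a) \<otimes>\<^bsub>A\<^esub> (c \<otimes>\<^bsub>A\<^esub> a)"
    define Q where "Q = star A a \<otimes>\<^bsub>A\<^esub> a"
    define S where "S = hinner X y y"
    have PQ: "P \<in> carrier A" "Q \<in> carrier A" "S \<in> carrier A" using c y by (simp_all add: P_def Q_def S_def)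
    have "hinner X w w = (P \<ominus>\<^bsub>A\<^esub> Q) \<ominus>\<^bsub>A\<^esub> (Q \<ominus>\<^bsub>A\<^esub> S)"
      using x y c by (simp add: w_def hinner_minus hinner_minus_left hinner_ract hinner_ract_left yx
          A.mult_minus_left A.mult_assoc A.star_mult P_def Q_def S_def flip: a_def)
    then have "star A z \<otimes>\<^bsub>A\<^esub> z \<oplus>\<^bsub>A\<^esub> (Q \<oplus>\<^bsub>A\<^esub> Q) = (P \<ominus>\<^bsub>A\<^esub> Q) \<ominus>\<^bsub>A\<^esub> (Q \<ominus>\<^bsub>A\<^esub> S) \<oplus>\<^bsub>A\<^esub> (Q \<oplus>\<^bsub>A\<^esub> Q)"
      using z by simp
    also have "\<dots> = S \<oplus>\<^bsub>A\<^esub> P" using PQ by (rule A.cross_cancel)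
    finally have "(cnorm A a)\<^sup>2 \<le> cnorm A S"
      using x c z PQ hnorm_sq[OF x(1)] A.cnorm_star[OF c(1)] hnorm_nonneg[OF x(1)]
      by (intro A.cnorm_schwarz_aux[of c z a S]) (auto simp: P_def Q_def power2_eq_iff_nonneg)
    then have "(cnorm A a)\<^sup>2 \<le> (hnorm A X y)\<^sup>2" using y by (simp add: S_def hnorm_sq)
    then show ?thesis using hnorm_nonneg[OF y] by (auto simp: a_def intro: power2_le_imp_le)
  qed
  show ?thesis
  proof (cases "hnorm A X x = 0")
    case True
    then have "x = \<zero>\<^bsub>X\<^esub>" using x hnorm_zero_iff by blast
    then show ?thesis using y hnorm_zero_iff[of "\<zero>\<^bsub>X\<^esub>"] by simp
  next
    case False
    then have pos: "hnorm A X x > 0" using hnorm_nonneg[OF x] by simp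
    let ?c = "complex_of_real (1 / hnorm A X x)"
    have "cnorm A (hinner X (?c \<odot>\<^bsub>X\<^esub> x) y) \<le> hnorm A X y"
      by (rule unit) (use x pos in \<open>auto simp: hnorm_smult norm_divide\<close>)
    then show ?thesis
      using x y pos by (simp add: hinner_smult_left A.N_smult norm_divide field_simps)
  qed
qed

text \<open>The circle closes: from here on, everything derived from the assumed inequality holds
  for all Hilbert modules.\<close>

sublocale hilbert_module \<subseteq> hilbert_module_cs
  by unfold_locales (rule hinner_cauchy_schwarz)

section \<open>Maps preserving inner products along a homomorphism\<close>

lemma cstar_hom_zero:
  assumes "cstar_algebra A" "cstar_algebra B" "cstar_hom A B f"
  shows "f \<zero>\<^bsub>A\<^esub> = \<zero>\<^bsub>B\<^esub>"
proof -
  interpret A: cstar_algebra A by fact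
  interpret B: cstar_algebra B by fact
  show ?thesis using cstar_homD(3)[OF assms(3), of "\<zero>\<^bsub>A\<^esub>" 0] cstar_homD(1)[OF assms(3), of "\<zero>\<^bsub>A\<^esub>"] by simp
qed

lemma cstar_hom_comp: "\<lbrakk>cstar_hom A B f; cstar_hom B C g\<rbrakk> \<Longrightarrow> cstar_hom A C (g \<circ> f)"
  unfolding cstar_hom_def by (auto simp: Pi_iff)

lemma cstar_hom_id: "cstar_hom A A (\<lambda>x. x)"
  unfolding cstar_hom_def by auto

definition bdd_linear ::
  "(complex, 'v, 'm) module_scheme \<Rightarrow> ('v \<Rightarrow> real) \<Rightarrow> (complex, 'w, 'n) module_scheme \<Rightarrow> ('w \<Rightarrow> real) \<Rightarrow>
    ('v \<Rightarrow> 'w) \<Rightarrow> bool" where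
  "bdd_linear M N M' N' f \<longleftrightarrow>
    f \<in> carrier M \<rightarrow> carrier M' \<and>
    (\<forall>x\<in>carrier M. \<forall>y\<in>carrier M. f (x \<oplus>\<^bsub>M\<^esub> y) = f x \<oplus>\<^bsub>M'\<^esub> f y) \<and>
    (\<forall>c. \<forall>x\<in>carrier M. f (c \<odot>\<^bsub>M\<^esub> x) = c \<odot>\<^bsub>M'\<^esub> f x) \<and>
    (\<exists>C. \<forall>x\<in>carrier M. N' (f x) \<le> C * N x)"

lemma bdd_linearI:
  assumes "\<And>x. x \<in> carrier M \<Longrightarrow> f x \<in> carrier M'"
    and "\<And>x y. \<lbrakk>x \<in> carrier M; y \<in> carrier M\<rbrakk> \<Longrightarrow> f (x \<oplus>\<^bsub>M\<^esub> y) = f x \<oplus>\<^bsub>M'\<^esub> f y"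
    and "\<And>c x. x \<in> carrier M \<Longrightarrow> f (c \<odot>\<^bsub>M\<^esub> x) = c \<odot>\<^bsub>M'\<^esub> f x"
    and "\<And>x. x \<in> carrier M \<Longrightarrow> N' (f x) \<le> C * N x"
  shows "bdd_linear M N M' N' f"
  unfolding bdd_linear_def
  by (intro conjI exI[of _ C] ballI allI funcsetI assms)

lemma bdd_linear_nlim:
  assumes "normed_cvs M N" "normed_cvs M' N'" "bdd_linear M N M' N' f" "normed_cvs.nlim M N \<sigma> x"
  shows "normed_cvs.nlim M' N' (\<lambda>n. f (\<sigma> n)) (f x)"
proof -
  interpret M: normed_cvs M N by fact
  interpret M': normed_cvs M' N' by fact
  note f = assms(3)[unfolded bdd_linear_def]
  obtain C where C: "\<And>x. x \<in> carrier M \<Longrightarrow> N' (f x) \<le> C * N x" using f by blast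
  note l = M.nlimD[OF assms(4)]
  have cl: "\<And>x. x \<in> carrier M \<Longrightarrow> f x \<in> carrier M'" using f by auto
  show ?thesis
  proof (rule M'.nlimI)
    show "N' (f (\<sigma> n) \<ominus>\<^bsub>M'\<^esub> f x) \<le> C * N (\<sigma> n \<ominus>\<^bsub>M\<^esub> x)" for n
    proof -
      have "f (\<sigma> n) \<ominus>\<^bsub>M'\<^esub> f x = f (\<sigma> n \<ominus>\<^bsub>M\<^esub> x)"
        using f l cl by (simp add: M.minus_eq_smult M'.minus_eq_smult)
      then show ?thesis using C[of "\<sigma> n \<ominus>\<^bsub>M\<^esub> x"] l by simp
    qed
    have "(\<lambda>n. C * N (\<sigma> n \<ominus>\<^bsub>M\<^esub> x)) \<longlonglongrightarrow> C * 0" by (intro tendsto_intros l)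
    then show "(\<lambda>n. C * N (\<sigma> n \<ominus>\<^bsub>M\<^esub> x)) \<longlonglongrightarrow> 0" by simp
  qed (use l cl in auto)
qed

lemma bdd_linear_comp:
  assumes f: "bdd_linear M N M' N' f" and g: "bdd_linear M' N' M'' N'' g"
    and "normed_cvs M' N'" "normed_cvs M N"
  shows "bdd_linear M N M'' N'' (\<lambda>x. g (f x))"
proof -
  interpret M: normed_cvs M N by fact
  interpret M': normed_cvs M' N' by fact
  obtain C where C: "\<And>x. x \<in> carrier M \<Longrightarrow> N' (f x) \<le> C * N x" using f unfolding bdd_linear_def by blast
  obtain C' where C': "\<And>x. x \<in> carrier M' \<Longrightarrow> N'' (g x) \<le> C' * N' x" using g unfolding bdd_linear_def by blast
  have fc: "\<And>x. x \<in> carrier M \<Longrightarrow> f x \<in> carrier M'" using f unfolding bdd_linear_def by auto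
  show ?thesis
  proof (rule bdd_linearI)
    fix x assume x: "x \<in> carrier M"
    \<comment> \<open>The constant in \<open>bdd_linear\<close> may have either sign; its absolute
      value keeps the estimate monotone.\<close>
    have "N'' (g (f x)) \<le> \<bar>C'\<bar> * N' (f x)"
      using C'[OF fc[OF x]] mult_right_mono[OF abs_ge_self[of C'] M'.N_nonneg[OF fc[OF x]]] by linarith
    also have "\<dots> \<le> \<bar>C'\<bar> * (C * N x)" using C[OF x] by (intro mult_left_mono) auto
    finally show "N'' (g (f x)) \<le> (\<bar>C'\<bar> * C) * N x" by (simp add: mult.assoc)
  qed (use f g fc in \<open>auto simp: bdd_linear_def\<close>)
qed

lemma bdd_linear_nclspan:
  assumes "normed_cvs M N" "normed_cvs M' N'" "bdd_linear M N M' N' f" and S: "S \<subseteq> carrier M"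
    and H: "\<And>s. s \<in> S \<Longrightarrow> f s \<in> H" "submodule H complex_ring M'" "normed_cvs.nclosed M' N' H"
    and x: "x \<in> normed_cvs.nclspan M N S"
  shows "f x \<in> H"
proof -
  interpret M: normed_cvs M N by fact
  interpret M': normed_cvs M' N' by fact
  note f = assms(3)[unfolded bdd_linear_def] and h = M'.submoduleD[OF H(2)]
  have "f \<zero>\<^bsub>M\<^esub> = \<zero>\<^bsub>M'\<^esub>"
    using f M.M.zero_closed M'.smult_0 M.smult_zero by (metis PiE)
  show ?thesis
    using x
  proof (rule M.nclspan_induct[OF _ S])
    show "f y \<in> H" if "\<And>n. f (\<sigma> n) \<in> H" "M.nlim \<sigma> y" for \<sigma> y
      by (rule M'.nclosedD[OF H(3) that(1) bdd_linear_nlim[OF assms(1-3) that(2)]])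
  qed (use \<open>f \<zero>\<^bsub>M\<^esub> = \<zero>\<^bsub>M'\<^esub>\<close> f h H(1) in auto)
qed

text \<open>The set of agreement is a closed subspace. Uniqueness statements about maps on tensor
  products are reduced to this.\<close>

lemma bdd_linear_agree:
  assumes "normed_cvs M N" "normed_cvs M' N'" "bdd_linear M N M' N' f" "bdd_linear M N M' N' g"
    and S: "S \<subseteq> carrier M" "\<And>s. s \<in> S \<Longrightarrow> f s = g s"
    and x: "x \<in> norm_closure M N (cspan M S)"
  shows "f x = g x"
proof -
  interpret M: normed_cvs M N by fact
  interpret M': normed_cvs M' N' by fact
  note f = assms(3)[unfolded bdd_linear_def] and g = assms(4)[unfolded bdd_linear_def]
  have "0 \<odot>\<^bsub>M\<^esub> \<zero>\<^bsub>M\<^esub> = \<zero>\<^bsub>M\<^esub>" by simp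
  then have z: "f \<zero>\<^bsub>M\<^esub> = \<zero>\<^bsub>M'\<^esub>" "g \<zero>\<^bsub>M\<^esub> = \<zero>\<^bsub>M'\<^esub>"
    using f g M.M.zero_closed M'.smult_0 by (metis PiE)+
  have "x \<in> M.nclspan S" using x by (simp add: M.nclspan_def)
  then have "x \<in> carrier M \<and> f x = g x"
  proof (rule M.nclspan_induct[OF _ S(1)])
    fix \<sigma> x assume \<sigma>: "\<And>n. \<sigma> n \<in> carrier M \<and> f (\<sigma> n) = g (\<sigma> n)" "M.nlim \<sigma> x"
    have "M'.nlim (\<lambda>n. f (\<sigma> n)) (f x)" "M'.nlim (\<lambda>n. g (\<sigma> n)) (g x)"
      by (rule bdd_linear_nlim[OF assms(1,2) _ \<sigma>(2)]; fact)+
    then show "x \<in> carrier M \<and> f x = g x"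
      using \<sigma> M'.nlim_unique M.nlimD(2)[OF \<sigma>(2)] by simp
  qed (use S z f g in auto)
  then show ?thesis ..
qed

section \<open>Approximating a vector by its right multiples\<close>

context hilbert_module
begin

lemma hinner_nlim:
  assumes "X.nlim \<sigma> x" "X.nlim \<tau> y"
  shows "A.nlim (\<lambda>n. hinner X (\<sigma> n) (\<tau> n)) (hinner X x y)"
proof (rule A.nlimI)
  note c = X.nlimD[OF assms(1)] X.nlimD[OF assms(2)]
  let ?b = "\<lambda>n. hnorm A X (\<sigma> n) * hnorm A X (\<tau> n \<ominus>\<^bsub>X\<^esub> y) + hnorm A X (\<sigma> n \<ominus>\<^bsub>X\<^esub> x) * hnorm A X y"
  have "?b \<longlonglongrightarrow> hnorm A X x * 0 + 0 * hnorm A X y"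
    by (intro tendsto_intros c X.nlim_norm assms)
  then show "?b \<longlonglongrightarrow> 0" by simp
  show "cnorm A (hinner X (\<sigma> n) (\<tau> n) \<ominus>\<^bsub>A\<^esub> hinner X x y) \<le> ?b n" for n
  proof -
    have "hinner X (\<sigma> n) (\<tau> n) \<ominus>\<^bsub>A\<^esub> hinner X x y =
        hinner X (\<sigma> n) (\<tau> n \<ominus>\<^bsub>X\<^esub> y) \<oplus>\<^bsub>A\<^esub> hinner X (\<sigma> n \<ominus>\<^bsub>X\<^esub> x) y"
      using c by (simp add: hinner_minus hinner_minus_left A.minus_add_minus)
    then show ?thesis
      using c by (simp del: X.N_nonneg) (intro order_trans[OF A.N_add] add_mono cauchy_schwarz; simp)
  qed
qed (use X.nlimD[OF assms(1)] X.nlimD[OF assms(2)] in auto)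

lemma ract_bdd: "a \<in> carrier A \<Longrightarrow> bdd_linear X (hnorm A X) X (hnorm A X) (\<lambda>x. ract X x a)"
  by (rule bdd_linearI[of _ _ _ _ "cnorm A a"])
    (auto simp: ract_add_left ract_smult_left mult.commute[of "cnorm A a"] hnorm_ract)

text \<open>Take for a the element h such that \<langle>y, y\<rangle> is h times the squared norm of
  y. The inner square of y - y h is the same multiple of h(1 - h)^2, whose norm is at most
  1/4.\<close>

lemma ract_half:
  assumes y: "y \<in> carrier X"
  shows "\<exists>a\<in>carrier A. hnorm A X (y \<ominus>\<^bsub>X\<^esub> ract X y a) \<le> hnorm A X y / 2"
proof (cases "hnorm A X y = 0")
  case True
  then have "y = \<zero>\<^bsub>X\<^esub>" using y hnorm_zero_iff by blast
  then show ?thesis by (intro bexI[of _ "\<zero>\<^bsub>A\<^esub>"]) auto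
next
  case False
  then have n: "hnorm A X y > 0" using hnorm_nonneg[OF y] by simp
  define c where "c = complex_of_real (1 / hnorm A X y)"
  obtain b where b: "b \<in> carrier A" "hinner X y y = star A b \<otimes>\<^bsub>A\<^esub> b" using hinner_pos[OF y] by blast
  define x where "x = c \<odot>\<^bsub>A\<^esub> b"
  define h where "h = star A x \<otimes>\<^bsub>A\<^esub> x"
  have x: "x \<in> carrier A" and h: "h \<in> carrier A" using b by (simp_all add: x_def h_def)
  have hs: "star A h = h" using x by (simp add: h_def A.star_mult)
  have yy: "hinner X y y = complex_of_real ((hnorm A X y)\<^sup>2) \<odot>\<^bsub>A\<^esub> h"
    using b n by (simp add: h_def x_def c_def A.star_smult A.smult_mult_left A.smult_mult_right
        A.smult_smult power2_eq_square)
  have "(hnorm A X y)\<^sup>2 * cnorm A h = (hnorm A X y)\<^sup>2"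
    using hnorm_sq[OF y] h unfolding yy by (simp add: A.N_smult norm_power)
  then have nh: "cnorm A h \<le> 1" using n by simp
  let ?k = "hinner X y y"
  have "hinner X (y \<ominus>\<^bsub>X\<^esub> ract X y h) (y \<ominus>\<^bsub>X\<^esub> ract X y h) =
      (?k \<ominus>\<^bsub>A\<^esub> ?k \<otimes>\<^bsub>A\<^esub> h) \<ominus>\<^bsub>A\<^esub> h \<otimes>\<^bsub>A\<^esub> (?k \<ominus>\<^bsub>A\<^esub> ?k \<otimes>\<^bsub>A\<^esub> h)"
  proof -
    have "hinner X (y \<ominus>\<^bsub>X\<^esub> ract X y h) (y \<ominus>\<^bsub>X\<^esub> ract X y h) =
        hinner X y (y \<ominus>\<^bsub>X\<^esub> ract X y h) \<ominus>\<^bsub>A\<^esub> h \<otimes>\<^bsub>A\<^esub> hinner X y (y \<ominus>\<^bsub>X\<^esub> ract X y h)"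
      using y h hs by (simp add: hinner_minus_left hinner_ract_left)
    then show ?thesis using y h by (simp add: hinner_minus hinner_ract)
  qed
  also have "\<dots> = complex_of_real ((hnorm A X y)\<^sup>2) \<odot>\<^bsub>A\<^esub>
      ((h \<ominus>\<^bsub>A\<^esub> h \<otimes>\<^bsub>A\<^esub> h) \<ominus>\<^bsub>A\<^esub> h \<otimes>\<^bsub>A\<^esub> (h \<ominus>\<^bsub>A\<^esub> h \<otimes>\<^bsub>A\<^esub> h))"
    unfolding yy using h
    by (simp add: A.smult_mult_left A.smult_mult_right A.smult_minus_right A.mult_minus_right)
  finally have "(hnorm A X (y \<ominus>\<^bsub>X\<^esub> ract X y h))\<^sup>2 =
      (hnorm A X y)\<^sup>2 * cnorm A ((h \<ominus>\<^bsub>A\<^esub> h \<otimes>\<^bsub>A\<^esub> h) \<ominus>\<^bsub>A\<^esub> h \<otimes>\<^bsub>A\<^esub> (h \<ominus>\<^bsub>A\<^esub> h \<otimes>\<^bsub>A\<^esub> h))"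
    using y h by (simp add: hnorm_sq A.N_smult norm_power)
  also have "\<dots> \<le> (hnorm A X y)\<^sup>2 * (1/4)"
    by (intro mult_left_mono A.cnorm_quarter[OF x h_def nh]) simp
  also have "\<dots> = (hnorm A X y / 2)\<^sup>2" by (simp add: power_divide)
  finally have "hnorm A X (y \<ominus>\<^bsub>X\<^esub> ract X y h) \<le> hnorm A X y / 2"
    by (rule power2_le_imp_le) (simp add: hnorm_nonneg[OF y])
  then show ?thesis using h by blast
qed

text \<open>This replaces an approximate unit. Halving is iterated: the remainder z = y - y a is
  again approximated by some z b, so the remainders shrink like powers of 1/2.\<close>

lemma ract_approx:
  assumes y: "y \<in> carrier X"
  obtains a where "\<And>n. a n \<in> carrier A" "X.nlim (\<lambda>n. ract X y (a n)) y"
proof -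
  have "\<exists>a\<in>carrier A. hnorm A X (y \<ominus>\<^bsub>X\<^esub> ract X y a) \<le> (1/2) ^ n * hnorm A X y" for n :: nat
  proof (induction n)
    case 0
    show ?case using y by (intro bexI[of _ "\<zero>\<^bsub>A\<^esub>"]) auto
  next
    case (Suc n)
    then obtain a where a: "a \<in> carrier A" "hnorm A X (y \<ominus>\<^bsub>X\<^esub> ract X y a) \<le> (1/2) ^ n * hnorm A X y" by blast
    define z where "z = y \<ominus>\<^bsub>X\<^esub> ract X y a"
    have z: "z \<in> carrier X" using y a by (simp add: z_def)
    obtain b where b: "b \<in> carrier A" "hnorm A X (z \<ominus>\<^bsub>X\<^esub> ract X z b) \<le> hnorm A X z / 2"
      using ract_half[OF z] by blast
    \<comment> \<open>Chosen so that formally 1 - c = (1 - a)(1 - b); then y - y c = z - z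
      b.\<close>
    define c where "c = a \<oplus>\<^bsub>A\<^esub> (b \<ominus>\<^bsub>A\<^esub> a \<otimes>\<^bsub>A\<^esub> b)"
    have c: "c \<in> carrier A" using a b by (simp add: c_def)
    have zb: "ract X z b = ract X y b \<ominus>\<^bsub>X\<^esub> ract X y (a \<otimes>\<^bsub>A\<^esub> b)"
      using y a b by (simp add: z_def ract_minus_left ract_mult)
    have yc: "ract X y c = ract X y a \<oplus>\<^bsub>X\<^esub> ract X z b"
      unfolding zb using y a b by (simp add: c_def ract_add_right ract_minus_right)
    have "z \<ominus>\<^bsub>X\<^esub> ract X z b = y \<ominus>\<^bsub>X\<^esub> ract X y c"
      unfolding yc using y a b z X.minus_minus_swap[of y "\<zero>\<^bsub>X\<^esub>" "ract X y a" "ract X z b"]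
      by (simp add: z_def[symmetric]) (simp add: a_minus_def)
    then have "hnorm A X (y \<ominus>\<^bsub>X\<^esub> ract X y c) \<le> (1/2) ^ Suc n * hnorm A X y"
      using a(2) b(2) by (simp flip: z_def)
    then show ?case using c by blast
  qed
  then obtain a where a: "\<And>n. a n \<in> carrier A"
    "\<And>n. hnorm A X (y \<ominus>\<^bsub>X\<^esub> ract X y (a n)) \<le> (1/2) ^ n * hnorm A X y"
    by metis
  have "X.nlim (\<lambda>n. ract X y (a n)) y"
  proof (rule X.nlimI)
    show "hnorm A X (ract X y (a n) \<ominus>\<^bsub>X\<^esub> y) \<le> (1/2) ^ n * hnorm A X y" for n
      using a[of n] y by (simp add: X.N_minus_commute[of "ract X y (a n)"])
    have "(\<lambda>n. (1/2) ^ n * hnorm A X y) \<longlonglongrightarrow> 0 * hnorm A X y"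
      by (intro tendsto_intros LIMSEQ_power_zero) simp
    then show "(\<lambda>n. (1/2) ^ n * hnorm A X y) \<longlonglongrightarrow> 0" by simp
  qed (use a y in auto)
  then show thesis using that a(1) by blast
qed

end

lemma (in cstar_algebra) mult_approx:
  assumes "y \<in> carrier A"
  obtains a where "\<And>n. a n \<in> carrier A" "nlim (\<lambda>n. y \<otimes> a n) y"
proof -
  interpret R: hilbert_module A "alg_corr A" by (rule hilbert_alg_corr)
  obtain a where a: "\<And>n. a n \<in> carrier A" "R.X.nlim (\<lambda>n. ract (alg_corr A) y (a n)) y"
    using R.ract_approx[of y] assms by auto
  have "nlim (\<lambda>n. y \<otimes> a n) y"
    using R.X.nlimD[OF a(2)] a(1) assms unfolding nlim_def by simp
  then show thesis using that a(1) by blast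
qed

lemma cstar_hom_bdd:
  assumes "cstar_algebra D" "cstar_algebra D'" "cstar_hom D D' \<sigma>"
  shows "bdd_linear D (cnorm D) D' (cnorm D') \<sigma>"
  by (rule bdd_linearI[of _ _ _ _ 1])
    (use cstar_homD[OF assms(3)] cstar_hom_norm[OF assms] in auto)

lemma (in cstar_algebra) mult_bdd:
  assumes "a \<in> carrier A"
  shows "bdd_linear A (cnorm A) A (cnorm A) (\<lambda>x. a \<otimes> x)" "bdd_linear A (cnorm A) A (cnorm A) (\<lambda>x. x \<otimes> a)"
proof -
  show "bdd_linear A (cnorm A) A (cnorm A) (\<lambda>x. a \<otimes> x)"
    by (rule bdd_linearI[of _ _ _ _ "cnorm A a"])
      (use assms in \<open>auto simp: mult_r_distr smult_mult_right cnorm_mult\<close>)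
  show "bdd_linear A (cnorm A) A (cnorm A) (\<lambda>x. x \<otimes> a)"
    by (rule bdd_linearI[of _ _ _ _ "cnorm A a"])
      (use assms in \<open>auto simp: mult_l_distr smult_mult_left cnorm_mult mult.commute[of "cnorm A a"]\<close>)
qed

text \<open>The graph of the linear map that should send s i to g i. As a relation it exists before
  well-definedness is known; single values come from a norm estimate between the two
  components.\<close>

inductive pair_span ::
  "(complex, 'z, 'n) module_scheme \<Rightarrow> (complex, 'w, 'q) module_scheme \<Rightarrow> ('i \<Rightarrow> 'z) \<Rightarrow> ('i \<Rightarrow> 'w) \<Rightarrow> 'i set \<Rightarrow>
    'z \<Rightarrow> 'w \<Rightarrow> bool"
  for Z W s g I where
  zero: "pair_span Z W s g I \<zero>\<^bsub>Z\<^esub> \<zero>\<^bsub>W\<^esub>"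
| base: "i \<in> I \<Longrightarrow> pair_span Z W s g I (s i) (g i)"
| add: "\<lbrakk>pair_span Z W s g I z w; pair_span Z W s g I z' w'\<rbrakk> \<Longrightarrow>
    pair_span Z W s g I (z \<oplus>\<^bsub>Z\<^esub> z') (w \<oplus>\<^bsub>W\<^esub> w')"
| smult: "pair_span Z W s g I z w \<Longrightarrow> pair_span Z W s g I (c \<odot>\<^bsub>Z\<^esub> z) (c \<odot>\<^bsub>W\<^esub> w)"

text \<open>The estimate makes the second components of a convergent sequence Cauchy, with a limit
  independent of choices. The value at a limit is described twice: by one approximating sequence of
  pairs, which serves to compute with f, and by all of them, which serves to identify its
  values.\<close>

lemma pair_span_extend:
  assumes "normed_cvs M N" "normed_cvs M' N'" and compl: "norm_complete M' N'"
    and s: "\<And>i. i \<in> I \<Longrightarrow> s i \<in> carrier M" and g: "\<And>i. i \<in> I \<Longrightarrow> g i \<in> carrier M'"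
    and le: "\<And>z w. pair_span M M' s g I z w \<Longrightarrow> N' w \<le> N z"
  shows "\<exists>f. \<forall>z\<in>norm_closure M N (cspan M (s ` I)).
      (\<exists>\<sigma> \<tau>. (\<forall>n. pair_span M M' s g I (\<sigma> n) (\<tau> n)) \<and> normed_cvs.nlim M N \<sigma> z \<and> normed_cvs.nlim M' N' \<tau> (f z)) \<and>
      (\<forall>w \<sigma> \<tau>. (\<forall>n. pair_span M M' s g I (\<sigma> n) (\<tau> n)) \<longrightarrow> normed_cvs.nlim M N \<sigma> z \<longrightarrow>
        normed_cvs.nlim M' N' \<tau> w \<longrightarrow> f z = w)"
proof -
  interpret M: normed_cvs M N by fact
  interpret M': normed_cvs M' N' by fact
  let ?R = "pair_span M M' s g I"
  have cl: "z \<in> carrier M \<and> w \<in> carrier M'" if "?R z w" for z w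
    using that by induction (auto simp: s g)
  have Rminus: "?R (z \<ominus>\<^bsub>M\<^esub> z') (w \<ominus>\<^bsub>M'\<^esub> w')" if "?R z w" "?R z' w'" for z w z' w'
    using pair_span.add[OF that(1) pair_span.smult[OF that(2), of "-1"]] cl[OF that(1)] cl[OF that(2)]
    by (simp add: M.minus_eq_smult M'.minus_eq_smult)
  have sI: "s ` I \<subseteq> carrier M" using s by blast
  have "cspan M (s ` I) \<subseteq> {z. \<exists>w. ?R z w}"
  proof (rule M.cspan_minimal)
    show "submodule {z. \<exists>w. ?R z w} complex_ring M"
      unfolding M.submodule_iff
    proof (intro conjI ballI allI subsetI)
      show "\<zero>\<^bsub>M\<^esub> \<in> {z. \<exists>w. ?R z w}" using pair_span.zero[of M M' s g I] by blast
      fix x assume "x \<in> {z. \<exists>w. ?R z w}"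
      then obtain w where w: "?R x w" by blast
      then show "x \<in> carrier M" using cl by blast
      show "c \<odot>\<^bsub>M\<^esub> x \<in> {z. \<exists>w. ?R z w}" for c using pair_span.smult[OF w, of c] by blast
      fix y assume "y \<in> {z. \<exists>w. ?R z w}"
      then obtain w' where "?R y w'" by blast
      from pair_span.add[OF w this] show "x \<oplus>\<^bsub>M\<^esub> y \<in> {z. \<exists>w. ?R z w}" by blast
    qed
  qed (auto intro: pair_span.base)
  then have ex: "\<exists>w. ?R z w" if "z \<in> cspan M (s ` I)" for z using that by blast
  have conv: "\<exists>w. M'.nlim \<tau> w" if \<sigma>: "\<And>n. ?R (\<sigma> n) (\<tau> n)" "M.nlim \<sigma> z" for z \<sigma> \<tau>
  proof -
    have "M.nCauchy \<sigma>" using M.nlim_Cauchy[OF \<sigma>(2)] .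
    moreover have "N' (\<tau> m \<ominus>\<^bsub>M'\<^esub> \<tau> n) \<le> N (\<sigma> m \<ominus>\<^bsub>M\<^esub> \<sigma> n)" for m n
      by (rule le[OF Rminus[OF \<sigma>(1) \<sigma>(1)]])
    ultimately have "M'.nCauchy \<tau>"
      unfolding M'.nCauchy_def M.nCauchy_def using cl[OF \<sigma>(1)] by (meson le_less_trans)
    then show ?thesis using compl M'.norm_complete_iff by blast
  qed
  have "\<exists>w \<sigma> \<tau>. (\<forall>n. ?R (\<sigma> n) (\<tau> n)) \<and> M.nlim \<sigma> z \<and> M'.nlim \<tau> w"
    if z: "z \<in> norm_closure M N (cspan M (s ` I))" for z
  proof -
    obtain \<sigma> where \<sigma>: "\<And>n. \<sigma> n \<in> cspan M (s ` I)" "M.nlim \<sigma> z"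
      using z M.norm_closure_seq[OF M.cspan_carrier[OF sI]] by blast
    obtain \<tau> where "\<And>n. ?R (\<sigma> n) (\<tau> n)" using ex[OF \<sigma>(1)] by metis
    with conv[OF this \<sigma>(2)] \<sigma>(2) show ?thesis by blast
  qed
  then obtain f where f: "\<And>z. z \<in> norm_closure M N (cspan M (s ` I)) \<Longrightarrow>
      \<exists>\<sigma> \<tau>. (\<forall>n. ?R (\<sigma> n) (\<tau> n)) \<and> M.nlim \<sigma> z \<and> M'.nlim \<tau> (f z)"
    by metis
  have uniq: "f z = w"
    if z: "z \<in> norm_closure M N (cspan M (s ` I))" and \<sigma>: "\<And>n. ?R (\<sigma> n) (\<tau> n)" "M.nlim \<sigma> z" "M'.nlim \<tau> w"
    for z w \<sigma> \<tau>
  proof -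
    obtain \<sigma>' \<tau>' where \<sigma>': "\<And>n. ?R (\<sigma>' n) (\<tau>' n)" "M.nlim \<sigma>' z" "M'.nlim \<tau>' (f z)" using f[OF z] by blast
    have "(\<lambda>n. N (\<sigma>' n \<ominus>\<^bsub>M\<^esub> \<sigma> n)) \<longlonglongrightarrow> N (z \<ominus>\<^bsub>M\<^esub> z)"
      by (intro M.nlim_norm M.nlim_minus \<sigma> \<sigma>')
    then have 0: "(\<lambda>n. N (\<sigma>' n \<ominus>\<^bsub>M\<^esub> \<sigma> n)) \<longlonglongrightarrow> 0" using M.nlimD(2)[OF \<sigma>(2)] by simp
    have "(\<lambda>n. N' (\<tau>' n \<ominus>\<^bsub>M'\<^esub> \<tau> n)) \<longlonglongrightarrow> N' (f z \<ominus>\<^bsub>M'\<^esub> w)"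
      by (intro M'.nlim_norm M'.nlim_minus \<sigma> \<sigma>')
    moreover have "N' (\<tau>' n \<ominus>\<^bsub>M'\<^esub> \<tau> n) \<le> N (\<sigma>' n \<ominus>\<^bsub>M\<^esub> \<sigma> n)" for n
      by (rule le[OF Rminus[OF \<sigma>'(1) \<sigma>(1)]])
    ultimately have "N' (f z \<ominus>\<^bsub>M'\<^esub> w) \<le> 0" using 0 by (blast intro: LIMSEQ_le)
    then show ?thesis
      using M'.nlimD(2)[OF \<sigma>(3)] M'.nlimD(2)[OF \<sigma>'(3)]
      by (intro M'.N_minus_eq_0) (auto intro: antisym)
  qed
  show ?thesis
  proof (intro exI[of _ f] ballI conjI allI impI)
    fix z assume z: "z \<in> norm_closure M N (cspan M (s ` I))"
    show "\<exists>\<sigma> \<tau>. (\<forall>n. ?R (\<sigma> n) (\<tau> n)) \<and> M.nlim \<sigma> z \<and> M'.nlim \<tau> (f z)" by (rule f[OF z])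
    fix w \<sigma> \<tau> assume "\<forall>n. ?R (\<sigma> n) (\<tau> n)" "M.nlim \<sigma> z" "M'.nlim \<tau> w"
    then show "f z = w" by (intro uniq[OF z, of \<sigma> \<tau>]) auto
  qed
qed

text \<open>A map of Hilbert modules along a homomorphism of the coefficients. Preservation of inner
  products yields additivity, homogeneity, the module property and contractivity. With target
  \<open>alg_corr D\<close> this is a representation in which the left action is left aside.\<close>

locale mod_rep = Z: hilbert_module A Z + W: hilbert_module D W
  for A :: "('a, 'm) cstar_algebra_scheme" and Z :: "('a, 'z, 'n) hilbert_module_scheme"
    and D :: "('d, 'p) cstar_algebra_scheme" and W :: "('d, 'w, 'q) hilbert_module_scheme" +
  fixes \<pi> :: "'a \<Rightarrow> 'd" and f :: "'z \<Rightarrow> 'w"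
  assumes hom: "cstar_hom A D \<pi>"
    and closed: "z \<in> carrier Z \<Longrightarrow> f z \<in> carrier W"
    and inner: "\<lbrakk>z \<in> carrier Z; z' \<in> carrier Z\<rbrakk> \<Longrightarrow> hinner W (f z) (f z') = \<pi> (hinner Z z z')"
begin

lemmas \<pi> = cstar_homD[OF hom]

lemma add:
  assumes "x \<in> carrier Z" "y \<in> carrier Z"
  shows "f (x \<oplus>\<^bsub>Z\<^esub> y) = f x \<oplus>\<^bsub>W\<^esub> f y"
  by (rule W.hinner_eqI)
    (use assms in \<open>simp_all add: closed inner \<pi> W.hinner_add W.hinner_add_left Z.hinner_add Z.hinner_add_left W.A.vadd_ac\<close>)

lemma smult:
  assumes "x \<in> carrier Z"
  shows "f (c \<odot>\<^bsub>Z\<^esub> x) = c \<odot>\<^bsub>W\<^esub> f x"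
  by (rule W.hinner_eqI)
    (use assms in \<open>simp_all add: closed inner \<pi> W.hinner_smult W.hinner_smult_left Z.hinner_smult Z.hinner_smult_left
      W.A.smult_smult mult.commute\<close>)

lemma ract:
  assumes "x \<in> carrier Z" "a \<in> carrier A"
  shows "f (ract Z x a) = ract W (f x) (\<pi> a)"
  by (rule W.hinner_eqI)
    (use assms in \<open>simp_all add: closed inner \<pi> W.hinner_ract W.hinner_ract_left Z.hinner_ract Z.hinner_ract_left
      W.A.mult_assoc\<close>)

lemma norm_le:
  assumes "x \<in> carrier Z"
  shows "hnorm D W (f x) \<le> hnorm A Z x"
proof -
  have "cnorm D (\<pi> (hinner Z x x)) \<le> cnorm A (hinner Z x x)"
    by (rule cstar_hom_norm[OF Z.A.cstar_algebra_axioms W.A.cstar_algebra_axioms hom])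
      (use assms in simp)
  then show ?thesis using assms by (simp add: hnorm_def inner)
qed

lemma bdd: "bdd_linear Z (hnorm A Z) W (hnorm D W) f"
  by (rule bdd_linearI[of _ _ _ _ 1]) (auto simp: closed add smult norm_le)

end

lemma mod_rep_comp:
  assumes "mod_rep A Z B V \<pi> f" "mod_rep B V D W \<sigma> g"
  shows "mod_rep A Z D W (\<lambda>a. \<sigma> (\<pi> a)) (\<lambda>z. g (f z))"
proof -
  interpret f: mod_rep A Z B V \<pi> f by fact
  interpret g: mod_rep B V D W \<sigma> g by fact
  show ?thesis
  proof
    show "cstar_hom A D (\<lambda>a. \<sigma> (\<pi> a))"
      using cstar_hom_comp[OF f.hom g.hom] by (simp add: o_def)
  qed (simp_all add: f.closed g.closed f.inner g.inner)
qed

lemma mod_rep_agree: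
  assumes "mod_rep A Z D W \<pi> f" "mod_rep A Z D W \<pi>' g"
    and "S \<subseteq> carrier Z" "\<And>s. s \<in> S \<Longrightarrow> f s = g s"
    and "norm_closure Z (hnorm A Z) (cspan Z S) = carrier Z" "z \<in> carrier Z"
  shows "f z = g z"
proof -
  interpret f: mod_rep A Z D W \<pi> f by fact
  interpret g: mod_rep A Z D W \<pi>' g by fact
  show ?thesis
    by (rule bdd_linear_agree[OF _ _ f.bdd g.bdd assms(3,4)])
      (use assms in \<open>auto intro: f.Z.X.normed_cvs_axioms f.W.X.normed_cvs_axioms\<close>)
qed

text \<open>The standard way to build maps out of tensor products: values on a total family and one
  comparison of inner products. Linearity and balance of g are consequences of that
  comparison.\<close>

lemma mod_rep_extend:
  assumes "hilbert_module A Z" "hilbert_module D W" and hom: "cstar_hom A D \<pi>"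
    and s: "\<And>x y. \<lbrakk>x \<in> S; y \<in> T\<rbrakk> \<Longrightarrow> s x y \<in> carrier Z"
    and g: "\<And>x y. \<lbrakk>x \<in> S; y \<in> T\<rbrakk> \<Longrightarrow> g x y \<in> carrier W"
    and dense: "norm_closure Z (hnorm A Z) (cspan Z {s x y |x y. x \<in> S \<and> y \<in> T}) = carrier Z"
    and inner: "\<And>x y x' y'. \<lbrakk>x \<in> S; y \<in> T; x' \<in> S; y' \<in> T\<rbrakk> \<Longrightarrow>
      hinner W (g x y) (g x' y') = \<pi> (hinner Z (s x y) (s x' y'))"
  shows "\<exists>f. mod_rep A Z D W \<pi> f \<and> (\<forall>x\<in>S. \<forall>y\<in>T. f (s x y) = g x y)"
proof -
  interpret Z: hilbert_module A Z by fact
  interpret W: hilbert_module D W by fact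
  note \<pi> = cstar_homD[OF hom]
  note cs = Z.A.cstar_algebra_axioms W.A.cstar_algebra_axioms
  note zero = cstar_hom_zero[OF cs hom]
  let ?I = "S \<times> T" and ?s = "\<lambda>(x, y). s x y" and ?g = "\<lambda>(x, y). g x y"
  let ?R = "pair_span Z W ?s ?g ?I"
  have sc: "?s i \<in> carrier Z" and gc: "?g i \<in> carrier W" if "i \<in> ?I" for i
    using that s g by auto
  have gs: "hinner W (?g i) (?g j) = \<pi> (hinner Z (?s i) (?s j))" if "i \<in> ?I" "j \<in> ?I" for i j
    using that inner by auto
  have cl: "z \<in> carrier Z \<and> w \<in> carrier W" if "?R z w" for z w
    using that by induction (auto simp: s g)
  \<comment> \<open>The comparison of inner products is extended from generators to
    \<open>pair_span\<close> one argument at a time.\<close>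
  have inner1: "hinner W w (?g j) = \<pi> (hinner Z z (?s j))" if "?R z w" and j: "j \<in> ?I" for z w j
    using that(1)
  proof induction
    case (base i)
    then show ?case by (rule gs[OF _ j])
  qed (use sc[OF j] gc[OF j] cl in \<open>simp_all add: zero \<pi> Z.hinner_add_left W.hinner_add_left
      Z.hinner_smult_left W.hinner_smult_left\<close>)
  have inner2: "hinner W w w' = \<pi> (hinner Z z z')" if "?R z' w'" and R: "?R z w" for z w z' w'
    using that(1)
  proof induction
    case (base i)
    then show ?case by (rule inner1[OF R])
  qed (use cl[OF R] cl in \<open>simp_all add: zero \<pi> Z.hinner_add W.hinner_add Z.hinner_smult W.hinner_smult\<close>)
  have Rnorm: "hnorm D W w \<le> hnorm A Z z" if "?R z w" for z w
    using cstar_hom_norm[OF cs hom, of "hinner Z z z"] cl[OF that] inner2[OF that that]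
    by (simp add: hnorm_def)
  have img: "?s ` ?I = {s x y |x y. x \<in> S \<and> y \<in> T}" by auto
  obtain f where f: "\<forall>z\<in>carrier Z.
      (\<exists>\<sigma> \<tau>. (\<forall>n. ?R (\<sigma> n) (\<tau> n)) \<and> Z.X.nlim \<sigma> z \<and> W.X.nlim \<tau> (f z)) \<and>
      (\<forall>w \<sigma> \<tau>. (\<forall>n. ?R (\<sigma> n) (\<tau> n)) \<longrightarrow> Z.X.nlim \<sigma> z \<longrightarrow> W.X.nlim \<tau> w \<longrightarrow> f z = w)"
    using pair_span_extend[of Z "hnorm A Z" W "hnorm D W" ?I ?s ?g, OF Z.X.normed_cvs_axioms W.X.normed_cvs_axioms
        W.hilbert_complete sc gc Rnorm]
    unfolding img dense ..
  have "mod_rep A Z D W \<pi> f"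
  proof
    show "cstar_hom A D \<pi>" by fact
    show "f z \<in> carrier W" if "z \<in> carrier Z" for z using bspec[OF f that] W.X.nlimD(2) by blast
    fix z z' assume z: "z \<in> carrier Z" "z' \<in> carrier Z"
    obtain \<sigma> \<tau> \<sigma>' \<tau>' where \<sigma>: "\<And>n. ?R (\<sigma> n) (\<tau> n)" "Z.X.nlim \<sigma> z" "W.X.nlim \<tau> (f z)"
      and \<sigma>': "\<And>n. ?R (\<sigma>' n) (\<tau>' n)" "Z.X.nlim \<sigma>' z'" "W.X.nlim \<tau>' (f z')"
      using bspec[OF f z(1)] bspec[OF f z(2)] by blast
    show "hinner W (f z) (f z') = \<pi> (hinner Z z z')"
    proof (rule W.A.nlim_unique)
      show "W.A.nlim (\<lambda>n. hinner W (\<tau> n) (\<tau>' n)) (hinner W (f z) (f z'))" by (rule W.hinner_nlim[OF \<sigma>(3) \<sigma>'(3)])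
      show "W.A.nlim (\<lambda>n. hinner W (\<tau> n) (\<tau>' n)) (\<pi> (hinner Z z z'))"
        using bdd_linear_nlim[OF Z.A.normed_cvs_axioms W.A.normed_cvs_axioms cstar_hom_bdd[OF cs hom]
            Z.hinner_nlim[OF \<sigma>(2) \<sigma>'(2)]] inner2[OF \<sigma>'(1) \<sigma>(1)] by simp
    qed
  qed
  moreover have "f (s x y) = g x y" if "x \<in> S" "y \<in> T" for x y
  proof -
    have R: "?R (s x y) (g x y)" using pair_span.base[of "(x, y)" ?I Z W ?s ?g] that by simp
    show ?thesis
      by (rule conjunct2[OF bspec[OF f s[OF that]], rule_format, of "\<lambda>_. s x y" "\<lambda>_. g x y"])
        (rule R Z.X.nlim_const W.X.nlim_const s g that)+
  qed
  ultimately show ?thesis by blast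
qed

section \<open>Compact operators\<close>

lemma cstar_subalgebra_cstar:
  assumes "cstar_algebra A" "cstar_subalgebra H A"
  shows "cstar_algebra (A\<lparr>carrier := H\<rparr>)"
proof -
  interpret A: cstar_algebra A by fact
  have sub: "submodule H complex_ring A" and cl: "norm_closure A (cnorm A) H = H"
    and m: "\<And>x y. \<lbrakk>x \<in> H; y \<in> H\<rbrakk> \<Longrightarrow> x \<otimes>\<^bsub>A\<^esub> y \<in> H" "\<And>x. x \<in> H \<Longrightarrow> star A x \<in> H"
    using assms(2) unfolding cstar_subalgebra_def by auto
  note H = A.submoduleD(1)[OF sub]
  have Hc [simp]: "x \<in> H \<Longrightarrow> x \<in> carrier A" for x using H by blast
  let ?B = "A\<lparr>carrier := H\<rparr>"
  have mod: "Module.module complex_ring ?B"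
    by (rule submodule.submodule_is_module[OF sub A.module_axioms])
  interpret B: cvs ?B by (intro cvs.intro mod)
  have [simp]: "cnorm ?B = cnorm A" "star ?B = star A" by simp_all
  have minus: "x \<ominus>\<^bsub>?B\<^esub> y = x \<ominus>\<^bsub>A\<^esub> y" if "x \<in> H" "y \<in> H" for x y
    using that B.minus_eq_smult[of x y] A.minus_eq_smult[of x y] by simp
  have Bn: "normed_cvs ?B (cnorm A)"
    by unfold_locales (use A.N_add A.N_smult A.N_eq_0_iff in auto)
  then interpret B: normed_cvs ?B "cnorm A" .
  have "norm_complete ?B (cnorm A)"
    unfolding B.norm_complete_iff
  proof (intro allI impI)
    fix \<sigma> assume \<sigma>: "B.nCauchy \<sigma>"
    then have \<sigma>H: "\<sigma> n \<in> H" for n by (simp add: B.nCauchy_def)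
    have "A.nCauchy \<sigma>" using \<sigma> \<sigma>H by (simp add: B.nCauchy_def A.nCauchy_def minus)
    then obtain x where x: "A.nlim \<sigma> x" using A.complete A.norm_complete_iff by blast
    have "x \<in> H" using A.nclosedD[OF _ \<sigma>H x] A.nclosed_iff[OF H] cl by blast
    then have "B.nlim \<sigma> x" using x \<sigma>H by (simp add: B.nlim_def A.nlim_def minus)
    then show "\<exists>x. B.nlim \<sigma> x" by blast
  qed
  then show ?thesis
    by (intro cstar_algebra.intro cstar_algebra_axioms.intro mod)
      (simp_all add: m A.mult_assoc A.mult_l_distr A.mult_r_distr A.smult_mult_left A.smult_mult_right
        A.star_add A.star_smult A.star_mult A.N_eq_0_iff A.N_add A.N_smult A.cnorm_mult A.cnorm_star)
qed

lemma (in cstar_algebra) nclspan_mult: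
  assumes S: "S \<subseteq> carrier A" "T \<subseteq> carrier A" and H: "submodule H complex_ring A" "nclosed H"
    and st: "\<And>s t. \<lbrakk>s \<in> S; t \<in> T\<rbrakk> \<Longrightarrow> s \<otimes> t \<in> H"
    and x: "x \<in> nclspan S" and y: "y \<in> nclspan T"
  shows "x \<otimes> y \<in> H"
proof -
  note n = normed_cvs_axioms normed_cvs_axioms
  have xt: "x \<otimes> t \<in> H" if t: "t \<in> T" for t
    by (rule bdd_linear_nclspan[OF n mult_bdd(2) S(1) _ H x]) (use t S st in auto)
  show ?thesis
    by (rule bdd_linear_nclspan[OF n mult_bdd(1) S(2) xt H y]) (use x nclspan_carrier in auto)
qed

lemma (in cstar_algebra) nclspan_star:
  assumes S: "S \<subseteq> carrier A" and H: "submodule H complex_ring A" "nclosed H"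
    and s: "\<And>s. s \<in> S \<Longrightarrow> star A s \<in> H" and x: "x \<in> nclspan S"
  shows "star A x \<in> H"
  using x
proof (rule nclspan_induct[OF _ S])
  show "star A y \<in> H" if "\<And>n. star A (\<sigma> n) \<in> H" "nlim \<sigma> y" for \<sigma> y
    by (rule nclosedD[OF H(2), of "\<lambda>n. star A (\<sigma> n)"]) (intro that nlim_star)+
qed (use s S submoduleD[OF H(1)] in \<open>auto simp: star_add star_smult subset_iff\<close>)

context hilbert_module
begin

abbreviation "rank_ones \<equiv> {rank_one X x y |x y. x \<in> carrier X \<and> y \<in> carrier X}"

sublocale L: unital_cstar \<L> by (rule adj_unital)

lemma rank_one_adj:
  assumes x: "x \<in> carrier X" and y: "y \<in> carrier X"
  shows "rank_one X x y \<in> carrier \<L>" "star \<L> (rank_one X x y) = rank_one X y x"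
  unfolding rank_one_def
  by (rule adj_memI[of _ "\<lambda>z. ract X y (hinner X x z)"];
      use x y in \<open>simp add: hinner_ract hinner_ract_left hinner_star\<close>)+

lemma rank_one_apply [simp]: "z \<in> carrier X \<Longrightarrow> rank_one X x y z = ract X x (hinner X y z)"
  by (simp add: rank_one_def)

lemma rank_one_comp_left:
  assumes T: "T \<in> carrier \<L>" and x: "x \<in> carrier X" and y: "y \<in> carrier X"
  shows "T \<otimes>\<^bsub>\<L>\<^esub> rank_one X x y = rank_one X (T x) y"
proof (rule adj_eqI)
  fix z assume "z \<in> carrier X"
  then show "(T \<otimes>\<^bsub>\<L>\<^esub> rank_one X x y) z = rank_one X (T x) y z"
    using T x y by (simp add: adj_ract)
qed (use T x y in \<open>simp_all add: rank_one_adj adj_closed\<close>)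

lemma rank_one_rank_one:
  "\<lbrakk>x \<in> carrier X; y \<in> carrier X; z \<in> carrier X; w \<in> carrier X\<rbrakk> \<Longrightarrow>
    rank_one X x y \<otimes>\<^bsub>\<L>\<^esub> rank_one X z w = rank_one X (ract X x (hinner X y z)) w"
  by (simp add: rank_one_comp_left rank_one_adj)

lemma rank_ones_adj: "rank_ones \<subseteq> carrier \<L>"
  using rank_one_adj(1) by blast

lemma compact_carrier: "carrier (compact_ops A X) = L.nclspan rank_ones"
  by (simp add: compact_ops_def L.nclspan_def)

lemma compact_sub_adj: "carrier (compact_ops A X) \<subseteq> carrier \<L>"
  unfolding compact_carrier by (rule L.nclspan_carrier)

text \<open>Products and adjoints of rank-one operators are again rank-one, and closed spans inherit
  both properties.\<close>

lemma compact_subalgebra: "cstar_subalgebra (carrier (compact_ops A X)) \<L>"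
proof -
  note H = L.nclspan_submodule[OF rank_ones_adj] L.nclspan_closed[OF rank_ones_adj]
  show ?thesis
    unfolding cstar_subalgebra_def compact_carrier
  proof (intro conjI ballI)
    fix S T assume "S \<in> L.nclspan rank_ones" "T \<in> L.nclspan rank_ones"
    then show "S \<otimes>\<^bsub>\<L>\<^esub> T \<in> L.nclspan rank_ones"
    proof (rule L.nclspan_mult[OF rank_ones_adj rank_ones_adj H, rotated])
      fix S T assume "S \<in> rank_ones" "T \<in> rank_ones"
      then obtain x y z w where "S = rank_one X x y" "T = rank_one X z w"
        "x \<in> carrier X" "y \<in> carrier X" "z \<in> carrier X" "w \<in> carrier X" by blast
      then have "S \<otimes>\<^bsub>\<L>\<^esub> T \<in> rank_ones"
        using rank_one_rank_one[of x y z w] ract_closed'[OF _ hinner_closed', of x y z] by blast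
      then show "S \<otimes>\<^bsub>\<L>\<^esub> T \<in> L.nclspan rank_ones" using L.nclspan_superset[OF rank_ones_adj] by blast
    qed
  next
    fix S assume "S \<in> L.nclspan rank_ones"
    then show "star \<L> S \<in> L.nclspan rank_ones"
    proof (rule L.nclspan_star[OF rank_ones_adj H, rotated])
      fix S assume "S \<in> rank_ones"
      then obtain x y where "S = rank_one X x y" "x \<in> carrier X" "y \<in> carrier X" by blast
      then have "star \<L> S \<in> rank_ones" using rank_one_adj(2)[of x y] by blast
      then show "star \<L> S \<in> L.nclspan rank_ones" using L.nclspan_superset[OF rank_ones_adj] by blast
    qed
  next
    show "norm_closure \<L> (cnorm \<L>) (L.nclspan rank_ones) = L.nclspan rank_ones"
      using H(2) L.nclosed_iff[OF L.nclspan_carrier] by blast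
  qed (rule H)
qed

lemma compact_cstar: "cstar_algebra (compact_ops A X)"
  using cstar_subalgebra_cstar[OF L.cstar_algebra_axioms compact_subalgebra]
  by (simp add: compact_ops_def)

lemma compact_simps:
  "monoid.mult (compact_ops A X) = monoid.mult \<L>" "add (compact_ops A X) = add \<L>" "smult (compact_ops A X) = smult \<L>"
  "star (compact_ops A X) = star \<L>" "cnorm (compact_ops A X) = cnorm \<L>" "zero (compact_ops A X) = zero \<L>"
  by (simp_all add: compact_ops_def)

end

section \<open>The homomorphism on compact operators induced by a representation\<close>

text \<open>The image of the compact operators under t^(1), described without mentioning that
  homomorphism.\<close>

definition rep_compacts ::
  "('d, 'p) cstar_algebra_scheme \<Rightarrow> ('a, 'x, 'n) hilbert_module_scheme \<Rightarrow> ('x \<Rightarrow> 'd) \<Rightarrow> 'd set" where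
  "rep_compacts D X t =
    norm_closure D (cnorm D) (cspan D {t x \<otimes>\<^bsub>D\<^esub> star D (t y) |x y. x \<in> carrier X \<and> y \<in> carrier X})"

locale alg_rep = mod_rep A X D "alg_corr D" \<pi> t
  for A :: "('a, 'm) cstar_algebra_scheme" and X :: "('a, 'x, 'n) hilbert_module_scheme"
    and D :: "('d, 'p) cstar_algebra_scheme" and \<pi> :: "'a \<Rightarrow> 'd" and t :: "'x \<Rightarrow> 'd"
begin

abbreviation "gens \<equiv> {t x \<otimes>\<^bsub>D\<^esub> star D (t y) |x y. x \<in> carrier X \<and> y \<in> carrier X}"
abbreviation "P \<equiv> rep_compacts D X t"

lemma t_closed [simp, intro]: "x \<in> carrier X \<Longrightarrow> t x \<in> carrier D"
  using closed by simp

lemma t_inner: "\<lbrakk>x \<in> carrier X; y \<in> carrier X\<rbrakk> \<Longrightarrow> star D (t x) \<otimes>\<^bsub>D\<^esub> t y = \<pi> (hinner X x y)"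
  using inner by simp

lemma t_ract: "\<lbrakk>x \<in> carrier X; a \<in> carrier A\<rbrakk> \<Longrightarrow> t (ract X x a) = t x \<otimes>\<^bsub>D\<^esub> \<pi> a"
  using ract by simp

lemma t_add: "\<lbrakk>x \<in> carrier X; y \<in> carrier X\<rbrakk> \<Longrightarrow> t (x \<oplus>\<^bsub>X\<^esub> y) = t x \<oplus>\<^bsub>D\<^esub> t y"
  using add by simp

lemma t_smult: "x \<in> carrier X \<Longrightarrow> t (c \<odot>\<^bsub>X\<^esub> x) = c \<odot>\<^bsub>D\<^esub> t x"
  using smult by simp

lemma t_norm: "x \<in> carrier X \<Longrightarrow> cnorm D (t x) \<le> hnorm A X x"
  using norm_le[of x] by simp

lemma t_bdd: "bdd_linear X (hnorm A X) D (cnorm D) t"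
  by (rule bdd_linearI[of _ _ _ _ 1]) (simp_all add: t_add t_smult t_norm)

lemma gens_carrier: "gens \<subseteq> carrier D"
  by auto

lemma P_eq: "P = W.A.nclspan gens"
  by (simp add: rep_compacts_def W.A.nclspan_def)

lemma P_sub: "submodule P complex_ring D" and P_nclosed: "W.A.nclosed P" and P_carrier: "P \<subseteq> carrier D"
  and gens_P: "gens \<subseteq> P"
  unfolding P_eq
  by (rule W.A.nclspan_submodule[OF gens_carrier] W.A.nclspan_closed[OF gens_carrier]
      W.A.nclspan_carrier W.A.nclspan_superset[OF gens_carrier])+

lemma gen_in_P: "\<lbrakk>x \<in> carrier X; y \<in> carrier X\<rbrakk> \<Longrightarrow> t x \<otimes>\<^bsub>D\<^esub> star D (t y) \<in> P"
  using gens_P by blast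

lemma P_star: "p \<in> P \<Longrightarrow> star D p \<in> P"
  unfolding P_eq
proof (rule W.A.nclspan_star[OF gens_carrier], fold P_eq)
  show "star D s \<in> P" if s: "s \<in> gens" for s
  proof -
    from s obtain x y where "s = t x \<otimes>\<^bsub>D\<^esub> star D (t y)" "x \<in> carrier X" "y \<in> carrier X" by blast
    then show ?thesis using gen_in_P[of y x] by (simp add: W.A.star_mult)
  qed
qed (rule P_sub P_nclosed | assumption)+

text \<open>The difference U annihilates t(X), hence every t(x) t(y)^*, hence the whole closed span,
  which contains U^*. So U U^* vanishes.\<close>

lemma P_cancel:
  assumes T: "T \<in> P" and S: "S \<in> P" and eq: "\<And>z. z \<in> carrier X \<Longrightarrow> T \<otimes>\<^bsub>D\<^esub> t z = S \<otimes>\<^bsub>D\<^esub> t z"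
  shows "T = S"
proof -
  have TS: "T \<in> carrier D" "S \<in> carrier D" using T S P_carrier by auto
  define U where "U = T \<ominus>\<^bsub>D\<^esub> S"
  have U: "U \<in> P" "U \<in> carrier D" unfolding U_def using W.A.submodule_minus[OF P_sub T S] TS by auto
  have Uz: "U \<otimes>\<^bsub>D\<^esub> t z = \<zero>\<^bsub>D\<^esub>" if "z \<in> carrier X" for z
    using that TS eq[OF that] by (simp add: U_def W.A.mult_minus_left)
  have U1: "U \<in> W.A.nclspan {U}" using W.A.nclspan_superset[of "{U}"] U by auto
  have z: "submodule {\<zero>\<^bsub>D\<^esub>} complex_ring D" "W.A.nclosed {\<zero>\<^bsub>D\<^esub>}"
  proof -
    show "submodule {\<zero>\<^bsub>D\<^esub>} complex_ring D" by (simp add: W.A.submodule_iff)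
    show "W.A.nclosed {\<zero>\<^bsub>D\<^esub>}"
    proof (rule W.A.nclosedI)
      fix \<sigma> x assume "\<And>n. \<sigma> n \<in> {\<zero>\<^bsub>D\<^esub>}" "W.A.nlim \<sigma> x"
      then have "W.A.nlim (\<lambda>_. \<zero>\<^bsub>D\<^esub>) x" by (simp add: W.A.nlim_def)
      then show "x \<in> {\<zero>\<^bsub>D\<^esub>}" using W.A.nlim_unique[OF _ W.A.nlim_const] by blast
    qed
  qed
  have "U \<otimes>\<^bsub>D\<^esub> star D U \<in> {\<zero>\<^bsub>D\<^esub>}"
  proof (rule W.A.nclspan_mult[OF _ gens_carrier z _ U1])
    show "star D U \<in> W.A.nclspan gens" using P_star[OF U(1)] by (simp add: P_eq)
    fix s v assume "s \<in> {U}" "v \<in> gens"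
    then obtain x y where "s = U" "v = t x \<otimes>\<^bsub>D\<^esub> star D (t y)" "x \<in> carrier X" "y \<in> carrier X" by blast
    then have "s \<otimes>\<^bsub>D\<^esub> v = (U \<otimes>\<^bsub>D\<^esub> t x) \<otimes>\<^bsub>D\<^esub> star D (t y)" using U by (simp add: W.A.mult_assoc)
    then show "s \<otimes>\<^bsub>D\<^esub> v \<in> {\<zero>\<^bsub>D\<^esub>}" using Uz \<open>x \<in> carrier X\<close> \<open>y \<in> carrier X\<close> by simp
  qed (use U in auto)
  then have "cnorm D U = 0" using W.A.cnorm_mult_star[OF U(2)] by simp
  then show ?thesis unfolding U_def using TS by (intro W.A.N_minus_eq_0)
qed

abbreviation "R0 \<equiv> pair_span Z.\<L> D (\<lambda>(x, y). rank_one X x y) (\<lambda>(x, y). t x \<otimes>\<^bsub>D\<^esub> star D (t y))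
  (carrier X \<times> carrier X)"

lemma R0_closed: "R0 K T \<Longrightarrow> K \<in> carrier Z.\<L> \<and> T \<in> carrier D"
  by (induction rule: pair_span.induct) (auto simp: Z.rank_one_adj)

lemma R0_P: "R0 K T \<Longrightarrow> T \<in> P"
  by (induction rule: pair_span.induct) (auto simp: gen_in_P W.A.submoduleD[OF P_sub])

lemma R0_apply: "\<lbrakk>R0 K T; z \<in> carrier X\<rbrakk> \<Longrightarrow> T \<otimes>\<^bsub>D\<^esub> t z = t (K z)"
proof (induction rule: pair_span.induct)
  case zero
  have "t \<zero>\<^bsub>X\<^esub> = \<zero>\<^bsub>D\<^esub>" using t_smult[of "\<zero>\<^bsub>X\<^esub>" 0] by simp
  then show ?case using zero by simp
next
  case (base i)
  then show ?case by (auto simp: W.A.mult_assoc t_inner t_ract)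
next
  case (add K T K' T')
  then show ?case
    using R0_closed[OF add.hyps(1)] R0_closed[OF add.hyps(2)]
    by (simp add: W.A.mult_l_distr t_add Z.adj_closed)
next
  case (smult K T c)
  then show ?case
    using R0_closed[OF smult.hyps(1)] by (simp add: W.A.smult_mult_left t_smult Z.adj_closed)
qed

lemma R0_star: "R0 K T \<Longrightarrow> R0 (star Z.\<L> K) (star D T)"
proof (induction rule: pair_span.induct)
  case zero
  show ?case using pair_span.zero by simp
next
  case (base i)
  then obtain x y where i: "i = (x, y)" "x \<in> carrier X" "y \<in> carrier X" by auto
  then show ?case
    using pair_span.base[of "(y, x)" "carrier X \<times> carrier X" Z.\<L> D
        "\<lambda>(x, y). rank_one X x y" "\<lambda>(x, y). t x \<otimes>\<^bsub>D\<^esub> star D (t y)"]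
    by (simp add: Z.rank_one_adj W.A.star_mult)
next
  case (add K T K' T')
  then show ?case
    using R0_closed[OF add.hyps(1)] R0_closed[OF add.hyps(2)]
    by (simp add: Z.L.star_add W.A.star_add pair_span.add)
next
  case (smult K T c)
  then show ?case
    using R0_closed[OF smult.hyps(1)] by (simp add: Z.L.star_smult W.A.star_smult pair_span.smult)
qed

text \<open>The constant depends on how K is written as a combination of rank-one operators but not
  on S: moving S into the first vectors of the summands costs only the norm of S. The constant is
  crude, but \<open>R0_norm\<close> lets powers wash it out.\<close>

lemma R0_left:
  assumes "R0 K T"
  shows "\<exists>C\<ge>0. \<forall>S\<in>carrier Z.\<L>. \<exists>U. R0 (S \<otimes>\<^bsub>Z.\<L>\<^esub> K) U \<and> cnorm D U \<le> C * cnorm Z.\<L> S"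
  using assms
proof (induction rule: pair_span.induct)
  case zero
  show ?case
    by (intro exI[of _ 0] conjI ballI exI[of _ "\<zero>\<^bsub>D\<^esub>"]) (simp_all add: pair_span.zero)
next
  case (base i)
  then obtain x y where i: "i = (x, y)" "x \<in> carrier X" "y \<in> carrier X" by auto
  show ?case
  proof (intro exI[of _ "hnorm A X x * hnorm A X y"] conjI ballI)
    show "0 \<le> hnorm A X x * hnorm A X y" using i by simp
    fix S assume S: "S \<in> carrier Z.\<L>"
    note Sx = Z.adj_closed[OF S i(2)]
    have "R0 (rank_one X (S x) y) (t (S x) \<otimes>\<^bsub>D\<^esub> star D (t y))"
      using pair_span.base[of "(S x, y)" "carrier X \<times> carrier X" Z.\<L> D
        "\<lambda>(x, y). rank_one X x y" "\<lambda>(x, y). t x \<otimes>\<^bsub>D\<^esub> star D (t y)"] Sx i by simp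
    moreover have "cnorm D (t (S x) \<otimes>\<^bsub>D\<^esub> star D (t y)) \<le> hnorm A X x * hnorm A X y * cnorm Z.\<L> S"
    proof -
      have "cnorm D (t (S x) \<otimes>\<^bsub>D\<^esub> star D (t y)) \<le> cnorm D (t (S x)) * cnorm D (t y)"
        using W.A.cnorm_mult[of "t (S x)" "star D (t y)"] Sx i by simp
      also have "\<dots> \<le> (cnorm Z.\<L> S * hnorm A X x) * hnorm A X y"
        using Sx i Z.L.N_nonneg[OF S]
        by (intro mult_mono order_trans[OF t_norm] Z.adj_norm_apply S t_norm) simp_all
      finally show ?thesis by (simp add: mult_ac)
    qed
    ultimately show "\<exists>U. R0 (S \<otimes>\<^bsub>Z.\<L>\<^esub> (case i of (x, y) \<Rightarrow> rank_one X x y)) U \<and>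
        cnorm D U \<le> hnorm A X x * hnorm A X y * cnorm Z.\<L> S"
      using i by (auto simp: Z.rank_one_comp_left[OF S])
  qed
next
  case (add K T K' T')
  note c = R0_closed[OF add.hyps(1)] R0_closed[OF add.hyps(2)]
  obtain C where C: "C \<ge> 0" "\<And>S. S \<in> carrier Z.\<L> \<Longrightarrow> \<exists>U. R0 (S \<otimes>\<^bsub>Z.\<L>\<^esub> K) U \<and> cnorm D U \<le> C * cnorm Z.\<L> S"
    using add.IH(1) by blast
  obtain C' where C': "C' \<ge> 0" "\<And>S. S \<in> carrier Z.\<L> \<Longrightarrow> \<exists>U. R0 (S \<otimes>\<^bsub>Z.\<L>\<^esub> K') U \<and> cnorm D U \<le> C' * cnorm Z.\<L> S"
    using add.IH(2) by blast
  show ?case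
  proof (intro exI[of _ "C + C'"] conjI ballI)
    fix S assume S: "S \<in> carrier Z.\<L>"
    obtain U where U: "R0 (S \<otimes>\<^bsub>Z.\<L>\<^esub> K) U" "cnorm D U \<le> C * cnorm Z.\<L> S" using C(2)[OF S] by blast
    obtain U' where U': "R0 (S \<otimes>\<^bsub>Z.\<L>\<^esub> K') U'" "cnorm D U' \<le> C' * cnorm Z.\<L> S" using C'(2)[OF S] by blast
    have "R0 (S \<otimes>\<^bsub>Z.\<L>\<^esub> (K \<oplus>\<^bsub>Z.\<L>\<^esub> K')) (U \<oplus>\<^bsub>D\<^esub> U')"
      using pair_span.add[OF U(1) U'(1)] S c by (simp add: Z.L.mult_r_distr)
    moreover have "cnorm D (U \<oplus>\<^bsub>D\<^esub> U') \<le> (C + C') * cnorm Z.\<L> S"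
      using W.A.N_add[of U U'] R0_closed[OF U(1)] R0_closed[OF U'(1)] U(2) U'(2)
      by (simp add: distrib_right)
    ultimately show "\<exists>U. R0 (S \<otimes>\<^bsub>Z.\<L>\<^esub> (K \<oplus>\<^bsub>Z.\<L>\<^esub> K')) U \<and> cnorm D U \<le> (C + C') * cnorm Z.\<L> S" by blast
  qed (use C C' in simp)
next
  case (smult K T c)
  note cl = R0_closed[OF smult.hyps(1)]
  obtain C where C: "C \<ge> 0" "\<And>S. S \<in> carrier Z.\<L> \<Longrightarrow> \<exists>U. R0 (S \<otimes>\<^bsub>Z.\<L>\<^esub> K) U \<and> cnorm D U \<le> C * cnorm Z.\<L> S"
    using smult.IH by blast
  show ?case
  proof (intro exI[of _ "cmod c * C"] conjI ballI)
    fix S assume S: "S \<in> carrier Z.\<L>"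
    obtain U where U: "R0 (S \<otimes>\<^bsub>Z.\<L>\<^esub> K) U" "cnorm D U \<le> C * cnorm Z.\<L> S" using C(2)[OF S] by blast
    have "R0 (S \<otimes>\<^bsub>Z.\<L>\<^esub> (c \<odot>\<^bsub>Z.\<L>\<^esub> K)) (c \<odot>\<^bsub>D\<^esub> U)"
      using pair_span.smult[OF U(1), of c] S cl by (simp add: Z.L.smult_mult_right)
    moreover have "cnorm D (c \<odot>\<^bsub>D\<^esub> U) \<le> cmod c * C * cnorm Z.\<L> S"
      using R0_closed[OF U(1)] U(2) by (simp add: W.A.N_smult mult_left_mono mult.assoc)
    ultimately show "\<exists>U. R0 (S \<otimes>\<^bsub>Z.\<L>\<^esub> (c \<odot>\<^bsub>Z.\<L>\<^esub> K)) U \<and> cnorm D U \<le> cmod c * C * cnorm Z.\<L> S" by blast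
  qed (use C in simp)
qed

lemma R0_unique: "\<lbrakk>R0 K T; R0 K T'\<rbrakk> \<Longrightarrow> T = T'"
  by (rule P_cancel) (simp_all add: R0_P R0_apply)

lemma R0_mult:
  assumes KT: "R0 K T" and KT': "R0 K' T'"
  shows "R0 (K \<otimes>\<^bsub>Z.\<L>\<^esub> K') (T \<otimes>\<^bsub>D\<^esub> T')"
  using KT'
proof (induction rule: pair_span.induct)
  case zero
  show ?case using R0_closed[OF KT] pair_span.zero[of Z.\<L> D] by simp
next
  case (base i)
  then obtain x y where i: "i = (x, y)" "x \<in> carrier X" "y \<in> carrier X" by auto
  note K = R0_closed[OF KT]
  have Kx: "K x \<in> carrier X" using K i by (simp add: Z.adj_closed)
  have "R0 (rank_one X (K x) y) (t (K x) \<otimes>\<^bsub>D\<^esub> star D (t y))"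
    using pair_span.base[of "(K x, y)" "carrier X \<times> carrier X" Z.\<L> D
        "\<lambda>(x, y). rank_one X x y" "\<lambda>(x, y). t x \<otimes>\<^bsub>D\<^esub> star D (t y)"] Kx i by simp
  moreover have "T \<otimes>\<^bsub>D\<^esub> (t x \<otimes>\<^bsub>D\<^esub> star D (t y)) = t (K x) \<otimes>\<^bsub>D\<^esub> star D (t y)"
    using K i R0_apply[OF KT i(2)] by (simp flip: W.A.mult_assoc)
  ultimately show ?case using i K by (simp add: Z.rank_one_comp_left)
next
  case (add K1 T1 K2 T2)
  then show ?case
    using R0_closed[OF KT] R0_closed[OF add.hyps(1)] R0_closed[OF add.hyps(2)]
    by (simp add: Z.L.mult_r_distr W.A.mult_r_distr pair_span.add)
next
  case (smult K1 T1 c)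
  then show ?case
    using R0_closed[OF KT] R0_closed[OF smult.hyps(1)]
    by (simp add: Z.L.smult_mult_right W.A.smult_mult_right pair_span.smult)
qed

text \<open>For \<open>(K, T)\<close> in \<open>R0\<close>, the powers of \<open>T\<^sup>* T\<close> grow no faster than those of \<open>K\<^sup>* K\<close>, up to the
  constant factor from \<open>R0_left\<close>; hence the norm bound.\<close>

lemma R0_norm:
  assumes KT: "R0 K T"
  shows "cnorm D T \<le> cnorm Z.\<L> K"
proof -
  note c = R0_closed[OF KT]
  define k where "k = star Z.\<L> K \<otimes>\<^bsub>Z.\<L>\<^esub> K"
  define h where "h = star D T \<otimes>\<^bsub>D\<^esub> T"
  have kh: "R0 k h" unfolding k_def h_def by (intro R0_mult R0_star KT)
  have kc: "k \<in> carrier Z.\<L>" and hc: "h \<in> carrier D" using R0_closed[OF kh] by auto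
  \<comment> \<open>Iterated squaring: \<open>E j\<close> is the power 2^j of k and
    \<open>F j\<close> that of h. The latter are self-adjoint, so their norms are known
    exactly.\<close>
  define E where "E j = ((\<lambda>x. x \<otimes>\<^bsub>Z.\<L>\<^esub> x) ^^ j) k" for j :: nat
  define F where "F j = ((\<lambda>x. x \<otimes>\<^bsub>D\<^esub> x) ^^ j) h" for j :: nat
  have EF: "R0 (E j) (F j)" for j
    by (induction j) (auto simp: E_def F_def kh intro: R0_mult)
  have F: "star D (F j) = F j" for j
  proof (induction j)
    case 0
    show ?case using c by (simp add: F_def h_def W.A.star_mult)
  next
    case (Suc j)
    then show ?case using R0_closed[OF EF[of j]] by (simp add: F_def W.A.star_mult)
  qed
  have normF: "cnorm D (F j) = cnorm D h ^ (2 ^ j)" for j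
  proof (induction j)
    case 0
    show ?case by (simp add: F_def)
  next
    case (Suc j)
    have "cnorm D (F (Suc j)) = (cnorm D (F j))\<^sup>2"
      using W.A.cnorm_star[of "F j"] F[of j] R0_closed[OF EF[of j]] by (simp add: F_def)
    then show ?case using Suc by (simp flip: power_mult add: mult.commute)
  qed
  \<comment> \<open>One factor k is split off each power, so that \<open>R0_left\<close> for the
    fixed pair k, h applies with an S whose norm is at most the power 2^j - 1 of the norm of
    k.\<close>
  have Efact: "\<exists>S\<in>carrier Z.\<L>. E j = S \<otimes>\<^bsub>Z.\<L>\<^esub> k \<and> cnorm Z.\<L> S \<le> cnorm Z.\<L> k ^ (2 ^ j - 1) \<and>
      cnorm Z.\<L> (E j) \<le> cnorm Z.\<L> k ^ (2 ^ j)" for j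
  proof (induction j)
    case 0
    show ?case
      using kc Z.L.cnorm_one by (intro bexI[of _ "\<one>\<^bsub>Z.\<L>\<^esub>"]) (auto simp: E_def)
  next
    case (Suc j)
    then obtain S where S: "S \<in> carrier Z.\<L>" "E j = S \<otimes>\<^bsub>Z.\<L>\<^esub> k" "cnorm Z.\<L> S \<le> cnorm Z.\<L> k ^ (2 ^ j - 1)"
      "cnorm Z.\<L> (E j) \<le> cnorm Z.\<L> k ^ (2 ^ j)" by blast
    have Ej: "E j \<in> carrier Z.\<L>" using R0_closed[OF EF] by blast
    have nk: "0 \<le> cnorm Z.\<L> k" using kc by simp
    have ES: "E (Suc j) = E j \<otimes>\<^bsub>Z.\<L>\<^esub> E j" by (simp add: E_def)
    show ?case
    proof (intro bexI[of _ "E j \<otimes>\<^bsub>Z.\<L>\<^esub> S"] conjI)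
      show "E (Suc j) = E j \<otimes>\<^bsub>Z.\<L>\<^esub> S \<otimes>\<^bsub>Z.\<L>\<^esub> k"
        unfolding ES using S Ej kc by (simp add: Z.L.mult_assoc)
      have "cnorm Z.\<L> (E j \<otimes>\<^bsub>Z.\<L>\<^esub> S) \<le> cnorm Z.\<L> k ^ (2 ^ j) * cnorm Z.\<L> k ^ (2 ^ j - 1)"
        using S Ej nk by (intro order_trans[OF Z.L.cnorm_mult] mult_mono) auto
      also have "\<dots> = cnorm Z.\<L> k ^ (2 ^ Suc j - 1)" by (simp add: mult_2 flip: power_add)
      finally show "cnorm Z.\<L> (E j \<otimes>\<^bsub>Z.\<L>\<^esub> S) \<le> cnorm Z.\<L> k ^ (2 ^ Suc j - 1)" .
      have "cnorm Z.\<L> (E (Suc j)) \<le> cnorm Z.\<L> k ^ (2 ^ j) * cnorm Z.\<L> k ^ (2 ^ j)"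
        unfolding ES using S Ej nk by (intro order_trans[OF Z.L.cnorm_mult] mult_mono) auto
      also have "\<dots> = cnorm Z.\<L> k ^ (2 ^ Suc j)" by (simp add: mult_2 flip: power_add)
      finally show "cnorm Z.\<L> (E (Suc j)) \<le> cnorm Z.\<L> k ^ (2 ^ Suc j)" .
    qed (use S Ej in simp)
  qed
  obtain C where C: "C \<ge> 0" "\<And>S. S \<in> carrier Z.\<L> \<Longrightarrow> \<exists>U. R0 (S \<otimes>\<^bsub>Z.\<L>\<^esub> k) U \<and> cnorm D U \<le> C * cnorm Z.\<L> S"
    using R0_left[OF kh] by blast
  define x where "x = cnorm D h"
  define r where "r = cnorm Z.\<L> k"
  have x: "x \<ge> 0" and r: "r \<ge> 0" using kc hc by (simp_all add: x_def r_def)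
  have le: "x ^ (2 ^ j) \<le> C * r ^ (2 ^ j - 1)" for j
  proof -
    obtain S where S: "S \<in> carrier Z.\<L>" "E j = S \<otimes>\<^bsub>Z.\<L>\<^esub> k" "cnorm Z.\<L> S \<le> r ^ (2 ^ j - 1)"
      using Efact[of j] unfolding r_def by blast
    obtain U where U: "R0 (E j) U" "cnorm D U \<le> C * cnorm Z.\<L> S" using C(2)[OF S(1)] S(2) by auto
    have "x ^ (2 ^ j) = cnorm D (F j)" by (simp add: normF x_def)
    also have "F j = U" by (rule R0_unique[OF EF U(1)])
    also have "cnorm D U \<le> C * r ^ (2 ^ j - 1)" using U(2) mult_left_mono[OF S(3) C(1)] by linarith
    finally show ?thesis .
  qed
  have "x \<le> r"
  proof (rule ccontr)
    assume "\<not> x \<le> r"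
    then have xr: "r < x" by simp
    then have x0: "x > 0" using r by simp
    have "x \<le> C * (r / x) ^ (2 ^ j - 1)" for j :: nat
    proof -
      define n :: nat where "n = 2 ^ j - 1"
      have n: "2 ^ j = Suc n" by (simp add: n_def)
      have "x * x ^ n \<le> C * r ^ n" using le[of j] by (simp add: n)
      then have "x * x ^ n / x ^ n \<le> C * r ^ n / x ^ n" using x0 by (intro divide_right_mono) auto
      then show ?thesis using x0 by (simp add: power_divide n_def)
    qed
    moreover have "(\<lambda>j. C * (r / x) ^ (2 ^ j - 1 :: nat)) \<longlonglongrightarrow> C * 0"
    proof -
      have "strict_mono (\<lambda>k. 2 ^ k - 1 :: nat)"
        by (rule strict_monoI) (simp add: diff_less_mono)
      then have "((\<lambda>n. (r / x) ^ n) \<circ> (\<lambda>k. 2 ^ k - 1 :: nat)) \<longlonglongrightarrow> 0"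
        using xr r by (intro LIMSEQ_subseq_LIMSEQ LIMSEQ_power_zero) auto
      then show ?thesis by (intro tendsto_intros) (simp add: o_def)
    qed
    ultimately have "x \<le> C * 0" by (intro LIMSEQ_le_const) auto
    then show False using x0 by simp
  qed
  then have "(cnorm D T)\<^sup>2 \<le> (cnorm Z.\<L> K)\<^sup>2"
    using c by (simp add: x_def r_def h_def k_def W.A.cnorm_star Z.L.cnorm_star)
  then show ?thesis by (rule power2_le_imp_le) (use c in simp)
qed

text \<open>By \<open>R0_norm\<close> the graph \<open>R0\<close> extends to its closure. Each
  algebraic property of t^(1) holds for pairs in \<open>R0\<close> and passes to limits by
  exhibiting one approximating sequence of pairs and invoking \<open>uniq\<close>.\<close>

lemma ex_compact_hom:
  obtains t1 where "cstar_hom (compact_ops A X) D t1"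
    "\<And>x y. \<lbrakk>x \<in> carrier X; y \<in> carrier X\<rbrakk> \<Longrightarrow> t1 (rank_one X x y) = t x \<otimes>\<^bsub>D\<^esub> star D (t y)"
    "\<And>K. K \<in> carrier (compact_ops A X) \<Longrightarrow> t1 K \<in> P"
    "\<And>K z. \<lbrakk>K \<in> carrier (compact_ops A X); z \<in> carrier X\<rbrakk> \<Longrightarrow> t1 K \<otimes>\<^bsub>D\<^esub> t z = t (K z)"
proof -
  let ?H = "carrier (compact_ops A X)"
  have img: "(\<lambda>(x, y). rank_one X x y) ` (carrier X \<times> carrier X) = Z.rank_ones" by auto
  have H: "norm_closure Z.\<L> (cnorm Z.\<L>) (cspan Z.\<L> ((\<lambda>(x, y). rank_one X x y) ` (carrier X \<times> carrier X))) = ?H"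
    unfolding img Z.compact_carrier by (simp add: Z.L.nclspan_def)
  have R: "\<exists>t1. \<forall>K\<in>?H. (\<exists>\<sigma> \<tau>. (\<forall>n. R0 (\<sigma> n) (\<tau> n)) \<and> Z.L.nlim \<sigma> K \<and> W.A.nlim \<tau> (t1 K)) \<and>
      (\<forall>T \<sigma> \<tau>. (\<forall>n. R0 (\<sigma> n) (\<tau> n)) \<longrightarrow> Z.L.nlim \<sigma> K \<longrightarrow> W.A.nlim \<tau> T \<longrightarrow> t1 K = T)"
    by (rule pair_span_extend[OF Z.L.normed_cvs_axioms W.A.normed_cvs_axioms W.A.complete _ _ R0_norm,
          of "carrier X \<times> carrier X" "\<lambda>(x, y). rank_one X x y" "\<lambda>(x, y). t x \<otimes>\<^bsub>D\<^esub> star D (t y)", unfolded H])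
      (auto simp: Z.rank_one_adj)
  from R obtain t1 where T: "\<forall>K\<in>?H. (\<exists>\<sigma> \<tau>. (\<forall>n. R0 (\<sigma> n) (\<tau> n)) \<and> Z.L.nlim \<sigma> K \<and> W.A.nlim \<tau> (t1 K)) \<and>
      (\<forall>T \<sigma> \<tau>. (\<forall>n. R0 (\<sigma> n) (\<tau> n)) \<longrightarrow> Z.L.nlim \<sigma> K \<longrightarrow> W.A.nlim \<tau> T \<longrightarrow> t1 K = T)" ..
  have t1: "\<exists>\<sigma> \<tau>. (\<forall>n. R0 (\<sigma> n) (\<tau> n)) \<and> Z.L.nlim \<sigma> K \<and> W.A.nlim \<tau> (t1 K)" if "K \<in> ?H" for K
    using bspec[OF T that] ..
  have uniq: "t1 K = T" if K: "K \<in> ?H" "\<And>n. R0 (\<sigma> n) (\<tau> n)" "Z.L.nlim \<sigma> K" "W.A.nlim \<tau> T" for K T \<sigma> \<tau>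
    using conjunct2[OF bspec[OF T K(1)]] K(2-) by blast
  have sub: "\<And>K. K \<in> ?H \<Longrightarrow> K \<in> carrier Z.\<L>" using Z.compact_sub_adj by blast
  have alg: "cstar_subalgebra ?H Z.\<L>" by (rule Z.compact_subalgebra)
  note Hm = alg[unfolded cstar_subalgebra_def]
  note Hsub = Z.L.submoduleD[OF conjunct1[OF Hm]]
  show thesis
  proof
    show "t1 K \<in> P" if K: "K \<in> ?H" for K
    proof -
      obtain \<sigma> \<tau> where "\<forall>n. R0 (\<sigma> n) (\<tau> n)" "W.A.nlim \<tau> (t1 K)" using t1[OF K] by blast
      then show ?thesis using W.A.nclosedD[OF P_nclosed] R0_P by blast
    qed
    show "t1 (rank_one X x y) = t x \<otimes>\<^bsub>D\<^esub> star D (t y)" if xy: "x \<in> carrier X" "y \<in> carrier X" for x y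
    proof (rule uniq)
      show "rank_one X x y \<in> ?H"
        unfolding Z.compact_carrier using Z.L.nclspan_superset[OF Z.rank_ones_adj] xy by blast
      show "R0 (rank_one X x y) (t x \<otimes>\<^bsub>D\<^esub> star D (t y))"
        using pair_span.base[of "(x, y)" "carrier X \<times> carrier X" Z.\<L> D
        "\<lambda>(x, y). rank_one X x y" "\<lambda>(x, y). t x \<otimes>\<^bsub>D\<^esub> star D (t y)"] xy by simp
      show "Z.L.nlim (\<lambda>n. rank_one X x y) (rank_one X x y)" by (intro Z.L.nlim_const Z.rank_one_adj xy)
      show "W.A.nlim (\<lambda>n. t x \<otimes>\<^bsub>D\<^esub> star D (t y)) (t x \<otimes>\<^bsub>D\<^esub> star D (t y))"
        by (intro W.A.nlim_const) (use xy in auto)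
    qed
    show "t1 K \<otimes>\<^bsub>D\<^esub> t z = t (K z)" if K: "K \<in> ?H" and z: "z \<in> carrier X" for K z
    proof -
      obtain \<sigma> \<tau> where \<sigma>: "\<forall>n. R0 (\<sigma> n) (\<tau> n)" "Z.L.nlim \<sigma> K" "W.A.nlim \<tau> (t1 K)" using t1[OF K] by blast
      have "W.A.nlim (\<lambda>n. \<tau> n \<otimes>\<^bsub>D\<^esub> t z) (t1 K \<otimes>\<^bsub>D\<^esub> t z)"
        by (intro W.A.nlim_mult W.A.nlim_const \<sigma> t_closed z)
      moreover have "bdd_linear Z.\<L> (cnorm Z.\<L>) D (cnorm D) (\<lambda>K. t (K z))"
      proof (rule bdd_linearI[of _ _ _ _ "hnorm A X z"])
        fix S assume S: "S \<in> carrier Z.\<L>"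
        show "cnorm D (t (S z)) \<le> hnorm A X z * cnorm Z.\<L> S"
          using order_trans[OF t_norm Z.adj_norm_apply] S z by (simp add: Z.adj_closed mult.commute)
      qed (use z in \<open>simp_all add: Z.adj_closed t_add t_smult\<close>)
      then have "W.A.nlim (\<lambda>n. t (\<sigma> n z)) (t (K z))"
        by (rule bdd_linear_nlim[OF Z.L.normed_cvs_axioms W.A.normed_cvs_axioms _ \<sigma>(2)])
      moreover have "\<tau> n \<otimes>\<^bsub>D\<^esub> t z = t (\<sigma> n z)" for n using R0_apply \<sigma>(1) z by blast
      ultimately show ?thesis using W.A.nlim_unique by simp
    qed
    show "cstar_hom (compact_ops A X) D t1"
      unfolding cstar_hom_def Z.compact_simps
    proof (intro conjI ballI allI)
      show "t1 \<in> ?H \<rightarrow> carrier D" using t1 W.A.nlimD(2) by blast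
      fix K assume K: "K \<in> ?H"
      obtain \<sigma> \<tau> where \<sigma>: "\<And>n. R0 (\<sigma> n) (\<tau> n)" "Z.L.nlim \<sigma> K" "W.A.nlim \<tau> (t1 K)" using t1[OF K] by blast
      show "t1 (c \<odot>\<^bsub>Z.\<L>\<^esub> K) = c \<odot>\<^bsub>D\<^esub> t1 K" for c
        by (rule uniq[of _ "\<lambda>n. c \<odot>\<^bsub>Z.\<L>\<^esub> \<sigma> n" "\<lambda>n. c \<odot>\<^bsub>D\<^esub> \<tau> n"])
          (intro Hsub K pair_span.smult \<sigma> Z.L.nlim_smult W.A.nlim_smult)+
      show "t1 (star Z.\<L> K) = star D (t1 K)"
        by (rule uniq[of _ "\<lambda>n. star Z.\<L> (\<sigma> n)" "\<lambda>n. star D (\<tau> n)"])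
          (use Hm K in \<open>auto intro!: R0_star \<sigma> Z.L.nlim_star W.A.nlim_star\<close>)
      fix S assume S: "S \<in> ?H"
      obtain \<sigma>' \<tau>' where \<sigma>': "\<And>n. R0 (\<sigma>' n) (\<tau>' n)" "Z.L.nlim \<sigma>' S" "W.A.nlim \<tau>' (t1 S)" using t1[OF S] by blast
      show "t1 (K \<oplus>\<^bsub>Z.\<L>\<^esub> S) = t1 K \<oplus>\<^bsub>D\<^esub> t1 S"
        by (rule uniq[of _ "\<lambda>n. \<sigma> n \<oplus>\<^bsub>Z.\<L>\<^esub> \<sigma>' n" "\<lambda>n. \<tau> n \<oplus>\<^bsub>D\<^esub> \<tau>' n"])
          (intro Hsub K S pair_span.add \<sigma> \<sigma>' Z.L.nlim_add W.A.nlim_add)+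
      show "t1 (K \<otimes>\<^bsub>Z.\<L>\<^esub> S) = t1 K \<otimes>\<^bsub>D\<^esub> t1 S"
        by (rule uniq[of _ "\<lambda>n. \<sigma> n \<otimes>\<^bsub>Z.\<L>\<^esub> \<sigma>' n" "\<lambda>n. \<tau> n \<otimes>\<^bsub>D\<^esub> \<tau>' n"])
          (use Hm K S in \<open>auto intro!: R0_mult \<sigma> \<sigma>' Z.L.nlim_mult W.A.nlim_mult\<close>)
    qed
  qed
qed

end

section \<open>Correspondences, tensor products and covariance\<close>

text \<open>The coefficient algebras on the left and on the right may differ, as in Z \<otimes> B,
  where A acts on the Hilbert B-module B through \<pi>. Correspondences are the case of equal
  algebras.\<close>

locale left_action = A: cstar_algebra A + Y: hilbert_module B Y
  for A :: "('a, 'm) cstar_algebra_scheme" and B :: "('b, 'p) cstar_algebra_scheme"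
    and Y :: "('b, 'y, 'q) hilbert_module_scheme" +
  fixes \<phi> :: "'a \<Rightarrow> 'y \<Rightarrow> 'y"
  assumes act_hom: "cstar_hom A (adjointable_ops B Y) (\<lambda>a. \<lambda>y\<in>carrier Y. \<phi> a y)"
begin

abbreviation "op a \<equiv> (\<lambda>y\<in>carrier Y. \<phi> a y)"

lemma op_closed: "a \<in> carrier A \<Longrightarrow> op a \<in> carrier Y.\<L>"
  using cstar_homD(1)[OF act_hom] .

lemma act_closed [simp, intro]: "\<lbrakk>a \<in> carrier A; y \<in> carrier Y\<rbrakk> \<Longrightarrow> \<phi> a y \<in> carrier Y"
  using Y.adj_closed[OF op_closed] by simp

lemma act_add: "\<lbrakk>a \<in> carrier A; y \<in> carrier Y; z \<in> carrier Y\<rbrakk> \<Longrightarrow> \<phi> a (y \<oplus>\<^bsub>Y\<^esub> z) = \<phi> a y \<oplus>\<^bsub>Y\<^esub> \<phi> a z"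
  using Y.adj_add[OF op_closed] by simp

lemma act_smult: "\<lbrakk>a \<in> carrier A; y \<in> carrier Y\<rbrakk> \<Longrightarrow> \<phi> a (c \<odot>\<^bsub>Y\<^esub> y) = c \<odot>\<^bsub>Y\<^esub> \<phi> a y"
  using Y.adj_smult[OF op_closed] by simp

lemma act_ract: "\<lbrakk>a \<in> carrier A; y \<in> carrier Y; b \<in> carrier B\<rbrakk> \<Longrightarrow> \<phi> a (ract Y y b) = ract Y (\<phi> a y) b"
  using Y.adj_ract[OF op_closed] by simp

lemma act_add_left: "\<lbrakk>a \<in> carrier A; b \<in> carrier A; y \<in> carrier Y\<rbrakk> \<Longrightarrow> \<phi> (a \<oplus>\<^bsub>A\<^esub> b) y = \<phi> a y \<oplus>\<^bsub>Y\<^esub> \<phi> b y"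
  using arg_cong[OF cstar_homD(2)[OF act_hom], of a b "\<lambda>T. T y"] by simp

lemma act_smult_left: "\<lbrakk>a \<in> carrier A; y \<in> carrier Y\<rbrakk> \<Longrightarrow> \<phi> (c \<odot>\<^bsub>A\<^esub> a) y = c \<odot>\<^bsub>Y\<^esub> \<phi> a y"
  using arg_cong[OF cstar_homD(3)[OF act_hom], of a "\<lambda>T. T y" c] by simp

lemma act_mult: "\<lbrakk>a \<in> carrier A; b \<in> carrier A; y \<in> carrier Y\<rbrakk> \<Longrightarrow> \<phi> (a \<otimes>\<^bsub>A\<^esub> b) y = \<phi> a (\<phi> b y)"
  using arg_cong[OF cstar_homD(4)[OF act_hom], of a b "\<lambda>T. T y"] by simp

lemma act_norm: "\<lbrakk>a \<in> carrier A; y \<in> carrier Y\<rbrakk> \<Longrightarrow> hnorm B Y (\<phi> a y) \<le> cnorm A a * hnorm B Y y"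
proof -
  assume a: "a \<in> carrier A" and y: "y \<in> carrier Y"
  have "hnorm B Y (op a y) \<le> cnorm Y.\<L> (op a) * hnorm B Y y"
    by (rule Y.adj_norm_apply[OF op_closed[OF a] y])
  also have "\<dots> \<le> cnorm A a * hnorm B Y y"
    by (intro mult_right_mono cstar_hom_norm[OF A.cstar_algebra_axioms Y.L.cstar_algebra_axioms act_hom] a)
      (use y in simp)
  finally show ?thesis using y by simp
qed

lemma act_bdd: "a \<in> carrier A \<Longrightarrow> bdd_linear Y (hnorm B Y) Y (hnorm B Y) (\<phi> a)"
  by (rule bdd_linearI[of _ _ _ _ "cnorm A a"]) (auto simp: act_add act_smult act_norm)

lemma act_bdd_left: "y \<in> carrier Y \<Longrightarrow> bdd_linear A (cnorm A) Y (hnorm B Y) (\<lambda>a. \<phi> a y)"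
  by (rule bdd_linearI[of _ _ _ _ "hnorm B Y y"])
    (auto simp: act_add_left act_smult_left act_norm mult.commute)

end

sublocale correspondence \<subseteq> C: left_action A A X "lact X"
  by unfold_locales (use left_hom in \<open>simp add: left_op_def[abs_def]\<close>)

lemma (in correspondence) nondegenerate': 
  assumes "x \<in> carrier X"
  obtains a y where "a \<in> carrier A" "y \<in> carrier X" "x = lact X a y"
  using assms nondegenerate by blast

locale tensor = X: hilbert_module A X + L: left_action A B Y \<phi> + W: hilbert_module B W
  for A :: "('a, 'm) cstar_algebra_scheme" and X :: "('a, 'x, 'n) hilbert_module_scheme"
    and \<phi> :: "'a \<Rightarrow> 'y \<Rightarrow> 'y" and B :: "('b, 'p) cstar_algebra_scheme"
    and Y :: "('b, 'y, 'q) hilbert_module_scheme" and W :: "('b, 'w, 'r) hilbert_module_scheme" +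
  fixes \<tau> :: "'x \<Rightarrow> 'y \<Rightarrow> 'w"
  assumes interior_tensor: "interior_tensor A X \<phi> B Y W \<tau>"
begin

lemma \<tau>_closed [simp, intro]: "\<lbrakk>x \<in> carrier X; y \<in> carrier Y\<rbrakk> \<Longrightarrow> \<tau> x y \<in> carrier W"
  and \<tau>_balanced: "\<lbrakk>x \<in> carrier X; a \<in> carrier A; y \<in> carrier Y\<rbrakk> \<Longrightarrow> \<tau> (ract X x a) y = \<tau> x (\<phi> a y)"
  and \<tau>_ract: "\<lbrakk>x \<in> carrier X; y \<in> carrier Y; b \<in> carrier B\<rbrakk> \<Longrightarrow> ract W (\<tau> x y) b = \<tau> x (ract Y y b)"
  and \<tau>_inner: "\<lbrakk>x \<in> carrier X; y \<in> carrier Y; x' \<in> carrier X; y' \<in> carrier Y\<rbrakk> \<Longrightarrow>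
      hinner W (\<tau> x y) (\<tau> x' y') = hinner Y y (\<phi> (hinner X x x') y')"
  and dense: "norm_closure W (hnorm B W) (cspan W {\<tau> x y |x y. x \<in> carrier X \<and> y \<in> carrier Y}) = carrier W"
  using interior_tensor unfolding interior_tensor_def by simp_all

lemma \<tau>_add_left: "\<lbrakk>x \<in> carrier X; x' \<in> carrier X; y \<in> carrier Y\<rbrakk> \<Longrightarrow> \<tau> (x \<oplus>\<^bsub>X\<^esub> x') y = \<tau> x y \<oplus>\<^bsub>W\<^esub> \<tau> x' y"
  and \<tau>_add_right: "\<lbrakk>x \<in> carrier X; y \<in> carrier Y; y' \<in> carrier Y\<rbrakk> \<Longrightarrow> \<tau> x (y \<oplus>\<^bsub>Y\<^esub> y') = \<tau> x y \<oplus>\<^bsub>W\<^esub> \<tau> x y'"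
  and \<tau>_smult_left: "\<lbrakk>x \<in> carrier X; y \<in> carrier Y\<rbrakk> \<Longrightarrow> \<tau> (c \<odot>\<^bsub>X\<^esub> x) y = c \<odot>\<^bsub>W\<^esub> \<tau> x y"
  and \<tau>_smult_right: "\<lbrakk>x \<in> carrier X; y \<in> carrier Y\<rbrakk> \<Longrightarrow> \<tau> x (c \<odot>\<^bsub>Y\<^esub> y) = c \<odot>\<^bsub>W\<^esub> \<tau> x y"
  using interior_tensor unfolding interior_tensor_def by simp_all

lemma \<tau>_norm:
  assumes "x \<in> carrier X" "y \<in> carrier Y"
  shows "hnorm B W (\<tau> x y) \<le> hnorm A X x * hnorm B Y y"
proof -
  have "(hnorm B W (\<tau> x y))\<^sup>2 \<le> hnorm B Y y * (cnorm A (hinner X x x) * hnorm B Y y)"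
    using assms by (simp only: W.hnorm_sq \<tau>_closed \<tau>_inner)
      (intro order_trans[OF L.Y.cauchy_schwarz] mult_left_mono L.act_norm; simp)
  also have "\<dots> = (hnorm A X x * hnorm B Y y)\<^sup>2"
    using assms by (simp add: power_mult_distrib power2_eq_square flip: X.hnorm_sq)
  finally show ?thesis by (rule power2_le_imp_le) (use assms in simp)
qed

lemma \<tau>_bdd_left: "y \<in> carrier Y \<Longrightarrow> bdd_linear X (hnorm A X) W (hnorm B W) (\<lambda>x. \<tau> x y)"
  by (rule bdd_linearI[of _ _ _ _ "hnorm B Y y"])
    (auto simp: \<tau>_add_left \<tau>_smult_left \<tau>_norm mult.commute)

lemma \<tau>_bdd_right: "x \<in> carrier X \<Longrightarrow> bdd_linear Y (hnorm B Y) W (hnorm B W) (\<tau> x)"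
  by (rule bdd_linearI[of _ _ _ _ "hnorm A X x"]) (auto simp: \<tau>_add_right \<tau>_smult_right \<tau>_norm)

lemma elements_carrier: "{\<tau> x y |x y. x \<in> carrier X \<and> y \<in> carrier Y} \<subseteq> carrier W"
  by auto

lemma bdd_agree:
  assumes "normed_cvs M N" "bdd_linear W (hnorm B W) M N f" "bdd_linear W (hnorm B W) M N g"
    and "\<And>x y. \<lbrakk>x \<in> carrier X; y \<in> carrier Y\<rbrakk> \<Longrightarrow> f (\<tau> x y) = g (\<tau> x y)" and "w \<in> carrier W"
  shows "f w = g w"
  by (rule bdd_linear_agree[OF W.X.normed_cvs_axioms assms(1-3) elements_carrier])
    (use assms(4,5) dense in auto)

lemma mod_rep_agree_tensor:
  assumes f: "mod_rep B W D V \<pi> f" and g: "mod_rep B W D V \<pi>' g"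
    and "\<And>x y. \<lbrakk>x \<in> carrier X; y \<in> carrier Y\<rbrakk> \<Longrightarrow> f (\<tau> x y) = g (\<tau> x y)" "w \<in> carrier W"
  shows "f w = g w"
  by (rule mod_rep_agree[OF f g elements_carrier _ dense]) (use assms(3,4) in auto)

end

lemma tensorI: "interior_tensor A X \<phi> B Y W \<tau> \<Longrightarrow> tensor A X \<phi> B Y W \<tau>"
  unfolding tensor_def tensor_axioms_def left_action_def left_action_axioms_def
  by (auto simp: interior_tensor_def hilbert_module_def)

lemma corr_tensorI: "corr_tensor A X Y W \<tau> \<Longrightarrow> tensor A X (lact Y) A Y W \<tau>"
  unfolding corr_tensor_def by (blast intro: tensorI)

section \<open>Representations, covariance and products of representations\<close>

locale corr_rep = alg_rep A X D \<pi> t + C: correspondence A X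
  for A :: "('a, 'm) cstar_algebra_scheme" and X :: "('a, 'x, 'n) correspondence_scheme"
    and D :: "('d, 'p) cstar_algebra_scheme" and \<pi> :: "'a \<Rightarrow> 'd" and t :: "'x \<Rightarrow> 'd" +
  assumes left: "\<lbrakk>a \<in> carrier A; x \<in> carrier X\<rbrakk> \<Longrightarrow> \<pi> a \<otimes>\<^bsub>D\<^esub> t x = t (lact X a x)"

lemma corr_repD:
  assumes "corr_rep A X D \<pi> t"
  shows "mod_rep A X D (alg_corr D) \<pi> t" "correspondence A X" "cstar_algebra D"
    "\<lbrakk>a \<in> carrier A; x \<in> carrier X\<rbrakk> \<Longrightarrow> \<pi> a \<otimes>\<^bsub>D\<^esub> t x = t (lact X a x)"
proof -
  interpret corr_rep A X D \<pi> t by fact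
  show "mod_rep A X D (alg_corr D) \<pi> t" "correspondence A X" "cstar_algebra D"
    "\<lbrakk>a \<in> carrier A; x \<in> carrier X\<rbrakk> \<Longrightarrow> \<pi> a \<otimes>\<^bsub>D\<^esub> t x = t (lact X a x)"
    by (rule mod_rep_axioms C.correspondence_axioms W.A.cstar_algebra_axioms left; assumption)+
qed

lemma corr_repI:
  assumes "mod_rep A X D (alg_corr D) \<pi> t" "correspondence A X"
    "\<And>a x. \<lbrakk>a \<in> carrier A; x \<in> carrier X\<rbrakk> \<Longrightarrow> \<pi> a \<otimes>\<^bsub>D\<^esub> t x = t (lact X a x)"
  shows "corr_rep A X D \<pi> t"
  using assms by (simp add: corr_rep_def corr_rep_axioms_def alg_rep_def)

lemma representation_iff:
  assumes "correspondence A X" "cstar_algebra D"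
  shows "representation A X D \<pi> t \<longleftrightarrow> corr_rep A X D \<pi> t"
proof
  assume r: "representation A X D \<pi> t"
  interpret C: correspondence A X by fact
  interpret D: cstar_algebra D by fact
  interpret DD: hilbert_module D "alg_corr D" by (rule D.hilbert_alg_corr)
  show "corr_rep A X D \<pi> t"
  proof (rule corr_repI)
    show "mod_rep A X D (alg_corr D) \<pi> t"
      by unfold_locales (use r in \<open>auto simp: representation_def\<close>)
  qed (use r assms in \<open>auto simp: representation_def\<close>)
next
  assume "corr_rep A X D \<pi> t"
  then interpret corr_rep A X D \<pi> t .
  show "representation A X D \<pi> t"
    unfolding representation_def by (simp add: hom t_add t_smult left t_inner Pi_iff)
qed

definition cov_rep ::
  "('a, 'm) cstar_algebra_scheme \<Rightarrow> ('a, 'x, 'n) correspondence_scheme \<Rightarrow> ('d, 'p) cstar_algebra_scheme \<Rightarrow>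
    ('a \<Rightarrow> 'd) \<Rightarrow> ('x \<Rightarrow> 'd) \<Rightarrow> bool" where
  "cov_rep A X D \<pi> t \<longleftrightarrow> corr_rep A X D \<pi> t \<and> (\<forall>a\<in>carrier A. \<pi> a \<in> rep_compacts D X t)"

text \<open>If \<pi> factors through t^(1), continuity puts the values of t^(1) on compact operators
  into \<open>P\<close>. Conversely, \<pi>(a) and the image of the operator of a both lie in
  \<open>P\<close> and have the same products with t(X), so \<open>P_cancel\<close> identifies
  them.\<close>

lemma covariant_representation_iff:
  assumes "correspondence A X" "cstar_algebra D"
  shows "covariant_representation A X D \<pi> t \<longleftrightarrow> cov_rep A X D \<pi> t"
proof (cases "corr_rep A X D \<pi> t")
  case False
  then show ?thesis
    using representation_iff[OF assms, of \<pi> t] by (simp add: covariant_representation_def cov_rep_def)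
next
  case True
  then interpret corr_rep A X D \<pi> t .
  have lop: "left_op X a \<in> carrier (compact_ops A X)" if "a \<in> carrier A" for a
    using C.left_compact that by blast
  show ?thesis
  proof
    assume "covariant_representation A X D \<pi> t"
    then obtain t1 where t1: "cstar_hom (compact_ops A X) D t1"
        "\<And>x y. \<lbrakk>x \<in> carrier X; y \<in> carrier X\<rbrakk> \<Longrightarrow> t1 (rank_one X x y) = t x \<otimes>\<^bsub>D\<^esub> star D (t y)"
        "\<And>a. a \<in> carrier A \<Longrightarrow> \<pi> a = t1 (left_op X a)"
      unfolding covariant_representation_def by blast
    note hom1 = cstar_homD[OF t1(1), unfolded Z.compact_simps]
    let ?H = "carrier (compact_ops A X)"
    have sub: "submodule ?H complex_ring Z.\<L>" and cl: "Z.L.nclosed ?H"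
      unfolding Z.compact_carrier
      using Z.L.nclspan_submodule[OF Z.rank_ones_adj] Z.L.nclspan_closed[OF Z.rank_ones_adj] by auto
    note s = Z.L.submoduleD[OF sub]
    \<comment> \<open>Membership in ?H is part of the induction, since t1 is known to be a
      homomorphism on the compact operators only.\<close>
    have "K \<in> ?H \<and> t1 K \<in> P" if "K \<in> Z.L.nclspan Z.rank_ones" for K
      using that
    proof (rule Z.L.nclspan_induct[OF _ Z.rank_ones_adj])
      fix K assume "K \<in> Z.rank_ones"
      then show "K \<in> ?H \<and> t1 K \<in> P"
        using Z.L.nclspan_superset[OF Z.rank_ones_adj] t1(2) gen_in_P
        by (auto simp: Z.compact_carrier)
    next
      have "t1 (0 \<odot>\<^bsub>Z.\<L>\<^esub> \<zero>\<^bsub>Z.\<L>\<^esub>) = 0 \<odot>\<^bsub>D\<^esub> t1 \<zero>\<^bsub>Z.\<L>\<^esub>" by (rule hom1(3)[OF s(2)])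
      then have "t1 \<zero>\<^bsub>Z.\<L>\<^esub> = \<zero>\<^bsub>D\<^esub>" using hom1(1)[OF s(2)] by simp
      then show "\<zero>\<^bsub>Z.\<L>\<^esub> \<in> ?H \<and> t1 \<zero>\<^bsub>Z.\<L>\<^esub> \<in> P" using s(2) W.A.submoduleD(2)[OF P_sub] by simp
    next
      fix \<sigma> K assume \<sigma>: "\<And>n. \<sigma> n \<in> ?H \<and> t1 (\<sigma> n) \<in> P" "Z.L.nlim \<sigma> K"
      have K: "K \<in> ?H" by (rule Z.L.nclosedD[OF cl _ \<sigma>(2)]) (use \<sigma> in blast)
      have "W.A.nlim (\<lambda>n. t1 (\<sigma> n)) (t1 K)"
      proof (rule W.A.nlimI)
        fix n
        have "t1 (\<sigma> n) \<ominus>\<^bsub>D\<^esub> t1 K = t1 (\<sigma> n \<ominus>\<^bsub>Z.\<L>\<^esub> K)"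
          using \<sigma>(1)[of n] K hom1 s Z.L.nlimD(1,2)[OF \<sigma>(2)]
          by (simp add: W.A.minus_eq_smult Z.L.minus_eq_smult)
        moreover have "\<sigma> n \<ominus>\<^bsub>Z.\<L>\<^esub> K \<in> ?H"
          using Z.L.submodule_minus[OF sub] \<sigma>(1) K by blast
        ultimately show "cnorm D (t1 (\<sigma> n) \<ominus>\<^bsub>D\<^esub> t1 K) \<le> cnorm Z.\<L> (\<sigma> n \<ominus>\<^bsub>Z.\<L>\<^esub> K)"
          using cstar_hom_norm[OF Z.compact_cstar W.A.cstar_algebra_axioms t1(1), of "\<sigma> n \<ominus>\<^bsub>Z.\<L>\<^esub> K"]
          by (simp add: Z.compact_simps)
        show "t1 (\<sigma> n) \<in> carrier D" using \<sigma>(1)[of n] P_carrier by blast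
      next
        show "(\<lambda>n. cnorm Z.\<L> (\<sigma> n \<ominus>\<^bsub>Z.\<L>\<^esub> K)) \<longlonglongrightarrow> 0" by (rule Z.L.nlimD(3)[OF \<sigma>(2)])
        show "t1 K \<in> carrier D" by (rule hom1(1)[OF K])
      qed
      then have "t1 K \<in> P" by (rule W.A.nclosedD[OF P_nclosed, rotated]) (use \<sigma>(1) in blast)
      then show "K \<in> ?H \<and> t1 K \<in> P" using K by blast
    qed (use s hom1 W.A.submoduleD[OF P_sub] in auto)
    then have "t1 (left_op X a) \<in> P" if "a \<in> carrier A" for a
      using lop[OF that] unfolding Z.compact_carrier by blast
    then show "cov_rep A X D \<pi> t"
      unfolding cov_rep_def using True t1(3) by simp
  next
    assume c: "cov_rep A X D \<pi> t"
    obtain t1 where t1: "cstar_hom (compact_ops A X) D t1"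
      "\<And>x y. \<lbrakk>x \<in> carrier X; y \<in> carrier X\<rbrakk> \<Longrightarrow> t1 (rank_one X x y) = t x \<otimes>\<^bsub>D\<^esub> star D (t y)"
      "\<And>K. K \<in> carrier (compact_ops A X) \<Longrightarrow> t1 K \<in> P"
      "\<And>K z. \<lbrakk>K \<in> carrier (compact_ops A X); z \<in> carrier X\<rbrakk> \<Longrightarrow> t1 K \<otimes>\<^bsub>D\<^esub> t z = t (K z)"
      using ex_compact_hom by blast
    have "\<pi> a = t1 (left_op X a)" if a: "a \<in> carrier A" for a
    proof (rule P_cancel)
      show "\<pi> a \<in> P" using c a by (simp add: cov_rep_def)
      show "t1 (left_op X a) \<in> P" by (rule t1(3)[OF lop[OF a]])
      show "\<pi> a \<otimes>\<^bsub>D\<^esub> t z = t1 (left_op X a) \<otimes>\<^bsub>D\<^esub> t z" if "z \<in> carrier X" for z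
        using t1(4)[OF lop[OF a] that] left[OF a that] that by (simp add: left_op_def)
    qed
    then show "covariant_representation A X D \<pi> t"
      unfolding covariant_representation_def
      using representation_iff[OF assms] True t1(1,2) by blast
  qed
qed

lemma hilbert_moduleD:
  assumes "hilbert_module A X"
  shows "cstar_algebra A" "normed_cvs X (hnorm A X)"
proof -
  interpret hilbert_module A X by fact
  show "cstar_algebra A" "normed_cvs X (hnorm A X)"
    by (rule A.cstar_algebra_axioms X.normed_cvs_axioms)+
qed

lemma mod_repD:
  assumes "mod_rep A Z D W \<pi> f"
  shows "hilbert_module A Z" "hilbert_module D W" "cstar_hom A D \<pi>"
  using assms by (simp_all add: mod_rep_def mod_rep_axioms_def)

lemma mod_rep_mult_bdd:
  assumes "mod_rep A Z D (alg_corr D) \<pi> f" "d \<in> carrier D"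
  shows "bdd_linear Z (hnorm A Z) D (cnorm D) (\<lambda>z. f z \<otimes>\<^bsub>D\<^esub> d)"
    and "bdd_linear Z (hnorm A Z) D (cnorm D) (\<lambda>z. d \<otimes>\<^bsub>D\<^esub> f z)"
proof -
  interpret D: cstar_algebra D using hilbert_moduleD(1)[OF mod_repD(2)[OF assms(1)]] .
  interpret f: alg_rep A Z D \<pi> f using assms(1) by (simp add: alg_rep_def)
  note n = D.normed_cvs_axioms f.Z.X.normed_cvs_axioms
  show "bdd_linear Z (hnorm A Z) D (cnorm D) (\<lambda>z. f z \<otimes>\<^bsub>D\<^esub> d)"
    by (rule bdd_linear_comp[OF f.t_bdd D.mult_bdd(2)[OF assms(2)] n])
  show "bdd_linear Z (hnorm A Z) D (cnorm D) (\<lambda>z. d \<otimes>\<^bsub>D\<^esub> f z)"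
    by (rule bdd_linear_comp[OF f.t_bdd D.mult_bdd(1)[OF assms(2)] n])
qed

text \<open>The map z \<otimes> x \<mapsto> f(z) t(x) preserves inner products because
  \<pi>(\<langle>z, z'\<rangle>) t(x') = t(\<langle>z, z'\<rangle> x'). With f a representation in D
  this is the product of two representations.\<close>

lemma ex_product:
  assumes T: "interior_tensor A Z (lact X) A X T \<tau>" and f: "mod_rep A Z D W \<pi> f"
    and t: "corr_rep A X D \<pi> t"
  shows "\<exists>h. mod_rep A T D W \<pi> h \<and>
    (\<forall>z\<in>carrier Z. \<forall>x\<in>carrier X. h (\<tau> z x) = ract W (f z) (t x))"
proof -
  interpret T: tensor A Z "lact X" A X T \<tau> by (rule tensorI[OF T])
  interpret f: mod_rep A Z D W \<pi> f by fact
  interpret t: corr_rep A X D \<pi> t by fact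
  show ?thesis
  proof (rule mod_rep_extend[where s = \<tau> and g = "\<lambda>z x. ract W (f z) (t x)"])
    show "hilbert_module A T" "hilbert_module D W" "cstar_hom A D \<pi>"
      by (rule T.W.hilbert_module_axioms f.W.hilbert_module_axioms f.hom)+
    fix z x z' x' assume zx: "z \<in> carrier Z" "x \<in> carrier X" "z' \<in> carrier Z" "x' \<in> carrier X"
    have "hinner W (ract W (f z) (t x)) (ract W (f z') (t x')) =
        star D (t x) \<otimes>\<^bsub>D\<^esub> (\<pi> (hinner Z z z') \<otimes>\<^bsub>D\<^esub> t x')"
      using zx by (simp add: f.closed f.W.hinner_ract f.W.hinner_ract_left f.inner f.\<pi> f.W.A.mult_assoc)
    also have "\<dots> = \<pi> (hinner X x (lact X (hinner Z z z') x'))"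
      using zx by (simp add: t.left t.t_inner)
    finally show "hinner W (ract W (f z) (t x)) (ract W (f z') (t x')) = \<pi> (hinner T (\<tau> z x) (\<tau> z' x'))"
      using zx by (simp add: T.\<tau>_inner)
  qed (auto simp: f.closed T.dense)
qed

lemma rep_compacts_subset:
  assumes "alg_rep A X D \<pi> t" "cstar_algebra D" "submodule H complex_ring D" "normed_cvs.nclosed D (cnorm D) H"
    and "\<And>x y. \<lbrakk>x \<in> carrier X; y \<in> carrier X\<rbrakk> \<Longrightarrow> t x \<otimes>\<^bsub>D\<^esub> star D (t y) \<in> H"
  shows "rep_compacts D X t \<subseteq> H"
proof -
  interpret alg_rep A X D \<pi> t by fact
  show ?thesis
    unfolding P_eq by (rule W.A.nclspan_minimal) (use assms in auto)
qed

text \<open>Since x is a limit of elements x a, the product t(x) t(x')^* is a limit of t(x) \<pi>(a)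
  t(x')^*, and by covariance of t' the middle factor is in the closed span of t'(Y) t'(Y)^*. So the
  closed span for t, which contains \<pi>(A), lies in that for h.\<close>

lemma cov_rep_product:
  assumes c: "cov_rep A X D \<pi> t" and c': "cov_rep A Y D \<pi> t'" and T: "corr_tensor A X Y T \<tau>"
    and h: "mod_rep A T D (alg_corr D) \<pi> h"
    and prod: "\<And>x y. \<lbrakk>x \<in> carrier X; y \<in> carrier Y\<rbrakk> \<Longrightarrow> h (\<tau> x y) = t x \<otimes>\<^bsub>D\<^esub> t' y"
  shows "cov_rep A T D \<pi> h"
proof -
  interpret D: cstar_algebra D using c corr_repD(3) by (auto simp: cov_rep_def)
  interpret T: tensor A X "lact Y" A Y T \<tau> by (rule corr_tensorI[OF T])
  interpret t: corr_rep A X D \<pi> t using c by (simp add: cov_rep_def)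
  interpret t': corr_rep A Y D \<pi> t' using c' by (simp add: cov_rep_def)
  interpret TC: correspondence A T using T by (simp add: corr_tensor_def)
  have lT: "lact T a (\<tau> x y) = \<tau> (lact X a x) y" if "a \<in> carrier A" "x \<in> carrier X" "y \<in> carrier Y" for a x y
    using T that by (simp add: corr_tensor_def)
  interpret h: alg_rep A T D \<pi> h using h by (simp add: alg_rep_def)
  have lh: "\<pi> a \<otimes>\<^bsub>D\<^esub> h w = h (lact T a w)" if a: "a \<in> carrier A" and w: "w \<in> carrier T" for a w
  proof (rule T.bdd_agree[OF D.normed_cvs_axioms _ _ _ w, of "\<lambda>w. \<pi> a \<otimes>\<^bsub>D\<^esub> h w" "\<lambda>w. h (lact T a w)"])
    show "bdd_linear T (hnorm A T) D (cnorm D) (\<lambda>w. h (lact T a w))"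
      by (rule bdd_linear_comp[OF TC.C.act_bdd[OF a] h.t_bdd]) (rule T.W.X.normed_cvs_axioms)+
    show "bdd_linear T (hnorm A T) D (cnorm D) (\<lambda>w. \<pi> a \<otimes>\<^bsub>D\<^esub> h w)"
      by (rule mod_rep_mult_bdd(2)[OF h]) (use a t.\<pi> in simp)
    fix x y assume xy: "x \<in> carrier X" "y \<in> carrier Y"
    then show "\<pi> a \<otimes>\<^bsub>D\<^esub> h (\<tau> x y) = h (lact T a (\<tau> x y))"
      using a by (simp add: prod lT t.\<pi> flip: D.mult_assoc t.left)
  qed
  have "rep_compacts D X t \<subseteq> rep_compacts D T h"
  proof (rule rep_compacts_subset[OF t.alg_rep_axioms D.cstar_algebra_axioms h.P_sub h.P_nclosed])
    fix x x' assume x: "x \<in> carrier X" and x': "x' \<in> carrier X"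
    have mid: "t x \<otimes>\<^bsub>D\<^esub> (p \<otimes>\<^bsub>D\<^esub> star D (t x')) \<in> rep_compacts D T h" if "p \<in> rep_compacts D Y t'" for p
    proof -
      have "bdd_linear D (cnorm D) D (cnorm D) (\<lambda>p. t x \<otimes>\<^bsub>D\<^esub> (p \<otimes>\<^bsub>D\<^esub> star D (t x')))"
        by (rule bdd_linear_comp[OF D.mult_bdd(2) D.mult_bdd(1)]) (use x x' D.normed_cvs_axioms in auto)
      then show ?thesis
      proof (rule bdd_linear_nclspan[OF D.normed_cvs_axioms D.normed_cvs_axioms _ t'.gens_carrier _ h.P_sub h.P_nclosed])
        show "p \<in> D.nclspan t'.gens" using that by (simp add: t'.P_eq)
        fix s assume "s \<in> t'.gens"
        then obtain y y' where s: "s = t' y \<otimes>\<^bsub>D\<^esub> star D (t' y')" "y \<in> carrier Y" "y' \<in> carrier Y" by blast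
        have "t x \<otimes>\<^bsub>D\<^esub> (s \<otimes>\<^bsub>D\<^esub> star D (t x')) = h (\<tau> x y) \<otimes>\<^bsub>D\<^esub> star D (h (\<tau> x' y'))"
          using s x x' by (simp add: prod D.star_mult D.mult_assoc)
        then show "t x \<otimes>\<^bsub>D\<^esub> (s \<otimes>\<^bsub>D\<^esub> star D (t x')) \<in> rep_compacts D T h"
          using h.gen_in_P[of "\<tau> x y" "\<tau> x' y'"] s x x' by simp
      qed
    qed
    obtain a where a: "\<And>n. a n \<in> carrier A" "T.X.X.nlim (\<lambda>n. ract X x (a n)) x"
      using T.X.ract_approx[OF x] by blast
    have lim: "D.nlim (\<lambda>n. t (ract X x (a n))) (t x)"
      by (rule bdd_linear_nlim[OF T.X.X.normed_cvs_axioms D.normed_cvs_axioms t.t_bdd a(2)])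
    show "t x \<otimes>\<^bsub>D\<^esub> star D (t x') \<in> rep_compacts D T h"
    proof (rule D.nclosedD[OF h.P_nclosed])
      show "D.nlim (\<lambda>n. t (ract X x (a n)) \<otimes>\<^bsub>D\<^esub> star D (t x')) (t x \<otimes>\<^bsub>D\<^esub> star D (t x'))"
        by (intro D.nlim_mult lim D.nlim_const) (use x' in simp)
      fix n
      have "\<pi> (a n) \<in> rep_compacts D Y t'" using c' a(1) by (simp add: cov_rep_def)
      then show "t (ract X x (a n)) \<otimes>\<^bsub>D\<^esub> star D (t x') \<in> rep_compacts D T h"
        using mid a(1) x x' t.\<pi>(1) by (simp add: t.t_ract D.mult_assoc)
    qed
  qed
  moreover have "corr_rep A T D \<pi> h"
    by (rule corr_repI[OF h TC.correspondence_axioms lh])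
  ultimately show ?thesis using c unfolding cov_rep_def by blast
qed

section \<open>Extension of scalars\<close>

text \<open>\<open>\<epsilon> z\<close> plays the role of \<open>z \<otimes> 1\<close>, which makes sense in \<open>Z \<otimes>\<^sub>A B\<close> even if \<open>B\<close> has no unit,
  because \<open>z\<close> is a limit of elements \<open>z a\<close>.\<close>

definition ext_mod ::
  "('a, 'm) cstar_algebra_scheme \<Rightarrow> ('a, 'z, 'n) hilbert_module_scheme \<Rightarrow> ('b, 'p) cstar_algebra_scheme \<Rightarrow>
    ('b, 'w, 'q) hilbert_module_scheme \<Rightarrow> ('a \<Rightarrow> 'b) \<Rightarrow> ('z \<Rightarrow> 'w) \<Rightarrow> bool" where
  "ext_mod A Z B W \<pi> \<epsilon> \<longleftrightarrow> mod_rep A Z B W \<pi> \<epsilon> \<and>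
    norm_closure W (hnorm B W) (cspan W {ract W (\<epsilon> z) b |z b. z \<in> carrier Z \<and> b \<in> carrier B}) = carrier W"

lemma (in hilbert_module) ract_dense:
  "norm_closure X (hnorm A X) (cspan X {ract X x a |x a. x \<in> carrier X \<and> a \<in> carrier A}) = carrier X"
proof
  show "carrier X \<subseteq> norm_closure X (hnorm A X) (cspan X {ract X x a |x a. x \<in> carrier X \<and> a \<in> carrier A})"
  proof
    fix x assume x: "x \<in> carrier X"
    let ?S = "{ract X x a |x a. x \<in> carrier X \<and> a \<in> carrier A}"
    have S: "?S \<subseteq> carrier X" by auto
    obtain a where a: "\<And>n. a n \<in> carrier A" "X.nlim (\<lambda>n. ract X x (a n)) x"
      using ract_approx[OF x] by blast
    have "ract X x (a n) \<in> X.nclspan ?S" for n using X.nclspan_superset[OF S] x a(1) by blast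
    then show "x \<in> norm_closure X (hnorm A X) (cspan X ?S)"
      unfolding X.nclspan_def[symmetric] by (rule X.nclosedD[OF X.nclspan_closed[OF S] _ a(2)])
  qed
qed (rule X.norm_closure_carrier)

lemma ex_ext_mod:
  assumes T: "interior_tensor A Z (hom_lact B \<pi>) B (alg_corr B) W e" and hom: "cstar_hom A B \<pi>"
  shows "\<exists>\<epsilon>. ext_mod A Z B W \<pi> \<epsilon> \<and> (\<forall>z\<in>carrier Z. \<forall>S\<in>carrier B. e z S = ract W (\<epsilon> z) S)"
proof -
  interpret B: cstar_algebra B
    using T hilbert_moduleD(1) by (auto simp: interior_tensor_def)
  interpret T: tensor A Z "hom_lact B \<pi>" B "alg_corr B" W e by (rule tensorI[OF T])
  note \<pi> = cstar_homD[OF hom]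
  \<comment> \<open>On products z a, the vector z \<otimes> 1 has to be z \<otimes> \<pi>(a). These
    products are total, so prescribing \<epsilon> on them suffices.\<close>
  have "\<exists>\<epsilon>. mod_rep A Z B W \<pi> \<epsilon> \<and> (\<forall>z\<in>carrier Z. \<forall>a\<in>carrier A. \<epsilon> (ract Z z a) = e z (\<pi> a))"
  proof (rule mod_rep_extend)
    show "hilbert_module A Z" "hilbert_module B W" "cstar_hom A B \<pi>"
      by (rule T.X.hilbert_module_axioms T.W.hilbert_module_axioms hom)+
    fix z a z' a' assume "z \<in> carrier Z" "a \<in> carrier A" "z' \<in> carrier Z" "a' \<in> carrier A"
    then show "hinner W (e z (\<pi> a)) (e z' (\<pi> a')) = \<pi> (hinner Z (ract Z z a) (ract Z z' a'))"
      by (simp add: T.\<tau>_inner \<pi> hom_lact_def T.X.hinner_ract T.X.hinner_ract_left B.mult_assoc)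
  qed (auto simp: \<pi> T.X.ract_dense)
  then obtain \<epsilon> where \<epsilon>: "mod_rep A Z B W \<pi> \<epsilon>" and \<epsilon>a: "\<And>z a. \<lbrakk>z \<in> carrier Z; a \<in> carrier A\<rbrakk> \<Longrightarrow> \<epsilon> (ract Z z a) = e z (\<pi> a)"
    by blast
  interpret \<epsilon>: mod_rep A Z B W \<pi> \<epsilon> by fact
  have eS: "e z S = ract W (\<epsilon> z) S" if z: "z \<in> carrier Z" and S: "S \<in> carrier B" for z S
  proof (rule bdd_linear_agree[OF T.X.X.normed_cvs_axioms T.W.X.normed_cvs_axioms, of "\<lambda>z. e z S" "\<lambda>z. ract W (\<epsilon> z) S"
        "{ract Z x a |x a. x \<in> carrier Z \<and> a \<in> carrier A}"])
    show "bdd_linear Z (hnorm A Z) W (hnorm B W) (\<lambda>z. e z S)" using S by (intro T.\<tau>_bdd_left) simp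
    show "bdd_linear Z (hnorm A Z) W (hnorm B W) (\<lambda>z. ract W (\<epsilon> z) S)"
      by (rule bdd_linear_comp[OF \<epsilon>.bdd T.W.ract_bdd[OF S]])
        (rule T.W.X.normed_cvs_axioms T.X.X.normed_cvs_axioms)+
    show "z \<in> norm_closure Z (hnorm A Z) (cspan Z {ract Z x a |x a. x \<in> carrier Z \<and> a \<in> carrier A})"
      unfolding T.X.ract_dense by (rule z)
    fix s assume "s \<in> {ract Z x a |x a. x \<in> carrier Z \<and> a \<in> carrier A}"
    then obtain x a where s: "s = ract Z x a" "x \<in> carrier Z" "a \<in> carrier A" by blast
    then show "e s S = ract W (\<epsilon> s) S"
      using S T.\<tau>_balanced[of x a S] T.\<tau>_ract[of x "\<pi> a" S] by (simp add: \<epsilon>a hom_lact_def \<pi>)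
  qed auto
  have "{e x y |x y. x \<in> carrier Z \<and> y \<in> carrier (alg_corr B)} = {ract W (\<epsilon> z) b |z b. z \<in> carrier Z \<and> b \<in> carrier B}"
    using eS by force
  then show ?thesis
    using T.dense \<epsilon> eS unfolding ext_mod_def by auto
qed

lemma hilbert_isometry_bdd:
  assumes "hilbert_module A X" "hilbert_isometry A X Y f"
  shows "bdd_linear X (hnorm A X) Y (hnorm A Y) f"
  by (rule bdd_linearI[of _ _ _ _ 1])
    (use assms in \<open>auto simp: hilbert_isometry_def hnorm_def Pi_iff\<close>)

lemma mod_rep_isometry:
  assumes "hilbert_module A X" "hilbert_module A Y" "hilbert_isometry A X Y f"
  shows "mod_rep A X A Y (\<lambda>a. a) f"
  using assms by (auto simp: mod_rep_def mod_rep_axioms_def hilbert_isometry_def cstar_hom_id)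

lemma mod_rep_hom:
  assumes "cstar_algebra D" "cstar_algebra D'" "cstar_hom D D' \<sigma>"
  shows "mod_rep D (alg_corr D) D' (alg_corr D') \<sigma> \<sigma>"
  using assms cstar_homD[OF assms(3)]
  by (simp add: mod_rep_def mod_rep_axioms_def cstar_algebra.hilbert_alg_corr cstar_algebra.star_closed)

lemma cov_rep_hom:
  assumes c: "cov_rep A X D \<pi> t" and D': "cstar_algebra D'" and \<sigma>: "cstar_hom D D' \<sigma>"
  shows "cov_rep A X D' (\<lambda>a. \<sigma> (\<pi> a)) (\<lambda>x. \<sigma> (t x))"
proof -
  note D = corr_repD(3)[OF conjunct1[OF c[unfolded cov_rep_def]]]
  interpret D: cstar_algebra D by fact
  interpret D': cstar_algebra D' by fact
  interpret t: corr_rep A X D \<pi> t using c by (simp add: cov_rep_def)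
  note s = cstar_homD[OF \<sigma>]
  have m: "mod_rep A X D' (alg_corr D') (\<lambda>a. \<sigma> (\<pi> a)) (\<lambda>x. \<sigma> (t x))"
    by (rule mod_rep_comp[OF t.mod_rep_axioms mod_rep_hom[OF D D' \<sigma>]])
  interpret s: alg_rep A X D' "\<lambda>a. \<sigma> (\<pi> a)" "\<lambda>x. \<sigma> (t x)" using m by (simp add: alg_rep_def)
  have "corr_rep A X D' (\<lambda>a. \<sigma> (\<pi> a)) (\<lambda>x. \<sigma> (t x))"
    by (rule corr_repI[OF m t.C.correspondence_axioms]) (simp add: t.\<pi> flip: s t.left)
  moreover have "\<sigma> p \<in> rep_compacts D' X (\<lambda>x. \<sigma> (t x))" if "p \<in> rep_compacts D X t" for p
  proof -
    show ?thesis
    proof (rule bdd_linear_nclspan[OF D.normed_cvs_axioms D'.normed_cvs_axioms cstar_hom_bdd[OF D D' \<sigma>]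
          t.gens_carrier _ s.P_sub s.P_nclosed])
      show "p \<in> D.nclspan t.gens" using that by (simp add: t.P_eq)
      fix g assume "g \<in> t.gens"
      then obtain x y where "g = t x \<otimes>\<^bsub>D\<^esub> star D (t y)" "x \<in> carrier X" "y \<in> carrier X" by blast
      then show "\<sigma> g \<in> rep_compacts D' X (\<lambda>x. \<sigma> (t x))"
        using s.gen_in_P[of x y] by (simp add: s)
    qed
  qed
  ultimately show ?thesis using c by (simp add: cov_rep_def)
qed

section \<open>Generated C*-subalgebras\<close>

lemma (in cstar_algebra) cstar_subalgebraI:
  assumes "H \<subseteq> carrier A" "\<zero> \<in> H" "\<And>x y. \<lbrakk>x \<in> H; y \<in> H\<rbrakk> \<Longrightarrow> x \<oplus> y \<in> H" "\<And>c x. x \<in> H \<Longrightarrow> c \<odot> x \<in> H"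
    "\<And>x y. \<lbrakk>x \<in> H; y \<in> H\<rbrakk> \<Longrightarrow> x \<otimes> y \<in> H" "\<And>x. x \<in> H \<Longrightarrow> star A x \<in> H" "nclosed H"
  shows "cstar_subalgebra H A"
  unfolding cstar_subalgebra_def submodule_iff using assms nclosed_iff[OF assms(1)] by auto

lemma cstar_generate_minimal: "\<lbrakk>cstar_subalgebra H A; S \<subseteq> H\<rbrakk> \<Longrightarrow> cstar_generate A S \<subseteq> H"
  unfolding cstar_generate_def by blast

lemma cstar_hom_agree:
  assumes A: "cstar_algebra A" and B: "cstar_algebra B" and f: "cstar_hom A B f" and g: "cstar_hom A B g"
    and gen: "cstar_generate A S = carrier A" and S: "S \<subseteq> carrier A" "\<And>s. s \<in> S \<Longrightarrow> f s = g s"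
    and x: "x \<in> carrier A"
  shows "f x = g x"
proof -
  interpret A: cstar_algebra A by fact
  interpret B: cstar_algebra B by fact
  note f' = cstar_homD[OF f] and g' = cstar_homD[OF g]
  have "cstar_subalgebra {x \<in> carrier A. f x = g x} A"
  proof (rule A.cstar_subalgebraI)
    show "A.nclosed {x \<in> carrier A. f x = g x}"
    proof (rule A.nclosedI)
      fix \<sigma> y assume \<sigma>: "\<And>n. \<sigma> n \<in> {x \<in> carrier A. f x = g x}" "A.nlim \<sigma> y"
      have "B.nlim (\<lambda>n. f (\<sigma> n)) (f y)" "B.nlim (\<lambda>n. g (\<sigma> n)) (g y)"
        by (rule bdd_linear_nlim[OF A.normed_cvs_axioms B.normed_cvs_axioms cstar_hom_bdd[OF A B] \<sigma>(2)]; fact)+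
      then show "y \<in> {x \<in> carrier A. f x = g x}"
        using \<sigma>(1) B.nlim_unique A.nlimD(2)[OF \<sigma>(2)] by simp
    qed
  qed (use f' g' cstar_hom_zero[OF A B f] cstar_hom_zero[OF A B g] in auto)
  then have "cstar_generate A S \<subseteq> {x \<in> carrier A. f x = g x}"
    by (rule cstar_generate_minimal) (use S in auto)
  then show ?thesis using gen x by blast
qed

text \<open>The set of all \<open>b\<close> such that \<open>Q\<close> holds for \<open>b\<close> and \<open>b\<^sup>*\<close> is a C*-subalgebra, even if \<open>Q\<close> is
  not preserved by the involution.\<close>

lemma (in cstar_algebra) cstar_generate_induct:
  assumes gen: "cstar_generate A S = carrier A" and S: "S \<subseteq> carrier A" and x: "x \<in> carrier A"
    and base: "\<And>s. s \<in> S \<Longrightarrow> Q s \<and> Q (star A s)" and zero: "Q \<zero>"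
    and add: "\<And>x y. \<lbrakk>x \<in> carrier A; y \<in> carrier A; Q x; Q y\<rbrakk> \<Longrightarrow> Q (x \<oplus> y)"
    and smult: "\<And>c x. \<lbrakk>x \<in> carrier A; Q x\<rbrakk> \<Longrightarrow> Q (c \<odot> x)"
    and mult: "\<And>x y. \<lbrakk>x \<in> carrier A; y \<in> carrier A; Q x; Q y\<rbrakk> \<Longrightarrow> Q (x \<otimes> y)"
    and lim: "\<And>\<sigma> x. \<lbrakk>\<And>n. Q (\<sigma> n); nlim \<sigma> x\<rbrakk> \<Longrightarrow> Q x"
  shows "Q x"
proof -
  let ?H = "{x \<in> carrier A. Q x \<and> Q (star A x)}"
  have "cstar_subalgebra ?H A"
  proof (rule cstar_subalgebraI)
    show "nclosed ?H"
    proof (rule nclosedI)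
      fix \<sigma> y assume \<sigma>: "\<And>n. \<sigma> n \<in> ?H" "nlim \<sigma> y"
      have "Q y" by (rule lim[OF _ \<sigma>(2)]) (use \<sigma>(1) in auto)
      moreover have "Q (star A y)" by (rule lim[OF _ nlim_star[OF \<sigma>(2)]]) (use \<sigma>(1) in auto)
      ultimately show "y \<in> ?H" using nlimD(2)[OF \<sigma>(2)] by simp
    qed
  qed (auto simp: zero add smult mult star_add star_smult star_mult)
  then have "cstar_generate A S \<subseteq> ?H"
    by (rule cstar_generate_minimal) (use S base in auto)
  then show ?thesis using gen x by blast
qed

section \<open>Representations of generating systems\<close>

lemma generating_systemD:
  assumes "generating_system k Y"
  shows "cstar_algebra (coeff Y)" "i \<in> {1..k} \<Longrightarrow> correspondence (coeff Y) (fibre Y i)"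
    "\<lbrakk>i \<in> {1..k}; j \<in> {1..k}\<rbrakk> \<Longrightarrow> corr_tensor (coeff Y) (fibre Y i) (fibre Y j) (sq Y i j) (tens Y i j)"
    "\<lbrakk>i \<in> {1..k}; j \<in> {1..k}\<rbrakk> \<Longrightarrow> corr_iso (coeff Y) (sq Y i j) (sq Y j i) (flip Y i j)"
    "\<lbrakk>i \<in> {1..k}; w \<in> carrier (sq Y i i)\<rbrakk> \<Longrightarrow> flip Y i i w = w"
    "\<lbrakk>i \<in> {1..k}; j \<in> {1..k}; w \<in> carrier (sq Y i j)\<rbrakk> \<Longrightarrow> flip Y j i (flip Y i j w) = w"
  using assms unfolding generating_system_def by blast+

lemma corr_isoD:
  assumes "corr_iso A X Y f"
  shows "hilbert_isometry A X Y f" "bij_betw f (carrier X) (carrier Y)" "x \<in> carrier X \<Longrightarrow> f x \<in> carrier Y"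
  using assms unfolding corr_iso_def hilbert_iso_def hilbert_isometry_def by auto

lemma corr_tensorD:
  assumes "corr_tensor A X Y W \<tau>"
  shows "correspondence A X" "correspondence A Y" "correspondence A W" "interior_tensor A X (lact Y) A Y W \<tau>"
    "\<lbrakk>a \<in> carrier A; x \<in> carrier X; y \<in> carrier Y\<rbrakk> \<Longrightarrow> lact W a (\<tau> x y) = \<tau> (lact X a x) y"
    "\<lbrakk>x \<in> carrier X; y \<in> carrier Y\<rbrakk> \<Longrightarrow> \<tau> x y \<in> carrier W"
proof -
  show 1: "correspondence A X" "correspondence A Y" "correspondence A W" "interior_tensor A X (lact Y) A Y W \<tau>"
    "\<lbrakk>a \<in> carrier A; x \<in> carrier X; y \<in> carrier Y\<rbrakk> \<Longrightarrow> lact W a (\<tau> x y) = \<tau> (lact X a x) y"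
    using assms unfolding corr_tensor_def by simp_all
  show "\<lbrakk>x \<in> carrier X; y \<in> carrier Y\<rbrakk> \<Longrightarrow> \<tau> x y \<in> carrier W"
    using 1(4) unfolding interior_tensor_def by simp
qed

lemma correspondence_hilbert: "correspondence A X \<Longrightarrow> hilbert_module A X"
  by (simp add: correspondence_def)

text \<open>The commutation relation between \<open>t\<^sub>i\<close> and \<open>t\<^sub>j\<close> imposed by \<open>\<theta>\<^sub>i\<^sub>j\<close>; \<open>\<mu>\<close> is the product
  \<open>y \<otimes> x \<mapsto> t\<^sub>j(y) t\<^sub>i(x)\<close>.\<close>

definition flip_rel ::
  "'u corr_system \<Rightarrow> ('d, 'p) cstar_algebra_scheme \<Rightarrow> ('u \<Rightarrow> 'd) \<Rightarrow> (nat \<Rightarrow> 'u \<Rightarrow> 'd) \<Rightarrow> nat \<Rightarrow> nat \<Rightarrow> bool" where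
  "flip_rel Y D \<pi> t i j \<longleftrightarrow> (\<exists>\<mu>. mod_rep (coeff Y) (sq Y j i) D (alg_corr D) \<pi> \<mu> \<and>
    (\<forall>x\<in>carrier (fibre Y i). \<forall>y\<in>carrier (fibre Y j).
      \<mu> (tens Y j i y x) = t j y \<otimes>\<^bsub>D\<^esub> t i x \<and>
      \<mu> (flip Y i j (tens Y i j x y)) = t i x \<otimes>\<^bsub>D\<^esub> t j y))"

text \<open>The relations for i < j give the others, since opposite flips are inverse to each other
  and the diagonal ones are identities; lengthening a family thus adds only the pairs with the new
  index. The clauses on D and \<pi> matter for n = 0, where no representation supplies them.\<close>

definition sys_rep ::
  "nat \<Rightarrow> 'u corr_system \<Rightarrow> ('d, 'p) cstar_algebra_scheme \<Rightarrow> ('u \<Rightarrow> 'd) \<Rightarrow> (nat \<Rightarrow> 'u \<Rightarrow> 'd) \<Rightarrow> bool" where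
  "sys_rep n Y D \<pi> t \<longleftrightarrow> cstar_algebra D \<and> cstar_hom (coeff Y) D \<pi> \<and>
    (\<forall>l\<in>{1..n}. cov_rep (coeff Y) (fibre Y l) D \<pi> (t l)) \<and>
    (\<forall>i\<in>{1..n}. \<forall>j\<in>{1..n}. i < j \<longrightarrow> flip_rel Y D \<pi> t i j)"

lemma sys_repD:
  assumes "sys_rep n Y D \<pi> t"
  shows "cstar_algebra D" "cstar_hom (coeff Y) D \<pi>"
    "l \<in> {1..n} \<Longrightarrow> cov_rep (coeff Y) (fibre Y l) D \<pi> (t l)"
    "l \<in> {1..n} \<Longrightarrow> corr_rep (coeff Y) (fibre Y l) D \<pi> (t l)"
    "\<lbrakk>l \<in> {1..n}; x \<in> carrier (fibre Y l)\<rbrakk> \<Longrightarrow> t l x \<in> carrier D"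
proof -
  show 1: "cstar_algebra D" "cstar_hom (coeff Y) D \<pi>" "l \<in> {1..n} \<Longrightarrow> cov_rep (coeff Y) (fibre Y l) D \<pi> (t l)"
    "l \<in> {1..n} \<Longrightarrow> corr_rep (coeff Y) (fibre Y l) D \<pi> (t l)"
    using assms by (simp_all add: sys_rep_def cov_rep_def)
  assume l: "l \<in> {1..n}" "x \<in> carrier (fibre Y l)"
  interpret corr_rep "coeff Y" "fibre Y l" D \<pi> "t l" using 1(4) l(1) by blast
  show "t l x \<in> carrier D" using l(2) by simp
qed

text \<open>Composing the witness \<mu> with \<open>flip Y i j\<close> gives a witness for the
  opposite pair, because the two flips are inverse to each other.\<close>

lemma flip_rel_swap:
  assumes Y: "generating_system k Y" and ij: "i \<in> {1..k}" "j \<in> {1..k}" and r: "flip_rel Y D \<pi> t i j"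
  shows "flip_rel Y D \<pi> t j i"
proof -
  note g = generating_systemD[OF Y]
  from r obtain \<mu> where \<mu>: "mod_rep (coeff Y) (sq Y j i) D (alg_corr D) \<pi> \<mu>"
    "\<And>x y. \<lbrakk>x \<in> carrier (fibre Y i); y \<in> carrier (fibre Y j)\<rbrakk> \<Longrightarrow>
      \<mu> (tens Y j i y x) = t j y \<otimes>\<^bsub>D\<^esub> t i x \<and> \<mu> (flip Y i j (tens Y i j x y)) = t i x \<otimes>\<^bsub>D\<^esub> t j y"
    unfolding flip_rel_def by blast
  have f: "mod_rep (coeff Y) (sq Y i j) (coeff Y) (sq Y j i) (\<lambda>a. a) (flip Y i j)"
    using g(3)[OF ij] g(3)[OF ij(2,1)] corr_isoD(1)[OF g(4)[OF ij]]
    by (intro mod_rep_isometry) (auto intro: correspondence_hilbert corr_tensorD)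
  have "flip Y i j (flip Y j i (tens Y j i y x)) = tens Y j i y x"
    if "x \<in> carrier (fibre Y i)" "y \<in> carrier (fibre Y j)" for x y
    using g(6)[OF ij(2,1)] corr_tensorD(6)[OF g(3)[OF ij(2,1)] that(2,1)] by blast
  then show ?thesis
    unfolding flip_rel_def using \<mu>(2)
    by (intro exI[of _ "\<lambda>w. \<mu> (flip Y i j w)"] conjI mod_rep_comp[OF f \<mu>(1)] ballI) simp_all
qed

lemma flip_rel_all:
  assumes Y: "generating_system k Y" and n: "n \<le> k" and r: "sys_rep n Y D \<pi> t"
    and ij: "i \<in> {1..n}" "j \<in> {1..n}"
  shows "flip_rel Y D \<pi> t i j"
proof -
  have ijk: "i \<in> {1..k}" "j \<in> {1..k}" using ij n by auto
  consider "i < j" | "j < i" | "i = j" by linarith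
  then show ?thesis
  proof cases
    case 1
    then show ?thesis using r ij by (simp add: sys_rep_def)
  next
    case 2
    then have "flip_rel Y D \<pi> t j i" using r ij by (simp add: sys_rep_def)
    then show ?thesis by (rule flip_rel_swap[OF Y ijk(2,1)])
  next
    case 3
    note T = generating_systemD(3)[OF Y ijk(1) ijk(1)]
    obtain \<mu> where \<mu>: "mod_rep (coeff Y) (sq Y i i) D (alg_corr D) \<pi> \<mu>"
      "\<forall>z\<in>carrier (fibre Y i). \<forall>x\<in>carrier (fibre Y i). \<mu> (tens Y i i z x) = t i z \<otimes>\<^bsub>D\<^esub> t i x"
      using ex_product[OF corr_tensorD(4)[OF T] corr_repD(1)[OF sys_repD(4)[OF r ij(1)]] sys_repD(4)[OF r ij(1)]]
      by auto
    have "flip Y i i (tens Y i i x y) = tens Y i i x y"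
      if "x \<in> carrier (fibre Y i)" "y \<in> carrier (fibre Y i)" for x y
      using generating_systemD(5)[OF Y ijk(1)] corr_tensorD(6)[OF T that] by blast
    then show ?thesis
      unfolding flip_rel_def 3[symmetric] using \<mu> by (intro exI[of _ \<mu>]) simp
  qed
qed

lemma flip_rel_hom:
  assumes D: "cstar_algebra D" and D': "cstar_algebra D'" and \<sigma>: "cstar_hom D D' \<sigma>"
    and cl: "\<And>x. x \<in> carrier (fibre Y i) \<Longrightarrow> t i x \<in> carrier D" "\<And>x. x \<in> carrier (fibre Y j) \<Longrightarrow> t j x \<in> carrier D"
    and r: "flip_rel Y D \<pi> t i j"
  shows "flip_rel Y D' (\<lambda>a. \<sigma> (\<pi> a)) (\<lambda>l x. \<sigma> (t l x)) i j"
proof -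
  from r obtain \<mu> where \<mu>: "mod_rep (coeff Y) (sq Y j i) D (alg_corr D) \<pi> \<mu>"
    "\<forall>x\<in>carrier (fibre Y i). \<forall>y\<in>carrier (fibre Y j).
      \<mu> (tens Y j i y x) = t j y \<otimes>\<^bsub>D\<^esub> t i x \<and> \<mu> (flip Y i j (tens Y i j x y)) = t i x \<otimes>\<^bsub>D\<^esub> t j y"
    unfolding flip_rel_def by blast
  then show ?thesis
    unfolding flip_rel_def
    by (intro exI[of _ "\<lambda>w. \<sigma> (\<mu> w)"] conjI mod_rep_comp[OF \<mu>(1) mod_rep_hom[OF D D' \<sigma>]])
      (simp add: cl cstar_homD(4)[OF \<sigma>])
qed

lemma sys_rep_hom:
  assumes r: "sys_rep n Y D \<pi> t" and D': "cstar_algebra D'" and \<sigma>: "cstar_hom D D' \<sigma>"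
  shows "sys_rep n Y D' (\<lambda>a. \<sigma> (\<pi> a)) (\<lambda>l x. \<sigma> (t l x))"
  unfolding sys_rep_def
proof (intro conjI ballI impI)
  note s = sys_repD[OF r]
  show "cstar_algebra D'" by fact
  show "cstar_hom (coeff Y) D' (\<lambda>a. \<sigma> (\<pi> a))" using cstar_hom_comp[OF s(2) \<sigma>] by (simp add: o_def)
  show "cov_rep (coeff Y) (fibre Y l) D' (\<lambda>a. \<sigma> (\<pi> a)) (\<lambda>x. \<sigma> (t l x))" if "l \<in> {1..n}" for l
    by (rule cov_rep_hom[OF s(3)[OF that] D' \<sigma>])
  show "flip_rel Y D' (\<lambda>a. \<sigma> (\<pi> a)) (\<lambda>l x. \<sigma> (t l x)) i j" if "i \<in> {1..n}" "j \<in> {1..n}" "i < j" for i j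
    by (rule flip_rel_hom[OF s(1) D' \<sigma> s(5) s(5)]) (use that r in \<open>auto simp: sys_rep_def\<close>)
qed

section \<open>Copies of an algebra in the type of sequences\<close>

text \<open>The universal properties concern algebras of type \<^typ>\<open>(nat \<Rightarrow> 'u) cstar_algebra\<close>; copies by constant
  sequences make them available for algebras of type \<^typ>\<open>'u cstar_algebra\<close>.\<close>

definition seq_copy :: "'u cstar_algebra \<Rightarrow> (nat \<Rightarrow> 'u) cstar_algebra" where
  "seq_copy D = \<lparr>carrier = (\<lambda>x _. x) ` carrier D, monoid.mult = (\<lambda>f g _. f 0 \<otimes>\<^bsub>D\<^esub> g 0), one = (\<lambda>_. \<one>\<^bsub>D\<^esub>),
    zero = (\<lambda>_. \<zero>\<^bsub>D\<^esub>), add = (\<lambda>f g _. f 0 \<oplus>\<^bsub>D\<^esub> g 0), smult = (\<lambda>c f _. c \<odot>\<^bsub>D\<^esub> f 0),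
    star = (\<lambda>f _. star D (f 0)), cnorm = (\<lambda>f. cnorm D (f 0))\<rparr>"

lemma seq_copy_simps:
  "carrier (seq_copy D) = (\<lambda>x _. x) ` carrier D" "f \<otimes>\<^bsub>seq_copy D\<^esub> g = (\<lambda>_. f 0 \<otimes>\<^bsub>D\<^esub> g 0)"
  "\<zero>\<^bsub>seq_copy D\<^esub> = (\<lambda>_. \<zero>\<^bsub>D\<^esub>)" "f \<oplus>\<^bsub>seq_copy D\<^esub> g = (\<lambda>_. f 0 \<oplus>\<^bsub>D\<^esub> g 0)"
  "c \<odot>\<^bsub>seq_copy D\<^esub> f = (\<lambda>_. c \<odot>\<^bsub>D\<^esub> f 0)" "star (seq_copy D) f = (\<lambda>_. star D (f 0))"
  "cnorm (seq_copy D) f = cnorm D (f 0)"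
  by (simp_all add: seq_copy_def)

lemma seq_copy_cstar:
  assumes "cstar_algebra D"
  shows "cstar_algebra (seq_copy D)"
proof -
  interpret D: cstar_algebra D by fact
  let ?C = "seq_copy D"
  note [simp] = seq_copy_simps
  have mod: "Module.module complex_ring ?C"
  proof (rule Module.moduleI[OF cring_complex_ring])
    show "abelian_group ?C"
    proof (rule abelian_groupI)
      fix f assume "f \<in> carrier ?C"
      then obtain x where x: "f = (\<lambda>_. x)" "x \<in> carrier D" by auto
      have "(\<lambda>_. \<ominus>\<^bsub>D\<^esub> x) \<oplus>\<^bsub>?C\<^esub> f = \<zero>\<^bsub>?C\<^esub>" using x by (simp add: D.l_neg)
      then show "\<exists>g\<in>carrier ?C. g \<oplus>\<^bsub>?C\<^esub> f = \<zero>\<^bsub>?C\<^esub>" using x(2) by (intro bexI[of _ "\<lambda>_. \<ominus>\<^bsub>D\<^esub> x"]) auto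
    qed (auto simp: D.vadd_ac)
  qed (auto simp: D.smult_add_left D.smult_add_right D.smult_smult)
  interpret C: cvs ?C by (intro cvs.intro mod)
  interpret C: normed_cvs ?C "cnorm ?C"
    by unfold_locales (auto simp: D.N_eq_0_iff D.N_add D.N_smult fun_eq_iff)
  have minus: "f \<ominus>\<^bsub>?C\<^esub> g = (\<lambda>_. f 0 \<ominus>\<^bsub>D\<^esub> g 0)" if "f \<in> carrier ?C" "g \<in> carrier ?C" for f g
    using that C.minus_eq_smult[OF that] by (auto simp: D.minus_eq_smult)
  have "norm_complete ?C (cnorm ?C)"
    unfolding C.norm_complete_iff
  proof (intro allI impI)
    fix \<sigma> assume \<sigma>: "C.nCauchy \<sigma>"
    then have \<sigma>c: "\<sigma> n \<in> carrier ?C" for n by (simp add: C.nCauchy_def)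
    have \<sigma>d: "\<sigma> n 0 \<in> carrier D" for n using \<sigma>c[of n] by auto
    have "D.nCauchy (\<lambda>n. \<sigma> n 0)"
      using \<sigma> \<sigma>d minus[OF \<sigma>c \<sigma>c] unfolding C.nCauchy_def D.nCauchy_def by (simp del: seq_copy_simps(1))
    then obtain x where x: "D.nlim (\<lambda>n. \<sigma> n 0) x" using D.complete D.norm_complete_iff by blast
    then have xc: "(\<lambda>_. x) \<in> carrier ?C" using D.nlimD(2) by auto
    have "C.nlim \<sigma> (\<lambda>_. x)"
      using x \<sigma>c xc minus[OF \<sigma>c xc] unfolding C.nlim_def D.nlim_def by (simp del: seq_copy_simps(1))
    then show "\<exists>x. C.nlim \<sigma> x" by blast
  qed
  then show ?thesis
    by (intro cstar_algebra.intro cstar_algebra_axioms.intro mod)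
      (auto simp: D.mult_assoc D.mult_l_distr D.mult_r_distr D.smult_mult_left D.smult_mult_right
        D.star_add D.star_smult D.star_mult D.N_eq_0_iff D.N_add D.N_smult D.cnorm_mult D.cnorm_star fun_eq_iff)
qed

lemma seq_copy_hom: "cstar_hom D (seq_copy D) (\<lambda>x _. x)" "cstar_hom (seq_copy D) D (\<lambda>f. f 0)"
  by (auto simp: cstar_hom_def seq_copy_simps)

section \<open>Universal representations of generating systems\<close>

definition sys_range :: "nat \<Rightarrow> 'u corr_system \<Rightarrow> ('u \<Rightarrow> 'd) \<Rightarrow> (nat \<Rightarrow> 'u \<Rightarrow> 'd) \<Rightarrow> 'd set" where
  "sys_range n Y \<pi> t = \<pi> ` carrier (coeff Y) \<union> (\<Union>l\<in>{1..n}. t l ` carrier (fibre Y l))"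

text \<open>The test algebras have the type used in \<open>cuntz_pimsner\<close> and
  \<open>ps_cuntz_pimsner\<close>, so both notions can be compared with this one. Uniqueness of
  \<rho> follows from generation.\<close>

definition sys_universal ::
  "nat \<Rightarrow> 'u corr_system \<Rightarrow> 'u cstar_algebra \<Rightarrow> ('u \<Rightarrow> 'u) \<Rightarrow> (nat \<Rightarrow> 'u \<Rightarrow> 'u) \<Rightarrow> bool" where
  "sys_universal n Y B \<pi> t \<longleftrightarrow> sys_rep n Y B \<pi> t \<and> cstar_generate B (sys_range n Y \<pi> t) = carrier B \<and>
    (\<forall>(D :: (nat \<Rightarrow> 'u) cstar_algebra) \<pi>' t'. sys_rep n Y D \<pi>' t' \<longrightarrow>
      (\<exists>\<rho>. cstar_hom B D \<rho> \<and> (\<forall>a\<in>carrier (coeff Y). \<rho> (\<pi> a) = \<pi>' a) \<and>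
        (\<forall>l\<in>{1..n}. \<forall>x\<in>carrier (fibre Y l). \<rho> (t l x) = t' l x)))"

lemma sys_range_carrier: "sys_rep n Y B \<pi> t \<Longrightarrow> sys_range n Y \<pi> t \<subseteq> carrier B"
  using sys_repD(5) cstar_homD(1)[OF sys_repD(2)] unfolding sys_range_def by fast

lemma sys_universal_hom:
  fixes B D :: "'u cstar_algebra"
  assumes u: "sys_universal n Y B \<pi> t" and r: "sys_rep n Y D \<pi>' t'"
  obtains \<rho> where "cstar_hom B D \<rho>" "\<And>a. a \<in> carrier (coeff Y) \<Longrightarrow> \<rho> (\<pi> a) = \<pi>' a"
    "\<And>l x. \<lbrakk>l \<in> {1..n}; x \<in> carrier (fibre Y l)\<rbrakk> \<Longrightarrow> \<rho> (t l x) = t' l x"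
proof -
  note D = sys_repD(1)[OF r]
  obtain \<rho> where \<rho>: "cstar_hom B (seq_copy D) \<rho>" "\<forall>a\<in>carrier (coeff Y). \<rho> (\<pi> a) = (\<lambda>_. \<pi>' a)"
    "\<forall>l\<in>{1..n}. \<forall>x\<in>carrier (fibre Y l). \<rho> (t l x) = (\<lambda>_. t' l x)"
    using u sys_rep_hom[OF r seq_copy_cstar[OF D] seq_copy_hom(1)] unfolding sys_universal_def by blast
  show thesis
    by (rule that[of "\<lambda>b. \<rho> b 0"])
      (use \<rho> cstar_hom_comp[OF \<rho>(1) seq_copy_hom(2)] in \<open>auto simp: o_def\<close>)
qed

lemma sys_universal_inverse:
  assumes u: "sys_universal n Y B \<pi> t" and u': "sys_universal n Y B' \<pi>' t'"
  obtains \<rho> \<rho>' where "cstar_hom B B' \<rho>" "cstar_hom B' B \<rho>'"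
    "\<And>b. b \<in> carrier B \<Longrightarrow> \<rho>' (\<rho> b) = b" "\<And>b. b \<in> carrier B' \<Longrightarrow> \<rho> (\<rho>' b) = b"
    "\<And>a. a \<in> carrier (coeff Y) \<Longrightarrow> \<rho> (\<pi> a) = \<pi>' a" "\<And>a. a \<in> carrier (coeff Y) \<Longrightarrow> \<rho>' (\<pi>' a) = \<pi> a"
    "\<And>l x. \<lbrakk>l \<in> {1..n}; x \<in> carrier (fibre Y l)\<rbrakk> \<Longrightarrow> \<rho> (t l x) = t' l x"
proof -
  have r: "sys_rep n Y B \<pi> t" and r': "sys_rep n Y B' \<pi>' t'"
    and g: "cstar_generate B (sys_range n Y \<pi> t) = carrier B" "cstar_generate B' (sys_range n Y \<pi>' t') = carrier B'"
    using u u' unfolding sys_universal_def by blast+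
  note B = sys_repD(1)[OF r] and B' = sys_repD(1)[OF r']
  obtain \<rho> where \<rho>: "cstar_hom B B' \<rho>" "\<And>a. a \<in> carrier (coeff Y) \<Longrightarrow> \<rho> (\<pi> a) = \<pi>' a"
    "\<And>l x. \<lbrakk>l \<in> {1..n}; x \<in> carrier (fibre Y l)\<rbrakk> \<Longrightarrow> \<rho> (t l x) = t' l x"
    by (rule sys_universal_hom[OF u r']) blast
  obtain \<rho>' where \<rho>': "cstar_hom B' B \<rho>'" "\<And>a. a \<in> carrier (coeff Y) \<Longrightarrow> \<rho>' (\<pi>' a) = \<pi> a"
    "\<And>l x. \<lbrakk>l \<in> {1..n}; x \<in> carrier (fibre Y l)\<rbrakk> \<Longrightarrow> \<rho>' (t' l x) = t l x"
    by (rule sys_universal_hom[OF u' r]) blast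
  have 1: "\<rho>' (\<rho> b) = b" if "b \<in> carrier B" for b
    using cstar_hom_agree[OF B B cstar_hom_comp[OF \<rho>(1) \<rho>'(1)] cstar_hom_id g(1) sys_range_carrier[OF r] _ that]
      \<rho> \<rho>' by (force simp: sys_range_def)
  have 2: "\<rho> (\<rho>' b) = b" if "b \<in> carrier B'" for b
    using cstar_hom_agree[OF B' B' cstar_hom_comp[OF \<rho>'(1) \<rho>(1)] cstar_hom_id g(2) sys_range_carrier[OF r'] _ that]
      \<rho> \<rho>' by (force simp: sys_range_def)
  show thesis by (rule that[of \<rho> \<rho>']) (simp_all add: \<rho> \<rho>' 1 2)
qed

section \<open>Tensor products with the universal algebra\<close>

locale ext_corr = Z: correspondence A Z + W: correspondence B W + mod_rep A Z B W \<pi> \<epsilon>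
  for A :: "('a, 'm) cstar_algebra_scheme" and Z :: "('a, 'z, 'n) correspondence_scheme"
    and B :: "('b, 'p) cstar_algebra_scheme" and W :: "('b, 'w, 'q) correspondence_scheme"
    and \<pi> :: "'a \<Rightarrow> 'b" and \<epsilon> :: "'z \<Rightarrow> 'w" +
  assumes dense: "norm_closure W (hnorm B W)
      (cspan W {ract W (\<epsilon> z) b |z b. z \<in> carrier Z \<and> b \<in> carrier B}) = carrier W"
    and lact_\<epsilon>: "\<lbrakk>a \<in> carrier A; z \<in> carrier Z\<rbrakk> \<Longrightarrow> lact W (\<pi> a) (\<epsilon> z) = \<epsilon> (lact Z a z)"
begin

abbreviation "elements \<equiv> {ract W (\<epsilon> z) b |z b. z \<in> carrier Z \<and> b \<in> carrier B}"

lemma \<epsilon>_closed [simp, intro]: "z \<in> carrier Z \<Longrightarrow> \<epsilon> z \<in> carrier W"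
  by (rule closed)

lemma elements_carrier: "elements \<subseteq> carrier W"
  by auto

lemma W_agree:
  assumes "normed_cvs M N" "bdd_linear W (hnorm B W) M N f" "bdd_linear W (hnorm B W) M N g"
    and "\<And>z b. \<lbrakk>z \<in> carrier Z; b \<in> carrier B\<rbrakk> \<Longrightarrow> f (ract W (\<epsilon> z) b) = g (ract W (\<epsilon> z) b)" and "w \<in> carrier W"
  shows "f w = g w"
  by (rule bdd_linear_agree[OF W.X.normed_cvs_axioms assms(1-3) elements_carrier])
    (use assms(4,5) dense in auto)

end

lemma ext_corrD:
  assumes "ext_corr A Z B W \<pi> \<epsilon>"
  shows "correspondence A Z" "correspondence B W" "mod_rep A Z B W \<pi> \<epsilon>" "ext_mod A Z B W \<pi> \<epsilon>"
    "\<lbrakk>a \<in> carrier A; z \<in> carrier Z\<rbrakk> \<Longrightarrow> lact W (\<pi> a) (\<epsilon> z) = \<epsilon> (lact Z a z)"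
  using assms by (simp_all add: ext_corr_def ext_corr_axioms_def ext_mod_def)

lemma ext_corrI:
  assumes "correspondence A Z" "correspondence B W" "ext_mod A Z B W \<pi> \<epsilon>"
    "\<And>a z. \<lbrakk>a \<in> carrier A; z \<in> carrier Z\<rbrakk> \<Longrightarrow> lact W (\<pi> a) (\<epsilon> z) = \<epsilon> (lact Z a z)"
  shows "ext_corr A Z B W \<pi> \<epsilon>"
  using assms by (simp add: ext_corr_def ext_corr_axioms_def ext_mod_def)

text \<open>The values on \<epsilon>(z) b are forced, and they respect inner products because \<rho>
  \<circ> \<pi> = \<pi>'. The lemma serves twice: with \<open>alg_corr D\<close> for V to extend a
  representation of Z to W, and with another model of the tensor product for V to compare the two
  models.\<close>

lemma ex_ext_corr_hom:
  assumes W: "ext_corr A Z B W \<pi> \<epsilon>" and f: "mod_rep A Z D V \<pi>' f"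
    and \<rho>: "cstar_hom B D \<rho>" "\<And>a. a \<in> carrier A \<Longrightarrow> \<rho> (\<pi> a) = \<pi>' a"
  shows "\<exists>\<phi>. mod_rep B W D V \<rho> \<phi> \<and> (\<forall>z\<in>carrier Z. \<forall>b\<in>carrier B. \<phi> (ract W (\<epsilon> z) b) = ract V (f z) (\<rho> b)) \<and>
    (\<forall>z\<in>carrier Z. \<phi> (\<epsilon> z) = f z)"
proof -
  interpret W: ext_corr A Z B W \<pi> \<epsilon> by fact
  interpret f: mod_rep A Z D V \<pi>' f by fact
  note rh = cstar_homD[OF \<rho>(1)]
  have "\<exists>\<phi>. mod_rep B W D V \<rho> \<phi> \<and> (\<forall>z\<in>carrier Z. \<forall>b\<in>carrier B. \<phi> (ract W (\<epsilon> z) b) = ract V (f z) (\<rho> b))"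
  proof (rule mod_rep_extend)
    show "hilbert_module B W" "hilbert_module D V" "cstar_hom B D \<rho>"
      by (rule W.W.hilbert_module_axioms f.W.hilbert_module_axioms \<rho>(1))+
    fix z b z' b' assume "z \<in> carrier Z" "b \<in> carrier B" "z' \<in> carrier Z" "b' \<in> carrier B"
    then show "hinner V (ract V (f z) (\<rho> b)) (ract V (f z') (\<rho> b')) =
        \<rho> (hinner W (ract W (\<epsilon> z) b) (ract W (\<epsilon> z') b'))"
      using W.\<pi>(1) by (simp add: W.W.hinner_ract W.W.hinner_ract_left f.W.hinner_ract f.W.hinner_ract_left
          W.inner f.inner f.closed rh \<rho>(2))
  qed (auto simp: rh(1) f.closed W.dense)
  then obtain \<phi> where \<phi>: "mod_rep B W D V \<rho> \<phi>"
    and \<phi>z: "\<And>z b. \<lbrakk>z \<in> carrier Z; b \<in> carrier B\<rbrakk> \<Longrightarrow> \<phi> (ract W (\<epsilon> z) b) = ract V (f z) (\<rho> b)"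
    by blast
  have "\<phi> (\<epsilon> z) = f z" if z: "z \<in> carrier Z" for z
  proof (rule mod_rep_agree[OF mod_rep_comp[OF W.mod_rep_axioms \<phi>] f.mod_rep_axioms _ _ W.Z.ract_dense z])
    fix y assume "y \<in> {ract Z x a |x a. x \<in> carrier Z \<and> a \<in> carrier A}"
    then obtain x a where "y = ract Z x a" "x \<in> carrier Z" "a \<in> carrier A" by blast
    then show "\<phi> (\<epsilon> y) = f y" using W.\<pi>(1) by (simp add: W.ract f.ract \<phi>z \<rho>(2))
  qed auto
  then show ?thesis using \<phi> \<phi>z by blast
qed

lemma ex_ext_corr:
  assumes Z: "correspondence A Z" and hom: "cstar_hom A B \<pi>" and e: "extended_corr A Z B \<pi> W e"
  shows "\<exists>\<epsilon>. ext_corr A Z B W \<pi> \<epsilon> \<and> (\<forall>z\<in>carrier Z. \<forall>S\<in>carrier B. e z S = ract W (\<epsilon> z) S)"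
proof -
  interpret Z: correspondence A Z by fact
  interpret W: correspondence B W using e by (simp add: extended_corr_def)
  note \<pi> = cstar_homD[OF hom]
  from e have T: "interior_tensor A Z (hom_lact B \<pi>) B (alg_corr B) W e"
    and le: "\<And>a z S. \<lbrakk>a \<in> carrier A; z \<in> carrier Z; S \<in> carrier B\<rbrakk> \<Longrightarrow> lact W (\<pi> a) (e z S) = e (lact Z a z) S"
    by (simp_all add: extended_corr_def)
  obtain \<epsilon> where \<epsilon>: "ext_mod A Z B W \<pi> \<epsilon>" "\<forall>z\<in>carrier Z. \<forall>S\<in>carrier B. e z S = ract W (\<epsilon> z) S"
    using ex_ext_mod[OF T hom] by blast
  have cl: "\<epsilon> z \<in> carrier W" if "z \<in> carrier Z" for z
    using \<epsilon>(1) mod_rep.closed that by (fastforce simp: ext_mod_def)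
  have "lact W (\<pi> a) (\<epsilon> z) = \<epsilon> (lact Z a z)" if az: "a \<in> carrier A" "z \<in> carrier Z" for a z
  proof (rule W.ract_cancel)
    fix S assume S: "S \<in> carrier B"
    have "ract W (lact W (\<pi> a) (\<epsilon> z)) S = lact W (\<pi> a) (ract W (\<epsilon> z) S)"
      using az S \<pi>(1) cl by (simp add: W.C.act_ract)
    also have "\<dots> = ract W (\<epsilon> (lact Z a z)) S"
      using le[OF az S] \<epsilon>(2) az S by simp
    finally show "ract W (lact W (\<pi> a) (\<epsilon> z)) S = ract W (\<epsilon> (lact Z a z)) S" .
  qed (use az \<pi>(1) cl in auto)
  then have "ext_corr A Z B W \<pi> \<epsilon>"
    by (rule ext_corrI[OF Z.correspondence_axioms W.correspondence_axioms \<epsilon>(1)])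
  then show ?thesis using \<epsilon>(2) by blast
qed

text \<open>The left action of \<open>t x\<close> for \<open>x\<close> in the fibre \<open>p\<close>, with \<open>\<epsilon> z\<close> in the role of \<open>z \<otimes> 1\<close>; the map
  \<open>\<mu>\<close> is \<open>z \<otimes> x \<mapsto> z \<otimes> t(x)\<close>.\<close>

definition creates ::
  "'u corr_system \<Rightarrow> nat \<Rightarrow> nat \<Rightarrow> ('b, 'p) cstar_algebra_scheme \<Rightarrow> ('u \<Rightarrow> 'b) \<Rightarrow> ('u \<Rightarrow> 'b) \<Rightarrow>
    ('b, 'w, 'q) correspondence_scheme \<Rightarrow> ('u \<Rightarrow> 'w) \<Rightarrow> bool" where
  "creates Y p j B \<pi> t W \<epsilon> \<longleftrightarrow> (\<exists>\<mu>. mod_rep (coeff Y) (sq Y j p) B W \<pi> \<mu> \<and>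
    (\<forall>x\<in>carrier (fibre Y p). \<forall>z\<in>carrier (fibre Y j).
      \<mu> (tens Y j p z x) = ract W (\<epsilon> z) (t x) \<and>
      lact W (t x) (\<epsilon> z) = \<mu> (flip Y p j (tens Y p j x z))))"

text \<open>In the model N of the triple tensor product let \<eta>(w) be w \<otimes> 1; the witness
  is F \<circ> \<eta>. The creation action is given on the vectors e z S, so both identities for
  \<epsilon>(z) are tested after right multiplication by S, which is then cancelled.\<close>

lemma creation_action_creates:
  assumes T: "corr_tensor (coeff Y) (fibre Y j) (fibre Y p) (sq Y j p) (tens Y j p)"
      "corr_tensor (coeff Y) (fibre Y p) (fibre Y j) (sq Y p j) (tens Y p j)"
    and flip: "\<And>w. w \<in> carrier (sq Y p j) \<Longrightarrow> flip Y p j w \<in> carrier (sq Y j p)"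
    and x: "ext_corr (coeff Y) (fibre Y j) B W \<pi> \<epsilon>"
    and e: "\<forall>z\<in>carrier (fibre Y j). \<forall>S\<in>carrier B. e z S = ract W (\<epsilon> z) S"
    and t: "\<And>x. x \<in> carrier (fibre Y p) \<Longrightarrow> t x \<in> carrier B"
    and c: "creation_action Y p j B \<pi> t W e"
  shows "creates Y p j B \<pi> t W \<epsilon>"
proof -
  interpret \<epsilon>: ext_corr "coeff Y" "fibre Y j" B W \<pi> \<epsilon> by fact
  let ?A = "coeff Y" and ?p = "fibre Y p" and ?j = "fibre Y j"
  from c obtain U u \<phi> V N n n' F where
    U: "interior_tensor ?A ?p (hom_lact B \<pi>) B (alg_corr B) (U :: ('a, 'a) hilbert_module) u"
    and V: "hilbert_isometry B U (alg_corr B) V" "\<forall>x\<in>carrier ?p. \<forall>S\<in>carrier B. V (u x S) = t x \<otimes>\<^bsub>B\<^esub> S"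
    and N: "triple_tensor ?A ?j ?p (hom_lact B \<pi>) B (alg_corr B) (sq Y j p) (tens Y j p) \<phi> U u
      (N :: ('a, 'a) hilbert_module) n n'"
    and F: "hilbert_isometry B N W F" "\<forall>z\<in>carrier ?j. \<forall>\<xi>\<in>carrier U. F (n' z \<xi>) = e z (V \<xi>)"
      "\<forall>x\<in>carrier ?p. \<forall>z\<in>carrier ?j. \<forall>S\<in>carrier B. lact W (t x) (e z S) = F (n (flip Y p j (tens Y p j x z)) S)"
    unfolding creation_action_def by blast
  have Ni: "interior_tensor ?A (sq Y j p) (hom_lact B \<pi>) B (alg_corr B) N n"
    and nn: "\<And>z x S. \<lbrakk>z \<in> carrier ?j; x \<in> carrier ?p; S \<in> carrier B\<rbrakk> \<Longrightarrow> n (tens Y j p z x) S = n' z (u x S)"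
    using N unfolding triple_tensor_def by simp_all
  obtain \<eta> where \<eta>: "ext_mod ?A (sq Y j p) B N \<pi> \<eta>" "\<forall>w\<in>carrier (sq Y j p). \<forall>S\<in>carrier B. n w S = ract N (\<eta> w) S"
    using ex_ext_mod[OF Ni \<epsilon>.hom] by blast
  have \<eta>m: "mod_rep ?A (sq Y j p) B N \<pi> \<eta>" using \<eta>(1) by (simp add: ext_mod_def)
  interpret F: mod_rep B N B W "\<lambda>b. b" F
    by (rule mod_rep_isometry[OF mod_repD(2)[OF \<eta>m] \<epsilon>.W.hilbert_module_axioms F(1)])
  interpret \<mu>: mod_rep ?A "sq Y j p" B W \<pi> "\<lambda>w. F (\<eta> w)"
    using mod_rep_comp[OF \<eta>m F.mod_rep_axioms] .
  interpret \<eta>: mod_rep ?A "sq Y j p" B N \<pi> \<eta> by (rule \<eta>m)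
  have Fn: "F (n w S) = ract W (F (\<eta> w)) S" if "w \<in> carrier (sq Y j p)" "S \<in> carrier B" for w S
    using that \<eta>(2) by (simp add: F.ract \<eta>.closed)
  interpret U: tensor ?A ?p "hom_lact B \<pi>" B "alg_corr B" U u by (rule tensorI[OF U])
  have "F (\<eta> (tens Y j p z x)) = ract W (\<epsilon> z) (t x) \<and> lact W (t x) (\<epsilon> z) = F (\<eta> (flip Y p j (tens Y p j x z)))"
    if x: "x \<in> carrier ?p" and z: "z \<in> carrier ?j" for x z
  proof
    have zx: "tens Y j p z x \<in> carrier (sq Y j p)" by (rule corr_tensorD(6)[OF T(1) z x])
    have xz: "flip Y p j (tens Y p j x z) \<in> carrier (sq Y j p)"
      by (rule flip[OF corr_tensorD(6)[OF T(2) x z]])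
    show "F (\<eta> (tens Y j p z x)) = ract W (\<epsilon> z) (t x)"
    proof (rule \<epsilon>.W.ract_cancel)
      fix S assume S: "S \<in> carrier B"
      have "u x S \<in> carrier U" using U.\<tau>_closed x S by simp
      then show "ract W (F (\<eta> (tens Y j p z x))) S = ract W (ract W (\<epsilon> z) (t x)) S"
        using x z S t e F(2) V(2) by (simp add: nn \<epsilon>.W.ract_mult flip: Fn[OF zx S])
    qed (use zx \<mu>.closed z x t in auto)
    show "lact W (t x) (\<epsilon> z) = F (\<eta> (flip Y p j (tens Y p j x z)))"
    proof (rule \<epsilon>.W.ract_cancel)
      fix S assume S: "S \<in> carrier B"
      then show "ract W (lact W (t x) (\<epsilon> z)) S = ract W (F (\<eta> (flip Y p j (tens Y p j x z)))) S"
        using x z t e F(3) by (simp add: Fn[OF xz S, symmetric] flip: \<epsilon>.W.C.act_ract)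
    qed (use xz \<mu>.closed z x t in auto)
  qed
  then show ?thesis unfolding creates_def using \<mu>.mod_rep_axioms by blast
qed

lemma (in cstar_algebra) alg_left_action: "left_action A A (alg_corr A) (\<otimes>)"
proof -
  interpret R: hilbert_module A "alg_corr A" by (rule hilbert_alg_corr)
  have "cstar_hom A LA emb"
    unfolding cstar_hom_def
    by (auto simp: emb_closed emb_star emb_add emb_mult)
      (auto simp: emb_def R.adj_simps fun_eq_iff smult_mult_left)
  then have "cstar_hom A LA (\<lambda>a. \<lambda>x\<in>carrier (alg_corr A). a \<otimes> x)"
    by (simp add: emb_def[abs_def])
  then show ?thesis
    by (simp add: left_action_def left_action_axioms_def cstar_algebra_axioms R.hilbert_module_axioms)
qed

text \<open>The adjoints \<open>t\<^sub>l(x)\<^sup>*\<close> are dealt with by nondegeneracy and covariance: \<open>W\<close> is the closed span of the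
  vectors \<open>t\<^sub>l(y) u\<close>, on which \<open>t\<^sub>l(x)\<^sup>*\<close> acts by \<open>\<pi>(\<langle>x, y\<rangle>) u\<close>.\<close>

lemma sys_fibre_intertwine:
  assumes r: "sys_rep n Y B \<pi> t" and gen: "cstar_generate B (sys_range n Y \<pi> t) = carrier B"
    and W: "ext_corr (coeff Y) Z B W \<pi> \<epsilon>"
    and T: "mod_rep B W D V \<rho> T" and act: "left_action D D V act"
    and base0: "\<And>a z. \<lbrakk>a \<in> carrier (coeff Y); z \<in> carrier Z\<rbrakk> \<Longrightarrow> act (\<rho> (\<pi> a)) (T (\<epsilon> z)) = T (\<epsilon> (lact Z a z))"
    and base1: "\<And>l x z. \<lbrakk>l \<in> {1..n}; x \<in> carrier (fibre Y l); z \<in> carrier Z\<rbrakk> \<Longrightarrow>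
      act (\<rho> (t l x)) (T (\<epsilon> z)) = T (lact W (t l x) (\<epsilon> z))"
    and b: "b \<in> carrier B" and w: "w \<in> carrier W"
  shows "act (\<rho> b) (T w) = T (lact W b w)"
proof -
  interpret B: cstar_algebra B by (rule sys_repD(1)[OF r])
  interpret V: left_action D D V act by (rule act)
  interpret W: ext_corr "coeff Y" Z B W \<pi> \<epsilon> by (rule W)
  interpret T: mod_rep B W D V \<rho> T by (rule T)
  note D = V.A.cstar_algebra_axioms
  have bdd1: "bdd_linear W (hnorm B W) V (hnorm D V) (\<lambda>w. act (\<rho> c) (T w))" if "c \<in> carrier B" for c
    by (rule bdd_linear_comp[OF T.bdd V.act_bdd]) (use that T.\<pi>(1) V.Y.X.normed_cvs_axioms W.W.X.normed_cvs_axioms in auto)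
  have bdd2: "bdd_linear W (hnorm B W) V (hnorm D V) (\<lambda>w. T (lact W c w))" if "c \<in> carrier B" for c
    by (rule bdd_linear_comp[OF W.W.C.act_bdd T.bdd]) (use that W.W.X.normed_cvs_axioms in auto)
  note agree = W.W_agree[OF V.Y.X.normed_cvs_axioms bdd1 bdd2]
  \<comment> \<open>An identity on the vectors \<epsilon>(z) extends to all of W, because both sides
    are maps of right modules along \<rho> and the vectors \<epsilon>(z) b are total.\<close>
  have Q1: "act (\<rho> c) (T w) = T (lact W c w)"
    if c: "c \<in> carrier B" and "\<And>z. z \<in> carrier Z \<Longrightarrow> act (\<rho> c) (T (\<epsilon> z)) = T (lact W c (\<epsilon> z))"
      and w: "w \<in> carrier W" for c w
  proof (rule agree[OF c c _ w])
    fix z b assume z: "z \<in> carrier Z" and b: "b \<in> carrier B"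
    have "act (\<rho> c) (T (ract W (\<epsilon> z) b)) = ract V (act (\<rho> c) (T (\<epsilon> z))) (\<rho> b)"
      using c z b by (simp add: T.ract V.act_ract T.closed T.\<pi>(1))
    also have "\<dots> = T (lact W c (ract W (\<epsilon> z) b))"
      using c z b by (simp add: that(2) W.W.C.act_ract T.ract)
    finally show "act (\<rho> c) (T (ract W (\<epsilon> z) b)) = T (lact W c (ract W (\<epsilon> z) b))" .
  qed
  have Q\<pi>: "act (\<rho> (\<pi> a)) (T w) = T (lact W (\<pi> a) w)" if "a \<in> carrier (coeff Y)" "w \<in> carrier W" for a w
    by (rule Q1) (use that W.\<pi>(1) base0 W.lact_\<epsilon> in auto)
  have Qt: "act (\<rho> (t l x)) (T w) = T (lact W (t l x) w)"
    if "l \<in> {1..n}" "x \<in> carrier (fibre Y l)" "w \<in> carrier W" for l x w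
    by (rule Q1[OF sys_repD(5)[OF r that(1,2)] _ that(3)]) (rule base1[OF that(1,2)])
  have Qs: "act (\<rho> (star B (t l x))) (T w) = T (lact W (star B (t l x)) w)"
    if l: "l \<in> {1..n}" and x: "x \<in> carrier (fibre Y l)" and w: "w \<in> carrier W" for l x w
  proof -
    have tc: "t l y \<in> carrier B" if "y \<in> carrier (fibre Y l)" for y by (rule sys_repD(5)[OF r l that])
    have c: "star B (t l x) \<in> carrier B" using tc[OF x] by simp
    interpret t: corr_rep "coeff Y" "fibre Y l" B \<pi> "t l" by (rule sys_repD(4)[OF r l])
    let ?P = "\<lambda>p v. act (\<rho> (star B (t l x))) (T (lact W p v)) = T (lact W (star B (t l x)) (lact W p v))"
    have P: "?P p v" if p: "p \<in> rep_compacts B (fibre Y l) (t l)" and v: "v \<in> carrier W" for p v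
    proof -
      have "p \<in> B.nclspan t.gens" using p by (simp add: t.P_eq)
      then show ?thesis
      proof (rule B.nclspan_induct[OF _ t.gens_carrier])
        fix s assume "s \<in> t.gens"
        then obtain y y' where s: "s = t l y \<otimes>\<^bsub>B\<^esub> star B (t l y')" "y \<in> carrier (fibre Y l)" "y' \<in> carrier (fibre Y l)"
          by blast
        define u where "u = lact W (star B (t l y')) v"
        have u: "u \<in> carrier W" unfolding u_def using s v tc by simp
        have su: "lact W s v = lact W (t l y) u" unfolding s(1) u_def using s v tc by (simp add: W.W.C.act_mult)
        have "act (\<rho> (star B (t l x))) (T (lact W (t l y) u)) = act (\<rho> (star B (t l x))) (act (\<rho> (t l y)) (T u))"
          by (simp add: Qt[OF l s(2) u])
        also have "\<dots> = act (\<rho> (\<pi> (hinner (fibre Y l) x y))) (T u)"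
          using u x s(2) tc by (simp add: T.closed T.\<pi> flip: V.act_mult t.t_inner)
        also have "\<dots> = T (lact W (star B (t l x) \<otimes>\<^bsub>B\<^esub> t l y) u)"
          using x s(2) u by (simp add: Q\<pi> t.t_inner)
        also have "\<dots> = T (lact W (star B (t l x)) (lact W (t l y) u))"
          using x s(2) u tc by (simp add: W.W.C.act_mult)
        finally show "?P s v" by (simp add: su)
      next
        show "?P \<zero>\<^bsub>B\<^esub> v"
          using W.W.C.act_smult_left[of "\<zero>\<^bsub>B\<^esub>" v 0] v c V.act_smult[of "\<rho> (star B (t l x))" "T v" 0]
            W.W.C.act_smult[of "star B (t l x)" v 0] T.smult[OF v, of 0] T.closed T.\<pi>(1) by simp
      next
        fix \<sigma> q assume \<sigma>: "\<And>i. ?P (\<sigma> i) v" "B.nlim \<sigma> q"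
        have l1: "W.W.X.nlim (\<lambda>i. lact W (\<sigma> i) v) (lact W q v)"
          by (rule bdd_linear_nlim[OF B.normed_cvs_axioms W.W.X.normed_cvs_axioms W.W.C.act_bdd_left[OF v] \<sigma>(2)])
        show "?P q v"
          using bdd_linear_nlim[OF W.W.X.normed_cvs_axioms V.Y.X.normed_cvs_axioms bdd1[OF c] l1]
            bdd_linear_nlim[OF W.W.X.normed_cvs_axioms V.Y.X.normed_cvs_axioms bdd2[OF c] l1] \<sigma>(1)
          by (auto intro: V.Y.X.nlim_unique)
      qed (use c v in \<open>simp_all add: W.W.C.act_add_left W.W.C.act_smult_left W.W.C.act_add W.W.C.act_smult
          T.add T.smult V.act_add V.act_smult T.closed T.\<pi>(1)\<close>)
    qed
    show ?thesis
    proof (rule agree[OF c c _ w])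
      fix z b assume z: "z \<in> carrier Z" and b: "b \<in> carrier B"
      obtain a z' where a: "a \<in> carrier (coeff Y)" "z' \<in> carrier Z" "z = lact Z a z'"
        by (rule W.Z.nondegenerate'[OF z])
      have "ract W (\<epsilon> z) b = lact W (\<pi> a) (ract W (\<epsilon> z') b)"
        using a b W.\<pi>(1) by (simp add: W.W.C.act_ract W.lact_\<epsilon>)
      moreover have "\<pi> a \<in> rep_compacts B (fibre Y l) (t l)"
        using sys_repD(3)[OF r l] a(1) by (simp add: cov_rep_def)
      ultimately show "act (\<rho> (star B (t l x))) (T (ract W (\<epsilon> z) b)) = T (lact W (star B (t l x)) (ract W (\<epsilon> z) b))"
        using P[of "\<pi> a" "ract W (\<epsilon> z') b"] a(2) b by simp
    qed
  qed
  \<comment> \<open>The property of b is quantified over all w, which makes it multiplicative: in a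
    product c d the factor c meets the vector d w.\<close>
  have "\<forall>w\<in>carrier W. act (\<rho> b) (T w) = T (lact W b w)"
  proof (rule B.cstar_generate_induct[OF gen sys_range_carrier[OF r] b])
    fix s assume "s \<in> sys_range n Y \<pi> t"
    then consider a where "a \<in> carrier (coeff Y)" "s = \<pi> a"
      | l x where "l \<in> {1..n}" "x \<in> carrier (fibre Y l)" "s = t l x"
      unfolding sys_range_def by blast
    then show "(\<forall>w\<in>carrier W. act (\<rho> s) (T w) = T (lact W s w)) \<and>
        (\<forall>w\<in>carrier W. act (\<rho> (star B s)) (T w) = T (lact W (star B s) w))"
    proof cases
      case 1
      then show ?thesis using Q\<pi> Q\<pi>[of "star (coeff Y) a"] by (simp add: W.\<pi>)
    next
      case 2
      then show ?thesis using Qt Qs by simp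
    qed
  next
    fix \<sigma> x assume \<sigma>: "\<And>n. \<forall>w\<in>carrier W. act (\<rho> (\<sigma> n)) (T w) = T (lact W (\<sigma> n) w)" "B.nlim \<sigma> x"
    show "\<forall>w\<in>carrier W. act (\<rho> x) (T w) = T (lact W x w)"
    proof
      fix w assume w: "w \<in> carrier W"
      have "V.A.nlim (\<lambda>n. \<rho> (\<sigma> n)) (\<rho> x)"
        by (rule bdd_linear_nlim[OF B.normed_cvs_axioms V.A.normed_cvs_axioms
              cstar_hom_bdd[OF B.cstar_algebra_axioms D T.hom] \<sigma>(2)])
      then have "V.Y.X.nlim (\<lambda>n. act (\<rho> (\<sigma> n)) (T w)) (act (\<rho> x) (T w))"
        by (rule bdd_linear_nlim[OF V.A.normed_cvs_axioms V.Y.X.normed_cvs_axioms V.act_bdd_left[OF T.closed[OF w]]])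
      moreover have "V.Y.X.nlim (\<lambda>n. T (lact W (\<sigma> n) w)) (T (lact W x w))"
        by (intro bdd_linear_nlim[OF W.W.X.normed_cvs_axioms V.Y.X.normed_cvs_axioms T.bdd]
            bdd_linear_nlim[OF B.normed_cvs_axioms W.W.X.normed_cvs_axioms W.W.C.act_bdd_left[OF w] \<sigma>(2)])
      ultimately show "act (\<rho> x) (T w) = T (lact W x w)" using \<sigma>(1) w by (auto intro: V.Y.X.nlim_unique)
    qed
  next
    show "\<forall>w\<in>carrier W. act (\<rho> \<zero>\<^bsub>B\<^esub>) (T w) = T (lact W \<zero>\<^bsub>B\<^esub> w)"
      using W.W.C.act_smult_left[of "\<zero>\<^bsub>B\<^esub>" _ 0] V.act_smult_left[of "\<zero>\<^bsub>D\<^esub>" _ 0] T.smult[of _ 0] T.closed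
        cstar_hom_zero[OF B.cstar_algebra_axioms D T.hom] by simp
  qed (simp_all add: W.W.C.act_add_left W.W.C.act_smult_left W.W.C.act_mult V.act_mult
      T.add T.smult V.act_add_left V.act_smult_left T.closed T.\<pi>)
  then show ?thesis using w by blast
qed

section \<open>The iteration\<close>

definition sys_fibre ::
  "nat \<Rightarrow> 'u corr_system \<Rightarrow> nat \<Rightarrow> ('b, 'p) cstar_algebra_scheme \<Rightarrow> ('u \<Rightarrow> 'b) \<Rightarrow> (nat \<Rightarrow> 'u \<Rightarrow> 'b) \<Rightarrow>
    ('b, 'w, 'q) correspondence_scheme \<Rightarrow> ('u \<Rightarrow> 'w) \<Rightarrow> bool" where
  "sys_fibre n Y j B \<pi> t W \<epsilon> \<longleftrightarrow>
    ext_corr (coeff Y) (fibre Y j) B W \<pi> \<epsilon> \<and> (\<forall>l\<in>{1..n}. creates Y l j B \<pi> (t l) W \<epsilon>)"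

lemma sys_fibreD:
  assumes "sys_fibre n Y j B \<pi> t W \<epsilon>"
  shows "ext_corr (coeff Y) (fibre Y j) B W \<pi> \<epsilon>" "l \<in> {1..n} \<Longrightarrow> creates Y l j B \<pi> (t l) W \<epsilon>"
  using assms by (simp_all add: sys_fibre_def)

lemma sys_rep_mono: "\<lbrakk>sys_rep n Y D \<pi> t; m \<le> n\<rbrakk> \<Longrightarrow> sys_rep m Y D \<pi> t"
  by (simp add: sys_rep_def)

text \<open>Covariance of \<open>\<tau> \<circ> \<epsilon>\<close>: the image of the compact operator \<open>z \<mapsto> a z\<close> and \<open>\<sigma>(\<pi>(a))\<close> agree on
  \<open>\<tau>(\<epsilon>(z) b)\<close>, hence on \<open>\<tau>(W)\<close>, and both belong to the closed span of \<open>\<tau>(W) \<tau>(W)\<^sup>*\<close>.\<close>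

lemma step_cov_rep:
  assumes W: "ext_corr A Z B W \<pi> \<epsilon>" and \<tau>: "cov_rep B W D \<sigma> \<tau>"
  shows "cov_rep A Z D (\<lambda>a. \<sigma> (\<pi> a)) (\<lambda>z. \<tau> (\<epsilon> z))"
proof -
  have \<tau>c: "corr_rep B W D \<sigma> \<tau>" using \<tau> by (simp add: cov_rep_def)
  interpret D: cstar_algebra D by (rule corr_repD(3)[OF \<tau>c])
  interpret W: ext_corr A Z B W \<pi> \<epsilon> by fact
  interpret \<tau>: corr_rep B W D \<sigma> \<tau> by fact
  note m = mod_rep_comp[OF W.mod_rep_axioms \<tau>.mod_rep_axioms]
  have c: "corr_rep A Z D (\<lambda>a. \<sigma> (\<pi> a)) (\<lambda>z. \<tau> (\<epsilon> z))"
    by (rule corr_repI[OF m W.Z.correspondence_axioms]) (simp add: \<tau>.left W.\<pi>(1) W.lact_\<epsilon>)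
  interpret c: corr_rep A Z D "\<lambda>a. \<sigma> (\<pi> a)" "\<lambda>z. \<tau> (\<epsilon> z)" by fact
  obtain t1 where "cstar_hom (compact_ops A Z) D t1"
    "\<And>x y. \<lbrakk>x \<in> carrier Z; y \<in> carrier Z\<rbrakk> \<Longrightarrow> t1 (rank_one Z x y) = \<tau> (\<epsilon> x) \<otimes>\<^bsub>D\<^esub> star D (\<tau> (\<epsilon> y))"
    and t1: "\<And>K. K \<in> carrier (compact_ops A Z) \<Longrightarrow> t1 K \<in> c.P"
    "\<And>K z. \<lbrakk>K \<in> carrier (compact_ops A Z); z \<in> carrier Z\<rbrakk> \<Longrightarrow> t1 K \<otimes>\<^bsub>D\<^esub> \<tau> (\<epsilon> z) = \<tau> (\<epsilon> (K z))"
    by (rule c.ex_compact_hom) (rule that)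
  have sub: "c.P \<subseteq> \<tau>.P"
    by (rule rep_compacts_subset[OF c.alg_rep_axioms D.cstar_algebra_axioms \<tau>.P_sub \<tau>.P_nclosed])
      (use \<tau>.gen_in_P in auto)
  have "\<sigma> (\<pi> a) \<in> c.P" if a: "a \<in> carrier A" for a
  proof -
    have K: "left_op Z a \<in> carrier (compact_ops A Z)" using W.Z.left_compact a by blast
    have TP: "t1 (left_op Z a) \<in> c.P" by (rule t1(1)[OF K])
    then have Tc: "t1 (left_op Z a) \<in> carrier D" using c.P_carrier by blast
    note bdd = mod_rep_mult_bdd(2)[OF \<tau>.mod_rep_axioms]
    have pc: "\<sigma> (\<pi> a) \<in> carrier D" using a W.\<pi>(1) \<tau>.\<pi>(1) by blast
    have "\<sigma> (\<pi> a) = t1 (left_op Z a)"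
    proof (rule \<tau>.P_cancel)
      show "\<sigma> (\<pi> a) \<in> \<tau>.P" using \<tau> W.\<pi>(1)[OF a] by (simp add: cov_rep_def)
      show "t1 (left_op Z a) \<in> \<tau>.P" using TP sub by blast
      fix w assume w: "w \<in> carrier W"
      show "\<sigma> (\<pi> a) \<otimes>\<^bsub>D\<^esub> \<tau> w = t1 (left_op Z a) \<otimes>\<^bsub>D\<^esub> \<tau> w"
      proof (rule W.W_agree[OF D.normed_cvs_axioms bdd[OF pc] bdd[OF Tc] _ w])
        fix z b assume z: "z \<in> carrier Z" and b: "b \<in> carrier B"
        have "t1 (left_op Z a) \<otimes>\<^bsub>D\<^esub> \<tau> (\<epsilon> z) = \<sigma> (\<pi> a) \<otimes>\<^bsub>D\<^esub> \<tau> (\<epsilon> z)"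
          using t1(2)[OF K z] c.left[OF a z] z by (simp add: left_op_def)
        then show "\<sigma> (\<pi> a) \<otimes>\<^bsub>D\<^esub> \<tau> (ract W (\<epsilon> z) b) = t1 (left_op Z a) \<otimes>\<^bsub>D\<^esub> \<tau> (ract W (\<epsilon> z) b)"
          using z b pc Tc \<tau>.\<pi>(1) by (simp add: \<tau>.t_ract flip: D.mult_assoc)
      qed
    qed
    then show ?thesis using TP by simp
  qed
  then show ?thesis using c by (simp add: cov_rep_def)
qed

text \<open>The map is T(\<epsilon>(z) b) = t'_p(z) \<rho>(b). It respects left actions because T
  carries the creation formula on W to the commutation relation of t'. For covariance, \<rho>(B)
  must lie in the closed span \<open>T.P\<close>, which absorbs \<rho>(B) from the left and contains
  \<rho>(\<pi>(A)) by covariance of t'_p; the t_l(x) follow as limits of products t_l(x)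
  \<pi>(a).\<close>

lemma step_universal:
  assumes r: "sys_rep n Y B \<pi> t" and gen: "cstar_generate B (sys_range n Y \<pi> t) = carrier B"
    and W: "sys_fibre n Y p B \<pi> t W \<epsilon>"
    and \<rho>: "cstar_hom B D \<rho>" "\<And>a. a \<in> carrier (coeff Y) \<Longrightarrow> \<rho> (\<pi> a) = \<pi>' a"
      "\<And>l x. \<lbrakk>l \<in> {1..n}; x \<in> carrier (fibre Y l)\<rbrakk> \<Longrightarrow> \<rho> (t l x) = t' l x"
    and cov: "cov_rep (coeff Y) (fibre Y p) D \<pi>' (t' p)"
    and flip: "\<And>l. l \<in> {1..n} \<Longrightarrow> flip_rel Y D \<pi>' t' l p"
    and Y: "generating_system k Y" and pk: "p \<in> {1..k}" and nk: "n \<le> k"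
  shows "\<exists>T. cov_rep B W D \<rho> T \<and> (\<forall>z\<in>carrier (fibre Y p). T (\<epsilon> z) = t' p z)"
proof -
  let ?A = "coeff Y" and ?Z = "fibre Y p"
  note g = generating_systemD[OF Y]
  have sc: "corr_rep ?A ?Z D \<pi>' (t' p)" using cov by (simp add: cov_rep_def)
  interpret B: cstar_algebra B by (rule sys_repD(1)[OF r])
  interpret D: cstar_algebra D by (rule corr_repD(3)[OF sc])
  interpret W: ext_corr ?A ?Z B W \<pi> \<epsilon> by (rule sys_fibreD(1)[OF W])
  interpret s: corr_rep ?A ?Z D \<pi>' "t' p" by (rule sc)
  note rh = cstar_homD[OF \<rho>(1)]
  have "\<exists>T. mod_rep B W D (alg_corr D) \<rho> T \<and>
      (\<forall>z\<in>carrier ?Z. \<forall>b\<in>carrier B. T (ract W (\<epsilon> z) b) = t' p z \<otimes>\<^bsub>D\<^esub> \<rho> b) \<and> (\<forall>z\<in>carrier ?Z. T (\<epsilon> z) = t' p z)"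
    using ex_ext_corr_hom[OF W.ext_corr_axioms s.mod_rep_axioms \<rho>(1,2)] by simp
  then obtain T where T: "mod_rep B W D (alg_corr D) \<rho> T"
    and Tz: "\<And>z b. \<lbrakk>z \<in> carrier ?Z; b \<in> carrier B\<rbrakk> \<Longrightarrow> T (ract W (\<epsilon> z) b) = t' p z \<otimes>\<^bsub>D\<^esub> \<rho> b"
    and T\<epsilon>: "\<And>z. z \<in> carrier ?Z \<Longrightarrow> T (\<epsilon> z) = t' p z"
    by blast
  interpret T: alg_rep B W D \<rho> T using T by (simp add: alg_rep_def)
  have left: "\<rho> b \<otimes>\<^bsub>D\<^esub> T w = T (lact W b w)" if bw: "b \<in> carrier B" "w \<in> carrier W" for b w
  proof (rule sys_fibre_intertwine[OF r gen W.ext_corr_axioms T D.alg_left_action _ _ bw])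
    show "\<rho> (\<pi> a) \<otimes>\<^bsub>D\<^esub> T (\<epsilon> z) = T (\<epsilon> (lact ?Z a z))" if "a \<in> carrier ?A" "z \<in> carrier ?Z" for a z
      using that by (simp add: \<rho>(2) T\<epsilon> s.left)
    fix l x z assume l: "l \<in> {1..n}" and x: "x \<in> carrier (fibre Y l)" and z: "z \<in> carrier ?Z"
    have lk: "l \<in> {1..k}" using l nk by simp
    obtain \<mu> where \<mu>: "mod_rep ?A (sq Y p l) B W \<pi> \<mu>"
      "\<And>x z. \<lbrakk>x \<in> carrier (fibre Y l); z \<in> carrier ?Z\<rbrakk> \<Longrightarrow> \<mu> (tens Y p l z x) = ract W (\<epsilon> z) (t l x) \<and>
        lact W (t l x) (\<epsilon> z) = \<mu> (flip Y l p (tens Y l p x z))"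
      using sys_fibreD(2)[OF W l] unfolding creates_def by blast
    obtain \<nu> where \<nu>: "mod_rep ?A (sq Y p l) D (alg_corr D) \<pi>' \<nu>"
      "\<And>x z. \<lbrakk>x \<in> carrier (fibre Y l); z \<in> carrier ?Z\<rbrakk> \<Longrightarrow> \<nu> (tens Y p l z x) = t' p z \<otimes>\<^bsub>D\<^esub> t' l x \<and>
        \<nu> (flip Y l p (tens Y l p x z)) = t' l x \<otimes>\<^bsub>D\<^esub> t' p z"
      using flip[OF l] unfolding flip_rel_def by blast
    note tl = sys_repD(5)[OF r l]
    \<comment> \<open>Both sides are determined by the elementary tensors z \<otimes> x, where they
      are t'_p(z) t'_l(x). At the flipped tensor, \<mu> gives the left action on W and \<nu> the
      product in the other order.\<close>
    have "T (\<mu> w) = \<nu> w" if "w \<in> carrier (sq Y p l)" for w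
      by (rule tensor.mod_rep_agree_tensor[OF corr_tensorI[OF g(3)[OF pk lk]] mod_rep_comp[OF \<mu>(1) T] \<nu>(1) _ that])
        (use \<mu>(2) \<nu>(2) Tz tl \<rho>(3)[OF l] in simp)
    moreover have "flip Y l p (tens Y l p x z) \<in> carrier (sq Y p l)"
      by (rule corr_isoD(3)[OF g(4)[OF lk pk] corr_tensorD(6)[OF g(3)[OF lk pk] x z]])
    ultimately show "\<rho> (t l x) \<otimes>\<^bsub>D\<^esub> T (\<epsilon> z) = T (lact W (t l x) (\<epsilon> z))"
      using \<mu>(2)[OF x z] \<nu>(2)[OF x z] z \<rho>(3)[OF l x] by (simp add: T\<epsilon>)
  qed
  have cT: "corr_rep B W D \<rho> T" by (rule corr_repI[OF T W.W.correspondence_axioms left])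
  have lP: "\<rho> b \<otimes>\<^bsub>D\<^esub> q \<in> T.P" if b: "b \<in> carrier B" and q: "q \<in> T.P" for b q
  proof (rule bdd_linear_nclspan[OF D.normed_cvs_axioms D.normed_cvs_axioms D.mult_bdd(1) T.gens_carrier _ T.P_sub T.P_nclosed])
    show "\<rho> b \<in> carrier D" "q \<in> D.nclspan T.gens" using b q rh(1) by (simp_all add: T.P_eq)
    fix s assume "s \<in> T.gens"
    then obtain x y where s: "s = T x \<otimes>\<^bsub>D\<^esub> star D (T y)" "x \<in> carrier W" "y \<in> carrier W" by blast
    then show "\<rho> b \<otimes>\<^bsub>D\<^esub> s \<in> T.P"
      using T.gen_in_P[of "lact W b x" y] b by (simp add: rh flip: D.mult_assoc left)
  qed
  have sP: "s.P \<subseteq> T.P"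
  proof (rule rep_compacts_subset[OF s.alg_rep_axioms D.cstar_algebra_axioms T.P_sub T.P_nclosed])
    show "t' p x \<otimes>\<^bsub>D\<^esub> star D (t' p y) \<in> T.P" if "x \<in> carrier ?Z" "y \<in> carrier ?Z" for x y
      using T.gen_in_P[of "\<epsilon> x" "\<epsilon> y"] that by (simp add: T\<epsilon>)
  qed
  have \<pi>P: "\<rho> (\<pi> a) \<in> T.P" if "a \<in> carrier ?A" for a
    using cov that sP by (auto simp: cov_rep_def \<rho>(2))
  have tP: "\<rho> (t l x) \<in> T.P" if l: "l \<in> {1..n}" and x: "x \<in> carrier (fibre Y l)" for l x
  proof -
    interpret t: corr_rep ?A "fibre Y l" B \<pi> "t l" by (rule sys_repD(4)[OF r l])
    obtain a where a: "\<And>i. a i \<in> carrier ?A" "t.Z.X.nlim (\<lambda>i. ract (fibre Y l) x (a i)) x"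
      using t.Z.ract_approx[OF x] by blast
    have "D.nlim (\<lambda>i. \<rho> (t l (ract (fibre Y l) x (a i)))) (\<rho> (t l x))"
      by (rule bdd_linear_nlim[OF B.normed_cvs_axioms D.normed_cvs_axioms
            cstar_hom_bdd[OF B.cstar_algebra_axioms D.cstar_algebra_axioms \<rho>(1)]])
        (rule bdd_linear_nlim[OF t.Z.X.normed_cvs_axioms B.normed_cvs_axioms t.t_bdd a(2)])
    moreover have "\<rho> (t l (ract (fibre Y l) x (a i))) \<in> T.P" for i
      using lP[OF _ \<pi>P[OF a(1)], of "t l x" i] x a(1) W.\<pi>(1) by (simp add: t.t_ract rh)
    ultimately show ?thesis by (rule D.nclosedD[OF T.P_nclosed, rotated])
  qed
  have "\<rho> b \<in> T.P" if b: "b \<in> carrier B" for b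
  proof (rule B.cstar_generate_induct[OF gen sys_range_carrier[OF r] b])
    fix s assume s: "s \<in> sys_range n Y \<pi> t"
    then have "\<rho> s \<in> T.P" using \<pi>P tP unfolding sys_range_def by blast
    moreover have "s \<in> carrier B" using s sys_range_carrier[OF r] by blast
    ultimately show "\<rho> s \<in> T.P \<and> \<rho> (star B s) \<in> T.P" using T.P_star by (simp add: rh)
  next
    show "\<rho> \<zero>\<^bsub>B\<^esub> \<in> T.P"
      using cstar_hom_zero[OF B.cstar_algebra_axioms D.cstar_algebra_axioms \<rho>(1)] D.submoduleD(2)[OF T.P_sub] by simp
    fix \<sigma> x assume \<sigma>: "\<And>n. \<rho> (\<sigma> n) \<in> T.P" "B.nlim \<sigma> x"
    show "\<rho> x \<in> T.P"
      by (rule D.nclosedD[OF T.P_nclosed \<sigma>(1) bdd_linear_nlim[OF B.normed_cvs_axioms D.normed_cvs_axioms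
            cstar_hom_bdd[OF B.cstar_algebra_axioms D.cstar_algebra_axioms \<rho>(1)] \<sigma>(2)]])
  qed (use D.submoduleD[OF T.P_sub] lP in \<open>auto simp: rh\<close>)
  then have "cov_rep B W D \<rho> T" using cT by (simp add: cov_rep_def)
  then show ?thesis using T\<epsilon> by blast
qed

definition step_rep :: "nat \<Rightarrow> (nat \<Rightarrow> 'u \<Rightarrow> 'b) \<Rightarrow> ('b \<Rightarrow> 'd) \<Rightarrow> ('b \<Rightarrow> 'd) \<Rightarrow> ('u \<Rightarrow> 'b) \<Rightarrow> nat \<Rightarrow> 'u \<Rightarrow> 'd" where
  "step_rep p t \<sigma> \<tau> \<epsilon> l x = (if l = p then \<tau> (\<epsilon> x) else \<sigma> (t l x))"

lemma flip_rel_cong: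
  assumes "\<And>x. x \<in> carrier (fibre Y i) \<Longrightarrow> t i x = t' i x" "\<And>x. x \<in> carrier (fibre Y j) \<Longrightarrow> t j x = t' j x"
  shows "flip_rel Y D \<pi> t i j \<longleftrightarrow> flip_rel Y D \<pi> t' i j"
  unfolding flip_rel_def using assms by (simp cong: conj_cong)

text \<open>For a new pair with second index m + 1 the witness is \<tau> \<circ> \<mu> with \<mu>
  from \<open>creates\<close>: \<tau> turns the right and the left action of t_i(x) on W into
  multiplication by \<sigma>(t_i(x)) from the right and from the left.\<close>

lemma step_sys_rep:
  assumes r: "sys_rep m Y B \<pi> t" and W: "sys_fibre m Y (Suc m) B \<pi> t W \<epsilon>" and \<tau>: "cov_rep B W D \<sigma> \<tau>"
  shows "sys_rep (Suc m) Y D (\<lambda>a. \<sigma> (\<pi> a)) (step_rep (Suc m) t \<sigma> \<tau> \<epsilon>)"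
  unfolding sys_rep_def
proof (intro conjI ballI impI)
  have \<tau>c: "corr_rep B W D \<sigma> \<tau>" using \<tau> by (simp add: cov_rep_def)
  interpret D: cstar_algebra D by (rule corr_repD(3)[OF \<tau>c])
  interpret W: ext_corr "coeff Y" "fibre Y (Suc m)" B W \<pi> \<epsilon> by (rule sys_fibreD(1)[OF W])
  interpret \<tau>: corr_rep B W D \<sigma> \<tau> by fact
  have s: "sys_rep m Y D (\<lambda>a. \<sigma> (\<pi> a)) (\<lambda>l x. \<sigma> (t l x))"
    by (rule sys_rep_hom[OF r D.cstar_algebra_axioms \<tau>.hom])
  show "cstar_algebra D" "cstar_hom (coeff Y) D (\<lambda>a. \<sigma> (\<pi> a))"
    by (rule sys_repD[OF s])+
  fix i assume i: "i \<in> {1..Suc m}"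
  show "cov_rep (coeff Y) (fibre Y i) D (\<lambda>a. \<sigma> (\<pi> a)) (step_rep (Suc m) t \<sigma> \<tau> \<epsilon> i)"
  proof (cases "i = Suc m")
    case True
    then show ?thesis
      using step_cov_rep[OF W.ext_corr_axioms \<tau>] by (simp add: step_rep_def[abs_def])
  next
    case False
    then show ?thesis using sys_repD(3)[OF s, of i] i by (simp add: step_rep_def[abs_def])
  qed
  fix j assume j: "j \<in> {1..Suc m}" and ij: "i < j"
  have im: "i \<in> {1..m}" using i j ij by auto
  show "flip_rel Y D (\<lambda>a. \<sigma> (\<pi> a)) (step_rep (Suc m) t \<sigma> \<tau> \<epsilon>) i j"
  proof (cases "j = Suc m")
    case True
    obtain \<mu> where \<mu>: "mod_rep (coeff Y) (sq Y j i) B W \<pi> \<mu>"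
      "\<And>x z. \<lbrakk>x \<in> carrier (fibre Y i); z \<in> carrier (fibre Y j)\<rbrakk> \<Longrightarrow> \<mu> (tens Y j i z x) = ract W (\<epsilon> z) (t i x) \<and>
        lact W (t i x) (\<epsilon> z) = \<mu> (flip Y i j (tens Y i j x z))"
      using sys_fibreD(2)[OF W im] unfolding creates_def True by blast
    have "\<tau> (\<mu> (tens Y j i z x)) = \<tau> (\<epsilon> z) \<otimes>\<^bsub>D\<^esub> \<sigma> (t i x) \<and>
        \<tau> (\<mu> (flip Y i j (tens Y i j x z))) = \<sigma> (t i x) \<otimes>\<^bsub>D\<^esub> \<tau> (\<epsilon> z)"
      if "x \<in> carrier (fibre Y i)" "z \<in> carrier (fibre Y j)" for x z
      using \<mu>(2)[OF that] that sys_repD(5)[OF r im] by (simp add: True \<tau>.t_ract \<tau>.left)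
    then show ?thesis
      unfolding flip_rel_def using im True
      by (intro exI[of _ "\<lambda>w. \<tau> (\<mu> w)"] conjI mod_rep_comp[OF \<mu>(1) \<tau>.mod_rep_axioms])
        (simp add: step_rep_def)
  next
    case False
    then have "flip_rel Y D (\<lambda>a. \<sigma> (\<pi> a)) (\<lambda>l x. \<sigma> (t l x)) i j" using s im j ij by (simp add: sys_rep_def)
    then show ?thesis using False im by (subst flip_rel_cong) (auto simp: step_rep_def)
  qed
qed

lemma cstar_generate_superset: "S \<subseteq> cstar_generate A S"
  unfolding cstar_generate_def by blast

lemma (in cstar_algebra) cstar_subalgebraD:
  assumes "cstar_subalgebra H A"
  shows "submodule H complex_ring A" "\<lbrakk>x \<in> H; y \<in> H\<rbrakk> \<Longrightarrow> x \<otimes> y \<in> H" "x \<in> H \<Longrightarrow> star A x \<in> H" "nclosed H"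
  using assms nclosed_iff[OF submoduleD(1)] by (auto simp: cstar_subalgebra_def)

text \<open>A C*-subalgebra containing the new family contains \<sigma>(B), because the old family
  generates B, and then the elements \<tau>(\<epsilon>(z) b) = \<tau>(\<epsilon>(z)) \<sigma>(b),
  which span \<tau>(W) up to closure.\<close>

lemma step_generate:
  assumes r: "sys_rep m Y B \<pi> t" and gen: "cstar_generate B (sys_range m Y \<pi> t) = carrier B"
    and W: "sys_fibre m Y (Suc m) B \<pi> t W \<epsilon>" and \<tau>: "cov_rep B W D \<sigma> \<tau>"
    and gen': "cstar_generate D (\<sigma> ` carrier B \<union> \<tau> ` carrier W) = carrier D"
  shows "cstar_generate D (sys_range (Suc m) Y (\<lambda>a. \<sigma> (\<pi> a)) (step_rep (Suc m) t \<sigma> \<tau> \<epsilon>)) = carrier D"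
proof -
  have \<tau>c: "corr_rep B W D \<sigma> \<tau>" using \<tau> by (simp add: cov_rep_def)
  interpret B: cstar_algebra B by (rule sys_repD(1)[OF r])
  interpret D: cstar_algebra D by (rule corr_repD(3)[OF \<tau>c])
  interpret W: ext_corr "coeff Y" "fibre Y (Suc m)" B W \<pi> \<epsilon> by (rule sys_fibreD(1)[OF W])
  interpret \<tau>: corr_rep B W D \<sigma> \<tau> by fact
  let ?S = "sys_range (Suc m) Y (\<lambda>a. \<sigma> (\<pi> a)) (step_rep (Suc m) t \<sigma> \<tau> \<epsilon>)"
  have S: "?S \<subseteq> carrier D" by (rule sys_range_carrier[OF step_sys_rep[OF r W \<tau>]])
  have Sp: "\<tau> (\<epsilon> z) \<in> ?S" if "z \<in> carrier (fibre Y (Suc m))" for z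
    unfolding sys_range_def by (intro UnI2 UN_I[of "Suc m"]) (use that in \<open>auto simp: step_rep_def[abs_def]\<close>)
  have Sm: "\<sigma> s \<in> ?S" if "s \<in> sys_range m Y \<pi> t" for s
    using that unfolding sys_range_def
  proof
    assume "s \<in> (\<Union>l\<in>{1..m}. t l ` carrier (fibre Y l))"
    then obtain l x where "l \<in> {1..m}" "x \<in> carrier (fibre Y l)" "s = t l x" by blast
    then show "\<sigma> s \<in> (\<lambda>a. \<sigma> (\<pi> a)) ` carrier (coeff Y) \<union>
        (\<Union>l\<in>{1..Suc m}. step_rep (Suc m) t \<sigma> \<tau> \<epsilon> l ` carrier (fibre Y l))"
      by (intro UnI2 UN_I[of l] image_eqI[of _ _ x]) (auto simp: step_rep_def)
  qed auto
  have "carrier D \<subseteq> H" if H: "cstar_subalgebra H D" "?S \<subseteq> H" for H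
  proof -
    note h = D.cstar_subalgebraD[OF H(1)]
    note hs = D.submoduleD[OF h(1)]
    have \<sigma>H: "\<sigma> b \<in> H" if b: "b \<in> carrier B" for b
    proof (rule B.cstar_generate_induct[OF gen sys_range_carrier[OF r] b])
      fix s assume s: "s \<in> sys_range m Y \<pi> t"
      then have "\<sigma> s \<in> H" "s \<in> carrier B" using Sm H(2) sys_range_carrier[OF r] by blast+
      then show "\<sigma> s \<in> H \<and> \<sigma> (star B s) \<in> H" by (simp add: \<tau>.\<pi> h)
    next
      show "\<sigma> \<zero>\<^bsub>B\<^esub> \<in> H"
        using cstar_hom_zero[OF B.cstar_algebra_axioms D.cstar_algebra_axioms \<tau>.hom] hs(2) by simp
      fix \<rho> x assume \<rho>: "\<And>n. \<sigma> (\<rho> n) \<in> H" "B.nlim \<rho> x"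
      show "\<sigma> x \<in> H"
        by (rule D.nclosedD[OF h(4) \<rho>(1) bdd_linear_nlim[OF B.normed_cvs_axioms D.normed_cvs_axioms
              cstar_hom_bdd[OF B.cstar_algebra_axioms D.cstar_algebra_axioms \<tau>.hom] \<rho>(2)]])
    qed (simp_all add: \<tau>.\<pi> hs h)
    have \<tau>H: "\<tau> w \<in> H" if w: "w \<in> carrier W" for w
    proof (rule bdd_linear_nclspan[OF W.W.X.normed_cvs_axioms D.normed_cvs_axioms \<tau>.t_bdd W.elements_carrier _ h(1,4)])
      show "w \<in> W.W.X.nclspan W.elements" using w W.dense by (simp add: W.W.X.nclspan_def)
      fix s assume "s \<in> W.elements"
      then obtain z b where s: "s = ract W (\<epsilon> z) b" "z \<in> carrier (fibre Y (Suc m))" "b \<in> carrier B" by blast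
      then have "\<tau> (\<epsilon> z) \<in> H" using Sp H(2) by blast
      then show "\<tau> s \<in> H" using s h(2) \<sigma>H by (simp add: \<tau>.t_ract)
    qed
    have "\<sigma> ` carrier B \<union> \<tau> ` carrier W \<subseteq> H" using \<sigma>H \<tau>H by auto
    from cstar_generate_minimal[OF H(1) this] show ?thesis by (simp add: gen')
  qed
  moreover have "cstar_subalgebra (carrier D) D"
    by (rule D.cstar_subalgebraI) (auto intro: D.nclosedI dest: D.nlimD(2))
  ultimately show ?thesis
    using S unfolding cstar_generate_def by (intro equalityI Inter_lower Inter_greatest) auto
qed

text \<open>Two universal properties are used in succession: the first m members of a family give
  \<rho> on B, the last member extends along \<rho> to a covariant representation T of W, and the
  universal property of D turns \<rho> and T into the required homomorphism.\<close>

lemma step_sys_universal: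
  assumes Y: "generating_system k Y" and m: "m < k" and u: "sys_universal m Y B \<pi> t"
    and W: "sys_fibre m Y (Suc m) B \<pi> t W \<epsilon>" and cp: "cuntz_pimsner B W D \<sigma> \<tau>"
  shows "cov_rep B W D \<sigma> \<tau>"
    and "sys_universal (Suc m) Y D (\<lambda>a. \<sigma> (\<pi> a)) (step_rep (Suc m) t \<sigma> \<tau> \<epsilon>)"
proof -
  have r: "sys_rep m Y B \<pi> t" and gen: "cstar_generate B (sys_range m Y \<pi> t) = carrier B"
    using u by (simp_all add: sys_universal_def)
  note W' = ext_corrD[OF sys_fibreD(1)[OF W]]
  have D: "cstar_algebra D" and gen': "cstar_generate D (\<sigma> ` carrier B \<union> \<tau> ` carrier W) = carrier D"
    using cp by (simp_all add: cuntz_pimsner_def)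
  show \<tau>: "cov_rep B W D \<sigma> \<tau>"
    using cp covariant_representation_iff[OF W'(2) D] by (simp add: cuntz_pimsner_def)
  have "\<exists>\<rho>. cstar_hom D D' \<rho> \<and> (\<forall>a\<in>carrier (coeff Y). \<rho> (\<sigma> (\<pi> a)) = \<pi>' a) \<and>
      (\<forall>l\<in>{1..Suc m}. \<forall>x\<in>carrier (fibre Y l). \<rho> (step_rep (Suc m) t \<sigma> \<tau> \<epsilon> l x) = t' l x)"
    if r': "sys_rep (Suc m) Y D' \<pi>' t'" for D' :: "(nat \<Rightarrow> 'a) cstar_algebra" and \<pi>' t'
  proof -
    note D' = sys_repD(1)[OF r']
    have "sys_rep m Y D' \<pi>' t'" by (rule sys_rep_mono[OF r']) simp
    then obtain \<rho> where \<rho>: "cstar_hom B D' \<rho>" "\<forall>a\<in>carrier (coeff Y). \<rho> (\<pi> a) = \<pi>' a"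
      "\<forall>l\<in>{1..m}. \<forall>x\<in>carrier (fibre Y l). \<rho> (t l x) = t' l x"
      using u unfolding sys_universal_def by blast
    have "\<exists>T. cov_rep B W D' \<rho> T \<and> (\<forall>z\<in>carrier (fibre Y (Suc m)). T (\<epsilon> z) = t' (Suc m) z)"
    proof (rule step_universal[OF r gen W \<rho>(1), of \<pi>' t' k])
      show "cov_rep (coeff Y) (fibre Y (Suc m)) D' \<pi>' (t' (Suc m))" by (rule sys_repD(3)[OF r']) simp
      show "flip_rel Y D' \<pi>' t' l (Suc m)" if "l \<in> {1..m}" for l
        using r' that by (simp add: sys_rep_def)
    qed (use \<rho> Y m in auto)
    then obtain T where T: "cov_rep B W D' \<rho> T" "\<forall>z\<in>carrier (fibre Y (Suc m)). T (\<epsilon> z) = t' (Suc m) z"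
      by blast
    then have "covariant_representation B W D' \<rho> T"
      using covariant_representation_iff[OF W'(2) D'] by simp
    then obtain \<omega> where \<omega>: "cstar_hom D D' \<omega>" "\<forall>b\<in>carrier B. \<omega> (\<sigma> b) = \<rho> b" "\<forall>w\<in>carrier W. \<omega> (\<tau> w) = T w"
      using cp D' unfolding cuntz_pimsner_def by blast
    have "\<omega> (step_rep (Suc m) t \<sigma> \<tau> \<epsilon> l x) = t' l x" if l: "l \<in> {1..Suc m}" and x: "x \<in> carrier (fibre Y l)" for l x
    proof (cases "l = Suc m")
      case True
      then show ?thesis using x \<omega>(3) T(2) mod_rep.closed[OF W'(3)] by (simp add: step_rep_def)
    next
      case False
      then have "l \<in> {1..m}" using l by simp
      then show ?thesis using False x \<omega>(2) \<rho>(3) sys_repD(5)[OF r] by (simp add: step_rep_def)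
    qed
    moreover have "\<forall>a\<in>carrier (coeff Y). \<omega> (\<sigma> (\<pi> a)) = \<pi>' a"
      using \<omega>(2) \<rho>(2) cstar_homD(1)[OF mod_repD(3)[OF W'(3)]] by simp
    ultimately show ?thesis using \<omega>(1) by blast
  qed
  then show "sys_universal (Suc m) Y D (\<lambda>a. \<sigma> (\<pi> a)) (step_rep (Suc m) t \<sigma> \<tau> \<epsilon>)"
    unfolding sys_universal_def using step_sys_rep[OF r W \<tau>] step_generate[OF r gen W \<tau> gen'] by blast
qed

section \<open>Composing extensions of scalars, and the inductive invariant\<close>

lemma ext_corr_comp:
  assumes W: "ext_corr A Z B W \<pi> \<epsilon>" and V: "ext_corr B W D V \<sigma> \<iota>"
  shows "ext_corr A Z D V (\<lambda>a. \<sigma> (\<pi> a)) (\<lambda>z. \<iota> (\<epsilon> z))"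
proof -
  interpret W: ext_corr A Z B W \<pi> \<epsilon> by fact
  interpret V: ext_corr B W D V \<sigma> \<iota> by fact
  let ?S = "{ract V (\<iota> (\<epsilon> z)) d |z d. z \<in> carrier Z \<and> d \<in> carrier D}"
  have S: "?S \<subseteq> carrier V" by auto
  \<comment> \<open>The vectors coming from Z are already total, because \<iota>(\<epsilon>(z) b) d
    = \<iota>(\<epsilon>(z)) \<sigma>(b) d.\<close>
  have el: "ract V (\<iota> w) d \<in> V.W.X.nclspan ?S" if w: "w \<in> carrier W" and d: "d \<in> carrier D" for w d
  proof (rule bdd_linear_nclspan[OF W.W.X.normed_cvs_axioms V.W.X.normed_cvs_axioms
        bdd_linear_comp[OF V.bdd V.W.ract_bdd[OF d]] W.elements_carrier _ V.W.X.nclspan_submodule[OF S] V.W.X.nclspan_closed[OF S]])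
    show "w \<in> W.W.X.nclspan W.elements" using w W.dense by (simp add: W.W.X.nclspan_def)
    fix s assume "s \<in> W.elements"
    then obtain z b where s: "s = ract W (\<epsilon> z) b" "z \<in> carrier Z" "b \<in> carrier B" by blast
    then have "ract V (\<iota> s) d = ract V (\<iota> (\<epsilon> z)) (\<sigma> b \<otimes>\<^bsub>D\<^esub> d)"
      using d V.\<pi>(1) by (simp add: V.ract V.W.ract_mult)
    then show "ract V (\<iota> s) d \<in> V.W.X.nclspan ?S"
      using V.W.X.nclspan_superset[OF S] s(2,3) d V.\<pi>(1) V.W.A.mult_closed by blast
  qed (rule W.W.X.normed_cvs_axioms V.W.X.normed_cvs_axioms)+
  have "V.W.X.nclspan V.elements \<subseteq> V.W.X.nclspan ?S"
    by (rule V.W.X.nclspan_minimal[OF V.W.X.nclspan_submodule[OF S] V.W.X.nclspan_closed[OF S]])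
      (use el in blast)
  then have "norm_closure V (hnorm D V) (cspan V ?S) = carrier V"
    using V.dense V.W.X.nclspan_carrier[of ?S] by (auto simp: V.W.X.nclspan_def)
  then show ?thesis
    using mod_rep_comp[OF W.mod_rep_axioms V.mod_rep_axioms]
    by (intro ext_corrI V.W.correspondence_axioms W.Z.correspondence_axioms)
      (simp_all add: ext_mod_def V.lact_\<epsilon> W.lact_\<epsilon> W.\<pi>(1))
qed

text \<open>The map is \<iota> \<otimes> \<iota>'; it respects inner products because \<sigma>(b)
  \<iota>'(v) = \<iota>'(b v).\<close>

lemma ex_ext_tensor:
  assumes W: "ext_corr B W D W' \<sigma> \<iota>" and V: "ext_corr B V D V' \<sigma> \<iota>'"
    and T: "corr_tensor B W V T \<tau>" and T': "corr_tensor D W' V' T' \<tau>'"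
  shows "\<exists>\<kappa>. mod_rep B T D T' \<sigma> \<kappa> \<and> (\<forall>w\<in>carrier W. \<forall>v\<in>carrier V. \<kappa> (\<tau> w v) = \<tau>' (\<iota> w) (\<iota>' v))"
proof -
  interpret W: ext_corr B W D W' \<sigma> \<iota> by fact
  interpret V: ext_corr B V D V' \<sigma> \<iota>' by fact
  interpret T: tensor B W "lact V" B V T \<tau> by (rule corr_tensorI[OF T])
  interpret T': tensor D W' "lact V'" D V' T' \<tau>' by (rule corr_tensorI[OF T'])
  show ?thesis
  proof (rule mod_rep_extend)
    show "hilbert_module B T" "hilbert_module D T'" "cstar_hom B D \<sigma>"
      by (rule T.W.hilbert_module_axioms T'.W.hilbert_module_axioms W.hom)+
    fix w v w' v' assume "w \<in> carrier W" "v \<in> carrier V" "w' \<in> carrier W" "v' \<in> carrier V"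
    then show "hinner T' (\<tau>' (\<iota> w) (\<iota>' v)) (\<tau>' (\<iota> w') (\<iota>' v')) = \<sigma> (hinner T (\<tau> w v) (\<tau> w' v'))"
      by (simp add: T.\<tau>_inner T'.\<tau>_inner W.inner V.inner V.lact_\<epsilon>)
  qed (auto simp: T.dense)
qed

lemma hilbert_isoD:
  assumes "hilbert_iso A X Y f"
  shows "hilbert_isometry A X Y f" "bij_betw f (carrier X) (carrier Y)"
    "x \<in> carrier X \<Longrightarrow> f x \<in> carrier Y" "\<lbrakk>x \<in> carrier X; a \<in> carrier A\<rbrakk> \<Longrightarrow> f (ract X x a) = ract Y (f x) a"
  using assms unfolding hilbert_iso_def hilbert_isometry_def by auto

text \<open>How the iteration extends a flip: \<open>\<kappa> = \<iota> \<otimes> \<iota>'\<close> satisfies \<open>\<nu>(\<kappa>(v) S) = n v S\<close>, since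
  \<open>\<nu>((z b \<otimes> 1) \<otimes> (z' \<otimes> S)) = z \<otimes> b (z' \<otimes> S)\<close>.\<close>

lemma ext_tensor_nu:
  assumes W: "ext_corr B W D W' \<sigma> \<iota>" and V: "ext_corr B V D V' \<sigma> \<iota>'"
    and T: "corr_tensor B W V T \<tau>" and T': "corr_tensor D W' V' T' \<tau>'"
    and \<kappa>: "mod_rep B T D T' \<sigma> \<kappa>" "\<forall>w\<in>carrier W. \<forall>v\<in>carrier V. \<kappa> (\<tau> w v) = \<tau>' (\<iota> w) (\<iota>' v)"
    and e: "\<forall>z\<in>carrier W. \<forall>S\<in>carrier D. e z S = ract W' (\<iota> z) S" "\<forall>z\<in>carrier V. \<forall>S\<in>carrier D. e' z S = ract V' (\<iota>' z) S"
    and N: "triple_tensor B W V (hom_lact D \<sigma>) D (alg_corr D) T \<tau> (\<lambda>c. lact V' (\<sigma> c)) V' e' N n n'"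
    and \<nu>: "hilbert_iso D T' N \<nu>" "\<forall>z\<in>carrier W. \<forall>S\<in>carrier D. \<forall>\<xi>\<in>carrier V'. \<nu> (\<tau>' (e z S) \<xi>) = n' z (lact V' S \<xi>)"
    and v: "v \<in> carrier T" and S: "S \<in> carrier D"
  shows "\<nu> (ract T' (\<kappa> v) S) = n v S"
proof -
  interpret W: ext_corr B W D W' \<sigma> \<iota> by fact
  interpret V: ext_corr B V D V' \<sigma> \<iota>' by fact
  interpret T: tensor B W "lact V" B V T \<tau> by (rule corr_tensorI[OF T])
  interpret T': tensor D W' "lact V'" D V' T' \<tau>' by (rule corr_tensorI[OF T'])
  interpret \<kappa>: mod_rep B T D T' \<sigma> \<kappa> by (rule \<kappa>(1))
  have Ni: "interior_tensor B T (hom_lact D \<sigma>) D (alg_corr D) N n"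
    and nn: "\<And>w v S. \<lbrakk>w \<in> carrier W; v \<in> carrier V; S \<in> carrier D\<rbrakk> \<Longrightarrow> n (\<tau> w v) S = n' w (e' v S)"
    using N unfolding triple_tensor_def by simp_all
  interpret N: tensor B T "hom_lact D \<sigma>" D "alg_corr D" N n by (rule tensorI[OF Ni])
  note normed = T'.W.X.normed_cvs_axioms T.W.X.normed_cvs_axioms N.W.X.normed_cvs_axioms
  show ?thesis
  proof (rule T.bdd_agree[OF N.W.X.normed_cvs_axioms _ _ _ v, of "\<lambda>v. \<nu> (ract T' (\<kappa> v) S)" "\<lambda>v. n v S"])
    have "bdd_linear T (hnorm B T) T' (hnorm D T') (\<lambda>v. ract T' (\<kappa> v) S)"
      by (rule bdd_linear_comp[OF \<kappa>.bdd T'.W.ract_bdd[OF S]]) (rule normed)+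
    then show "bdd_linear T (hnorm B T) N (hnorm D N) (\<lambda>v. \<nu> (ract T' (\<kappa> v) S))"
      by (rule bdd_linear_comp[OF _ hilbert_isometry_bdd[OF T'.W.hilbert_module_axioms hilbert_isoD(1)[OF \<nu>(1)]]])
        (rule normed)+
    show "bdd_linear T (hnorm B T) N (hnorm D N) (\<lambda>v. n v S)" by (rule N.\<tau>_bdd_left) (use S in simp)
    fix z z' assume z: "z \<in> carrier W" and z': "z' \<in> carrier V"
    obtain b y where b: "b \<in> carrier B" "y \<in> carrier V" "z' = lact V b y" by (rule V.Z.nondegenerate'[OF z'])
    have zb: "\<tau> z z' = \<tau> (ract W z b) y" using z b by (simp add: T.\<tau>_balanced)
    have "ract T' (\<kappa> (\<tau> z z')) S = \<tau>' (e z (\<sigma> b)) (ract V' (\<iota>' y) S)"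
      unfolding zb using z b(1,2) S W.\<pi>(1) \<kappa>(2) e(1) by (simp add: W.ract T'.\<tau>_ract)
    then have "\<nu> (ract T' (\<kappa> (\<tau> z z')) S) = n' z (lact V' (\<sigma> b) (ract V' (\<iota>' y) S))"
      using z b(1,2) S W.\<pi>(1) \<nu>(2) by simp
    also have "\<dots> = n' z (e' z' S)"
      using b S W.\<pi>(1) z' e(2) by (simp add: V.W.C.act_ract V.lact_\<epsilon>)
    finally show "\<nu> (ract T' (\<kappa> (\<tau> z z')) S) = n (\<tau> z z') S" using nn[OF z z' S] by simp
  qed
qed

text \<open>The invariant of the induction. \<open>\<kappa> i j\<close> is the tensor product of
  \<open>\<epsilon> i\<close> and \<open>\<epsilon> j\<close>; its compatibility with the flips lets
  the creation formula of the next step, stated with the flips of E, be read with those of Y. Of E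
  being a generating system the invariant keeps the tensor products and the fact that flips map
  between the right carriers.\<close>

definition sys_ext ::
  "nat \<Rightarrow> nat \<Rightarrow> 'u corr_system \<Rightarrow> 'u corr_system \<Rightarrow> ('u \<Rightarrow> 'u) \<Rightarrow> (nat \<Rightarrow> 'u \<Rightarrow> 'u) \<Rightarrow> (nat \<Rightarrow> 'u \<Rightarrow> 'u) \<Rightarrow>
    (nat \<Rightarrow> nat \<Rightarrow> 'u \<Rightarrow> 'u) \<Rightarrow> bool" where
  "sys_ext k n Y E \<pi> t \<epsilon> \<kappa> \<longleftrightarrow> sys_universal n Y (coeff E) \<pi> t \<and>
    (\<forall>j\<in>{1..k}. sys_fibre n Y j (coeff E) \<pi> t (fibre E j) (\<epsilon> j)) \<and>
    (\<forall>i\<in>{1..k}. \<forall>j\<in>{1..k}.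
      corr_tensor (coeff E) (fibre E i) (fibre E j) (sq E i j) (tens E i j) \<and>
      mod_rep (coeff Y) (sq Y i j) (coeff E) (sq E i j) \<pi> (\<kappa> i j) \<and>
      (\<forall>x\<in>carrier (fibre Y i). \<forall>y\<in>carrier (fibre Y j). \<kappa> i j (tens Y i j x y) = tens E i j (\<epsilon> i x) (\<epsilon> j y)) \<and>
      (\<forall>w\<in>carrier (sq Y i j). flip E i j (\<kappa> i j w) = \<kappa> j i (flip Y i j w)) \<and>
      (\<forall>w\<in>carrier (sq E i j). flip E i j w \<in> carrier (sq E j i)))"

text \<open>A family of length 0 is just a homomorphism on the coefficient algebra, so that algebra
  itself is universal.\<close>

lemma sys_ext_refl:
  assumes Y: "generating_system k Y"
  shows "sys_ext k 0 Y Y (\<lambda>a. a) t (\<lambda>j x. x) (\<lambda>i j w. w)"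
proof -
  note g = generating_systemD[OF Y]
  interpret A: cstar_algebra "coeff Y" by (rule g(1))
  have id: "mod_rep (coeff Y) X (coeff Y) X (\<lambda>a. a) (\<lambda>x. x)" if "hilbert_module (coeff Y) X" for X :: "('a, 'a) correspondence"
    using that by (simp add: mod_rep_def mod_rep_axioms_def cstar_hom_id)
  have "ext_corr (coeff Y) X (coeff Y) X (\<lambda>a. a) (\<lambda>x. x)" if X: "correspondence (coeff Y) X"
    for X :: "('a, 'a) correspondence"
  proof -
    interpret X: correspondence "coeff Y" X by fact
    show ?thesis
      by (rule ext_corrI) (use X id[OF X.hilbert_module_axioms] X.ract_dense in \<open>auto simp: ext_mod_def\<close>)
  qed
  moreover have "cstar_generate (coeff Y) (carrier (coeff Y)) = carrier (coeff Y)"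
  proof
    have "cstar_subalgebra (carrier (coeff Y)) (coeff Y)"
      by (rule A.cstar_subalgebraI) (auto intro: A.nclosedI dest: A.nlimD(2))
    then show "cstar_generate (coeff Y) (carrier (coeff Y)) \<subseteq> carrier (coeff Y)"
      by (rule cstar_generate_minimal) simp
  qed (rule cstar_generate_superset)
  then have "sys_universal 0 Y (coeff Y) (\<lambda>a. a) t"
    unfolding sys_universal_def sys_range_def sys_rep_def using g(1) by (auto simp: cstar_hom_id)
  ultimately show ?thesis
    unfolding sys_ext_def sys_fibre_def
    using g(2,3) corr_isoD(3)[OF g(4)] id[OF correspondence_hilbert[OF corr_tensorD(3)[OF g(3)]]] by simp
qed

text \<open>The new data are the composites \<sigma> \<circ> \<pi>, \<iota> \<circ> \<epsilon> and
  \<omega> \<circ> \<kappa>, where \<iota> and \<omega> belong to the single step from Z to E. The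
  creation formulas for l \<le> n are pushed forward by \<iota>; the one for l = n + 1 is pulled
  back by \<kappa>.\<close>

lemma sys_ext_step:
  assumes Y: "generating_system k Y" and n: "n < k" and inv: "sys_ext k n Y Z \<pi> t \<epsilon> \<kappa>"
    and step: "iteration_step k (Suc n) Z E"
  shows "\<exists>\<pi>' t' \<epsilon>' \<kappa>'. sys_ext k (Suc n) Y E \<pi>' t' \<epsilon>' \<kappa>'"
proof -
  let ?p = "Suc n" and ?A = "coeff Y" and ?B = "coeff Z" and ?D = "coeff E" and ?K = "{1..k}"
  note g = generating_systemD[OF Y]
  have pk: "?p \<in> ?K" using n by simp
  have u: "sys_universal n Y ?B \<pi> t"
    and fib: "\<And>j. j \<in> ?K \<Longrightarrow> sys_fibre n Y j ?B \<pi> t (fibre Z j) (\<epsilon> j)"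
    and ZT: "\<And>i j. \<lbrakk>i \<in> ?K; j \<in> ?K\<rbrakk> \<Longrightarrow> corr_tensor ?B (fibre Z i) (fibre Z j) (sq Z i j) (tens Z i j)"
    and \<kappa>: "\<And>i j. \<lbrakk>i \<in> ?K; j \<in> ?K\<rbrakk> \<Longrightarrow> mod_rep ?A (sq Y i j) ?B (sq Z i j) \<pi> (\<kappa> i j)"
      "\<And>i j x y. \<lbrakk>i \<in> ?K; j \<in> ?K; x \<in> carrier (fibre Y i); y \<in> carrier (fibre Y j)\<rbrakk> \<Longrightarrow>
        \<kappa> i j (tens Y i j x y) = tens Z i j (\<epsilon> i x) (\<epsilon> j y)"
      "\<And>i j w. \<lbrakk>i \<in> ?K; j \<in> ?K; w \<in> carrier (sq Y i j)\<rbrakk> \<Longrightarrow> flip Z i j (\<kappa> i j w) = \<kappa> j i (flip Y i j w)"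
    and Zflip: "\<And>i j w. \<lbrakk>i \<in> ?K; j \<in> ?K; w \<in> carrier (sq Z i j)\<rbrakk> \<Longrightarrow> flip Z i j w \<in> carrier (sq Z j i)"
    using inv unfolding sys_ext_def by simp_all
  have r: "sys_rep n Y ?B \<pi> t" using u by (simp add: sys_universal_def)
  obtain \<sigma> \<tau> e and N :: "nat \<Rightarrow> nat \<Rightarrow> ('a, 'a) hilbert_module" and n1 n1' \<nu> M where cp: "cuntz_pimsner ?B (fibre Z ?p) ?D \<sigma> \<tau>"
    and ext: "\<forall>i\<in>?K. extended_corr ?B (fibre Z i) ?D \<sigma> (fibre E i) (e i) \<and>
      creation_action Z ?p i ?D \<sigma> \<tau> (fibre E i) (e i)"
    and ET: "\<forall>i\<in>?K. \<forall>j\<in>?K. corr_tensor ?D (fibre E i) (fibre E j) (sq E i j) (tens E i j)"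
    and all: "\<forall>i\<in>?K. \<forall>j\<in>?K. triple_tensor ?B (fibre Z i) (fibre Z j) (hom_lact ?D \<sigma>) ?D (alg_corr ?D) (sq Z i j) (tens Z i j)
          (\<lambda>c. lact (fibre E j) (\<sigma> c)) (fibre E j) (e j) (N i j) (n1 i j) (n1' i j) \<and>
        hilbert_iso ?D (sq E i j) (N i j) (\<nu> i j) \<and>
        (\<forall>z\<in>carrier (fibre Z i). \<forall>S\<in>carrier ?D. \<forall>\<xi>\<in>carrier (fibre E j).
          \<nu> i j (tens E i j (e i z S) \<xi>) = n1' i j z (lact (fibre E j) S \<xi>)) \<and>
        hilbert_iso ?D (N i j) (N j i) (M i j) \<and>
        (\<forall>w\<in>carrier (sq Z i j). \<forall>S\<in>carrier ?D. M i j (n1 i j w S) = n1 j i (flip Z i j w) S) \<and>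
        (\<forall>w\<in>carrier (sq E i j).
          flip E i j w = inv_into (carrier (sq E j i)) (\<nu> j i) (M i j (\<nu> i j w)))"
    using step unfolding iteration_step_def by (elim exE conjE) (rule that)
  note ex = ext_corrD[OF sys_fibreD(1)[OF fib]]
  note su = step_sys_universal[OF Y n u fib[OF pk] cp]
  have \<sigma>: "cstar_hom ?B ?D \<sigma>" and \<tau>: "corr_rep ?B (fibre Z ?p) ?D \<sigma> \<tau>"
    using su(1) mod_repD(3)[OF corr_repD(1)] by (auto simp: cov_rep_def)
  have D: "cstar_algebra ?D" using cp by (simp add: cuntz_pimsner_def)
  have "\<exists>\<iota>. \<forall>j\<in>?K. ext_corr ?B (fibre Z j) ?D (fibre E j) \<sigma> (\<iota> j) \<and>
      (\<forall>z\<in>carrier (fibre Z j). \<forall>S\<in>carrier ?D. e j z S = ract (fibre E j) (\<iota> j z) S)"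
    by (rule bchoice) (use ex_ext_corr[OF ex(2) \<sigma>] ext in blast)
  then obtain \<iota> where \<iota>: "\<And>j. j \<in> ?K \<Longrightarrow> ext_corr ?B (fibre Z j) ?D (fibre E j) \<sigma> (\<iota> j)"
    and e: "\<And>j. j \<in> ?K \<Longrightarrow> \<forall>z\<in>carrier (fibre Z j). \<forall>S\<in>carrier ?D. e j z S = ract (fibre E j) (\<iota> j z) S"
    by blast
  have "\<exists>\<omega>. \<forall>i\<in>?K. \<forall>j\<in>?K. mod_rep ?B (sq Z i j) ?D (sq E i j) \<sigma> (\<omega> i j) \<and>
      (\<forall>w\<in>carrier (fibre Z i). \<forall>v\<in>carrier (fibre Z j). \<omega> i j (tens Z i j w v) = tens E i j (\<iota> i w) (\<iota> j v))"
    using ex_ext_tensor[OF \<iota> \<iota> ZT] ET by (intro bchoice ballI) blast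
  then obtain \<omega> where \<omega>: "\<And>i j. \<lbrakk>i \<in> ?K; j \<in> ?K\<rbrakk> \<Longrightarrow> mod_rep ?B (sq Z i j) ?D (sq E i j) \<sigma> (\<omega> i j)"
    "\<And>i j. \<lbrakk>i \<in> ?K; j \<in> ?K\<rbrakk> \<Longrightarrow> \<forall>w\<in>carrier (fibre Z i). \<forall>v\<in>carrier (fibre Z j).
      \<omega> i j (tens Z i j w v) = tens E i j (\<iota> i w) (\<iota> j v)"
    by blast
  have N: "\<And>i j. \<lbrakk>i \<in> ?K; j \<in> ?K\<rbrakk> \<Longrightarrow> triple_tensor ?B (fibre Z i) (fibre Z j) (hom_lact ?D \<sigma>) ?D (alg_corr ?D)
          (sq Z i j) (tens Z i j) (\<lambda>c. lact (fibre E j) (\<sigma> c)) (fibre E j) (e j) (N i j) (n1 i j) (n1' i j)"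
    and \<nu>: "\<And>i j. \<lbrakk>i \<in> ?K; j \<in> ?K\<rbrakk> \<Longrightarrow> hilbert_iso ?D (sq E i j) (N i j) (\<nu> i j)"
    "\<And>i j. \<lbrakk>i \<in> ?K; j \<in> ?K\<rbrakk> \<Longrightarrow> \<forall>z\<in>carrier (fibre Z i). \<forall>S\<in>carrier ?D. \<forall>\<xi>\<in>carrier (fibre E j).
          \<nu> i j (tens E i j (e i z S) \<xi>) = n1' i j z (lact (fibre E j) S \<xi>)"
    and M: "\<And>i j. \<lbrakk>i \<in> ?K; j \<in> ?K\<rbrakk> \<Longrightarrow> hilbert_iso ?D (N i j) (N j i) (M i j)"
    "\<And>i j w S. \<lbrakk>i \<in> ?K; j \<in> ?K; w \<in> carrier (sq Z i j); S \<in> carrier ?D\<rbrakk> \<Longrightarrow>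
          M i j (n1 i j w S) = n1 j i (flip Z i j w) S"
    and flipE: "\<And>i j w. \<lbrakk>i \<in> ?K; j \<in> ?K; w \<in> carrier (sq E i j)\<rbrakk> \<Longrightarrow>
          flip E i j w = inv_into (carrier (sq E j i)) (\<nu> j i) (M i j (\<nu> i j w))"
    using all by simp_all
  have ET: "\<And>i j. \<lbrakk>i \<in> ?K; j \<in> ?K\<rbrakk> \<Longrightarrow> corr_tensor ?D (fibre E i) (fibre E j) (sq E i j) (tens E i j)"
    using ET by blast
  \<comment> \<open>The flip of E is given through an inverse of \<nu>; this equation replaces that
    description and rests on \<nu> being onto.\<close>
  have \<nu>flip: "\<nu> j i (flip E i j w) = M i j (\<nu> i j w)" and flip_closed: "flip E i j w \<in> carrier (sq E j i)"
    if ij: "i \<in> ?K" "j \<in> ?K" and w: "w \<in> carrier (sq E i j)" for i j w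
  proof -
    have "M i j (\<nu> i j w) \<in> \<nu> j i ` carrier (sq E j i)"
      using hilbert_isoD(3)[OF M(1)[OF ij] hilbert_isoD(3)[OF \<nu>(1)[OF ij] w]] hilbert_isoD(2)[OF \<nu>(1)[OF ij(2,1)]]
      by (simp add: bij_betw_def)
    then show "\<nu> j i (flip E i j w) = M i j (\<nu> i j w)" "flip E i j w \<in> carrier (sq E j i)"
      unfolding flipE[OF ij w] by (rule f_inv_into_f, rule inv_into_into)
  qed
  have \<nu>\<omega>: "\<nu> i j (ract (sq E i j) (\<omega> i j v) S) = n1 i j v S"
    if ij: "i \<in> ?K" "j \<in> ?K" and "v \<in> carrier (sq Z i j)" "S \<in> carrier ?D" for i j v S
    by (rule ext_tensor_nu[OF \<iota>[OF ij(1)] \<iota>[OF ij(2)] ZT[OF ij] ET[OF ij] \<omega>(1,2)[OF ij] e[OF ij(1)] e[OF ij(2)] N[OF ij]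
          \<nu>[OF ij] that(3,4)])
  \<comment> \<open>After multiplication by S and an application of \<nu>, the vector \<omega>(v)
    becomes v \<otimes> S, on which M is the flip of Z tensored with 1. Injectivity of \<nu> and
    cancellation of S give the claim.\<close>
  have flip\<omega>: "flip E i j (\<omega> i j v) = \<omega> j i (flip Z i j v)"
    if ij: "i \<in> ?K" "j \<in> ?K" and v: "v \<in> carrier (sq Z i j)" for i j v
  proof -
    interpret T: correspondence ?D "sq E i j" by (rule corr_tensorD(3)[OF ET[OF ij]])
    interpret T': correspondence ?D "sq E j i" by (rule corr_tensorD(3)[OF ET[OF ij(2,1)]])
    have \<omega>v: "\<omega> i j v \<in> carrier (sq E i j)" by (rule mod_rep.closed[OF \<omega>(1)[OF ij] v])
    note fv = Zflip[OF ij v]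
    have \<omega>f: "\<omega> j i (flip Z i j v) \<in> carrier (sq E j i)" by (rule mod_rep.closed[OF \<omega>(1)[OF ij(2,1)] fv])
    show ?thesis
    proof (rule T'.ract_cancel[OF flip_closed[OF ij \<omega>v] \<omega>f])
      fix S assume S: "S \<in> carrier ?D"
      have "\<nu> j i (ract (sq E j i) (flip E i j (\<omega> i j v)) S) = ract (N j i) (M i j (\<nu> i j (\<omega> i j v))) S"
        by (simp add: hilbert_isoD(4)[OF \<nu>(1)[OF ij(2,1)] flip_closed[OF ij \<omega>v] S] \<nu>flip[OF ij \<omega>v])
      also have "\<dots> = M i j (\<nu> i j (ract (sq E i j) (\<omega> i j v) S))"
        by (simp add: hilbert_isoD(4)[OF \<nu>(1)[OF ij] \<omega>v S] hilbert_isoD(4)[OF M(1)[OF ij] hilbert_isoD(3)[OF \<nu>(1)[OF ij] \<omega>v] S])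
      also have "\<dots> = \<nu> j i (ract (sq E j i) (\<omega> j i (flip Z i j v)) S)"
        by (simp add: \<nu>\<omega>[OF ij v S] \<nu>\<omega>[OF ij(2,1) fv S] M(2)[OF ij v S])
      finally show "ract (sq E j i) (flip E i j (\<omega> i j v)) S = ract (sq E j i) (\<omega> j i (flip Z i j v)) S"
        by (rule inj_onD[OF bij_betw_imp_inj_on[OF hilbert_isoD(2)[OF \<nu>(1)[OF ij(2,1)]]]])
          (use flip_closed[OF ij \<omega>v] \<omega>f S in auto)
    qed
  qed
  let ?\<pi> = "\<lambda>a. \<sigma> (\<pi> a)" and ?t = "step_rep ?p t \<sigma> \<tau> (\<epsilon> ?p)" and ?\<epsilon> = "\<lambda>j z. \<iota> j (\<epsilon> j z)" and ?\<kappa> = "\<lambda>i j w. \<omega> i j (\<kappa> i j w)"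
  have \<epsilon>c: "\<epsilon> j z \<in> carrier (fibre Z j)" if "j \<in> ?K" "z \<in> carrier (fibre Y j)" for j z
    by (rule mod_rep.closed[OF ex(3)[OF that(1)] that(2)])
  have Yflip: "flip Y i j (tens Y i j x y) \<in> carrier (sq Y j i)"
    if "i \<in> ?K" "j \<in> ?K" "x \<in> carrier (fibre Y i)" "y \<in> carrier (fibre Y j)" for i j x y
    by (rule corr_isoD(3)[OF g(4)[OF that(1,2)] corr_tensorD(6)[OF g(3)[OF that(1,2)] that(3,4)]])
  have fibE: "sys_fibre ?p Y j ?D ?\<pi> ?t (fibre E j) (?\<epsilon> j)" if j: "j \<in> ?K" for j
    unfolding sys_fibre_def
  proof (intro conjI ballI)
    show "ext_corr ?A (fibre Y j) ?D (fibre E j) ?\<pi> (?\<epsilon> j)"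
      by (rule ext_corr_comp[OF sys_fibreD(1)[OF fib[OF j]] \<iota>[OF j]])
    note \<iota>m = ext_corrD(3)[OF \<iota>[OF j]]
    fix l assume l: "l \<in> {1..?p}"
    show "creates Y l j ?D ?\<pi> (?t l) (fibre E j) (?\<epsilon> j)"
    proof (cases "l = ?p")
      case True
      have "creates Z ?p j ?D \<sigma> \<tau> (fibre E j) (\<iota> j)"
      proof (rule creation_action_creates[OF ZT[OF j pk] ZT[OF pk j] _ \<iota>[OF j] e[OF j]])
        show "creation_action Z ?p j ?D \<sigma> \<tau> (fibre E j) (e j)" using ext j by blast
        show "\<tau> x \<in> carrier ?D" if "x \<in> carrier (fibre Z ?p)" for x
          using mod_rep.closed[OF corr_repD(1)[OF \<tau>] that] by simp
      qed (rule Zflip[OF pk j])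
      then obtain \<mu> where \<mu>: "mod_rep ?B (sq Z j ?p) ?D (fibre E j) \<sigma> \<mu>"
        "\<And>x z. \<lbrakk>x \<in> carrier (fibre Z ?p); z \<in> carrier (fibre Z j)\<rbrakk> \<Longrightarrow> \<mu> (tens Z j ?p z x) = ract (fibre E j) (\<iota> j z) (\<tau> x) \<and>
          lact (fibre E j) (\<tau> x) (\<iota> j z) = \<mu> (flip Z ?p j (tens Z ?p j x z))"
        unfolding creates_def by blast
      \<comment> \<open>The formula for Z is evaluated at the vectors \<epsilon>(x) and
        \<epsilon>(z), whose tensors and flips are the images under \<kappa> of those in Y.\<close>
      have "\<mu> (\<kappa> j ?p (tens Y j ?p z x)) = ract (fibre E j) (\<iota> j (\<epsilon> j z)) (\<tau> (\<epsilon> ?p x)) \<and>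
          lact (fibre E j) (\<tau> (\<epsilon> ?p x)) (\<iota> j (\<epsilon> j z)) = \<mu> (\<kappa> j ?p (flip Y ?p j (tens Y ?p j x z)))"
        if x: "x \<in> carrier (fibre Y ?p)" and z: "z \<in> carrier (fibre Y j)" for x z
        using \<mu>(2)[OF \<epsilon>c[OF pk x] \<epsilon>c[OF j z]] \<kappa>(2)[OF j pk z x] \<kappa>(2)[OF pk j x z]
          \<kappa>(3)[OF pk j corr_tensorD(6)[OF g(3)[OF pk j] x z]] by simp
      then show ?thesis
        unfolding creates_def True step_rep_def
        by (intro exI[of _ "\<lambda>w. \<mu> (\<kappa> j ?p w)"] conjI mod_rep_comp[OF \<kappa>(1)[OF j pk] \<mu>(1)]) simp
    next
      case False
      then have l: "l \<in> {1..n}" and lk: "l \<in> ?K" using l n by auto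
      obtain \<mu> where \<mu>: "mod_rep ?A (sq Y j l) ?B (fibre Z j) \<pi> \<mu>"
        "\<And>x z. \<lbrakk>x \<in> carrier (fibre Y l); z \<in> carrier (fibre Y j)\<rbrakk> \<Longrightarrow> \<mu> (tens Y j l z x) = ract (fibre Z j) (\<epsilon> j z) (t l x) \<and>
          lact (fibre Z j) (t l x) (\<epsilon> j z) = \<mu> (flip Y l j (tens Y l j x z))"
        using sys_fibreD(2)[OF fib[OF j] l] unfolding creates_def by blast
      have "\<iota> j (\<mu> (tens Y j l z x)) = ract (fibre E j) (\<iota> j (\<epsilon> j z)) (\<sigma> (t l x)) \<and>
          lact (fibre E j) (\<sigma> (t l x)) (\<iota> j (\<epsilon> j z)) = \<iota> j (\<mu> (flip Y l j (tens Y l j x z)))"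
        if x: "x \<in> carrier (fibre Y l)" and z: "z \<in> carrier (fibre Y j)" for x z
        using \<mu>(2)[OF x z] mod_rep.ract[OF \<iota>m \<epsilon>c[OF j z] sys_repD(5)[OF r l x]]
          ext_corrD(5)[OF \<iota>[OF j] sys_repD(5)[OF r l x] \<epsilon>c[OF j z]] by simp
      then show ?thesis
        unfolding creates_def using False
        by (intro exI[of _ "\<lambda>w. \<iota> j (\<mu> w)"] conjI mod_rep_comp[OF \<mu>(1) \<iota>m]) (simp add: step_rep_def)
    qed
  qed
  have "sys_ext k ?p Y E ?\<pi> ?t ?\<epsilon> ?\<kappa>"
    unfolding sys_ext_def
  proof (intro conjI ballI)
    fix i j assume ij: "i \<in> ?K" "j \<in> ?K"
    show "mod_rep ?A (sq Y i j) ?D (sq E i j) ?\<pi> (?\<kappa> i j)"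
      by (rule mod_rep_comp[OF \<kappa>(1)[OF ij] \<omega>(1)[OF ij]])
    show "?\<kappa> i j (tens Y i j x y) = tens E i j (?\<epsilon> i x) (?\<epsilon> j y)"
      if "x \<in> carrier (fibre Y i)" "y \<in> carrier (fibre Y j)" for x y
      using \<omega>(2)[OF ij] \<kappa>(2)[OF ij that] \<epsilon>c[OF ij(1) that(1)] \<epsilon>c[OF ij(2) that(2)] by simp
    show "flip E i j (?\<kappa> i j w) = ?\<kappa> j i (flip Y i j w)" if w: "w \<in> carrier (sq Y i j)" for w
      using flip\<omega>[OF ij mod_rep.closed[OF \<kappa>(1)[OF ij] w]] \<kappa>(3)[OF ij w] by simp
  qed (use su(2) fibE ET flip_closed in auto)
  then show ?thesis by blast
qed

lemma iterated_sys_ext: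
  assumes Y: "generating_system k Y" and E: "iterated_systems k Y E" and m: "m < k"
  shows "\<exists>\<pi> t \<epsilon> \<kappa>. sys_ext k m Y (E m) \<pi> t \<epsilon> \<kappa>"
  using m
proof (induction m)
  case 0
  have "E 0 = Y" using E by (simp add: iterated_systems_def)
  then show ?case using sys_ext_refl[OF Y] by metis
next
  case (Suc m)
  then obtain \<pi> t \<epsilon> \<kappa> where inv: "sys_ext k m Y (E m) \<pi> t \<epsilon> \<kappa>" by auto
  have "iteration_step k (Suc m) (E (Suc m - 1)) (E (Suc m))"
    by (rule bspec[OF conjunct2[OF E[unfolded iterated_systems_def]]]) (use Suc.prems in auto)
  then have "iteration_step k (Suc m) (E m) (E (Suc m))" by simp
  with Suc.prems show ?case by (intro sys_ext_step[OF Y _ inv]) simp_all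
qed

section \<open>Product systems\<close>

lemma unit_multi_index: "l \<in> {1..n} \<Longrightarrow> unit_index l \<in> multi_index n"
  by (simp add: multi_index_def)

lemma zero_multi_index: "0 \<in> multi_index n"
  by (simp add: multi_index_def)

lemma add_multi_index: "\<lbrakk>s \<in> multi_index n; r \<in> multi_index n\<rbrakk> \<Longrightarrow> s + r \<in> multi_index n"
  unfolding multi_index_def using Poly_Mapping.keys_add[of s r] by blast

definition total_degree :: "nat \<Rightarrow> (nat \<Rightarrow>\<^sub>0 nat) \<Rightarrow> nat" where
  "total_degree n s = (\<Sum>l\<in>{1..n}. Poly_Mapping.lookup s l)"

lemma total_degree_add: "total_degree n (s + r) = total_degree n s + total_degree n r"
  by (simp add: total_degree_def lookup_add sum.distrib)

lemma total_degree_unit: "l \<in> {1..n} \<Longrightarrow> total_degree n (unit_index l) = 1"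
  by (simp add: total_degree_def lookup_single when_def)

lemma multi_index_cases:
  assumes "s \<in> multi_index n"
  obtains "s = 0" | r l where "s = r + unit_index l" "l \<in> {1..n}" "r \<in> multi_index n"
proof (cases "s = 0")
  case False
  then obtain l where l: "l \<in> Poly_Mapping.keys s" by (auto simp flip: keys_eq_empty)
  then have pos: "0 < Poly_Mapping.lookup s l" by (simp add: in_keys_iff)
  have eq: "s = (s - unit_index l) + unit_index l"
    using pos by (intro poly_mapping_eqI) (auto simp: lookup_add lookup_minus lookup_single when_def)
  have "Poly_Mapping.keys (s - unit_index l) \<subseteq> Poly_Mapping.keys s"
    by (auto simp: in_keys_iff lookup_minus)
  moreover have "l \<in> {1..n}" using l assms unfolding multi_index_def by blast
  ultimately show thesis using that(2)[OF eq] assms unfolding multi_index_def by blast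
qed (use that in blast)

text \<open>Since l and l' differ, coordinate l' of r equals that of r' plus one; it is positive, so
  one unit can be removed.\<close>

lemma multi_index_exchange:
  assumes eq: "r + unit_index l = r' + unit_index l'" and ne: "l \<noteq> l'" and r: "r \<in> multi_index n"
  obtains q where "q \<in> multi_index n" "r = q + unit_index l'" "r' = q + unit_index l"
proof
  let ?q = "r - unit_index l'"
  have lk: "Poly_Mapping.lookup r i + (if i = l then 1 else 0) = Poly_Mapping.lookup r' i + (if i = l' then 1 else 0)" for i
    using arg_cong[OF eq, of "\<lambda>s. Poly_Mapping.lookup s i"] by (simp add: lookup_add lookup_single when_def eq_commute split: if_splits)
  have pos: "0 < Poly_Mapping.lookup r l'" using lk[of l'] ne by simp
  show 1: "r = ?q + unit_index l'"
    using pos by (intro poly_mapping_eqI) (auto simp: lookup_add lookup_minus lookup_single when_def)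
  show "r' = ?q + unit_index l"
  proof (rule poly_mapping_eqI)
    fix i show "Poly_Mapping.lookup r' i = Poly_Mapping.lookup (?q + unit_index l) i"
      using lk[of i] pos ne by (auto simp: lookup_add lookup_minus lookup_single when_def split: if_splits)
  qed
  have "Poly_Mapping.keys ?q \<subseteq> Poly_Mapping.keys r" by (auto simp: in_keys_iff lookup_minus)
  then show "?q \<in> multi_index n" using r by (auto simp: multi_index_def)
qed

lemma product_systemD:
  assumes "product_system A n X mul"
  shows "cstar_algebra A" "s \<in> multi_index n \<Longrightarrow> correspondence A (X s)" "X 0 = alg_corr A"
    "\<lbrakk>s \<in> multi_index n; r \<in> multi_index n\<rbrakk> \<Longrightarrow> corr_tensor A (X s) (X r) (X (s + r)) (mul s r)"
    "\<lbrakk>s \<in> multi_index n; r \<in> multi_index n; q \<in> multi_index n; x \<in> carrier (X s); y \<in> carrier (X r); z \<in> carrier (X q)\<rbrakk> \<Longrightarrow>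
      mul (s + r) q (mul s r x y) z = mul s (r + q) x (mul r q y z)"
    "\<lbrakk>s \<in> multi_index n; a \<in> carrier A; x \<in> carrier (X s)\<rbrakk> \<Longrightarrow> mul 0 s a x = lact (X s) a x"
    "\<lbrakk>s \<in> multi_index n; a \<in> carrier A; x \<in> carrier (X s)\<rbrakk> \<Longrightarrow> mul s 0 x a = ract (X s) x a"
  using assms unfolding product_system_def by simp_all

text \<open>The last fact frees the flip from an inverse: \<open>m i j\<close> and
  \<open>m j i\<close> have the same target, because unit indices commute, and \<open>m j i\<close>
  is onto.\<close>

lemma generated_product_systemD:
  assumes "generated_product_system n Y X mul"
  shows "product_system (coeff Y) n X mul" "l \<in> {1..n} \<Longrightarrow> X (unit_index l) = fibre Y l"
    "\<exists>m. \<forall>i\<in>{1..n}. \<forall>j\<in>{1..n}.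
      corr_iso (coeff Y) (sq Y i j) (X (unit_index i + unit_index j)) (m i j) \<and>
      (\<forall>x\<in>carrier (fibre Y i). \<forall>y\<in>carrier (fibre Y j).
        m i j (tens Y i j x y) = mul (unit_index i) (unit_index j) x y) \<and>
      (\<forall>w\<in>carrier (sq Y i j). m j i (flip Y i j w) = m i j w)"
proof -
  show X: "product_system (coeff Y) n X mul" "l \<in> {1..n} \<Longrightarrow> X (unit_index l) = fibre Y l"
    using assms unfolding generated_product_system_def by simp_all
  from assms obtain m where m: "\<And>i j. \<lbrakk>i \<in> {1..n}; j \<in> {1..n}\<rbrakk> \<Longrightarrow>
      corr_iso (coeff Y) (sq Y i j) (X (unit_index i + unit_index j)) (m i j) \<and>
      (\<forall>x\<in>carrier (fibre Y i). \<forall>y\<in>carrier (fibre Y j).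
        m i j (tens Y i j x y) = mul (unit_index i) (unit_index j) x y) \<and>
      (\<forall>w\<in>carrier (sq Y i j).
        flip Y i j w = inv_into (carrier (sq Y j i)) (m j i) (m i j w))"
    unfolding generated_product_system_def by blast
  have "m j i (flip Y i j w) = m i j w" if ij: "i \<in> {1..n}" "j \<in> {1..n}" and w: "w \<in> carrier (sq Y i j)" for i j w
  proof -
    have "m i j w \<in> carrier (X (unit_index j + unit_index i))"
      using corr_isoD(3)[OF conjunct1[OF m[OF ij]] w] by (simp add: add.commute)
    then have "m i j w \<in> m j i ` carrier (sq Y j i)"
      using corr_isoD(2)[OF conjunct1[OF m[OF ij(2,1)]]] by (simp add: bij_betw_def)
    then show ?thesis using m[OF ij] w by (simp add: f_inv_into_f)
  qed
  then show "\<exists>m. \<forall>i\<in>{1..n}. \<forall>j\<in>{1..n}.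
      corr_iso (coeff Y) (sq Y i j) (X (unit_index i + unit_index j)) (m i j) \<and>
      (\<forall>x\<in>carrier (fibre Y i). \<forall>y\<in>carrier (fibre Y j).
        m i j (tens Y i j x y) = mul (unit_index i) (unit_index j) x y) \<and>
      (\<forall>w\<in>carrier (sq Y i j). m j i (flip Y i j w) = m i j w)"
    using m by blast
qed

text \<open>The commutation relation holds because both products of the fibres i and j land in the
  one fibre over \<open>unit_index j + unit_index i\<close>; the witness is \<psi> on this fibre
  composed with \<open>m j i\<close>.\<close>

lemma ps_sys_rep:
  assumes Y: "generating_system k Y" and n: "n \<le> k" and X: "generated_product_system n Y X mul"
    and D: "cstar_algebra D" and \<psi>: "ps_covariant_representation (coeff Y) n X mul D \<psi>"
  shows "sys_rep n Y D (\<psi> 0) (\<lambda>l. \<psi> (unit_index l))"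
proof -
  note g = generating_systemD[OF Y] and xl = generated_product_systemD(2)[OF X]
  note p = product_systemD[OF generated_product_systemD(1)[OF X]]
  have cov: "cov_rep (coeff Y) (X s) D (\<psi> 0) (\<psi> s)" if "s \<in> multi_index n" for s
    using \<psi> that covariant_representation_iff[OF p(2)[OF that] D] unfolding ps_covariant_representation_def by blast
  have prod: "\<psi> s x \<otimes>\<^bsub>D\<^esub> \<psi> r y = \<psi> (s + r) (mul s r x y)"
    if "s \<in> multi_index n" "r \<in> multi_index n" "x \<in> carrier (X s)" "y \<in> carrier (X r)" for s r x y
    using \<psi> that unfolding ps_covariant_representation_def by blast
  have rep: "corr_rep (coeff Y) (X s) D (\<psi> 0) (\<psi> s)" if "s \<in> multi_index n" for s
    using cov[OF that] by (simp add: cov_rep_def)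
  obtain m where m: "\<And>i j. \<lbrakk>i \<in> {1..n}; j \<in> {1..n}\<rbrakk> \<Longrightarrow>
      corr_iso (coeff Y) (sq Y i j) (X (unit_index i + unit_index j)) (m i j)"
    "\<And>i j x y. \<lbrakk>i \<in> {1..n}; j \<in> {1..n}; x \<in> carrier (fibre Y i); y \<in> carrier (fibre Y j)\<rbrakk> \<Longrightarrow>
      m i j (tens Y i j x y) = mul (unit_index i) (unit_index j) x y"
    "\<And>i j w. \<lbrakk>i \<in> {1..n}; j \<in> {1..n}; w \<in> carrier (sq Y i j)\<rbrakk> \<Longrightarrow> m j i (flip Y i j w) = m i j w"
    using generated_product_systemD(3)[OF X] by blast
  show ?thesis
    unfolding sys_rep_def
  proof (intro conjI ballI impI)
    show "cstar_algebra D" by (rule D)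
    show "cstar_hom (coeff Y) D (\<psi> 0)" by (rule mod_repD(3)[OF corr_repD(1)[OF rep[OF zero_multi_index]]])
    show "cov_rep (coeff Y) (fibre Y l) D (\<psi> 0) (\<psi> (unit_index l))" if "l \<in> {1..n}" for l
      using cov[OF unit_multi_index[OF that]] xl[OF that] by simp
    fix i j assume ij: "i \<in> {1..n}" "j \<in> {1..n}"
    have ijk: "i \<in> {1..k}" "j \<in> {1..k}" using ij n by auto
    note ui = unit_multi_index[OF ij(1)] and uj = unit_multi_index[OF ij(2)]
    let ?s = "unit_index j + unit_index i"
    note us = add_multi_index[OF uj ui]
    have mr: "mod_rep (coeff Y) (sq Y j i) (coeff Y) (X ?s) (\<lambda>a. a) (m j i)"
      by (rule mod_rep_isometry[OF correspondence_hilbert[OF corr_tensorD(3)[OF g(3)[OF ijk(2,1)]]]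
            correspondence_hilbert[OF p(2)[OF us]] corr_isoD(1)[OF m(1)[OF ij(2,1)]]])
    show "flip_rel Y D (\<psi> 0) (\<lambda>l. \<psi> (unit_index l)) i j"
      unfolding flip_rel_def
    proof (intro exI[of _ "\<lambda>w. \<psi> ?s (m j i w)"] conjI ballI mod_rep_comp[OF mr corr_repD(1)[OF rep[OF us]]])
      fix x y assume x: "x \<in> carrier (fibre Y i)" and y: "y \<in> carrier (fibre Y j)"
      show "\<psi> ?s (m j i (tens Y j i y x)) = \<psi> (unit_index j) y \<otimes>\<^bsub>D\<^esub> \<psi> (unit_index i) x"
        using prod[OF uj ui] x y by (simp add: m(2)[OF ij(2,1)] xl[OF ij(1)] xl[OF ij(2)] del: One_nat_def)
      have "m j i (flip Y i j (tens Y i j x y)) = mul (unit_index i) (unit_index j) x y"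
        by (simp add: m(3)[OF ij corr_tensorD(6)[OF g(3)[OF ijk] x y]] m(2)[OF ij x y])
      then show "\<psi> ?s (m j i (flip Y i j (tens Y i j x y))) = \<psi> (unit_index i) x \<otimes>\<^bsub>D\<^esub> \<psi> (unit_index j) y"
        using prod[OF ui uj] x y by (simp add: xl[OF ij(1)] xl[OF ij(2)] add.commute del: One_nat_def)
    qed
  qed
qed

text \<open>The converse in degree two. The product t_i t_j defines \<gamma> on the fibre over e_i +
  e_j; pulled back along \<open>m i j\<close> it is the witness \<mu> of the commutation relation,
  so \<gamma> computes t_j t_i as well.\<close>

lemma ps_flip_product:
  assumes Y: "generating_system k Y" and n: "n \<le> k" and X: "generated_product_system n Y X mul"
    and r: "sys_rep n Y D \<pi> t" and ij: "i \<in> {1..n}" "j \<in> {1..n}"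
  shows "\<exists>\<gamma>. mod_rep (coeff Y) (X (unit_index i + unit_index j)) D (alg_corr D) \<pi> \<gamma> \<and>
    (\<forall>x\<in>carrier (fibre Y i). \<forall>y\<in>carrier (fibre Y j).
      \<gamma> (mul (unit_index i) (unit_index j) x y) = t i x \<otimes>\<^bsub>D\<^esub> t j y \<and>
      \<gamma> (mul (unit_index j) (unit_index i) y x) = t j y \<otimes>\<^bsub>D\<^esub> t i x)"
proof -
  note g = generating_systemD[OF Y] and xl = generated_product_systemD(2)[OF X]
  note p = product_systemD[OF generated_product_systemD(1)[OF X]]
  have ijk: "i \<in> {1..k}" "j \<in> {1..k}" using ij n by auto
  note ui = unit_multi_index[OF ij(1)] and uj = unit_multi_index[OF ij(2)]
  let ?s = "unit_index i + unit_index j"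
  note us = add_multi_index[OF ui uj]
  obtain m where m: "\<And>i j. \<lbrakk>i \<in> {1..n}; j \<in> {1..n}\<rbrakk> \<Longrightarrow>
      corr_iso (coeff Y) (sq Y i j) (X (unit_index i + unit_index j)) (m i j)"
    "\<And>i j x y. \<lbrakk>i \<in> {1..n}; j \<in> {1..n}; x \<in> carrier (fibre Y i); y \<in> carrier (fibre Y j)\<rbrakk> \<Longrightarrow>
      m i j (tens Y i j x y) = mul (unit_index i) (unit_index j) x y"
    "\<And>i j w. \<lbrakk>i \<in> {1..n}; j \<in> {1..n}; w \<in> carrier (sq Y i j)\<rbrakk> \<Longrightarrow> m j i (flip Y i j w) = m i j w"
    using generated_product_systemD(3)[OF X] by blast
  have mr: "mod_rep (coeff Y) (sq Y i j) (coeff Y) (X ?s) (\<lambda>a. a) (m i j)"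
    by (rule mod_rep_isometry[OF correspondence_hilbert[OF corr_tensorD(3)[OF g(3)[OF ijk]]]
          correspondence_hilbert[OF p(2)[OF us]] corr_isoD(1)[OF m(1)[OF ij]]])
  have T: "interior_tensor (coeff Y) (fibre Y i) (lact (fibre Y j)) (coeff Y) (fibre Y j) (X ?s)
      (mul (unit_index i) (unit_index j))"
    using corr_tensorD(4)[OF p(4)[OF ui uj]] by (simp add: xl[OF ij(1)] xl[OF ij(2)] del: One_nat_def)
  obtain \<gamma> where \<gamma>: "mod_rep (coeff Y) (X ?s) D (alg_corr D) \<pi> \<gamma>"
    "\<forall>x\<in>carrier (fibre Y i). \<forall>y\<in>carrier (fibre Y j).
      \<gamma> (mul (unit_index i) (unit_index j) x y) = t i x \<otimes>\<^bsub>D\<^esub> t j y"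
    using ex_product[OF T corr_repD(1)[OF sys_repD(4)[OF r ij(1)]] sys_repD(4)[OF r ij(2)]] by auto
  obtain \<mu> where \<mu>: "mod_rep (coeff Y) (sq Y i j) D (alg_corr D) \<pi> \<mu>"
    "\<And>x y. \<lbrakk>x \<in> carrier (fibre Y i); y \<in> carrier (fibre Y j)\<rbrakk> \<Longrightarrow>
      \<mu> (tens Y i j x y) = t i x \<otimes>\<^bsub>D\<^esub> t j y \<and> \<mu> (flip Y j i (tens Y j i y x)) = t j y \<otimes>\<^bsub>D\<^esub> t i x"
    using flip_rel_all[OF Y n r ij(2,1)] unfolding flip_rel_def by blast
  have \<gamma>\<mu>: "\<gamma> (m i j w) = \<mu> w" if "w \<in> carrier (sq Y i j)" for w
    by (rule tensor.mod_rep_agree_tensor[OF corr_tensorI[OF g(3)[OF ijk]] mod_rep_comp[OF mr \<gamma>(1)] \<mu>(1) _ that])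
      (use \<gamma>(2) \<mu>(2) m(2)[OF ij] in simp)
  have "\<gamma> (mul (unit_index j) (unit_index i) y x) = t j y \<otimes>\<^bsub>D\<^esub> t i x"
    if x: "x \<in> carrier (fibre Y i)" and y: "y \<in> carrier (fibre Y j)" for x y
  proof -
    note c = corr_tensorD(6)[OF g(3)[OF ijk(2,1)] y x]
    have "mul (unit_index j) (unit_index i) y x = m i j (flip Y j i (tens Y j i y x))"
      by (simp add: m(3)[OF ij(2,1) c] m(2)[OF ij(2,1) y x])
    then show ?thesis using \<gamma>\<mu>[OF corr_isoD(3)[OF g(4)[OF ijk(2,1)] c]] \<mu>(2)[OF x y] by simp
  qed
  then show ?thesis using \<gamma> by blast
qed

text \<open>The requirement on a value h over s, given values f over smaller indices: the product
  rule for every way to split off a last factor. Over s = 0 only covariance remains.\<close>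

definition ps_lift ::
  "nat \<Rightarrow> 'u corr_system \<Rightarrow> ((nat \<Rightarrow>\<^sub>0 nat) \<Rightarrow> ('u, 'u) correspondence) \<Rightarrow>
    ((nat \<Rightarrow>\<^sub>0 nat) \<Rightarrow> (nat \<Rightarrow>\<^sub>0 nat) \<Rightarrow> 'u \<Rightarrow> 'u \<Rightarrow> 'u) \<Rightarrow> ('d, 'p) cstar_algebra_scheme \<Rightarrow> ('u \<Rightarrow> 'd) \<Rightarrow>
    (nat \<Rightarrow> 'u \<Rightarrow> 'd) \<Rightarrow> ((nat \<Rightarrow>\<^sub>0 nat) \<Rightarrow> 'u \<Rightarrow> 'd) \<Rightarrow> (nat \<Rightarrow>\<^sub>0 nat) \<Rightarrow> ('u \<Rightarrow> 'd) \<Rightarrow> bool" where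
  "ps_lift n Y X mul D \<pi> t f s h \<longleftrightarrow> cov_rep (coeff Y) (X s) D \<pi> h \<and>
    (\<forall>l\<in>{1..n}. \<forall>r\<in>multi_index n. s = r + unit_index l \<longrightarrow>
      (\<forall>x\<in>carrier (X r). \<forall>y\<in>carrier (fibre Y l). h (mul r (unit_index l) x y) = f r x \<otimes>\<^bsub>D\<^esub> t l y))"

text \<open>If \<open>s = r + e\<^sub>l = r' + e\<^sub>l\<^sub>'\<close> with \<open>l \<noteq> l'\<close>, write \<open>r = q + e\<^sub>l\<^sub>'\<close>; the two candidates for the value over
  \<open>s\<close> agree on the products of the fibres over \<open>q\<close> and \<open>e\<^sub>l + e\<^sub>l\<^sub>'\<close>.\<close>

lemma ex_ps_lift:
  assumes Y: "generating_system k Y" and n: "n \<le> k" and X: "generated_product_system n Y X mul"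
    and r: "sys_rep n Y D \<pi> t" and s: "s \<in> multi_index n" "s \<noteq> 0"
    and cov: "\<And>r. \<lbrakk>r \<in> multi_index n; total_degree n r < total_degree n s\<rbrakk> \<Longrightarrow> cov_rep (coeff Y) (X r) D \<pi> (f r)"
    and prod: "\<And>r l x y. \<lbrakk>r \<in> multi_index n; l \<in> {1..n}; total_degree n (r + unit_index l) < total_degree n s;
        x \<in> carrier (X r); y \<in> carrier (fibre Y l)\<rbrakk> \<Longrightarrow>
      f (r + unit_index l) (mul r (unit_index l) x y) = f r x \<otimes>\<^bsub>D\<^esub> t l y"
  shows "\<exists>h. ps_lift n Y X mul D \<pi> t f s h"
proof -
  note xl = generated_product_systemD(2)[OF X]
  note p = product_systemD[OF generated_product_systemD(1)[OF X]]
  note D = sys_repD(1)[OF r]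
  interpret D: cstar_algebra D by (rule D)
  have deg: "total_degree n r < total_degree n (r + unit_index l)" if "l \<in> {1..n}" for r l
    using total_degree_unit[OF that] by (simp add: total_degree_add del: One_nat_def)
  have ex: "\<exists>h. mod_rep (coeff Y) (X s) D (alg_corr D) \<pi> h \<and>
      (\<forall>x\<in>carrier (X r). \<forall>y\<in>carrier (fibre Y l). h (mul r (unit_index l) x y) = f r x \<otimes>\<^bsub>D\<^esub> t l y)"
    if "s = r' + unit_index l" "l \<in> {1..n}" "r' \<in> multi_index n" "r = r'" for r r' l
  proof -
    have "cov_rep (coeff Y) (X r) D \<pi> (f r)" using cov that deg by simp
    then have c: "corr_rep (coeff Y) (X r) D \<pi> (f r)" by (simp add: cov_rep_def)
    have "interior_tensor (coeff Y) (X r) (lact (fibre Y l)) (coeff Y) (fibre Y l) (X s) (mul r (unit_index l))"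
      using corr_tensorD(4)[OF p(4)[OF that(3) unit_multi_index[OF that(2)]]] that by (simp add: xl del: One_nat_def)
    from ex_product[OF this corr_repD(1)[OF c] sys_repD(4)[OF r that(2)]] show ?thesis by simp
  qed
  have key: "h w = h' w"
    if l: "s = r + unit_index l" "l \<in> {1..n}" "r \<in> multi_index n"
      and l': "s = r' + unit_index l'" "l' \<in> {1..n}" "r' \<in> multi_index n"
      and h: "mod_rep (coeff Y) (X s) D (alg_corr D) \<pi> h"
        "\<And>x y. \<lbrakk>x \<in> carrier (X r); y \<in> carrier (fibre Y l)\<rbrakk> \<Longrightarrow> h (mul r (unit_index l) x y) = f r x \<otimes>\<^bsub>D\<^esub> t l y"
      and h': "mod_rep (coeff Y) (X s) D (alg_corr D) \<pi> h'"
        "\<And>x y. \<lbrakk>x \<in> carrier (X r'); y \<in> carrier (fibre Y l')\<rbrakk> \<Longrightarrow> h' (mul r' (unit_index l') x y) = f r' x \<otimes>\<^bsub>D\<^esub> t l' y"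
      and ne: "l \<noteq> l'" and w: "w \<in> carrier (X s)"
    for r l r' l' h h' w
  proof -
    obtain q where q: "q \<in> multi_index n" "r = q + unit_index l'" "r' = q + unit_index l"
      by (rule multi_index_exchange[OF l(1)[unfolded l'(1), symmetric] ne l(3)])
    obtain \<gamma> where \<gamma>: "mod_rep (coeff Y) (X (unit_index l' + unit_index l)) D (alg_corr D) \<pi> \<gamma>"
      "\<And>x y. \<lbrakk>x \<in> carrier (fibre Y l'); y \<in> carrier (fibre Y l)\<rbrakk> \<Longrightarrow>
        \<gamma> (mul (unit_index l') (unit_index l) x y) = t l' x \<otimes>\<^bsub>D\<^esub> t l y \<and>
        \<gamma> (mul (unit_index l) (unit_index l') y x) = t l y \<otimes>\<^bsub>D\<^esub> t l' x"
      using ps_flip_product[OF Y n X r l'(2) l(2)] by blast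
    note ul = unit_multi_index[OF l(2)] and ul' = unit_multi_index[OF l'(2)]
    have s2: "s = q + (unit_index l' + unit_index l)" "s = q + (unit_index l + unit_index l')"
      using l(1) q(2) by (simp_all add: ac_simps)
    have dq: "total_degree n q < total_degree n r" "total_degree n r < total_degree n s"
        "total_degree n q < total_degree n r'" "total_degree n r' < total_degree n s"
    proof -
      show "total_degree n q < total_degree n r" unfolding q(2) by (rule deg[OF l'(2)])
      show "total_degree n r < total_degree n s" unfolding l(1) by (rule deg[OF l(2)])
      show "total_degree n q < total_degree n r'" unfolding q(3) by (rule deg[OF l(2)])
      show "total_degree n r' < total_degree n s" unfolding l'(1) by (rule deg[OF l'(2)])
    qed
    have "corr_rep (coeff Y) (X q) D \<pi> (f q)" using cov[OF q(1)] dq by (simp add: cov_rep_def)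
    then interpret fq: corr_rep "coeff Y" "X q" D \<pi> "f q" .
    have tc: "t l y \<in> carrier D" if "y \<in> carrier (fibre Y l)" for y by (rule sys_repD(5)[OF r l(2) that])
    have tc': "t l' y \<in> carrier D" if "y \<in> carrier (fibre Y l')" for y by (rule sys_repD(5)[OF r l'(2) that])
    interpret S: tensor "coeff Y" "X q" "lact (X (unit_index l' + unit_index l))" "coeff Y"
      "X (unit_index l' + unit_index l)" "X s" "mul q (unit_index l' + unit_index l)"
      using corr_tensorI[OF p(4)[OF q(1) add_multi_index[OF ul' ul]]] s2(1) by (simp del: One_nat_def)
    have T: "tensor (coeff Y) (fibre Y l') (lact (fibre Y l)) (coeff Y) (fibre Y l)
        (X (unit_index l' + unit_index l)) (mul (unit_index l') (unit_index l))"
      using corr_tensorI[OF p(4)[OF ul' ul]] by (simp add: xl[OF l(2)] xl[OF l'(2)] del: One_nat_def)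
    have T': "tensor (coeff Y) (fibre Y l) (lact (fibre Y l')) (coeff Y) (fibre Y l')
        (X (unit_index l' + unit_index l)) (mul (unit_index l) (unit_index l'))"
      using corr_tensorI[OF p(4)[OF ul ul']] by (simp add: xl[OF l(2)] xl[OF l'(2)] add.commute del: One_nat_def)
    have tq: "interior_tensor (coeff Y) (X q) (lact (fibre Y j)) (coeff Y) (fibre Y j) (X (q + unit_index j)) (mul q (unit_index j))"
      if "j \<in> {1..n}" for j
      using corr_tensorD(4)[OF p(4)[OF q(1) unit_multi_index[OF that]]] by (simp add: xl[OF that] del: One_nat_def)
    have mc: "mul q (unit_index j) x y \<in> carrier (X (q + unit_index j))"
      if "j \<in> {1..n}" "x \<in> carrier (X q)" "y \<in> carrier (fibre Y j)" for j x y
      using tq[OF that(1)] that(2,3) by (simp add: interior_tensor_def)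
    have bdd: "bdd_linear (X (unit_index l' + unit_index l)) (hnorm (coeff Y) (X (unit_index l' + unit_index l))) D (cnorm D)
        (\<lambda>v. g (mul q (unit_index l' + unit_index l) x v))"
      if "mod_rep (coeff Y) (X s) D (alg_corr D) \<pi> g" "x \<in> carrier (X q)" for g x
    proof -
      interpret g: alg_rep "coeff Y" "X s" D \<pi> g using that(1) by (simp add: alg_rep_def)
      show ?thesis
        by (rule bdd_linear_comp[OF S.\<tau>_bdd_right[OF that(2)] g.t_bdd])
          (rule S.W.X.normed_cvs_axioms S.L.Y.X.normed_cvs_axioms)+
    qed
    note bg = mod_rep_mult_bdd(2)[OF \<gamma>(1)]
    \<comment> \<open>Associativity and the product rule over r = q + e_l' make h equal to f q x
      times \<gamma>. Since \<gamma> computes the products in both orders, the same expression is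
      reached from h'.\<close>
    have h1: "h (mul q (unit_index l' + unit_index l) x v) = f q x \<otimes>\<^bsub>D\<^esub> \<gamma> v"
      if x: "x \<in> carrier (X q)" and v: "v \<in> carrier (X (unit_index l' + unit_index l))" for x v
    proof (rule tensor.bdd_agree[OF T D.normed_cvs_axioms bdd[OF h(1) x] bg _ v])
      show "f q x \<in> carrier D" using x by simp
      fix y' y assume y': "y' \<in> carrier (fibre Y l')" and y: "y \<in> carrier (fibre Y l)"
      have "mul q (unit_index l' + unit_index l) x (mul (unit_index l') (unit_index l) y' y) =
          mul r (unit_index l) (mul q (unit_index l') x y') y"
        using p(5)[OF q(1) ul' ul x] y y' by (simp add: xl[OF l(2)] xl[OF l'(2)] q(2) del: One_nat_def)
      then show "h (mul q (unit_index l' + unit_index l) x (mul (unit_index l') (unit_index l) y' y)) =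
          f q x \<otimes>\<^bsub>D\<^esub> \<gamma> (mul (unit_index l') (unit_index l) y' y)"
        using h(2)[of "mul q (unit_index l') x y'" y] mc[OF l'(2) x y'] y y' x \<gamma>(2)[OF y' y] tc tc'
          prod[OF q(1) l'(2) _ x y'] dq(2)
        by (simp add: q(2) D.mult_assoc del: One_nat_def)
    qed
    have h2: "h' (mul q (unit_index l' + unit_index l) x v) = f q x \<otimes>\<^bsub>D\<^esub> \<gamma> v"
      if x: "x \<in> carrier (X q)" and v: "v \<in> carrier (X (unit_index l' + unit_index l))" for x v
    proof (rule tensor.bdd_agree[OF T' D.normed_cvs_axioms bdd[OF h'(1) x] bg _ v])
      show "f q x \<in> carrier D" using x by simp
      fix y y' assume y: "y \<in> carrier (fibre Y l)" and y': "y' \<in> carrier (fibre Y l')"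
      have "mul q (unit_index l' + unit_index l) x (mul (unit_index l) (unit_index l') y y') =
          mul r' (unit_index l') (mul q (unit_index l) x y) y'"
        using p(5)[OF q(1) ul ul' x] y y'
        by (simp add: xl[OF l(2)] xl[OF l'(2)] q(3) add.commute[of "unit_index l'"] del: One_nat_def)
      then show "h' (mul q (unit_index l' + unit_index l) x (mul (unit_index l) (unit_index l') y y')) =
          f q x \<otimes>\<^bsub>D\<^esub> \<gamma> (mul (unit_index l) (unit_index l') y y')"
        using h'(2)[of "mul q (unit_index l) x y" y'] mc[OF l(2) x y] y y' x \<gamma>(2)[OF y' y] tc tc'
          prod[OF q(1) l(2) _ x y] dq(4)
        by (simp add: q(3) D.mult_assoc del: One_nat_def)
    qed
    show ?thesis
      by (rule S.mod_rep_agree_tensor[OF h(1) h'(1) _ w]) (simp add: h1 h2 del: One_nat_def)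
  qed
  obtain r0 l0 where l0: "s = r0 + unit_index l0" "l0 \<in> {1..n}" "r0 \<in> multi_index n"
    using multi_index_cases[OF s(1)] s(2) by metis
  obtain h where h: "mod_rep (coeff Y) (X s) D (alg_corr D) \<pi> h"
    "\<And>x y. \<lbrakk>x \<in> carrier (X r0); y \<in> carrier (fibre Y l0)\<rbrakk> \<Longrightarrow> h (mul r0 (unit_index l0) x y) = f r0 x \<otimes>\<^bsub>D\<^esub> t l0 y"
    using ex[OF l0 refl] by blast
  have "h (mul r (unit_index l) x y) = f r x \<otimes>\<^bsub>D\<^esub> t l y"
    if l: "s = r + unit_index l" "l \<in> {1..n}" "r \<in> multi_index n" and x: "x \<in> carrier (X r)" and y: "y \<in> carrier (fibre Y l)"
    for r l x y
  \<comment> \<open>For l = l0 cancellation gives r = r0, so the exchange concerns distinct l and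
    l0.\<close>
  proof (cases "l = l0")
    case True
    then show ?thesis using h(2) l(1) l0(1) x y by (simp del: One_nat_def)
  next
    case False
    obtain h' where h': "mod_rep (coeff Y) (X s) D (alg_corr D) \<pi> h'"
      "\<And>x y. \<lbrakk>x \<in> carrier (X r); y \<in> carrier (fibre Y l)\<rbrakk> \<Longrightarrow> h' (mul r (unit_index l) x y) = f r x \<otimes>\<^bsub>D\<^esub> t l y"
      using ex[OF l refl] by blast
    have "y \<in> carrier (X (unit_index l))" using y by (simp only: xl[OF l(2)])
    then have c: "mul r (unit_index l) x y \<in> carrier (X s)"
      unfolding l(1) by (rule corr_tensorD(6)[OF p(4)[OF l(3) unit_multi_index[OF l(2)]] x])
    show ?thesis using key[OF l l0 h' h False c] h'(2)[OF x y] by (simp del: One_nat_def)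
  qed
  moreover have "cov_rep (coeff Y) (X s) D \<pi> h"
  proof (rule cov_rep_product[OF cov[OF l0(3)] sys_repD(3)[OF r l0(2)] _ h])
    show "total_degree n r0 < total_degree n s" using deg[OF l0(2)] l0(1) by simp
    show "corr_tensor (coeff Y) (X r0) (fibre Y l0) (X s) (mul r0 (unit_index l0))"
      using p(4)[OF l0(3) unit_multi_index[OF l0(2)]] l0(1) by (simp add: xl[OF l0(2)] del: One_nat_def)
  qed
  ultimately show ?thesis unfolding ps_lift_def by blast
qed

text \<open>Every a is a limit of products a b, and \<pi>(a b) has the form t(x) t(y)^* with x = a
  and y the adjoint of b. Thus the fibre over 0 is covariant automatically.\<close>

lemma cov_rep_alg_corr:
  assumes A: "correspondence A (alg_corr A)" and D: "cstar_algebra D" and \<pi>: "cstar_hom A D \<pi>"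
  shows "cov_rep A (alg_corr A) D \<pi> \<pi>"
proof -
  interpret A: correspondence A "alg_corr A" by fact
  have m: "mod_rep A (alg_corr A) D (alg_corr D) \<pi> \<pi>"
    by (rule mod_rep_hom[OF A.A.cstar_algebra_axioms D \<pi>])
  interpret D: cstar_algebra D by fact
  interpret t: alg_rep A "alg_corr A" D \<pi> \<pi> using m by (simp add: alg_rep_def)
  have "\<pi> a \<in> t.P" if a: "a \<in> carrier A" for a
  proof -
    obtain b where b: "\<And>n. b n \<in> carrier A" "A.A.nlim (\<lambda>n. a \<otimes>\<^bsub>A\<^esub> b n) a"
      using A.A.mult_approx[OF a] by blast
    have "D.nlim (\<lambda>n. \<pi> (a \<otimes>\<^bsub>A\<^esub> b n)) (\<pi> a)"
      by (rule bdd_linear_nlim[OF A.A.normed_cvs_axioms D.normed_cvs_axioms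
            cstar_hom_bdd[OF A.A.cstar_algebra_axioms D \<pi>] b(2)])
    moreover have "\<pi> (a \<otimes>\<^bsub>A\<^esub> b n) \<in> t.P" for n
      using t.gen_in_P[of a "star A (b n)"] a b(1) by (simp add: cstar_homD[OF \<pi>])
    ultimately show ?thesis by (rule D.nclosedD[OF t.P_nclosed, rotated])
  qed
  moreover have "corr_rep A (alg_corr A) D \<pi> \<pi>"
    by (rule corr_repI[OF m A]) (simp add: cstar_homD[OF \<pi>])
  ultimately show ?thesis by (simp add: cov_rep_def)
qed

lemma ex_ps_rep:
  assumes Y: "generating_system k Y" and n: "n \<le> k" and X: "generated_product_system n Y X mul"
    and r: "sys_rep n Y D \<pi> t"
  shows "\<exists>\<psi>. \<psi> 0 = \<pi> \<and> (\<forall>s\<in>multi_index n. cov_rep (coeff Y) (X s) D \<pi> (\<psi> s)) \<and>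
    (\<forall>r\<in>multi_index n. \<forall>l\<in>{1..n}. \<forall>x\<in>carrier (X r). \<forall>y\<in>carrier (fibre Y l).
      \<psi> (r + unit_index l) (mul r (unit_index l) x y) = \<psi> r x \<otimes>\<^bsub>D\<^esub> t l y)"
proof -
  note p = product_systemD[OF generated_product_systemD(1)[OF X]]
  let ?lift = "ps_lift n Y X mul D \<pi> t"
  \<comment> \<open>\<open>\<Psi> N\<close> is meant for indices of total degree N, and \<psi>
    selects the right level. One previous level is enough for the recursion, since
    \<open>ps_lift\<close> refers to f only at indices one degree lower.\<close>
  define \<Psi> where "\<Psi> = rec_nat (\<lambda>s. \<pi>) (\<lambda>N F s. SOME h. ?lift F s h)"
  define \<psi> where "\<psi> s = \<Psi> (total_degree n s) s" for s
  have deg0: "total_degree n 0 = 0" by (simp add: total_degree_def)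
  have \<psi>0: "\<psi> 0 = \<pi>" by (simp add: \<psi>_def \<Psi>_def deg0)
  have deg: "total_degree n (r + unit_index l) = Suc (total_degree n r)" if "l \<in> {1..n}" for r l
    using total_degree_unit[OF that] by (simp add: total_degree_add del: One_nat_def)
  have lift: "?lift \<psi> s (\<psi> s)"
    if s: "s \<in> multi_index n" "s \<noteq> 0" and h: "\<exists>h. ?lift \<psi> s h" for s
  proof -
    obtain r l where l: "s = r + unit_index l" "l \<in> {1..n}"
      using multi_index_cases[OF s(1)] s(2) by metis
    define N where "N = total_degree n r"
    have N: "total_degree n s = Suc N" unfolding l(1) N_def by (rule deg[OF l(2)])
    have "?lift (\<Psi> N) s h \<longleftrightarrow> ?lift \<psi> s h" for h
    proof -
      have "\<Psi> N r' = \<psi> r'" if "s = r' + unit_index l'" "l' \<in> {1..n}" for r' l'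
        using N deg[OF that(2), of r'] unfolding \<psi>_def that(1) by simp
      then show ?thesis unfolding ps_lift_def by (auto simp del: One_nat_def)
    qed
    moreover have "\<psi> s = (SOME h. ?lift (\<Psi> N) s h)" by (simp add: \<psi>_def N \<Psi>_def)
    ultimately have "\<psi> s = (SOME h. ?lift \<psi> s h)" by simp
    then show ?thesis using someI_ex[OF h] by simp
  qed
  have main: "cov_rep (coeff Y) (X s) D \<pi> (\<psi> s) \<and> (s \<noteq> 0 \<longrightarrow> ?lift \<psi> s (\<psi> s))" if "s \<in> multi_index n" for s
    using that
  proof (induction "total_degree n s" arbitrary: s rule: less_induct)
    case less
    show ?case
    proof (cases "s = 0")
      case True
      have "correspondence (coeff Y) (alg_corr (coeff Y))"
        using p(2)[OF zero_multi_index] p(3) by simp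
      then show ?thesis using cov_rep_alg_corr[OF _ sys_repD(1,2)[OF r]] True p(3) \<psi>0 by simp
    next
      case False
      have "\<exists>h. ?lift \<psi> s h"
      proof (rule ex_ps_lift[OF Y n X r less.prems False])
        show "cov_rep (coeff Y) (X r) D \<pi> (\<psi> r)"
          if "r \<in> multi_index n" "total_degree n r < total_degree n s" for r
          using less.hyps that by blast
        fix r l x y assume rl: "r \<in> multi_index n" "l \<in> {1..n}" "total_degree n (r + unit_index l) < total_degree n s"
          and xy: "x \<in> carrier (X r)" "y \<in> carrier (fibre Y l)"
        have "r + unit_index l \<noteq> 0" using deg[OF rl(2), of r] deg0 by (metis Zero_not_Suc)
        then have "?lift \<psi> (r + unit_index l) (\<psi> (r + unit_index l))"
          using less.hyps[OF rl(3) add_multi_index[OF rl(1) unit_multi_index[OF rl(2)]]] by blast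
        then show "\<psi> (r + unit_index l) (mul r (unit_index l) x y) = \<psi> r x \<otimes>\<^bsub>D\<^esub> t l y"
          using rl(1,2) xy unfolding ps_lift_def by blast
      qed
      then have "?lift \<psi> s (\<psi> s)" by (rule lift[OF less.prems False])
      then show ?thesis by (simp add: ps_lift_def)
    qed
  qed
  have "\<psi> (r + unit_index l) (mul r (unit_index l) x y) = \<psi> r x \<otimes>\<^bsub>D\<^esub> t l y"
    if rl: "r \<in> multi_index n" "l \<in> {1..n}" and xy: "x \<in> carrier (X r)" "y \<in> carrier (fibre Y l)" for r l x y
  proof -
    have "r + unit_index l \<noteq> 0" using deg[OF rl(2), of r] deg0 by (metis Zero_not_Suc)
    then have "?lift \<psi> (r + unit_index l) (\<psi> (r + unit_index l))"
      using main[OF add_multi_index[OF rl(1) unit_multi_index[OF rl(2)]]] by blast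
    then show ?thesis using rl(1,2) xy unfolding ps_lift_def by blast
  qed
  then show ?thesis using \<psi>0 main by blast
qed

lemma ps_corr_tensor:
  assumes X: "generated_product_system n Y X mul" and l: "l \<in> {1..n}" and r: "r \<in> multi_index n"
  shows "corr_tensor (coeff Y) (X r) (fibre Y l) (X (r + unit_index l)) (mul r (unit_index l))"
  using product_systemD(4)[OF generated_product_systemD(1)[OF X] r unit_multi_index[OF l]]
  by (simp add: generated_product_systemD(2)[OF X l] del: One_nat_def)

lemma multi_index_induct [consumes 1, case_names zero add]:
  assumes "s \<in> multi_index n" and "P 0"
    and "\<And>r l. \<lbrakk>r \<in> multi_index n; l \<in> {1..n}; P r\<rbrakk> \<Longrightarrow> P (r + unit_index l)"
  shows "P s"
  using assms(1)
proof (induction "total_degree n s" arbitrary: s rule: less_induct)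
  case less
  show ?case
  proof (rule multi_index_cases[OF less.prems])
    fix r l assume s: "s = r + unit_index l" "l \<in> {1..n}" "r \<in> multi_index n"
    have "total_degree n r < total_degree n s"
      unfolding s(1) using total_degree_unit[OF s(2)] by (simp add: total_degree_add del: One_nat_def)
    from assms(3)[OF s(3,2) less.hyps[OF this s(3)]] show "P s" by (simp only: s(1))
  qed (use assms(2) in simp)
qed

text \<open>\<open>ex_ps_rep\<close> gives the product rule for right factors in fibres over unit
  indices. Induction on the right index extends it: on products z y it follows from associativity,
  and these span the fibre up to closure.\<close>

lemma ex_ps_covariant:
  assumes Y: "generating_system k Y" and n: "n \<le> k" and X: "generated_product_system n Y X mul"
    and r: "sys_rep n Y D \<pi> t"
  shows "\<exists>\<psi>. ps_covariant_representation (coeff Y) n X mul D \<psi> \<and> \<psi> 0 = \<pi> \<and>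
    (\<forall>l\<in>{1..n}. \<forall>x\<in>carrier (fibre Y l). \<psi> (unit_index l) x = t l x)"
proof -
  note p = product_systemD[OF generated_product_systemD(1)[OF X]] and xl = generated_product_systemD(2)[OF X]
  interpret D: cstar_algebra D by (rule sys_repD(1)[OF r])
  obtain \<psi> where \<psi>0: "\<psi> 0 = \<pi>" and cov: "\<And>s. s \<in> multi_index n \<Longrightarrow> cov_rep (coeff Y) (X s) D \<pi> (\<psi> s)"
    and prod: "\<And>r l x y. \<lbrakk>r \<in> multi_index n; l \<in> {1..n}; x \<in> carrier (X r); y \<in> carrier (fibre Y l)\<rbrakk> \<Longrightarrow>
      \<psi> (r + unit_index l) (mul r (unit_index l) x y) = \<psi> r x \<otimes>\<^bsub>D\<^esub> t l y"
    using ex_ps_rep[OF Y n X r] by blast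
  have rep: "corr_rep (coeff Y) (X s) D \<pi> (\<psi> s)" if "s \<in> multi_index n" for s
    using cov[OF that] by (simp add: cov_rep_def)
  have cl: "\<psi> s x \<in> carrier D" if "s \<in> multi_index n" "x \<in> carrier (X s)" for s x
    using mod_rep.closed[OF corr_repD(1)[OF rep[OF that(1)]] that(2)] by simp
  have mult: "\<psi> s x \<otimes>\<^bsub>D\<^esub> \<psi> r y = \<psi> (s + r) (mul s r x y)"
    if s: "s \<in> multi_index n" and x: "x \<in> carrier (X s)" and r: "r \<in> multi_index n" and y: "y \<in> carrier (X r)" for s r x y
    using r y
  proof (induction r arbitrary: y rule: multi_index_induct)
    case zero
    interpret s: corr_rep "coeff Y" "X s" D \<pi> "\<psi> s" by (rule rep[OF s])
    show ?case using zero x p(7)[OF s _ x] by (simp add: \<psi>0 p(3) s.t_ract)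
  next
    case (add q l)
    let ?r = "q + unit_index l"
    have qr: "?r \<in> multi_index n" by (rule add_multi_index[OF add.hyps(1) unit_multi_index[OF add.hyps(2)]])
    interpret T: tensor "coeff Y" "X q" "lact (fibre Y l)" "coeff Y" "fibre Y l" "X ?r" "mul q (unit_index l)"
      by (rule corr_tensorI[OF ps_corr_tensor[OF X add.hyps(2,1)]])
    interpret S: tensor "coeff Y" "X s" "lact (X ?r)" "coeff Y" "X ?r" "X (s + ?r)" "mul s ?r"
      by (rule corr_tensorI[OF p(4)[OF s qr]])
    note sr = add_multi_index[OF s qr]
    interpret sr: corr_rep "coeff Y" "X (s + ?r)" D \<pi> "\<psi> (s + ?r)" by (rule rep[OF sr])
    show ?case
    proof (rule T.bdd_agree[OF D.normed_cvs_axioms _ _ _ add.prems,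
          of "\<lambda>y. \<psi> s x \<otimes>\<^bsub>D\<^esub> \<psi> ?r y" "\<lambda>y. \<psi> (s + ?r) (mul s ?r x y)"])
      show "bdd_linear (X ?r) (hnorm (coeff Y) (X ?r)) D (cnorm D) (\<lambda>y. \<psi> s x \<otimes>\<^bsub>D\<^esub> \<psi> ?r y)"
        by (rule mod_rep_mult_bdd(2)[OF corr_repD(1)[OF rep[OF qr]] cl[OF s x]])
      show "bdd_linear (X ?r) (hnorm (coeff Y) (X ?r)) D (cnorm D) (\<lambda>y. \<psi> (s + ?r) (mul s ?r x y))"
        by (rule bdd_linear_comp[OF S.\<tau>_bdd_right[OF x] sr.t_bdd])
          (rule S.W.X.normed_cvs_axioms T.W.X.normed_cvs_axioms)+
      fix z y assume z: "z \<in> carrier (X q)" and y: "y \<in> carrier (fibre Y l)"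
      have tl: "t l y \<in> carrier D" by (rule sys_repD(5)[OF \<open>sys_rep n Y D \<pi> t\<close> add.hyps(2) y])
      have szc: "mul s q x z \<in> carrier (X (s + q))" by (rule corr_tensorD(6)[OF p(4)[OF s add.hyps(1)] x z])
      have y': "y \<in> carrier (X (unit_index l))" using y by (simp only: xl[OF add.hyps(2)])
      have "\<psi> s x \<otimes>\<^bsub>D\<^esub> \<psi> ?r (mul q (unit_index l) z y) = (\<psi> s x \<otimes>\<^bsub>D\<^esub> \<psi> q z) \<otimes>\<^bsub>D\<^esub> t l y"
        using tl cl[OF s x] cl[OF add.hyps(1) z] by (simp only: prod[OF add.hyps(1,2) z y] D.mult_assoc)
      also have "\<dots> = \<psi> (s + q + unit_index l) (mul (s + q) (unit_index l) (mul s q x z) y)"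
        by (simp only: add.IH[OF z] prod[OF add_multi_index[OF s add.hyps(1)] add.hyps(2) szc y])
      also have "\<dots> = \<psi> (s + ?r) (mul s ?r x (mul q (unit_index l) z y))"
        by (simp only: p(5)[OF s add.hyps(1) unit_multi_index[OF add.hyps(2)] x z y'] add.assoc)
      finally show "\<psi> s x \<otimes>\<^bsub>D\<^esub> \<psi> ?r (mul q (unit_index l) z y) =
          \<psi> (s + ?r) (mul s ?r x (mul q (unit_index l) z y))" .
    qed
  qed
  \<comment> \<open>The recursion reaches \<open>unit_index l\<close> as 0 +
    \<open>unit_index l\<close>. Nondegeneracy writes y = a y', a product of the fibres over 0 and
    over \<open>unit_index l\<close>, for which the product rule gives \<pi>(a) t_l(y') = t_l(a
    y').\<close>
  have "\<psi> (unit_index l) y = t l y" if l: "l \<in> {1..n}" and y: "y \<in> carrier (fibre Y l)" for l y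
  proof -
    interpret t: corr_rep "coeff Y" "fibre Y l" D \<pi> "t l" by (rule sys_repD(4)[OF r l])
    obtain a y' where a: "a \<in> carrier (coeff Y)" "y' \<in> carrier (fibre Y l)" "y = lact (fibre Y l) a y'"
      by (rule t.C.nondegenerate'[OF y])
    have "y = mul 0 (unit_index l) a y'"
      using p(6)[OF unit_multi_index[OF l] a(1), of y'] a(2,3) by (simp add: xl[OF l] del: One_nat_def)
    then show ?thesis
      using prod[OF zero_multi_index l _ a(2), of a] a by (simp add: \<psi>0 p(3) t.left del: One_nat_def)
  qed
  moreover have "covariant_representation (coeff Y) (X s) D (\<psi> 0) (\<psi> s)" if "s \<in> multi_index n" for s
    using covariant_representation_iff[OF p(2)[OF that] D.cstar_algebra_axioms] cov[OF that] \<psi>0 by simp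
  ultimately show ?thesis using mult \<psi>0 unfolding ps_covariant_representation_def by blast
qed

text \<open>The fibre over r + e_l is the closed span of products, so by induction its image lies in
  every C*-subalgebra containing the images of the coefficients and of the fibres over unit indices.
  Universality is transported by \<open>ex_ps_covariant\<close>, which turns a test family into a
  test representation.\<close>

lemma ps_sys_universal:
  assumes Y: "generating_system k Y" and n: "n \<le> k" and X: "generated_product_system n Y X mul"
    and B: "ps_cuntz_pimsner (coeff Y) n X mul B \<psi>"
  shows "sys_universal n Y B (\<psi> 0) (\<lambda>l. \<psi> (unit_index l))"
proof -
  note p = product_systemD[OF generated_product_systemD(1)[OF X]] and xl = generated_product_systemD(2)[OF X]
  have cB: "cstar_algebra B" and \<psi>: "ps_covariant_representation (coeff Y) n X mul B \<psi>"
    and gen: "cstar_generate B (\<Union>s\<in>multi_index n. \<psi> s ` carrier (X s)) = carrier B"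
    using B by (simp_all add: ps_cuntz_pimsner_def)
  interpret B: cstar_algebra B by fact
  have sr: "sys_rep n Y B (\<psi> 0) (\<lambda>l. \<psi> (unit_index l))" by (rule ps_sys_rep[OF Y n X cB \<psi>])
  have rep: "corr_rep (coeff Y) (X s) B (\<psi> 0) (\<psi> s)" if "s \<in> multi_index n" for s
    using \<psi> that covariant_representation_iff[OF p(2)[OF that] cB, of "\<psi> 0" "\<psi> s"]
    unfolding ps_covariant_representation_def cov_rep_def by blast
  let ?S = "sys_range n Y (\<psi> 0) (\<lambda>l. \<psi> (unit_index l))"
  have in_H: "carrier B \<subseteq> H" if H: "cstar_subalgebra H B" "?S \<subseteq> H" for H
  proof -
    note h = B.cstar_subalgebraD[OF H(1)]
    note hs = B.submoduleD[OF h(1)]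
    have "\<psi> s x \<in> H" if "s \<in> multi_index n" "x \<in> carrier (X s)" for s x
      using that
    proof (induction s arbitrary: x rule: multi_index_induct)
      case zero
      then show ?case using H(2) by (auto simp: sys_range_def p(3))
    next
      case (add q l)
      let ?r = "q + unit_index l"
      have qr: "?r \<in> multi_index n" by (rule add_multi_index[OF add.hyps(1) unit_multi_index[OF add.hyps(2)]])
      interpret T: tensor "coeff Y" "X q" "lact (fibre Y l)" "coeff Y" "fibre Y l" "X ?r" "mul q (unit_index l)"
        by (rule corr_tensorI[OF ps_corr_tensor[OF X add.hyps(2,1)]])
      interpret r: corr_rep "coeff Y" "X ?r" B "\<psi> 0" "\<psi> ?r" by (rule rep[OF qr])
      show ?case
      proof (rule bdd_linear_nclspan[OF T.W.X.normed_cvs_axioms B.normed_cvs_axioms r.t_bdd T.elements_carrier _ h(1,4)])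
        show "x \<in> T.W.X.nclspan {mul q (unit_index l) z y |z y. z \<in> carrier (X q) \<and> y \<in> carrier (fibre Y l)}"
          unfolding T.W.X.nclspan_def T.dense by (rule add.prems)
        fix s assume "s \<in> {mul q (unit_index l) z y |z y. z \<in> carrier (X q) \<and> y \<in> carrier (fibre Y l)}"
        then obtain z y where zy: "s = mul q (unit_index l) z y" "z \<in> carrier (X q)" "y \<in> carrier (fibre Y l)" by blast
        have y': "y \<in> carrier (X (unit_index l))" using zy(3) by (simp only: xl[OF add.hyps(2)])
        have "\<psi> q z \<otimes>\<^bsub>B\<^esub> \<psi> (unit_index l) y = \<psi> ?r (mul q (unit_index l) z y)"
          using \<psi> add.hyps(1) unit_multi_index[OF add.hyps(2)] zy(2) y' unfolding ps_covariant_representation_def by blast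
        moreover have "\<psi> (unit_index l) y \<in> H" using H(2) add.hyps(2) zy(3) unfolding sys_range_def by blast
        ultimately show "\<psi> ?r s \<in> H"
          using h(2)[OF add.IH[OF zy(2)], of "\<psi> (unit_index l) y"] zy(1) by (simp del: One_nat_def)
      qed
    qed
    then have "(\<Union>s\<in>multi_index n. \<psi> s ` carrier (X s)) \<subseteq> H" by blast
    from cstar_generate_minimal[OF H(1) this] show ?thesis by (simp add: gen)
  qed
  have "cstar_subalgebra (carrier B) B"
    by (rule B.cstar_subalgebraI) (auto intro: B.nclosedI dest: B.nlimD(2))
  then have "cstar_generate B ?S = carrier B"
    using in_H sys_range_carrier[OF sr] unfolding cstar_generate_def by (intro equalityI Inter_lower Inter_greatest) auto
  moreover have "\<exists>\<rho>. cstar_hom B D \<rho> \<and> (\<forall>a\<in>carrier (coeff Y). \<rho> (\<psi> 0 a) = \<pi>' a) \<and>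
      (\<forall>l\<in>{1..n}. \<forall>x\<in>carrier (fibre Y l). \<rho> (\<psi> (unit_index l) x) = t' l x)"
    if r': "sys_rep n Y D \<pi>' t'" for D :: "(nat \<Rightarrow> 'a) cstar_algebra" and \<pi>' t'
  proof -
    obtain \<psi>' where \<psi>': "ps_covariant_representation (coeff Y) n X mul D \<psi>'" "\<psi>' 0 = \<pi>'"
      "\<forall>l\<in>{1..n}. \<forall>x\<in>carrier (fibre Y l). \<psi>' (unit_index l) x = t' l x"
      using ex_ps_covariant[OF Y n X r'] by blast
    obtain \<rho> where \<rho>: "cstar_hom B D \<rho>" "\<forall>s\<in>multi_index n. \<forall>x\<in>carrier (X s). \<rho> (\<psi> s x) = \<psi>' s x"
      using B sys_repD(1)[OF r'] \<psi>'(1) unfolding ps_cuntz_pimsner_def by blast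
    have "\<rho> (\<psi> 0 a) = \<pi>' a" if "a \<in> carrier (coeff Y)" for a
      using bspec[OF \<rho>(2) zero_multi_index] that by (simp add: p(3) \<psi>'(2))
    moreover have "\<rho> (\<psi> (unit_index l) x) = t' l x" if "l \<in> {1..n}" "x \<in> carrier (fibre Y l)" for l x
      using bspec[OF \<rho>(2) unit_multi_index[OF that(1)]] that \<psi>'(3) by (simp add: xl[OF that(1)] del: One_nat_def)
    ultimately show ?thesis using \<rho>(1) by blast
  qed
  ultimately show ?thesis using sr unfolding sys_universal_def by blast
qed

section \<open>Uniqueness\<close>

lemma cstar_isoI:
  assumes "cstar_hom B B' \<rho>" "cstar_hom B' B \<rho>'"
    "\<And>b. b \<in> carrier B \<Longrightarrow> \<rho>' (\<rho> b) = b" "\<And>b. b \<in> carrier B' \<Longrightarrow> \<rho> (\<rho>' b) = b"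
  shows "cstar_iso B B' \<rho>"
  unfolding cstar_iso_def
  by (intro conjI assms(1) bij_betw_byWitness[of _ \<rho>'])
    (use assms cstar_homD(1)[OF assms(1)] cstar_homD(1)[OF assms(2)] in auto)

text \<open>The map \<epsilon>(z) b \<mapsto> \<epsilon>'(z) \<rho>(b) and its counterpart along the
  inverse of \<rho> are mutually inverse on total sets. Left actions correspond by
  \<open>sys_fibre_intertwine\<close>, with the creation formulas on both sides as input.\<close>

lemma sys_fibre_isomorphic:
  assumes Y: "generating_system k Y" and n: "n \<le> k" and j: "j \<in> {1..k}"
    and u: "sys_universal n Y B \<pi> t" and u': "sys_universal n Y B' \<pi>' t'"
    and W: "sys_fibre n Y j B \<pi> t W \<epsilon>" and W': "sys_fibre n Y j B' \<pi>' t' W' \<epsilon>'"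
  shows "corr_isomorphic B W B' W'"
proof -
  note g = generating_systemD[OF Y]
  have r: "sys_rep n Y B \<pi> t" and r': "sys_rep n Y B' \<pi>' t'"
    and gen: "cstar_generate B (sys_range n Y \<pi> t) = carrier B"
    using u u' unfolding sys_universal_def by blast+
  obtain \<rho> \<rho>' where \<rho>: "cstar_hom B B' \<rho>" "cstar_hom B' B \<rho>'"
    "\<And>b. b \<in> carrier B \<Longrightarrow> \<rho>' (\<rho> b) = b" "\<And>b. b \<in> carrier B' \<Longrightarrow> \<rho> (\<rho>' b) = b"
    "\<And>a. a \<in> carrier (coeff Y) \<Longrightarrow> \<rho> (\<pi> a) = \<pi>' a" "\<And>a. a \<in> carrier (coeff Y) \<Longrightarrow> \<rho>' (\<pi>' a) = \<pi> a"
    "\<And>l x. \<lbrakk>l \<in> {1..n}; x \<in> carrier (fibre Y l)\<rbrakk> \<Longrightarrow> \<rho> (t l x) = t' l x"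
    by (rule sys_universal_inverse[OF u u']) (rule that)
  interpret W: ext_corr "coeff Y" "fibre Y j" B W \<pi> \<epsilon> by (rule sys_fibreD(1)[OF W])
  interpret W': ext_corr "coeff Y" "fibre Y j" B' W' \<pi>' \<epsilon>' by (rule sys_fibreD(1)[OF W'])
  obtain \<phi> where \<phi>: "mod_rep B W B' W' \<rho> \<phi>"
    "\<forall>z\<in>carrier (fibre Y j). \<forall>b\<in>carrier B. \<phi> (ract W (\<epsilon> z) b) = ract W' (\<epsilon>' z) (\<rho> b)"
    "\<forall>z\<in>carrier (fibre Y j). \<phi> (\<epsilon> z) = \<epsilon>' z"
    using ex_ext_corr_hom[OF W.ext_corr_axioms W'.mod_rep_axioms \<rho>(1,5)] by blast
  obtain \<phi>' where \<phi>': "mod_rep B' W' B W \<rho>' \<phi>'"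
    "\<forall>z\<in>carrier (fibre Y j). \<forall>b\<in>carrier B'. \<phi>' (ract W' (\<epsilon>' z) b) = ract W (\<epsilon> z) (\<rho>' b)"
    using ex_ext_corr_hom[OF W'.ext_corr_axioms W.mod_rep_axioms \<rho>(2,6)] by blast
  interpret \<phi>: mod_rep B W B' W' \<rho> \<phi> by (rule \<phi>(1))
  interpret \<phi>': mod_rep B' W' B W \<rho>' \<phi>' by (rule \<phi>'(1))
  have id: "mod_rep B W B W (\<lambda>b. b) (\<lambda>w. w)" "mod_rep B' W' B' W' (\<lambda>b. b) (\<lambda>w. w)"
    by (simp_all add: mod_rep_def mod_rep_axioms_def cstar_hom_id W.W.hilbert_module_axioms W'.W.hilbert_module_axioms)
  have 1: "\<phi>' (\<phi> w) = w" if "w \<in> carrier W" for w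
    by (rule mod_rep_agree[OF mod_rep_comp[OF \<phi>(1) \<phi>'(1)] id(1) W.elements_carrier _ W.dense that])
      (use \<phi>(2) \<phi>'(2) \<phi>.\<pi>(1) \<rho>(3) in auto)
  have 2: "\<phi> (\<phi>' w) = w" if "w \<in> carrier W'" for w
    by (rule mod_rep_agree[OF mod_rep_comp[OF \<phi>'(1) \<phi>(1)] id(2) W'.elements_carrier _ W'.dense that])
      (use \<phi>(2) \<phi>'(2) \<phi>'.\<pi>(1) \<rho>(4) in auto)
  have "bij_betw \<phi> (carrier W) (carrier W')"
    by (rule bij_betw_byWitness[of _ \<phi>']) (use 1 2 \<phi>.closed \<phi>'.closed in auto)
  moreover have lact: "lact W' (\<rho> b) (\<phi> w) = \<phi> (lact W b w)" if bw: "b \<in> carrier B" "w \<in> carrier W" for b w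
  proof (rule sys_fibre_intertwine[OF r gen W.ext_corr_axioms \<phi>(1) W'.W.C.left_action_axioms _ _ bw])
    show "lact W' (\<rho> (\<pi> a)) (\<phi> (\<epsilon> z)) = \<phi> (\<epsilon> (lact (fibre Y j) a z))"
      if "a \<in> carrier (coeff Y)" "z \<in> carrier (fibre Y j)" for a z
      using that \<phi>(3) by (simp add: \<rho>(5) W'.lact_\<epsilon>)
    fix l x z assume l: "l \<in> {1..n}" and x: "x \<in> carrier (fibre Y l)" and z: "z \<in> carrier (fibre Y j)"
    have lk: "l \<in> {1..k}" using l n by simp
    obtain \<mu> where \<mu>: "mod_rep (coeff Y) (sq Y j l) B W \<pi> \<mu>"
      "\<And>x z. \<lbrakk>x \<in> carrier (fibre Y l); z \<in> carrier (fibre Y j)\<rbrakk> \<Longrightarrow> \<mu> (tens Y j l z x) = ract W (\<epsilon> z) (t l x) \<and>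
        lact W (t l x) (\<epsilon> z) = \<mu> (flip Y l j (tens Y l j x z))"
      using sys_fibreD(2)[OF W l] unfolding creates_def by blast
    obtain \<mu>' where \<mu>': "mod_rep (coeff Y) (sq Y j l) B' W' \<pi>' \<mu>'"
      "\<And>x z. \<lbrakk>x \<in> carrier (fibre Y l); z \<in> carrier (fibre Y j)\<rbrakk> \<Longrightarrow> \<mu>' (tens Y j l z x) = ract W' (\<epsilon>' z) (t' l x) \<and>
        lact W' (t' l x) (\<epsilon>' z) = \<mu>' (flip Y l j (tens Y l j x z))"
      using sys_fibreD(2)[OF W' l] unfolding creates_def by blast
    have "\<phi> (\<mu> w) = \<mu>' w" if "w \<in> carrier (sq Y j l)" for w
      by (rule tensor.mod_rep_agree_tensor[OF corr_tensorI[OF g(3)[OF j lk]] mod_rep_comp[OF \<mu>(1) \<phi>(1)] \<mu>'(1) _ that])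
        (use \<mu>(2) \<mu>'(2) \<phi>(2) sys_repD(5)[OF r l] \<rho>(7)[OF l] in simp)
    moreover have "flip Y l j (tens Y l j x z) \<in> carrier (sq Y j l)"
      by (rule corr_isoD(3)[OF g(4)[OF lk j] corr_tensorD(6)[OF g(3)[OF lk j] x z]])
    ultimately show "lact W' (\<rho> (t l x)) (\<phi> (\<epsilon> z)) = \<phi> (lact W (t l x) (\<epsilon> z))"
      using \<mu>(2)[OF x z] \<mu>'(2)[OF x z] z \<rho>(7)[OF l x] \<phi>(3) by simp
  qed
  have "\<phi> (lact W b (ract W w b')) = lact W' (\<rho> b) (ract W' (\<phi> w) (\<rho> b'))"
    if "b \<in> carrier B" "w \<in> carrier W" "b' \<in> carrier B" for b w b'
    using lact[of b "ract W w b'"] that by (simp add: \<phi>.ract)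
  ultimately show ?thesis
    unfolding corr_isomorphic_def
    by (intro exI[of _ \<rho>] exI[of _ \<phi>] conjI cstar_isoI[OF \<rho>(1-4)]) (simp_all add: \<phi>.add \<phi>.smult \<phi>.inner)
qed

theorem theorem4p3:
  fixes A :: "'u cstar_algebra" and Y :: "'u corr_system" and E :: "nat \<Rightarrow> 'u corr_system"
    and k i :: nat
  assumes "cstar_algebra A"
    and "k \<ge> 2"
    and "generating_system k Y" and "coeff Y = A"
    and "iterated_systems k Y E"
    and "1 \<le> i" and "i < k"
  shows
    "(\<forall>j\<in>{1..k}. \<forall>X mul B \<psi> W.
        generated_product_system i Y X mul \<and> ps_cuntz_pimsner A i X mul B \<psi> \<and>
        ps_extended_corr i Y j B \<psi> W \<longrightarrow>
        corr_isomorphic (coeff (E i)) (fibre (E i) j) B W) \<and>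
     (\<forall>D \<pi> t X mul B \<psi>.
        cuntz_pimsner (coeff (E i)) (fibre (E i) (i + 1)) D \<pi> t \<and>
        generated_product_system (i + 1) Y X mul \<and> ps_cuntz_pimsner A (i + 1) X mul B \<psi> \<longrightarrow>
        cstar_isomorphic D B)"
proof (intro conjI ballI allI impI; elim conjE)
  note Y = assms(3) and A = assms(4) and i = assms(7)
  note g = generating_systemD[OF Y]
  obtain \<pi>E tE \<epsilon> \<kappa> where inv: "sys_ext k i Y (E i) \<pi>E tE \<epsilon> \<kappa>"
    using iterated_sys_ext[OF Y assms(5) i] by blast
  then have u: "sys_universal i Y (coeff (E i)) \<pi>E tE"
    and fib: "\<And>j. j \<in> {1..k} \<Longrightarrow> sys_fibre i Y j (coeff (E i)) \<pi>E tE (fibre (E i) j) (\<epsilon> j)"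
    unfolding sys_ext_def by blast+
  {
    fix j X mul B \<psi> W
    assume j: "j \<in> {1..k}" and X: "generated_product_system i Y X mul" and B: "ps_cuntz_pimsner A i X mul B \<psi>"
      and W: "ps_extended_corr i Y j B \<psi> W"
    have ik: "i \<le> k" using i by simp
    have u': "sys_universal i Y B (\<psi> 0) (\<lambda>l. \<psi> (unit_index l))"
      by (rule ps_sys_universal[OF Y ik X]) (use B A in simp)
    then have r: "sys_rep i Y B (\<psi> 0) (\<lambda>l. \<psi> (unit_index l))" by (simp add: sys_universal_def)
    from W obtain e where e: "extended_corr (coeff Y) (fibre Y j) B (\<psi> 0) W e"
      "\<And>l. l \<in> {1..i} \<Longrightarrow> creation_action Y l j B (\<psi> 0) (\<psi> (unit_index l)) W e"
      unfolding ps_extended_corr_def by blast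
    obtain \<epsilon>' where \<epsilon>': "ext_corr (coeff Y) (fibre Y j) B W (\<psi> 0) \<epsilon>'"
      "\<forall>z\<in>carrier (fibre Y j). \<forall>S\<in>carrier B. e z S = ract W (\<epsilon>' z) S"
      using ex_ext_corr[OF g(2)[OF j] sys_repD(2)[OF r] e(1)] by blast
    have "creates Y l j B (\<psi> 0) (\<psi> (unit_index l)) W \<epsilon>'" if l: "l \<in> {1..i}" for l
    proof -
      have lk: "l \<in> {1..k}" using l i by simp
      show ?thesis
        by (rule creation_action_creates[OF g(3)[OF j lk] g(3)[OF lk j] corr_isoD(3)[OF g(4)[OF lk j]] \<epsilon>'
              sys_repD(5)[OF r l] e(2)[OF l]])
    qed
    then have "sys_fibre i Y j B (\<psi> 0) (\<lambda>l. \<psi> (unit_index l)) W \<epsilon>'"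
      using \<epsilon>'(1) unfolding sys_fibre_def by blast
    then show "corr_isomorphic (coeff (E i)) (fibre (E i) j) B W"
      by (rule sys_fibre_isomorphic[OF Y ik j u u' fib[OF j]])
  }
  fix D \<pi> t X mul B \<psi>
  assume D: "cuntz_pimsner (coeff (E i)) (fibre (E i) (i + 1)) D \<pi> t"
    and X: "generated_product_system (i + 1) Y X mul" and B: "ps_cuntz_pimsner A (i + 1) X mul B \<psi>"
  \<comment> \<open>Half a step further: the Cuntz-Pimsner algebra of the fibre over i + 1 is
    formed, but no new fibres over it. So i = k - 1 is covered, beyond which there is no iterated
    system.\<close>
  have "sys_universal (Suc i) Y D (\<lambda>a. \<pi> (\<pi>E a)) (step_rep (Suc i) tE \<pi> t (\<epsilon> (Suc i)))"
    by (rule step_sys_universal(2)[OF Y i u fib]) (use i D in auto)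
  moreover have "sys_universal (Suc i) Y B (\<psi> 0) (\<lambda>l. \<psi> (unit_index l))"
    by (rule ps_sys_universal[OF Y _]) (use i X B A in auto)
  ultimately obtain \<rho> \<rho>' where \<rho>: "cstar_hom D B \<rho>" "cstar_hom B D \<rho>'"
    "\<And>b. b \<in> carrier D \<Longrightarrow> \<rho>' (\<rho> b) = b" "\<And>b. b \<in> carrier B \<Longrightarrow> \<rho> (\<rho>' b) = b"
    by (rule sys_universal_inverse) (rule that)
  then show "cstar_isomorphic D B"
    unfolding cstar_isomorphic_def using cstar_isoI[OF \<rho>] by blast
qed

end
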